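(* Let $\Bbbk$ be a field of prime characteristic $p$, $R=\Bbbk[x_1,\dots,x_n]$, $I$ an ideal of $R$, and $i\ge 0$ an integer. There exist an integer $\alpha\ge1$ and an $\alpha\times\alpha$ matrix $U$ with entries in $R$ representing a root morphism of $H^i_I(R)$ such that, for every prime ideal $P\subset R$, $$\operatorname{crk}\big(H^i_{IR_P}(R_P)\big)\neq 0\ \Longrightarrow\ P\in\mathcal{A}_{R^\alpha},$$ where $\mathcal{A}_{R^\alpha}$ is the set of all $U$-special prime ideals $P$ of $R$ with $\mathcal{K}\nsubseteq PR^\alpha$, and $\mathcal{K}$ is the stable value of $\{I_e(U^{[p^{e-1}]}U^{[p^{e-2}]}\cdots U R^\alpha)\}_{e\ge 1}$.
   Context: For a matrix or vector $V$ with entries in $R$, $V^{[p^e]}$ is obtained by raising all entries to the $p^e$-th power. For a submodule $K\subseteq R^\alpha$, $K^{[p^e]}$ is the submodule generated by $\{v^{[p^e]}\mid v\in K\}$, and $I_e(K)$ is the smallest submodule $L\subseteq R^\alpha$ with $K\subseteq L^{[p^e]}$ (it exists). The sequence $\{I_e(U^{[p^{e-1}]}\cdots U R^\alpha)\}_{e\ge1}$ is known to become constant. An ideal of $R$ is $U$-special if it equals $\operatorname{Ann}_R(R^\alpha/V)$ for some submodule $V\subseteq R^\alpha$ with $UV\subseteq V^{[p]}$. The set $\mathcal{A}_{R^\alpha}$ is the output of the paper's algorithm (a generalization of the Katzman-Zhang algorithm) with input $U$. $F$-modules: let $A$ be a regular Noetherian ring of characteristic $p$ and $F_A(M)=F_*A\otimes_A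 M$ the Frobenius functor. An $F$-module is an $A$-module $\mathcal{M}$ with an $A$-isomorphism $\theta:\mathcal{M}\to F_A(\mathcal{M})$. An $F$-submodule is a submodule $\mathcal{N}$ such that $\theta$ restricts to an isomorphism $\mathcal{N}\to F_A(\mathcal{N})$. $\mathcal{M}$ is $F$-finite if $\mathcal{M}=\varinjlim(M\xrightarrow{\beta}F_A(M)\xrightarrow{F_A(\beta)}F_A^2(M)\to\cdots)$ for some finitely generated $M$ and $A$-linear $\beta:M\to F_A(M)$, with $\theta$ induced by the maps $F_A^j(\beta)$. If in addition $\beta$ is injective, $\beta$ is a root morphism of $\mathcal{M}$. The canonical isomorphism $A\to F_A(A)$ makes $A$, and hence every local cohomology module $H^i_I(A)$, an $F$-finite $F$-module, and each $H^i_I(A)$ has a root morphism. A root morphism of $H^i_I(R)$ can be written, using a presentation $M\cong\operatorname{Coker}A=R^\alpha/\operatorname{Im}A$ for a matrix $A$ over $R$, as the map $\operatorname{Coker}A\xrightarrow{U}\operatorname{Coker}A^{[p]}$ given by an $\alpha\times\alpha$ matrix $U$ with $U\operatorname{Im}A\subseteq\operatorname{Im}A^{[p]}$; we then say $U$ represents the root morphism, and $H^i_I(R)\cong\varinjlim(\operatorname{Coker}A\xrightarrow{U}\operatorname{Coker}A^{[p]}\to\cdots)$. Corank: if $A$ is local, for any $F$-finite $F$-module $\mathcal{M}$ there is a smallest $F$-submodule $\mathcal{N}\subseteq\mathcal{M}$ with $\dim\operatorname{Supp}(\mathcal{M}/\mathcal{N})=0$ (where $\mathcal{N}=\mathcal{M}$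 is allowed), and $\mathcal{M}/\mathcal{N}\cong E^k$ as $A$-modules for some $k\in\mathbb{N}$, $k\geq 0$, where $E$ is the injective hull of the residue field of $A$. The corank is $\operatorname{crk}\mathcal{M}=k$. *)

theory Defs
  imports
    "HOL-Algebra.Module"
    "HOL-Algebra.Ideal"
    "HOL-Library.Poly_Mapping"
    "HOL-Library.Extended_Nat"
    "HOL-Computational_Algebra.Primes"
begin

section \<open>Polynomial rings\<close>

text \<open>Exponent vectors are finitely supported functions on all of the naturals; the polynomial
  ring in n variables keeps the polynomials all of whose monomials involve only the variables
  with index less than n.\<close>

type_synonym 'k mpoly = "(nat \<Rightarrow>\<^sub>0 nat) \<Rightarrow>\<^sub>0 'k"

definition poly_ring :: "nat \<Rightarrow> ('k::field) mpoly ring" where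
  "poly_ring n =
    \<lparr>carrier = {f. \<forall>m\<in>Poly_Mapping.keys f. Poly_Mapping.keys m \<subseteq> {..<n}},
     monoid.mult = (*), one = 1, ring.zero = 0, ring.add = (+)\<rparr>"


section \<open>Modules over a commutative ring\<close>

text \<open>The multiplicative fields of a module record play no role and are left undefined, except in
  the ring of fractions below.\<close>

definition reg :: "('a, 'x) ring_scheme \<Rightarrow> ('a, 'a) module" where
  "reg A = \<lparr>carrier = carrier A, monoid.mult = monoid.mult A, one = one A,
            ring.zero = ring.zero A, ring.add = ring.add A, smult = monoid.mult A\<rparr>"

definition mod_hom ::
  "('a, 'x) ring_scheme \<Rightarrow> ('a, 'm) module \<Rightarrow> ('a, 'n) module \<Rightarrow> ('m \<Rightarrow> 'n) set" where
  "mod_hom A M N = {f \<in> carrier M \<rightarrow> carrier N.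
     (\<forall>x\<in>carrier M. \<forall>y\<in>carrier M. f (x \<oplus>\<^bsub>M\<^esub> y) = f x \<oplus>\<^bsub>N\<^esub> f y) \<and>
     (\<forall>a\<in>carrier A. \<forall>x\<in>carrier M. f (a \<odot>\<^bsub>M\<^esub> x) = a \<odot>\<^bsub>N\<^esub> f x)}"

definition mod_iso ::
  "('a, 'x) ring_scheme \<Rightarrow> ('a, 'm) module \<Rightarrow> ('a, 'n) module \<Rightarrow> ('m \<Rightarrow> 'n) set" where
  "mod_iso A M N = {f \<in> mod_hom A M N. bij_betw f (carrier M) (carrier N)}"

definition submod :: "('a, 'm) module \<Rightarrow> 'm set \<Rightarrow> ('a, 'm) module" where
  "submod M N = M\<lparr>carrier := N\<rparr>"

definition gen_submodule :: "('a, 'x) ring_scheme \<Rightarrow> ('a, 'm) module \<Rightarrow> 'm set \<Rightarrow> 'm set" where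
  "gen_submodule A M S = \<Inter>{N. submodule N A M \<and> S \<subseteq> N}"

definition fin_gen :: "('a, 'x) ring_scheme \<Rightarrow> ('a, 'm) module \<Rightarrow> bool" where
  "fin_gen A M \<longleftrightarrow> (\<exists>S. finite S \<and> S \<subseteq> carrier M \<and> gen_submodule A M S = carrier M)"

text \<open>In the scalar multiplication the summand N makes the result a full coset, also for
  scalars that do not act surjectively on N.\<close>

definition quot_module ::
  "('a, 'm) module \<Rightarrow> 'm set \<Rightarrow> ('a, 'm set) module" where
  "quot_module M N = \<lparr>carrier = a_rcosets\<^bsub>M\<^esub> N, monoid.mult = undefined, one = undefined,
     ring.zero = N, ring.add = (<+>\<^bsub>M\<^esub>), smult = (\<lambda>a X. N <+>\<^bsub>M\<^esub> ((\<lambda>x. a \<odot>\<^bsub>M\<^esub> x) ` X))\<rparr>"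

definition ann :: "('a, 'x) ring_scheme \<Rightarrow> ('a, 'm) module \<Rightarrow> 'a set" where
  "ann A M = {a \<in> carrier A. \<forall>x\<in>carrier M. a \<odot>\<^bsub>M\<^esub> x = \<zero>\<^bsub>M\<^esub>}"

definition direct_sum :: "'j set \<Rightarrow> ('j \<Rightarrow> ('a, 'm) module) \<Rightarrow> ('a, 'j \<Rightarrow> 'm) module" where
  "direct_sum J M = \<lparr>carrier = {x \<in> (\<Pi>\<^sub>E j\<in>J. carrier (M j)). finite {j\<in>J. x j \<noteq> \<zero>\<^bsub>M j\<^esub>}},
     monoid.mult = undefined, one = undefined,
     ring.zero = (\<lambda>j\<in>J. \<zero>\<^bsub>M j\<^esub>),
     ring.add = (\<lambda>x y. \<lambda>j\<in>J. x j \<oplus>\<^bsub>M j\<^esub> y j),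
     smult = (\<lambda>a x. \<lambda>j\<in>J. a \<odot>\<^bsub>M j\<^esub> x j)\<rparr>"

definition direct_sum_inj :: "'j set \<Rightarrow> ('j \<Rightarrow> ('a, 'm) module) \<Rightarrow> 'j \<Rightarrow> 'm \<Rightarrow> 'j \<Rightarrow> 'm" where
  "direct_sum_inj J M j x = (\<lambda>l\<in>J. if l = j then x else \<zero>\<^bsub>M l\<^esub>)"

abbreviation free_module :: "('a, 'x) ring_scheme \<Rightarrow> 'j set \<Rightarrow> ('a, 'j \<Rightarrow> 'a) module" where
  "free_module A J \<equiv> direct_sum J (\<lambda>_. reg A)"

definition free_basis :: "('a, 'x) ring_scheme \<Rightarrow> 'j set \<Rightarrow> 'j \<Rightarrow> 'j \<Rightarrow> 'a" where
  "free_basis A J j = direct_sum_inj J (\<lambda>_. reg A) j \<one>\<^bsub>A\<^esub>"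

definition dirlim_rel ::
  "('a, 'x) ring_scheme \<Rightarrow> (nat \<Rightarrow> ('a, 'm) module) \<Rightarrow> (nat \<Rightarrow> 'm \<Rightarrow> 'm) \<Rightarrow> (nat \<Rightarrow> 'm) set" where
  "dirlim_rel A M t = gen_submodule A (direct_sum UNIV M)
     {direct_sum_inj UNIV M j x \<ominus>\<^bsub>direct_sum UNIV M\<^esub> direct_sum_inj UNIV M (Suc j) (t j x) | j x. x \<in> carrier (M j)}"

definition dirlim ::
  "('a, 'x) ring_scheme \<Rightarrow> (nat \<Rightarrow> ('a, 'm) module) \<Rightarrow> (nat \<Rightarrow> 'm \<Rightarrow> 'm)
    \<Rightarrow> ('a, (nat \<Rightarrow> 'm) set) module" where
  "dirlim A M t = quot_module (direct_sum UNIV M) (dirlim_rel A M t)"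

definition dirlim_map ::
  "('a, 'x) ring_scheme \<Rightarrow> (nat \<Rightarrow> ('a, 'm) module) \<Rightarrow> (nat \<Rightarrow> 'm \<Rightarrow> 'm)
    \<Rightarrow> nat \<Rightarrow> 'm \<Rightarrow> (nat \<Rightarrow> 'm) set" where
  "dirlim_map A M t j x = dirlim_rel A M t +>\<^bsub>direct_sum UNIV M\<^esub> direct_sum_inj UNIV M j x"

definition is_smallest :: "('b set \<Rightarrow> bool) \<Rightarrow> 'b set \<Rightarrow> bool" where
  "is_smallest Q L \<longleftrightarrow> Q L \<and> (\<forall>L'. Q L' \<longrightarrow> L \<subseteq> L')"


section \<open>Localization and support\<close>

definition fraction ::
  "('a, 'x) ring_scheme \<Rightarrow> 'a set \<Rightarrow> ('a, 'm) module \<Rightarrow> 'm \<Rightarrow> 'a \<Rightarrow> ('m \<times> 'a) set" where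
  "fraction A S M m s = {(m', s'). m' \<in> carrier M \<and> s' \<in> S \<and>
     (\<exists>u\<in>S. u \<odot>\<^bsub>M\<^esub> (s' \<odot>\<^bsub>M\<^esub> m) = u \<odot>\<^bsub>M\<^esub> (s \<odot>\<^bsub>M\<^esub> m'))}"

text \<open>The unions below are taken over all representatives; their members coincide.\<close>

definition loc_module ::
  "('a, 'x) ring_scheme \<Rightarrow> 'a set \<Rightarrow> ('a, 'm) module \<Rightarrow> ('a, ('m \<times> 'a) set) module" where
  "loc_module A S M = \<lparr>carrier = {fraction A S M m s | m s. m \<in> carrier M \<and> s \<in> S},
     monoid.mult = undefined, one = undefined,
     ring.zero = fraction A S M \<zero>\<^bsub>M\<^esub> \<one>\<^bsub>A\<^esub>,
     ring.add = (\<lambda>X Y. \<Union>(m, s)\<in>X. \<Union>(m', s')\<in>Y.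
              fraction A S M (s' \<odot>\<^bsub>M\<^esub> m \<oplus>\<^bsub>M\<^esub> s \<odot>\<^bsub>M\<^esub> m') (s \<otimes>\<^bsub>A\<^esub> s')),
     smult = (\<lambda>a X. \<Union>(m, s)\<in>X. fraction A S M (a \<odot>\<^bsub>M\<^esub> m) s)\<rparr>"

text \<open>As a module record, \<open>loc_ring A S\<close> is also an A-algebra.\<close>

definition loc_ring ::
  "('a, 'x) ring_scheme \<Rightarrow> 'a set \<Rightarrow> ('a, ('a \<times> 'a) set) module" where
  "loc_ring A S = (loc_module A S (reg A))
     \<lparr>monoid.mult := (\<lambda>X Y. \<Union>(a, s)\<in>X. \<Union>(b, t)\<in>Y. fraction A S (reg A) (a \<otimes>\<^bsub>A\<^esub> b) (s \<otimes>\<^bsub>A\<^esub> t)),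
      one := fraction A S (reg A) \<one>\<^bsub>A\<^esub> \<one>\<^bsub>A\<^esub>\<rparr>"

definition loc_map ::
  "('a, 'x) ring_scheme \<Rightarrow> 'a set \<Rightarrow> 'a \<Rightarrow> ('a \<times> 'a) set" where
  "loc_map A S a = fraction A S (reg A) a \<one>\<^bsub>A\<^esub>"

abbreviation loc_at_prime ::
  "('a, 'x) ring_scheme \<Rightarrow> 'a set \<Rightarrow> ('a, ('a \<times> 'a) set) module" where
  "loc_at_prime A P \<equiv> loc_ring A (carrier A - P)"

definition extended_ideal :: "('a, 'x) ring_scheme \<Rightarrow> 'a set \<Rightarrow> 'a set \<Rightarrow> ('a \<times> 'a) set set" where
  "extended_ideal A P I =
     genideal (loc_at_prime A P) (loc_map A (carrier A - P) ` I)"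

definition supp :: "('a, 'x) ring_scheme \<Rightarrow> ('a, 'm) module \<Rightarrow> 'a set set" where
  "supp A M = {Q. primeideal Q A \<and>
     carrier (loc_module A (carrier A - Q) M) \<noteq> {\<zero>\<^bsub>loc_module A (carrier A - Q) M\<^esub>}}"

text \<open>Dimension of a set of primes, as the supremum of the lengths of its chains. In \<^typ>\<open>enat\<close> the
  supremum of the empty set is 0, so the empty support (the zero module) also gets dimension 0.\<close>

definition dim_primes :: "'a set set \<Rightarrow> enat" where
  "dim_primes T =
     Sup {enat n | n. \<exists>c::nat \<Rightarrow> 'a set. (\<forall>j\<le>n. c j \<in> T) \<and> (\<forall>j<n. c j \<subset> c (Suc j))}"


section \<open>Frobenius functors\<close>

text \<open>For q a power of the characteristic, \<open>Frob A q M\<close> is the extension of scalars of M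
  along the ring endomorphism sending a to its q-th power, that is the tensor product over A of M
  with the iterated Frobenius pushforward of A. It is presented by generators (the elements m of M,
  standing for the tensor of 1 with m) and relations. In particular the e-fold iterate of the
  Frobenius functor is taken to be \<open>Frob A (p ^ e)\<close>, see \<open>Frob_comp\<close>.\<close>

definition Frob_rel ::
  "('a, 'x) ring_scheme \<Rightarrow> nat \<Rightarrow> ('a, 'm) module \<Rightarrow> ('m \<Rightarrow> 'a) set" where
  "Frob_rel A q M =
    (let G = free_module A (carrier M); d = free_basis A (carrier M) in
     gen_submodule A G
       ({d (m \<oplus>\<^bsub>M\<^esub> m') \<ominus>\<^bsub>G\<^esub> (d m \<oplus>\<^bsub>G\<^esub> d m') | m m'. m \<in> carrier M \<and> m' \<in> carrier M}
      \<union> {d (a \<odot>\<^bsub>M\<^esub> m) \<ominus>\<^bsub>G\<^esub> ((a [^]\<^bsub>A\<^esub> q) \<odot>\<^bsub>G\<^esub> d m) | a m. a \<in> carrier A \<and> m \<in> carrier M}))"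

definition Frob ::
  "('a, 'x) ring_scheme \<Rightarrow> nat \<Rightarrow> ('a, 'm) module \<Rightarrow> ('a, ('m \<Rightarrow> 'a) set) module" where
  "Frob A q M = quot_module (free_module A (carrier M)) (Frob_rel A q M)"

definition one_tensor ::
  "('a, 'x) ring_scheme \<Rightarrow> nat \<Rightarrow> ('a, 'm) module \<Rightarrow> 'm \<Rightarrow> ('m \<Rightarrow> 'a) set" where
  "one_tensor A q M m = Frob_rel A q M +>\<^bsub>free_module A (carrier M)\<^esub> free_basis A (carrier M) m"

text \<open>The map on a Frobenius pullback of M that sends the tensor of a and m to
  \<open>a ^ r\<close> times \<open>g m\<close>. It is used only for g semilinear with respect to the appropriate power
  of the Frobenius endomorphism and r a power of the characteristic, when the value does not depend on the
  representative.\<close>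

definition Frob_lift ::
  "('a, 'x) ring_scheme \<Rightarrow> ('a, 'm) module \<Rightarrow> ('a, 'n) module \<Rightarrow> nat \<Rightarrow> ('m \<Rightarrow> 'n)
    \<Rightarrow> ('m \<Rightarrow> 'a) set \<Rightarrow> 'n" where
  "Frob_lift A M N r g X = the_elem ((\<lambda>c. finsum N (\<lambda>m. (c m [^]\<^bsub>A\<^esub> r) \<odot>\<^bsub>N\<^esub> g m)
     {m \<in> carrier M. c m \<noteq> \<zero>\<^bsub>A\<^esub>}) ` X)"

definition Frob_map ::
  "('a, 'x) ring_scheme \<Rightarrow> nat \<Rightarrow> ('a, 'm) module \<Rightarrow> ('a, 'n) module \<Rightarrow> ('m \<Rightarrow> 'n)
    \<Rightarrow> ('m \<Rightarrow> 'a) set \<Rightarrow> ('n \<Rightarrow> 'a) set" where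
  "Frob_map A q M N f = Frob_lift A M (Frob A q N) 1 (\<lambda>m. one_tensor A q N (f m))"

text \<open>The canonical isomorphism from \<open>Frob A q (Frob A q' M)\<close> to \<open>Frob A (q * q') M\<close>, sending
  the tensor of a with (b tensor m) to the tensor of \<open>a * b ^ q\<close> with m.\<close>

definition Frob_comp ::
  "('a, 'x) ring_scheme \<Rightarrow> nat \<Rightarrow> nat \<Rightarrow> ('a, 'm) module
    \<Rightarrow> (('m \<Rightarrow> 'a) set \<Rightarrow> 'a) set \<Rightarrow> ('m \<Rightarrow> 'a) set" where
  "Frob_comp A q q' M = Frob_lift A (Frob A q' M) (Frob A (q * q') M) 1
     (Frob_lift A M (Frob A (q * q') M) q (one_tensor A (q * q') M))"


section \<open>F-modules\<close>

definition F_module ::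
  "('a, 'x) ring_scheme \<Rightarrow> nat \<Rightarrow> ('a, 'm) module \<Rightarrow> ('m \<Rightarrow> ('m \<Rightarrow> 'a) set) \<Rightarrow> bool" where
  "F_module A p M \<theta> \<longleftrightarrow> Module.module A M \<and> \<theta> \<in> mod_iso A M (Frob A p M)"

definition F_module_iso ::
  "('a, 'x) ring_scheme \<Rightarrow> nat \<Rightarrow> ('a, 'm) module \<Rightarrow> ('m \<Rightarrow> ('m \<Rightarrow> 'a) set)
    \<Rightarrow> ('a, 'n) module \<Rightarrow> ('n \<Rightarrow> ('n \<Rightarrow> 'a) set) \<Rightarrow> ('m \<Rightarrow> 'n) set" where
  "F_module_iso A p M \<theta> N \<eta> =
     {\<psi> \<in> mod_iso A M N. \<forall>x\<in>carrier M. \<eta> (\<psi> x) = Frob_map A p M N \<psi> (\<theta> x)}"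

text \<open>Over a regular ring the functor is exact, so that the pullback of a submodule N embeds
  into that of M. The isomorphism \<open>\<theta>'\<close> is the restriction of \<open>\<theta>\<close>.\<close>

definition F_submodule ::
  "('a, 'x) ring_scheme \<Rightarrow> nat \<Rightarrow> ('a, 'm) module \<Rightarrow> ('m \<Rightarrow> ('m \<Rightarrow> 'a) set) \<Rightarrow> 'm set \<Rightarrow> bool" where
  "F_submodule A p M \<theta> N \<longleftrightarrow> submodule N A M \<and>
     (\<exists>\<theta>'\<in>mod_iso A (submod M N) (Frob A p (submod M N)).
        \<forall>x\<in>N. Frob_map A p (submod M N) M (\<lambda>y. y) (\<theta>' x) = \<theta> x)"

text \<open>The system of the iterated Frobenius pullbacks of \<open>M0\<close> generated by \<open>\<beta>\<close>, a map from \<open>M0\<close> to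
  \<open>Frob A p M0\<close>; its j-th transition map is the j-th iterate of the functor applied to \<open>\<beta>\<close>.\<close>

definition gen_step ::
  "('a, 'x) ring_scheme \<Rightarrow> nat \<Rightarrow> ('a, 'm) module \<Rightarrow> ('m \<Rightarrow> ('m \<Rightarrow> 'a) set)
    \<Rightarrow> nat \<Rightarrow> ('m \<Rightarrow> 'a) set \<Rightarrow> ('m \<Rightarrow> 'a) set" where
  "gen_step A p M0 \<beta> j x =
     Frob_comp A (p ^ j) p M0 (Frob_map A (p ^ j) M0 (Frob A p M0) \<beta> x)"

definition gen_limit ::
  "('a, 'x) ring_scheme \<Rightarrow> nat \<Rightarrow> ('a, 'm) module \<Rightarrow> ('m \<Rightarrow> ('m \<Rightarrow> 'a) set)
    \<Rightarrow> ('a, (nat \<Rightarrow> ('m \<Rightarrow> 'a) set) set) module" where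
  "gen_limit A p M0 \<beta> = dirlim A (\<lambda>j. Frob A (p ^ j) M0) (gen_step A p M0 \<beta>)"

definition gen_limit_map ::
  "('a, 'x) ring_scheme \<Rightarrow> nat \<Rightarrow> ('a, 'm) module \<Rightarrow> ('m \<Rightarrow> ('m \<Rightarrow> 'a) set)
    \<Rightarrow> nat \<Rightarrow> ('m \<Rightarrow> 'a) set \<Rightarrow> (nat \<Rightarrow> ('m \<Rightarrow> 'a) set) set" where
  "gen_limit_map A p M0 \<beta> = dirlim_map A (\<lambda>j. Frob A (p ^ j) M0) (gen_step A p M0 \<beta>)"

text \<open>The structure map of the limit, induced by the transition maps, whose targets are regarded as
  pullbacks \<open>Frob A p (Frob A (p ^ j) M0)\<close> via the inverse of \<open>Frob_comp\<close>.\<close>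

definition gen_limit_structure ::
  "('a, 'x) ring_scheme \<Rightarrow> nat \<Rightarrow> ('a, 'm) module \<Rightarrow> ('m \<Rightarrow> ('m \<Rightarrow> 'a) set)
    \<Rightarrow> ((nat \<Rightarrow> ('m \<Rightarrow> 'a) set) set \<Rightarrow> ((nat \<Rightarrow> ('m \<Rightarrow> 'a) set) set \<Rightarrow> 'a) set) \<Rightarrow> bool" where
  "gen_limit_structure A p M0 \<beta> \<theta> \<longleftrightarrow>
    (let L = gen_limit A p M0 \<beta> in
     \<theta> \<in> mod_hom A L (Frob A p L) \<and>
     (\<forall>j. \<forall>x\<in>carrier (Frob A (p ^ j) M0).
        \<theta> (gen_limit_map A p M0 \<beta> j x) =
        Frob_map A p (Frob A (p ^ j) M0) L (gen_limit_map A p M0 \<beta> j)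
          (inv_into (carrier (Frob A p (Frob A (p ^ j) M0))) (Frob_comp A p (p ^ j) M0)
             (gen_step A p M0 \<beta> j x))))"

definition root_morphism ::
  "('a, 'x) ring_scheme \<Rightarrow> nat \<Rightarrow> ('a, 'm) module \<Rightarrow> ('m \<Rightarrow> ('m \<Rightarrow> 'a) set)
    \<Rightarrow> ('a, 'n) module \<Rightarrow> ('n \<Rightarrow> ('n \<Rightarrow> 'a) set) \<Rightarrow> bool" where
  "root_morphism A p M0 \<beta> M \<theta> \<longleftrightarrow>
     Module.module A M0 \<and> fin_gen A M0 \<and> \<beta> \<in> mod_hom A M0 (Frob A p M0) \<and> inj_on \<beta> (carrier M0) \<and>
     F_module A p M \<theta> \<and>
     (\<exists>\<theta>L. gen_limit_structure A p M0 \<beta> \<theta>L \<and>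
           F_module_iso A p (gen_limit A p M0 \<beta>) \<theta>L M \<theta> \<noteq> {})"


section \<open>Matrices, special ideals\<close>

abbreviation vecs :: "('a, 'x) ring_scheme \<Rightarrow> nat \<Rightarrow> ('a, nat \<Rightarrow> 'a) module" where
  "vecs A \<alpha> \<equiv> free_module A {..<\<alpha>}"

definition is_matrix :: "('a, 'x) ring_scheme \<Rightarrow> nat \<Rightarrow> nat \<Rightarrow> (nat \<Rightarrow> nat \<Rightarrow> 'a) \<Rightarrow> bool" where
  "is_matrix A r c B \<longleftrightarrow> (\<forall>i<r. \<forall>j<c. B i j \<in> carrier A)"

definition mat_vec ::
  "('a, 'x) ring_scheme \<Rightarrow> nat \<Rightarrow> nat \<Rightarrow> (nat \<Rightarrow> nat \<Rightarrow> 'a) \<Rightarrow> (nat \<Rightarrow> 'a) \<Rightarrow> nat \<Rightarrow> 'a" where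
  "mat_vec A r c B v = (\<lambda>i\<in>{..<r}. \<Oplus>\<^bsub>A\<^esub>j\<in>{..<c}. B i j \<otimes>\<^bsub>A\<^esub> v j)"

definition mat_pow ::
  "('a, 'x) ring_scheme \<Rightarrow> nat \<Rightarrow> (nat \<Rightarrow> nat \<Rightarrow> 'a) \<Rightarrow> nat \<Rightarrow> nat \<Rightarrow> 'a" where
  "mat_pow A q B = (\<lambda>i j. B i j [^]\<^bsub>A\<^esub> q)"

definition vec_pow ::
  "('a, 'x) ring_scheme \<Rightarrow> nat \<Rightarrow> nat \<Rightarrow> (nat \<Rightarrow> 'a) \<Rightarrow> nat \<Rightarrow> 'a" where
  "vec_pow A \<alpha> q v = (\<lambda>i\<in>{..<\<alpha>}. v i [^]\<^bsub>A\<^esub> q)"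

definition mat_image :: "('a, 'x) ring_scheme \<Rightarrow> nat \<Rightarrow> nat \<Rightarrow> (nat \<Rightarrow> nat \<Rightarrow> 'a) \<Rightarrow> (nat \<Rightarrow> 'a) set" where
  "mat_image A r c B = mat_vec A r c B ` carrier (vecs A c)"

definition coker ::
  "('a, 'x) ring_scheme \<Rightarrow> nat \<Rightarrow> nat \<Rightarrow> (nat \<Rightarrow> nat \<Rightarrow> 'a) \<Rightarrow> ('a, (nat \<Rightarrow> 'a) set) module" where
  "coker A r c B = quot_module (vecs A r) (mat_image A r c B)"

definition coker_class ::
  "('a, 'x) ring_scheme \<Rightarrow> nat \<Rightarrow> nat \<Rightarrow> (nat \<Rightarrow> nat \<Rightarrow> 'a) \<Rightarrow> (nat \<Rightarrow> 'a) \<Rightarrow> (nat \<Rightarrow> 'a) set" where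
  "coker_class A r c B v = mat_image A r c B +>\<^bsub>vecs A r\<^esub> v"

text \<open>The canonical isomorphism from the Frobenius pullback of the cokernel of B to the cokernel of
  the entrywise power, sending the tensor of a and the class of v to a times the class of the
  entrywise power of v.\<close>

definition Frob_coker ::
  "('a, 'x) ring_scheme \<Rightarrow> nat \<Rightarrow> nat \<Rightarrow> nat \<Rightarrow> (nat \<Rightarrow> nat \<Rightarrow> 'a)
    \<Rightarrow> ((nat \<Rightarrow> 'a) set \<Rightarrow> 'a) set \<Rightarrow> (nat \<Rightarrow> 'a) set" where
  "Frob_coker A q r c B = Frob_lift A (coker A r c B) (coker A r c (mat_pow A q B)) 1
     (\<lambda>X. the_elem ((\<lambda>v. coker_class A r c (mat_pow A q B) (vec_pow A r q v)) ` X))"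

text \<open>The presentation of the root is absorbed into the choice of the root: the root is taken
  to be the cokernel of B itself, which is no restriction because a root may be replaced
  by an isomorphic module.\<close>

definition represents_root ::
  "('a, 'x) ring_scheme \<Rightarrow> nat \<Rightarrow> nat \<Rightarrow> (nat \<Rightarrow> nat \<Rightarrow> 'a)
    \<Rightarrow> ('a, 'n) module \<Rightarrow> ('n \<Rightarrow> ('n \<Rightarrow> 'a) set) \<Rightarrow> bool" where
  "represents_root A p \<alpha> U M \<theta> \<longleftrightarrow>
     (\<exists>c B \<beta>. is_matrix A \<alpha> c B \<and>
        mat_vec A \<alpha> \<alpha> U ` mat_image A \<alpha> c B \<subseteq> mat_image A \<alpha> c (mat_pow A p B) \<and>
        root_morphism A p (coker A \<alpha> c B) \<beta> M \<theta> \<and>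
        (\<forall>v\<in>carrier (vecs A \<alpha>).
           Frob_coker A p \<alpha> c B (\<beta> (coker_class A \<alpha> c B v)) =
           coker_class A \<alpha> c (mat_pow A p B) (mat_vec A \<alpha> \<alpha> U v)))"

definition submod_pow ::
  "('a, 'x) ring_scheme \<Rightarrow> nat \<Rightarrow> nat \<Rightarrow> (nat \<Rightarrow> 'a) set \<Rightarrow> (nat \<Rightarrow> 'a) set" where
  "submod_pow A \<alpha> q K = gen_submodule A (vecs A \<alpha>) (vec_pow A \<alpha> q ` K)"

definition I_op ::
  "('a, 'x) ring_scheme \<Rightarrow> nat \<Rightarrow> nat \<Rightarrow> nat \<Rightarrow> (nat \<Rightarrow> 'a) set \<Rightarrow> (nat \<Rightarrow> 'a) set" where
  "I_op A p \<alpha> e K =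
     (THE L. is_smallest (\<lambda>L. submodule L A (vecs A \<alpha>) \<and> K \<subseteq> submod_pow A \<alpha> (p ^ e) L) L)"

text \<open>The submodule obtained from the full free module by applying U, its p-th power, and so on, up
  to the power with exponent \<open>p ^ (e - 1)\<close>.\<close>

primrec iter_image ::
  "('a, 'x) ring_scheme \<Rightarrow> nat \<Rightarrow> nat \<Rightarrow> (nat \<Rightarrow> nat \<Rightarrow> 'a) \<Rightarrow> nat \<Rightarrow> (nat \<Rightarrow> 'a) set" where
  "iter_image A p \<alpha> U 0 = carrier (vecs A \<alpha>)"
| "iter_image A p \<alpha> U (Suc e) = mat_vec A \<alpha> \<alpha> (mat_pow A (p ^ e) U) ` iter_image A p \<alpha> U e"

definition stable_value :: "(nat \<Rightarrow> 'b) \<Rightarrow> 'b" where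
  "stable_value s = (THE K. \<exists>e0. \<forall>e\<ge>e0. s e = K)"

definition stable_K ::
  "('a, 'x) ring_scheme \<Rightarrow> nat \<Rightarrow> nat \<Rightarrow> (nat \<Rightarrow> nat \<Rightarrow> 'a) \<Rightarrow> (nat \<Rightarrow> 'a) set" where
  "stable_K A p \<alpha> U = stable_value (\<lambda>e. I_op A p \<alpha> e (iter_image A p \<alpha> U e))"

definition special_ideal ::
  "('a, 'x) ring_scheme \<Rightarrow> nat \<Rightarrow> nat \<Rightarrow> (nat \<Rightarrow> nat \<Rightarrow> 'a) \<Rightarrow> 'a set \<Rightarrow> bool" where
  "special_ideal A p \<alpha> U J \<longleftrightarrow>
     (\<exists>V. submodule V A (vecs A \<alpha>) \<and> mat_vec A \<alpha> \<alpha> U ` V \<subseteq> submod_pow A \<alpha> p V \<and>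
          J = ann A (quot_module (vecs A \<alpha>) V))"

definition ideal_vecs :: "('a, 'x) ring_scheme \<Rightarrow> nat \<Rightarrow> 'a set \<Rightarrow> (nat \<Rightarrow> 'a) set" where
  "ideal_vecs A \<alpha> J =
     gen_submodule A (vecs A \<alpha>) {a \<odot>\<^bsub>vecs A \<alpha>\<^esub> v | a v. a \<in> J \<and> v \<in> carrier (vecs A \<alpha>)}"

definition special_primes ::
  "('a, 'x) ring_scheme \<Rightarrow> nat \<Rightarrow> nat \<Rightarrow> (nat \<Rightarrow> nat \<Rightarrow> 'a) \<Rightarrow> 'a set set" where
  "special_primes A p \<alpha> U =
     {P. primeideal P A \<and> special_ideal A p \<alpha> U P \<and> \<not> stable_K A p \<alpha> U \<subseteq> ideal_vecs A \<alpha> P}"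


section \<open>Local cohomology\<close>

text \<open>Local cohomology of A with support in the ideal generated by a list fs, as the
  cohomology of the Cech complex. For a set S of positions of fs, \<open>cech_denoms A fs S\<close> is the
  multiplicative set generated by the members of fs at these positions; inverting it is
  the same as inverting their product.\<close>

definition cech_denoms :: "('a, 'x) ring_scheme \<Rightarrow> 'a list \<Rightarrow> nat set \<Rightarrow> 'a set" where
  "cech_denoms A fs S = {finprod A (\<lambda>j. (fs ! j) [^]\<^bsub>A\<^esub> (e j)) S | e :: nat \<Rightarrow> nat. True}"

abbreviation cech_loc ::
  "('a, 'x) ring_scheme \<Rightarrow> 'a list \<Rightarrow> nat set \<Rightarrow> ('a, ('a \<times> 'a) set) module" where
  "cech_loc A fs S \<equiv> loc_ring A (cech_denoms A fs S)"

definition cech_index :: "'a list \<Rightarrow> nat \<Rightarrow> nat set set" where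
  "cech_index fs i = {S. S \<subseteq> {..<length fs} \<and> card S = i}"

definition cech ::
  "('a, 'x) ring_scheme \<Rightarrow> 'a list \<Rightarrow> nat \<Rightarrow> ('a, nat set \<Rightarrow> ('a \<times> 'a) set) module" where
  "cech A fs i = direct_sum (cech_index fs i) (cech_loc A fs)"

text \<open>The localization map between two terms of the complex (a fraction is sent to the same
  fraction), for S contained in T.\<close>

definition cech_res ::
  "('a, 'x) ring_scheme \<Rightarrow> 'a list \<Rightarrow> nat set \<Rightarrow> ('a \<times> 'a) set \<Rightarrow> ('a \<times> 'a) set" where
  "cech_res A fs T X = (\<Union>(a, s)\<in>X. fraction A (cech_denoms A fs T) (reg A) a s)"

definition cech_diff ::
  "('a, 'x) ring_scheme \<Rightarrow> 'a list \<Rightarrow> nat \<Rightarrow> (nat set \<Rightarrow> ('a \<times> 'a) set)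
    \<Rightarrow> nat set \<Rightarrow> ('a \<times> 'a) set" where
  "cech_diff A fs i x = (\<lambda>T\<in>cech_index fs (Suc i).
     \<Oplus>\<^bsub>cech_loc A fs T\<^esub>j\<in>T.
       (let y = cech_res A fs T (x (T - {j}))
        in if even (card {l\<in>T. l < j}) then y else \<ominus>\<^bsub>cech_loc A fs T\<^esub> y))"

definition cech_cycles ::
  "('a, 'x) ring_scheme \<Rightarrow> 'a list \<Rightarrow> nat \<Rightarrow> (nat set \<Rightarrow> ('a \<times> 'a) set) set" where
  "cech_cycles A fs i = {x \<in> carrier (cech A fs i). cech_diff A fs i x = \<zero>\<^bsub>cech A fs (Suc i)\<^esub>}"

definition cech_boundaries ::
  "('a, 'x) ring_scheme \<Rightarrow> 'a list \<Rightarrow> nat \<Rightarrow> (nat set \<Rightarrow> ('a \<times> 'a) set) set" where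
  "cech_boundaries A fs i = (case i of 0 \<Rightarrow> {\<zero>\<^bsub>cech A fs 0\<^esub>}
     | Suc k \<Rightarrow> cech_diff A fs k ` carrier (cech A fs k))"

definition cech_cohomology ::
  "('a, 'x) ring_scheme \<Rightarrow> 'a list \<Rightarrow> nat
    \<Rightarrow> ('a, (nat set \<Rightarrow> ('a \<times> 'a) set) set) module" where
  "cech_cohomology A fs i =
     quot_module (submod (cech A fs i) (cech_cycles A fs i)) (cech_boundaries A fs i)"

text \<open>The p-th power maps of the rings in the complex induce a map on cohomology, which is
  semilinear with respect to the Frobenius endomorphism of A.\<close>

definition cech_frob ::
  "('a, 'x) ring_scheme \<Rightarrow> nat \<Rightarrow> 'a list \<Rightarrow> nat
    \<Rightarrow> (nat set \<Rightarrow> ('a \<times> 'a) set) set \<Rightarrow> (nat set \<Rightarrow> ('a \<times> 'a) set) set" where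
  "cech_frob A p fs i X = the_elem
     ((\<lambda>z. cech_boundaries A fs i +>\<^bsub>cech A fs i\<^esub>
             (\<lambda>S\<in>cech_index fs i. z S [^]\<^bsub>cech_loc A fs S\<^esub> p)) ` X)"

text \<open>The canonical isomorphism of A with \<open>Frob A p (reg A)\<close> sends a to the tensor of a and 1.
  After localization, its inverse sends the tensor of a and x to \<open>a * x ^ p\<close>. Hence the
  isomorphism that it induces on cohomology is the inverse of the linearization of \<open>cech_frob\<close>.\<close>

definition cech_structure ::
  "('a, 'x) ring_scheme \<Rightarrow> nat \<Rightarrow> 'a list \<Rightarrow> nat \<Rightarrow> (nat set \<Rightarrow> ('a \<times> 'a) set) set
    \<Rightarrow> ((nat set \<Rightarrow> ('a \<times> 'a) set) set \<Rightarrow> 'a) set" where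
  "cech_structure A p fs i =
     (let H = cech_cohomology A fs i in
      inv_into (carrier (Frob A p H)) (Frob_lift A H H 1 (cech_frob A p fs i)))"

text \<open>The F-module of local cohomology in degree i with support in I. It depends on the
  generators of I only up to isomorphism; every finite list of generators is admitted.\<close>

definition local_cohomology ::
  "('a, 'x) ring_scheme \<Rightarrow> nat \<Rightarrow> 'a set \<Rightarrow> nat
    \<Rightarrow> ('a, (nat set \<Rightarrow> ('a \<times> 'a) set) set) module
    \<Rightarrow> ((nat set \<Rightarrow> ('a \<times> 'a) set) set \<Rightarrow> ((nat set \<Rightarrow> ('a \<times> 'a) set) set \<Rightarrow> 'a) set) \<Rightarrow> bool" where
  "local_cohomology A p I i H \<theta> \<longleftrightarrow>
     (\<exists>fs. set fs \<subseteq> carrier A \<and> I = genideal A (set fs) \<and>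
           H = cech_cohomology A fs i \<and> \<theta> = cech_structure A p fs i)"


section \<open>Corank\<close>

text \<open>The test modules Y live on a fixed type that has room for the ring A itself; by Baer's
  criterion extending maps from the submodules of A is already sufficient, so the choice of the type is
  immaterial.\<close>

definition injective_module ::
  "('a, 'x) ring_scheme \<Rightarrow> ('a, 'm) module \<Rightarrow> bool" where
  "injective_module A E \<longleftrightarrow> Module.module A E \<and>
     (\<forall>(Y :: ('a, nat \<Rightarrow> 'a) module) X. Module.module A Y \<and> submodule X A Y \<longrightarrow>
        (\<forall>f\<in>mod_hom A (submod Y X) E. \<exists>g\<in>mod_hom A Y E. \<forall>x\<in>X. g x = f x))"

definition injective_hull ::
  "('a, 'x) ring_scheme \<Rightarrow> ('a, 'k) module \<Rightarrow> ('a, 'm) module \<Rightarrow> bool" where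
  "injective_hull A K E \<longleftrightarrow> injective_module A E \<and>
     (\<exists>\<iota>\<in>mod_hom A K E. inj_on \<iota> (carrier K) \<and>
        (\<forall>N. submodule N A E \<and> N \<noteq> {\<zero>\<^bsub>E\<^esub>} \<longrightarrow> N \<inter> \<iota> ` carrier K \<noteq> {\<zero>\<^bsub>E\<^esub>}))"

definition residue_module :: "('a, 'x) ring_scheme \<Rightarrow> ('a, 'a set) module" where
  "residue_module A = quot_module (reg A) (THE \<mm>. maximalideal \<mm> A)"

text \<open>\<open>corank_is A p M \<theta> k\<close> says that the corank of the F-module \<open>(M, \<theta>)\<close> over the local ring A is k. It is
  stated as a relation between M and k because the existence of N and of k is a theorem about F-finite
  modules over regular local rings. For A noetherian local the injective hull E of the residue field is
  a countable union of modules of finite length, so its cardinality is at most that of A or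
  countable; hence it has a copy on the type \<^typ>\<open>nat \<Rightarrow> 'a\<close>. The condition on the dimension is also
  satisfied by \<open>N = carrier M\<close>, see \<open>dim_primes\<close>.\<close>

definition corank_is ::
  "('a, 'x) ring_scheme \<Rightarrow> nat \<Rightarrow> ('a, 'm) module \<Rightarrow> ('m \<Rightarrow> ('m \<Rightarrow> 'a) set) \<Rightarrow> nat \<Rightarrow> bool" where
  "corank_is A p M \<theta> k \<longleftrightarrow>
     (\<exists>N (E :: ('a, nat \<Rightarrow> 'a) module).
        is_smallest (\<lambda>N. F_submodule A p M \<theta> N \<and> dim_primes (supp A (quot_module M N)) = 0) N \<and>
        injective_hull A (residue_module A) E \<and>
        mod_iso A (quot_module M N) (direct_sum {..<k} (\<lambda>_. E)) \<noteq> {})"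

end

theory Submission
  imports Defs Complex_Main "HOL-Algebra.QuotRing"
begin

text \<open>Let \<open>b j\<close> be a basis of R over its p-th powers. An F-module structure on H is a p-linear map \<open>\<phi>\<close> such that
every x is uniquely a sum of terms \<open>b j \<phi> (D j x)\<close>. If \<open>x 0, \<dots>, x (d - 1)\<close> generate a root of H and
\<open>x i\<close> is the sum of the \<open>U j i \<phi> (x j)\<close>, then U represents the root, and the surjection g from \<open>R^d\<close> onto the root
intertwines \<open>D j\<close> with \<open>v \<mapsto> D j (U v)\<close>; hence submodules of H that are stable under all \<open>D j\<close> pull back to
submodules V with \<open>U V \<subseteq> V^[p]\<close>. The root is chosen minimal, as the last member \<open>M1\<close> of a descending chain that
stabilises because degrees are bounded, so that g maps the stable value K of the chain of the theorem onto \<open>M1\<close>.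

If the corank at P is not zero, the smallest F-submodule of the local cohomology at P pulls back to a D-stable
\<open>N \<subseteq> H\<close> that is saturated at P and whose quotient is P-torsion and not zero. For a not in \<open>(N : M1)\<close> with
\<open>P a \<subseteq> (N : M1)\<close>, the submodule \<open>V = {v. a g v \<in> N}\<close> makes P a U-special ideal, and \<open>K \<subseteq> P R^d\<close> would imply
\<open>a M1 \<subseteq> N\<close>. That local cohomology at P may be computed from any generators of the ideal follows by removing a
redundant generator: the part of the Cech complex indexed by the sets containing it is exact.\<close>

text \<open>The field need not be finite over its p-th powers, so the basis may be infinite, and
  only finite expansions are used. Two operators on submodules carry the argument:
  \<open>Dinv L\<close> consists of the elements all of whose components lie in L, and
  \<open>Dgen K\<close> is generated by the components of K. On R^d, \<open>Dinv L\<close> is L^[p]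
  and \<open>Dgen K\<close> is I_1(K), and \<open>Dgen K <= L\<close> iff
  \<open>K <= Dinv L\<close>. This adjunction stands in for flatness of Frobenius and turns
  statements on matrices and p-th powers into statements on the maps D j, which are additive and
  commute with localization. Two estimates give finiteness. D j divides pole orders by p, so
  cocycles with simple poles generate a root. If U and v have exponents at most delta, then U v has
  exponents at most 2 delta <= p delta, and D j brings this back to delta; this makes a descending
  chain stationary, which noetherianness alone does not give. The corank enters through the quotient
  by the smallest F-submodule, a power of the injective hull E: E is not zero, and each element of P
  acts on E locally nilpotently.\<close>

abbreviation (input) add_at (\<open>_ +\<^sub>_ _\<close> [65,1000,66] 65) where "x +\<^sub>M y \<equiv> x \<oplus>\<^bsub>M\<^esub> y"
abbreviation (input) minus_at (\<open>_ -\<^sub>_ _\<close> [65,1000,66] 65) where "x -\<^sub>M y \<equiv> x \<ominus>\<^bsub>M\<^esub> y"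
abbreviation (input) uminus_at (\<open>-\<^sub>_ _\<close> [1000,81] 80) where "-\<^sub>M y \<equiv> \<ominus>\<^bsub>M\<^esub> y"
abbreviation (input) mult_at (\<open>_ \<otimes>\<^sub>_ _\<close> [70,1000,71] 70) where "x \<otimes>\<^sub>M y \<equiv> x \<otimes>\<^bsub>M\<^esub> y"
abbreviation (input) smult_at (\<open>_ *\<^sub>_ _\<close> [70,1000,71] 70) where "x *\<^sub>M y \<equiv> x \<odot>\<^bsub>M\<^esub> y"
abbreviation (input) coset_at (\<open>_ +>\<^sub>_ _\<close> [60,1000,61] 60) where "x +>\<^sub>M y \<equiv> x +>\<^bsub>M\<^esub> y"
abbreviation (input) pow_at (\<open>_ ^\<^sub>_ _\<close> [76,1000,75] 75) where "x ^\<^sub>M n \<equiv> x [^]\<^bsub>M\<^esub> n"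
abbreviation (input) zero_at (\<open>0\<^sub>_\<close> [1000] 1000) where "0\<^sub>M \<equiv> \<zero>\<^bsub>M\<^esub>"
abbreviation (input) one_at (\<open>1\<^sub>_\<close> [1000] 1000) where "1\<^sub>M \<equiv> \<one>\<^bsub>M\<^esub>"

section \<open>Modules over commutative rings\<close>

text \<open>Linear maps are the case q = 1 (\<open>mod_hom_eq_semilin\<close>), so one stock of
  lemmas serves linear maps, Frobenius maps and their iterates. Additivity of a -> a^q is a separate
  matter and is assumed where it is used.\<close>

definition semilin ::
 "('a, 'x) ring_scheme => nat => ('a, 'm) module => ('a, 'n) module => ('m => 'n) set" where
 "semilin A q M N = {f : carrier M \<rightarrow> carrier N.
   (\<forall>x\<in>carrier M. \<forall>y\<in>carrier M. f (x +\<^sub>M y) = f x +\<^sub>N f y) \<and>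
   (\<forall>a\<in>carrier A. \<forall>x\<in>carrier M. f (a *\<^sub>M x) = (a ^\<^sub>A q) *\<^sub>N f x)}"

lemma semilinI:
 assumes "\<And>x. x : carrier M ==> f x : carrier N"
  and "\<And>x y. x : carrier M ==> y : carrier M ==> f (x +\<^sub>M y) = f x +\<^sub>N f y"
  and "\<And>a x. a : carrier A ==> x : carrier M ==> f (a *\<^sub>M x) = (a ^\<^sub>A q) *\<^sub>N f x"
 shows "f : semilin A q M N" using assms unfolding semilin_def by auto

lemma semilinD:
 assumes "f : semilin A q M N"
 shows semilin_closed: "\<And>x. x : carrier M ==> f x : carrier N"
  and semilin_add: "\<And>x y. x : carrier M ==> y : carrier M ==> f (x +\<^sub>M y) = f x +\<^sub>N f y"
  and semilin_smult: "\<And>a x. a : carrier A ==> x : carrier M ==> f (a *\<^sub>M x) = (a ^\<^sub>A q) *\<^sub>N f x"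
 using assms unfolding semilin_def by auto

lemma mod_hom_eq_semilin: "cring A ==> mod_hom A M N = semilin A 1 M N"
proof -
 assume "cring A"
 then interpret cring A .
 have "a ^\<^sub>A (1::nat) = a" if "a : carrier A" for a using that by simp
 then show ?thesis unfolding mod_hom_def semilin_def by auto
qed

lemma mod_homI:
 assumes "\<And>x. x : carrier M ==> f x : carrier N"
  and "\<And>x y. x : carrier M ==> y : carrier M ==> f (x +\<^sub>M y) = f x +\<^sub>N f y"
  and "\<And>a x. a : carrier A ==> x : carrier M ==> f (a *\<^sub>M x) = a *\<^sub>N f x"
 shows "f : mod_hom A M N" using assms unfolding mod_hom_def by auto

lemma mod_homD:
 assumes "f : mod_hom A M N"
 shows "\<And>x. x : carrier M ==> f x : carrier N"
  and "\<And>x y. x : carrier M ==> y : carrier M ==> f (x +\<^sub>M y) = f x +\<^sub>N f y"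
  and "\<And>a x. a : carrier A ==> x : carrier M ==> f (a *\<^sub>M x) = a *\<^sub>N f x"
 using assms unfolding mod_hom_def by auto

lemma abelian_group_minus_zero: "abelian_group G ==> -\<^sub>G 0\<^sub>G = 0\<^sub>G"
 by (simp add: abelian_group.minus_equality abelian_groupE(2) abelian_groupE(5))

lemma module_cring: "Module.module A M ==> cring A"
 and module_ab: "Module.module A M ==> abelian_group M" by (auto simp: Module.module_def)

context
 fixes A :: "('a, 'x) ring_scheme" and M :: "('a, 'm) module" and N :: "('a, 'n) module"
  and f q
 assumes M: "Module.module A M" and N: "Module.module A N" and f: "f : semilin A q M N"
begin

interpretation M: Module.module A M by (fact M)
interpretation N: Module.module A N by (fact N)

lemma semilin_zero: "f 0\<^sub>M = 0\<^sub>N"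
proof -
 have "f 0\<^sub>M +\<^sub>N f 0\<^sub>M = f 0\<^sub>M" using semilin_add[OF f, of "0\<^sub>M" "0\<^sub>M"] by simp
 then show ?thesis using semilin_closed[OF f, of "0\<^sub>M"]
  by (metis M.M.zero_closed N.M.add.r_cancel_one')
qed

lemma semilin_neg: "x : carrier M ==> f (-\<^sub>M x) = -\<^sub>N f x"
proof -
 assume x: "x : carrier M"
 have "f x +\<^sub>N f (-\<^sub>M x) = 0\<^sub>N"
  using semilin_add[OF f, of x "-\<^sub>M x"] x semilin_zero by (simp add: M.M.r_neg)
 then show ?thesis using semilin_closed[OF f] x
  by (metis M.M.a_inv_closed N.M.a_comm N.M.minus_equality)
qed

lemma semilin_minus: "x : carrier M ==> y : carrier M ==> f (x -\<^sub>M y) = f x -\<^sub>N f y"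
 by (simp add: a_minus_def semilin_add[OF f] semilin_neg)

lemma semilin_finsum:
 assumes "finite S" "x : S \<rightarrow> carrier M"
 shows "f (\<Oplus>\<^bsub>M\<^esub>i\<in>S. x i) = (\<Oplus>\<^bsub>N\<^esub>i\<in>S. f (x i))" using assms
proof (induction S)
 case empty
 then show ?case by (simp add: semilin_zero)
next
 case (insert s S)
 then have "(\<lambda>i. f (x i)) : S \<rightarrow> carrier N" "x : S \<rightarrow> carrier M" "f (x s) : carrier N" "x s : carrier M"
  using semilin_closed[OF f] by auto
 with insert show ?case by (simp add: semilin_add[OF f])
qed

text \<open>Holds because a^q is again a scalar. Together with \<open>gen_submodule_minimal\<close>
  it is the standard way here to prove that all elements of a generated submodule have some
  property.\<close>

lemma semilin_preimage:
 assumes "submodule L A N"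
 shows "submodule {x : carrier M. f x : L} A M"
 using N.submoduleE[OF assms] semilinD[OF f] semilin_zero semilin_neg
  subgroup.one_closed[OF submodule.axioms(1)[OF assms]] by (intro M.submoduleI) auto

end

lemma semilin_comp:
 assumes "cring A" "f : semilin A q M N" "g : semilin A r N L"
 shows "(\<lambda>x. g (f x)) : semilin A (q * r) M L"
proof -
 interpret cring A by fact
 show ?thesis using semilinD[OF assms(2)] semilinD[OF assms(3)]
  by (intro semilinI) (auto simp: nat_pow_pow)
qed

lemma submodule_zero: "submodule N A M ==> 0\<^sub>M : N"
 using subgroup.one_closed[OF submodule.axioms(1)] by fastforce

lemma submodule_minus:
 assumes "Module.module A M" "submodule N A M" "x : N" "y : N"
 shows "x -\<^sub>M y : N"
 using Module.module.submoduleE[OF assms(1,2)] assms(3,4) by (auto simp: a_minus_def)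

lemma submodule_finsum:
 assumes "Module.module A M" "submodule N A M" "finite S" "\<And>i. i : S ==> x i : N"
 shows "(\<Oplus>\<^bsub>M\<^esub>i\<in>S. x i) : N" using assms(3,4)
proof (induction S)
 case empty
 interpret Module.module A M by fact
 show ?case using submodule_zero[OF assms(2)] by simp
next
 case (insert s S)
 interpret Module.module A M by fact
 show ?case using insert submoduleE[OF assms(2)] by (subst M.finsum_insert) auto
qed

text \<open>The intersection of no sets at all is the whole type, hence the nonempty family; in
  \<open>gen_submodule_is_submodule\<close> the full carrier supplies a member.\<close>

lemma submodule_UNIV_Int:
 assumes "Module.module A M" "\<And>N. N : \<N> ==> submodule N A M" "\<N> \<noteq> {}"
 shows "submodule (\<Inter>\<N>) A M"
proof -
 interpret Module.module A M by fact
 note sub = submodule_zero[OF assms(2)] submoduleE[OF assms(2)]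
 show ?thesis
 proof (rule submoduleI)
  show "\<Inter>\<N> <= carrier M" using assms(3) sub(2) by blast
 qed (use sub in simp_all)
qed

lemma submodule_Int:
 assumes "Module.module A M" "submodule N A M" "submodule L A M"
 shows "submodule (N \<inter> L) A M" using submodule_UNIV_Int[of A M "{N, L}"] assms by auto

context
 fixes A :: "('a, 'x) ring_scheme" and M :: "('a, 'm) module" and S :: "'m set"
 assumes M: "Module.module A M"
begin

interpretation M: Module.module A M by (fact M)

lemma gen_submodule_subset: "S <= gen_submodule A M S" unfolding gen_submodule_def by auto

lemma gen_submodule_minimal: "submodule N A M ==> S <= N ==> gen_submodule A M S <= N"
 unfolding gen_submodule_def by auto

lemma gen_submodule_is_submodule: "S <= carrier M ==> submodule (gen_submodule A M S) A M"
 unfolding gen_submodule_def by (rule submodule_UNIV_Int[OF M]) (use M.carrier_is_submodule in auto)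

lemma gen_submodule_le_iff:
 "submodule N A M ==> gen_submodule A M S <= N \<longleftrightarrow> S <= N"
 using gen_submodule_minimal gen_submodule_subset by blast

lemma gen_submodule_self: "submodule S A M ==> gen_submodule A M S = S"
 using gen_submodule_minimal gen_submodule_subset by blast

lemma gen_submodule_closed: "S <= carrier M ==> gen_submodule A M S <= carrier M"
 using gen_submodule_minimal M.carrier_is_submodule by blast

end

lemma gen_submodule_mono: "S <= T ==> gen_submodule A M S <= gen_submodule A M T"
 unfolding gen_submodule_def by auto

lemma mod_hom_image_submodule:
 assumes M: "Module.module A M" and N: "Module.module A N" and f: "f : mod_hom A M N"
  and L: "submodule L A M"
 shows "submodule (f ` L) A N"
proof -
 interpret M: Module.module A M by fact
 interpret N: Module.module A N by fact
 have f': "f : semilin A 1 M N" using f mod_hom_eq_semilin[of A M N] M.R.is_cring by simp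
 note L' = M.submoduleE[OF L] submodule_zero[OF L]
 show ?thesis
 proof (rule N.submoduleI)
  show "f ` L <= carrier N" using L'(1) mod_homD(1)[OF f] by auto
  show "0\<^sub>N : f ` L" using semilin_zero[OF M N f'] L' by (metis image_eqI)
  show "-\<^sub>N a : f ` L" if a: "a : f ` L" for a
  proof -
   obtain y where "y : L" "a = f y" using a by auto
   then show ?thesis using semilin_neg[OF M N f', of y] L' by (metis image_eqI subsetD)
  qed
  show "a +\<^sub>N b : f ` L" if a: "a : f ` L" "b : f ` L" for a b
  proof -
   obtain y z where "y : L" "a = f y" "z : L" "b = f z" using a by auto
   then show ?thesis using mod_homD(2)[OF f, of y z] L' by (metis image_eqI subsetD)
  qed
  show "a *\<^sub>N b : f ` L" if a: "a : carrier A" "b : f ` L" for a b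
  proof -
   obtain y where "y : L" "b = f y" using a by auto
   then show ?thesis using mod_homD(3)[OF f, of a y] a L' by (metis image_eqI subsetD)
  qed
 qed
qed

lemma mod_hom_image_gen:
 assumes M: "Module.module A M" and N: "Module.module A N" and f: "f : mod_hom A M N"
  and S: "S <= carrier M"
 shows "f ` gen_submodule A M S = gen_submodule A N (f ` S)"
proof
 interpret M: Module.module A M by fact
 interpret N: Module.module A N by fact
 have f': "f : semilin A 1 M N" using f mod_hom_eq_semilin[of A M N] M.R.is_cring by simp
 have fS: "f ` S <= carrier N" using S mod_homD(1)[OF f] by auto
 show "gen_submodule A N (f ` S) <= f ` gen_submodule A M S"
  by (intro gen_submodule_minimal N mod_hom_image_submodule[OF M N f] gen_submodule_is_submodule M S
    image_mono gen_submodule_subset)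
 have "gen_submodule A M S <= {x : carrier M. f x : gen_submodule A N (f ` S)}"
  using S gen_submodule_subset[OF N, of "f ` S"]
  by (intro gen_submodule_minimal M semilin_preimage[OF M N f'] gen_submodule_is_submodule N fS) auto
 then show "f ` gen_submodule A M S <= gen_submodule A N (f ` S)" by auto
qed

lemma gen_submodule_lincomb:
 assumes M: "Module.module A M" and I: "finite I" and x: "x : I \<rightarrow> carrier M"
 shows "gen_submodule A M (x ` I) = {\<Oplus>\<^bsub>M\<^esub>i\<in>I. v i *\<^sub>M x i | v. v : I \<rightarrow> carrier A}" (is "_ = ?L")
proof
 interpret M: Module.module A M by fact
 have xI: "x ` I <= carrier M" using x by auto
 have xm: "x i : carrier M" if "i : I" for i using that x by auto
 have *: "submodule ?L A M"
 proof (rule M.submoduleI)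
  show "?L <= carrier M" using x by (auto intro!: M.M.finsum_closed)
  show "0\<^sub>M : ?L"
   by (rule CollectI, rule exI[of _ "\<lambda>_. 0\<^sub>A"]) (auto simp: xm intro!: M.M.add.finprod_one_eqI[symmetric])
  show "-\<^sub>M a : ?L" if a: "a : ?L" for a
  proof -
   obtain v where v: "v : I \<rightarrow> carrier A" "a = (\<Oplus>\<^bsub>M\<^esub>i\<in>I. v i *\<^sub>M x i)" using a by auto
   have "a : carrier M" unfolding v using v x by (intro M.M.finsum_closed) auto
   then have "-\<^sub>M a = (-\<^sub>A 1\<^sub>A) *\<^sub>M a" by (simp add: M.smult_l_minus)
   also have "\<dots> = (\<Oplus>\<^bsub>M\<^esub>i\<in>I. (-\<^sub>A 1\<^sub>A) *\<^sub>M (v i *\<^sub>M x i))"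
    unfolding v using v x by (intro M.finsum_smult_ldistr I) auto
   also have "\<dots> = (\<Oplus>\<^bsub>M\<^esub>i\<in>I. ((-\<^sub>A 1\<^sub>A) \<otimes>\<^sub>A v i) *\<^sub>M x i)"
    using v x by (intro M.M.finsum_cong) (auto simp: M.smult_assoc1 Pi_iff)
   finally show ?thesis using v by (intro CollectI exI[of _ "\<lambda>i. (-\<^sub>A 1\<^sub>A) \<otimes>\<^sub>A v i"]) auto
  qed
  show "a +\<^sub>M b : ?L" if ab: "a : ?L" "b : ?L" for a b
  proof -
   obtain v where v: "v : I \<rightarrow> carrier A" "a = (\<Oplus>\<^bsub>M\<^esub>i\<in>I. v i *\<^sub>M x i)" using ab by auto
   obtain w where w: "w : I \<rightarrow> carrier A" "b = (\<Oplus>\<^bsub>M\<^esub>i\<in>I. w i *\<^sub>M x i)" using ab by auto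
   have "a +\<^sub>M b = (\<Oplus>\<^bsub>M\<^esub>i\<in>I. v i *\<^sub>M x i +\<^sub>M w i *\<^sub>M x i)"
    unfolding v w using v w x by (intro M.M.finsum_addf[symmetric]) auto
   also have "\<dots> = (\<Oplus>\<^bsub>M\<^esub>i\<in>I. (v i +\<^sub>A w i) *\<^sub>M x i)"
    using v w x by (intro M.M.finsum_cong) (auto simp: M.smult_l_distr Pi_iff)
   finally show ?thesis using v w by (intro CollectI exI[of _ "\<lambda>i. v i +\<^sub>A w i"]) auto
  qed
  show "a *\<^sub>M b : ?L" if ab: "a : carrier A" "b : ?L" for a b
  proof -
   obtain w where w: "w : I \<rightarrow> carrier A" "b = (\<Oplus>\<^bsub>M\<^esub>i\<in>I. w i *\<^sub>M x i)" using ab by auto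
   have "a *\<^sub>M b = (\<Oplus>\<^bsub>M\<^esub>i\<in>I. a *\<^sub>M (w i *\<^sub>M x i))"
    unfolding w using w x ab by (intro M.finsum_smult_ldistr I) auto
   also have "\<dots> = (\<Oplus>\<^bsub>M\<^esub>i\<in>I. (a \<otimes>\<^sub>A w i) *\<^sub>M x i)"
    using w x ab by (intro M.M.finsum_cong) (auto simp: M.smult_assoc1 Pi_iff)
   finally show ?thesis using w ab by (intro CollectI exI[of _ "\<lambda>i. a \<otimes>\<^sub>A w i"]) auto
  qed
 qed
 have "x i : ?L" if i: "i : I" for i
 proof -
  have "x i = (\<Oplus>\<^bsub>M\<^esub>j\<in>I. if i = j then x j else 0\<^sub>M)" using M.M.finsum_singleton[OF i I x] by simp
  also have "\<dots> = (\<Oplus>\<^bsub>M\<^esub>j\<in>I. (if i = j then 1\<^sub>A else 0\<^sub>A) *\<^sub>M x j)"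
   using x by (intro M.M.finsum_cong) (auto simp: Pi_iff simp_implies_def)
  finally show ?thesis by (intro CollectI exI[of _ "\<lambda>j. if i = j then 1\<^sub>A else 0\<^sub>A"]) auto
 qed
 then show "gen_submodule A M (x ` I) <= ?L" by (intro gen_submodule_minimal M *) auto
 have "gen_submodule A M (x ` I) = gen_submodule A M (x ` I)" ..
 have g: "submodule (gen_submodule A M (x ` I)) A M" by (intro gen_submodule_is_submodule M xI)
 show "?L <= gen_submodule A M (x ` I)"
  using M.submoduleE[OF g] gen_submodule_subset[OF M, of "x ` I"]
  by (auto intro!: submodule_finsum[OF M g I] simp: Pi_iff)
qed

subsection \<open>Quotients\<close>

context
 fixes A :: "('a, 'x) ring_scheme" and M :: "('a, 'm) module" and N :: "'m set"
 assumes M: "Module.module A M" and N: "submodule N A M"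
begin

interpretation M: Module.module A M by (fact M)

lemmas N' = M.submoduleE[OF N] submodule_zero[OF N]

lemma coset_eq: "x : carrier M ==> N +>\<^sub>M x = {z : carrier M. z -\<^sub>M x : N}"
proof (intro equalityI subsetI)
 fix z assume x: "x : carrier M" and z: "z : N +>\<^sub>M x"
 then obtain h where h: "h : N" "z = h +\<^sub>M x" by (auto simp: a_r_coset_def')
 then have "h : carrier M" using N' by auto
 then have "z -\<^sub>M x = h" using h x by (simp add: a_minus_def M.M.a_assoc M.M.r_neg)
 then show "z : {z : carrier M. z -\<^sub>M x : N}" using h x \<open>h : carrier M\<close> by simp
next
 fix z assume x: "x : carrier M" and z: "z : {z : carrier M. z -\<^sub>M x : N}"
 then have "z = (z -\<^sub>M x) +\<^sub>M x" by (simp add: a_minus_def M.M.a_assoc M.M.l_neg)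
 then show "z : N +>\<^sub>M x" using z by (auto simp: a_r_coset_def')
qed

lemma coset_mem: "x : carrier M ==> x : N +>\<^sub>M x"
 using N' by (simp add: coset_eq a_minus_def M.M.r_neg)

lemma minus_swap: "x : carrier M ==> y : carrier M ==> x -\<^sub>M y : N ==> y -\<^sub>M x : N"
 using N'(3)[of "x -\<^sub>M y"] by (simp add: a_minus_def M.M.minus_add M.M.a_comm)

lemma coset_eq_iff:
 assumes "x : carrier M" "y : carrier M"
 shows "N +>\<^sub>M x = N +>\<^sub>M y \<longleftrightarrow> x -\<^sub>M y : N"
proof
 assume "N +>\<^sub>M x = N +>\<^sub>M y"
 then show "x -\<^sub>M y : N" using coset_mem[OF assms(1)] assms by (simp add: coset_eq)
next
 have *: "z -\<^sub>M y : N" if "x -\<^sub>M y : N" "z -\<^sub>M x : N" "x : carrier M" "y : carrier M" "z : carrier M" for x y z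
 proof -
  have "(z -\<^sub>M x) +\<^sub>M (x -\<^sub>M y) = z +\<^sub>M ((-\<^sub>M x) +\<^sub>M x) +\<^sub>M -\<^sub>M y"
   using that unfolding a_minus_def by (simp add: M.M.a_assoc)
  also have "\<dots> = z -\<^sub>M y" using that by (simp add: M.M.l_neg a_minus_def)
  finally show ?thesis using N'(5)[OF that(2,1)] by simp
 qed
 assume "x -\<^sub>M y : N"
 then show "N +>\<^sub>M x = N +>\<^sub>M y" unfolding coset_eq[OF assms(1)] coset_eq[OF assms(2)]
  using *[of x y] *[of y x] minus_swap[OF assms] assms by blast
qed

lemma coset_zero: "N +>\<^sub>M 0\<^sub>M = N" using N' by auto

lemma coset_eq_N_iff: "x : carrier M ==> N +>\<^sub>M x = N \<longleftrightarrow> x : N"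
 using coset_eq_iff[of x "0\<^sub>M"] coset_zero by (simp add: a_minus_def abelian_group_minus_zero[OF module_ab[OF M]])

lemma coset_add:
 assumes "x : carrier M" "y : carrier M"
 shows "(N +>\<^sub>M x) <+>\<^bsub>M\<^esub> (N +>\<^sub>M y) = N +>\<^sub>M (x +\<^sub>M y)"
proof (intro equalityI subsetI)
 fix z assume "z : (N +>\<^sub>M x) <+>\<^bsub>M\<^esub> (N +>\<^sub>M y)"
 then obtain h k where hk: "h : N" "k : N" "z = (h +\<^sub>M x) +\<^sub>M (k +\<^sub>M y)"
  by (auto simp: set_add_def' a_r_coset_def')
 then have "h : carrier M" "k : carrier M" using N' by auto
 then have "z = (h +\<^sub>M k) +\<^sub>M (x +\<^sub>M y)" using hk assms by (simp add: M.M.a_ac)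
 then show "z : N +>\<^sub>M (x +\<^sub>M y)" using N' hk by (auto simp: a_r_coset_def')
next
 fix z assume "z : N +>\<^sub>M (x +\<^sub>M y)"
 then obtain h where hk: "h : N" "z = h +\<^sub>M (x +\<^sub>M y)" by (auto simp: a_r_coset_def')
 then have z: "z = (h +\<^sub>M x) +\<^sub>M (0\<^sub>M +\<^sub>M y)"
  using assms N'(1) by (simp add: M.M.a_assoc subset_iff)
 have "h +\<^sub>M x : N +>\<^sub>M x" "0\<^sub>M +\<^sub>M y : N +>\<^sub>M y"
  using hk(1) N'(7) by (auto simp only: a_r_coset_def')
 then show "z : (N +>\<^sub>M x) <+>\<^bsub>M\<^esub> (N +>\<^sub>M y)" unfolding z set_add_def' by blast
qed

lemma coset_smult:
 assumes "a : carrier A" "x : carrier M"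
 shows "N <+>\<^bsub>M\<^esub> ((\<lambda>y. a *\<^sub>M y) ` (N +>\<^sub>M x)) = N +>\<^sub>M (a *\<^sub>M x)"
proof (intro equalityI subsetI)
 fix z assume "z : N <+>\<^bsub>M\<^esub> ((\<lambda>y. a *\<^sub>M y) ` (N +>\<^sub>M x))"
 then obtain h k where hk: "h : N" "k : N" "z = h +\<^sub>M (a *\<^sub>M (k +\<^sub>M x))"
  by (auto simp: set_add_def' a_r_coset_def')
 have kc: "k : carrier M" "h : carrier M" using hk N' by auto
 have "z = (h +\<^sub>M a *\<^sub>M k) +\<^sub>M (a *\<^sub>M x)" using hk kc assms by (simp add: M.smult_r_distr M.M.a_assoc)
 then show "z : N +>\<^sub>M (a *\<^sub>M x)" using N' hk assms by (auto simp: a_r_coset_def')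
next
 fix z assume "z : N +>\<^sub>M (a *\<^sub>M x)"
 then obtain h where hk: "h : N" "z = h +\<^sub>M (a *\<^sub>M x)" by (auto simp: a_r_coset_def')
 moreover have "x : N +>\<^sub>M x" using assms by (simp add: coset_mem)
 ultimately show "z : N <+>\<^bsub>M\<^esub> ((\<lambda>y. a *\<^sub>M y) ` (N +>\<^sub>M x))" unfolding set_add_def' by blast
qed

lemma quot_carrier: "carrier (quot_module M N) = (\<lambda>x. N +>\<^sub>M x) ` carrier M"
 by (auto simp: quot_module_def A_RCOSETS_def')

lemma quot_add:
 "x : carrier M ==> y : carrier M ==> (N +>\<^sub>M x) +\<^sub>(quot_module M N) (N +>\<^sub>M y) = N +>\<^sub>M (x +\<^sub>M y)"
 by (simp add: quot_module_def coset_add)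

lemma quot_smult:
 "a : carrier A ==> x : carrier M ==> a *\<^sub>(quot_module M N) (N +>\<^sub>M x) = N +>\<^sub>M (a *\<^sub>M x)"
 by (simp add: quot_module_def coset_smult)

lemma quot_zero: "0\<^sub>(quot_module M N) = N" by (simp add: quot_module_def)

lemma quot_is_module: "Module.module A (quot_module M N)"
proof (intro moduleI abelian_groupI)
 let ?Q = "quot_module M N"
 show "cring A" by (rule M.R.is_cring)
 fix X assume "X : carrier ?Q"
 then obtain x where x: "x : carrier M" "X = N +>\<^sub>M x" by (auto simp: quot_carrier)
 show "0\<^sub>?Q +\<^sub>?Q X = X" using x quot_add[of "0\<^sub>M" x] by (simp add: quot_zero coset_zero)
 show "\<exists>y\<in>carrier ?Q. y +\<^sub>?Q X = 0\<^sub>?Q" using x quot_add[of "-\<^sub>M x" x]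
  by (intro bexI[of _ "N +>\<^sub>M (-\<^sub>M x)"]) (auto simp: quot_zero coset_zero M.M.l_neg quot_carrier)
 show "1\<^sub>A *\<^sub>?Q X = X" using x by (simp add: quot_smult)
 fix Y assume "Y : carrier ?Q"
 then obtain y where y: "y : carrier M" "Y = N +>\<^sub>M y" by (auto simp: quot_carrier)
 show "X +\<^sub>?Q Y : carrier ?Q" using x y by (auto simp: quot_add quot_carrier)
 show "X +\<^sub>?Q Y = Y +\<^sub>?Q X" using x y by (auto simp: quot_add M.M.a_comm)
 fix Z assume "Z : carrier ?Q"
 then obtain z where z: "z : carrier M" "Z = N +>\<^sub>M z" by (auto simp: quot_carrier)
 show "X +\<^sub>?Q Y +\<^sub>?Q Z = X +\<^sub>?Q (Y +\<^sub>?Q Z)" using x y z by (auto simp: quot_add M.M.a_assoc)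
next
 let ?Q = "quot_module M N"
 show "0\<^sub>?Q : carrier ?Q" using coset_zero by (auto simp: quot_zero quot_carrier)
 fix a X assume a: "a : carrier A" and "X : carrier ?Q"
 then obtain x where x: "x : carrier M" "X = N +>\<^sub>M x" by (auto simp: quot_carrier)
 show "a *\<^sub>?Q X : carrier ?Q" using x a by (auto simp: quot_smult quot_carrier)
 {
  fix b assume b: "b : carrier A"
  show "(a +\<^sub>A b) *\<^sub>?Q X = a *\<^sub>?Q X +\<^sub>?Q b *\<^sub>?Q X"
   using a b x by (simp add: quot_smult quot_add M.smult_l_distr)
  show "(a \<otimes>\<^sub>A b) *\<^sub>?Q X = a *\<^sub>?Q (b *\<^sub>?Q X)" using a b x by (simp add: quot_smult M.smult_assoc1)
 }
 fix Y assume "Y : carrier ?Q"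
 then obtain y where y: "y : carrier M" "Y = N +>\<^sub>M y" by (auto simp: quot_carrier)
 show "a *\<^sub>?Q (X +\<^sub>?Q Y) = a *\<^sub>?Q X +\<^sub>?Q a *\<^sub>?Q Y"
  using a x y by (simp add: quot_smult quot_add M.smult_r_distr)
qed

lemma quot_class_hom: "(\<lambda>x. N +>\<^sub>M x) : mod_hom A M (quot_module M N)"
 by (intro mod_homI) (auto simp: quot_carrier quot_add quot_smult)

lemma quot_class_semilin: "(\<lambda>x. N +>\<^sub>M x) : semilin A 1 M (quot_module M N)"
 using quot_class_hom mod_hom_eq_semilin[OF M.R.is_cring] by auto

end

lemma the_elem_image_const:
 assumes "x : X" "\<And>y. y : X ==> f y = c"
 shows "the_elem (f ` X) = c"
proof -
 have "f ` X = {c}" using assms by force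
 then show ?thesis by simp
qed

text \<open>The target is only an abelian group: the map on cohomology induced by localization goes
  between modules over different rings, where lifting of linear maps does not apply.\<close>

lemma quot_lift_additive:
 fixes M :: "('a, 'm) module"
 assumes M: "Module.module A M" and K: "submodule K A M" and N: "abelian_group N"
  and add: "\<And>x y. x : carrier M ==> y : carrier M ==> f (x +\<^sub>M y) = f x +\<^sub>N f y"
  and cl: "\<And>x. x : carrier M ==> f x : carrier N"
  and f0: "\<And>x. x : K ==> f x = 0\<^sub>N" and x: "x : carrier M"
 shows "the_elem (f ` (K +>\<^sub>M x)) = f x"
proof (rule the_elem_image_const)
 interpret M: Module.module A M by fact
 interpret N: abelian_group N by fact
 show "x : K +>\<^sub>M x" using coset_mem[OF M K] x by auto
 fix y assume "y : K +>\<^sub>M x"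
 then obtain h where "h : K" "y = h +\<^sub>M x" by (auto simp: a_r_coset_def')
 then show "f y = f x" using add[of h x] M.submoduleE(1)[OF K] x f0[of h] cl by auto
qed

lemma quot_lift:
 fixes M :: "('a, 'm) module" and N :: "('a, 'n) module"
 assumes "Module.module A M" "submodule K A M" "Module.module A N"
  and "\<And>x y. x : carrier M ==> y : carrier M ==> f (x +\<^sub>M y) = f x +\<^sub>N f y"
  and "\<And>x. x : carrier M ==> f x : carrier N"
  and "\<And>x. x : K ==> f x = 0\<^sub>N" and "x : carrier M"
 shows "the_elem (f ` (K +>\<^sub>M x)) = f x"
 using quot_lift_additive[OF assms(1,2) module_ab[OF assms(3)], of f x] assms(4-) by blast

lemma quot_lift_semilin:
 fixes M :: "('a, 'm) module" and N :: "('a, 'n) module"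
 assumes M: "Module.module A M" and K: "submodule K A M" and N: "Module.module A N"
  and f: "f : semilin A q M N" and f0: "\<And>x. x : K ==> f x = 0\<^sub>N"
 shows "(\<lambda>X. the_elem (f ` X)) : semilin A q (quot_module M K) N"
proof -
 interpret M: Module.module A M by fact
 interpret N: Module.module A N by fact
 note ql = quot_lift[OF M K N semilin_add[OF f] semilin_closed[OF f] f0]
 show ?thesis by (intro semilinI)
   (auto simp: quot_carrier[OF M K] quot_add[OF M K] quot_smult[OF M K] ql semilinD[OF f])
qed

subsection \<open>Direct sums\<close>

lemma reg_simps [simp]:
 "carrier (reg A) = carrier A" "0\<^sub>(reg A) = 0\<^sub>A" "x +\<^sub>(reg A) y = x +\<^sub>A y"
 "x *\<^sub>(reg A) y = x \<otimes>\<^sub>A y" "1\<^sub>(reg A) = 1\<^sub>A" "x \<otimes>\<^sub>(reg A) y = x \<otimes>\<^sub>A y" by (auto simp: reg_def)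

lemma reg_is_module: "cring A ==> Module.module A (reg A)"
proof -
 assume "cring A"
 then interpret cring A .
 show ?thesis by (intro moduleI abelian_groupI is_cring) (auto simp: a_ac m_ac r_distr)
qed

lemma finsum_reg [simp]: "finsum (reg A) f S = finsum A f S"
 unfolding finsum_def by (simp add: reg_def finprod_def)

lemma a_inv_reg [simp]: "-\<^sub>(reg A) x = -\<^sub>A x" unfolding a_inv_def m_inv_def by simp

lemma a_minus_reg [simp]: "x -\<^sub>(reg A) y = x -\<^sub>A y" unfolding a_minus_def by simp

lemma direct_sum_simps [simp]:
 "0\<^sub>(direct_sum J M) = (\<lambda>j\<in>J. 0\<^sub>(M j))"
 "x +\<^sub>(direct_sum J M) y = (\<lambda>j\<in>J. x j +\<^sub>(M j) y j)"
 "a *\<^sub>(direct_sum J M) x = (\<lambda>j\<in>J. a *\<^sub>(M j) x j)" by (auto simp: direct_sum_def)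

lemma direct_sum_carrier:
 "x : carrier (direct_sum J M) \<longleftrightarrow>
  x : extensional J \<and> (\<forall>j\<in>J. x j : carrier (M j)) \<and> finite {j : J. x j \<noteq> 0\<^sub>(M j)}"
 by (auto simp: direct_sum_def PiE_def)

lemma direct_sum_eqI:
 assumes "x : carrier (direct_sum J M)" "y : carrier (direct_sum J M)" "\<And>j. j : J ==> x j = y j"
 shows "x = y" using assms by (intro extensionalityI[of x J y]) (auto simp: direct_sum_carrier)

context
 fixes A :: "('a, 'x) ring_scheme" and M :: "'j => ('a, 'm) module" and J :: "'j set"
 assumes A: "cring A" and M: "\<And>j. j : J ==> Module.module A (M j)"
begin

lemma direct_sum_is_module: "Module.module A (direct_sum J M)"
proof (intro moduleI abelian_groupI A)
 let ?D = "direct_sum J M"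
 have ab: "abelian_group (M j)" if "j : J" for j using module_ab[OF M[OF that]] .
 note ag = abelian_groupE[OF ab]
 show "0\<^sub>?D : carrier ?D" using ag by (auto simp: direct_sum_carrier)
 fix x assume x: "x : carrier ?D"
 show "0\<^sub>?D +\<^sub>?D x = x" using x ag by (auto simp: direct_sum_carrier extensional_def)
 show "\<exists>y\<in>carrier ?D. y +\<^sub>?D x = 0\<^sub>?D"
 proof (intro bexI[of _ "\<lambda>j\<in>J. -\<^sub>(M j) x j"])
  show "(\<lambda>j\<in>J. -\<^sub>(M j) x j) +\<^sub>?D x = 0\<^sub>?D"
   using x ab by (auto simp: direct_sum_carrier abelian_group.l_neg)
  have "{j : J. (\<lambda>j\<in>J. -\<^sub>(M j) x j) j \<noteq> 0\<^sub>(M j)} <= {j : J. x j \<noteq> 0\<^sub>(M j)}"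
   using ab abelian_group_minus_zero by fastforce
  then have "finite {j : J. (\<lambda>j\<in>J. -\<^sub>(M j) x j) j \<noteq> 0\<^sub>(M j)}"
   by (rule finite_subset) (use x in \<open>simp add: direct_sum_carrier\<close>)
  then show "(\<lambda>j\<in>J. -\<^sub>(M j) x j) : carrier ?D"
   using x abelian_group.a_inv_closed[OF ab] unfolding direct_sum_carrier by simp
 qed
 show "1\<^sub>A *\<^sub>?D x = x"
  using x Module.module.smult_one[OF M] by (auto simp: direct_sum_carrier extensional_def)
 fix y assume y: "y : carrier ?D"
 have "{j : J. (x +\<^sub>?D y) j \<noteq> 0\<^sub>(M j)} <= {j : J. x j \<noteq> 0\<^sub>(M j)} \<union> {j : J. y j \<noteq> 0\<^sub>(M j)}"
  using ag by fastforce
 then have "finite {j : J. (x +\<^sub>?D y) j \<noteq> 0\<^sub>(M j)}"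
  by (rule finite_subset) (use x y in \<open>simp add: direct_sum_carrier\<close>)
 then show "x +\<^sub>?D y : carrier ?D" using x y ag(1) unfolding direct_sum_carrier by simp
 show "x +\<^sub>?D y = y +\<^sub>?D x" using x y ag(4) by (auto simp: direct_sum_carrier)
 fix z assume z: "z : carrier ?D"
 show "x +\<^sub>?D y +\<^sub>?D z = x +\<^sub>?D (y +\<^sub>?D z)" using x y z ag(3) by (auto simp: direct_sum_carrier)
next
 let ?D = "direct_sum J M"
 note mod = Module.module.smult_closed[OF M] Module.module.smult_l_distr[OF M]
  Module.module.smult_r_distr[OF M] Module.module.smult_assoc1[OF M]
 fix a x assume a: "a : carrier A" and x: "x : carrier ?D"
 have "{j : J. (a *\<^sub>?D x) j \<noteq> 0\<^sub>(M j)} <= {j : J. x j \<noteq> 0\<^sub>(M j)}"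
  using Module.module.smult_r_null[OF M] a by fastforce
 then have "finite {j : J. (a *\<^sub>?D x) j \<noteq> 0\<^sub>(M j)}"
  by (rule finite_subset) (use x in \<open>simp add: direct_sum_carrier\<close>)
 then show "a *\<^sub>?D x : carrier ?D" using x mod(1) a unfolding direct_sum_carrier by simp
 {
  fix b assume b: "b : carrier A"
  show "(a +\<^sub>A b) *\<^sub>?D x = a *\<^sub>?D x +\<^sub>?D b *\<^sub>?D x"
   using a b x mod(2) by (auto simp: direct_sum_carrier)
  show "(a \<otimes>\<^sub>A b) *\<^sub>?D x = a *\<^sub>?D (b *\<^sub>?D x)" using a b x mod(4) by (auto simp: direct_sum_carrier)
 }
 fix y assume y: "y : carrier ?D"
 show "a *\<^sub>?D (x +\<^sub>?D y) = a *\<^sub>?D x +\<^sub>?D a *\<^sub>?D y"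
  using a x y mod(3) by (auto simp: direct_sum_carrier)
qed

lemma direct_sum_proj_hom: "j : J ==> (\<lambda>x. x j) : mod_hom A (direct_sum J M) (M j)"
 by (intro mod_homI) (auto simp: direct_sum_carrier)

lemma direct_sum_proj_semilin: "j : J ==> (\<lambda>x. x j) : semilin A 1 (direct_sum J M) (M j)"
 using direct_sum_proj_hom mod_hom_eq_semilin[OF A] by blast

lemma direct_sum_inj_hom: "j : J ==> direct_sum_inj J M j : mod_hom A (M j) (direct_sum J M)"
proof (intro mod_homI)
 assume j: "j : J"
 note mod = module_ab[OF M, THEN abelian_groupE(2)] module_ab[OF M, THEN abelian_groupE(5)] Module.module.smult_r_null[OF M]
 fix x assume x: "x : carrier (M j)"
 have "{l : J. direct_sum_inj J M j x l \<noteq> 0\<^sub>(M l)} <= {j}" by (auto simp: direct_sum_inj_def)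
 then show "direct_sum_inj J M j x : carrier (direct_sum J M)"
  using j x mod by (auto simp: direct_sum_carrier direct_sum_inj_def)
 show "direct_sum_inj J M j (a *\<^sub>(M j) x) = a *\<^sub>(direct_sum J M) direct_sum_inj J M j x" if "a : carrier A" for a
  using mod(3)[OF _ that] by (auto simp: direct_sum_inj_def)
 show "direct_sum_inj J M j (x +\<^sub>(M j) y) = direct_sum_inj J M j x +\<^sub>(direct_sum J M) direct_sum_inj J M j y" for y
  using mod(1,2) by (auto simp: direct_sum_inj_def)
qed

lemma direct_sum_inj_closed: "j : J ==> x : carrier (M j) ==> direct_sum_inj J M j x : carrier (direct_sum J M)"
 using mod_homD(1)[OF direct_sum_inj_hom] .

lemma direct_sum_finsum_apply:
 assumes "finite S" "x : S \<rightarrow> carrier (direct_sum J M)" "j : J"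
 shows "(\<Oplus>\<^bsub>direct_sum J M\<^esub>i\<in>S. x i) j = (\<Oplus>\<^bsub>M j\<^esub>i\<in>S. x i j)"
 using semilin_finsum[OF direct_sum_is_module M direct_sum_proj_semilin assms(1,2)] assms(3) by auto

text \<open>Stated for any finite F outside of which x vanishes, so that J may be infinite, as it is
  for the free module on the elements of a module.\<close>

lemma direct_sum_decomp:
 assumes x: "x : carrier (direct_sum J M)" and F: "finite F" "F <= J" "\<And>j. j : J - F ==> x j = 0\<^sub>(M j)"
 shows "x = (\<Oplus>\<^bsub>direct_sum J M\<^esub>j\<in>F. direct_sum_inj J M j (x j))" (is "_ = ?r")
proof (rule direct_sum_eqI[OF x])
 interpret D: Module.module A "direct_sum J M" by (rule direct_sum_is_module)
 have cl: "(\<lambda>j. direct_sum_inj J M j (x j)) : F \<rightarrow> carrier (direct_sum J M)"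
  using F x by (auto intro!: direct_sum_inj_closed simp: direct_sum_carrier[of x])
 then show "?r : carrier (direct_sum J M)" by (rule D.M.finsum_closed)
 fix l assume l: "l : J"
 interpret Ml: Module.module A "M l" using M[OF l] .
 have xl: "x l : carrier (M l)" using x l by (auto simp: direct_sum_carrier)
 have "?r l = (\<Oplus>\<^bsub>M l\<^esub>j\<in>F. direct_sum_inj J M j (x j) l)"
  by (rule direct_sum_finsum_apply[OF F(1) cl l])
 also have "\<dots> = (\<Oplus>\<^bsub>M l\<^esub>j\<in>F. if l = j then x l else 0\<^sub>(M l))"
  using l xl by (intro Ml.M.finsum_cong) (auto simp: direct_sum_inj_def simp_implies_def)
 also have "\<dots> = x l"
 proof (cases "l : F")
  case True
  then show ?thesis using Ml.M.finsum_singleton[OF True F(1), of "\<lambda>_. x l"] xl by simp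
 next
  case False
  then show ?thesis using F(3)[of l] l by (auto intro!: Ml.M.add.finprod_one_eqI)
 qed
 finally show "x l = ?r l" by simp
qed

end

subsection \<open>Noetherian modules\<close>

text \<open>Ideals are taken as submodules of \<open>reg A\<close>, so that the module lemmas apply
  to them.\<close>

definition noeth_ring :: "('a, 'x) ring_scheme => bool" where
 "noeth_ring A \<longleftrightarrow> cring A \<and> (\<forall>N. submodule N A (reg A) \<longrightarrow>
   (\<exists>S. finite S \<and> S <= N \<and> N = gen_submodule A (reg A) S))"

text \<open>For L spanned by the remaining generators, this is the ideal of coefficients of x in the
  elements of N modulo L; \<open>noeth_gen\<close> uses it to peel off the generator x.\<close>

lemma (in Module.module) lincomb_ideal:
 assumes N: "submodule N R M" and L: "submodule L R M" and x: "x : carrier M"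
 shows "submodule {a : carrier R. \<exists>y\<in>L. a *\<^sub>M x +\<^sub>M y : N} R (reg R)"
proof -
 note N' = submoduleE[OF N] submodule_zero[OF N]
 note L' = submoduleE[OF L] submodule_zero[OF L]
 show ?thesis
 proof (rule Module.module.submoduleI[OF reg_is_module[OF R.is_cring]])
  let ?I = "{a : carrier R. \<exists>y\<in>L. a *\<^sub>M x +\<^sub>M y : N}"
  show "?I <= carrier (reg R)" by auto
  show "0\<^sub>(reg R) : ?I" using x L'(7) N'(7) by (auto intro!: bexI[of _ "0\<^sub>M"])
  show sm: "c *\<^sub>(reg R) a : ?I" if c: "c : carrier R" and a: "a : ?I" for c a
  proof -
   obtain y where y: "y : L" "a *\<^sub>M x +\<^sub>M y : N" and a': "a : carrier R" using a by auto
   have "y : carrier M" using y L'(1) by auto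
   then have "(c \<otimes> a) *\<^sub>M x +\<^sub>M c *\<^sub>M y = c *\<^sub>M (a *\<^sub>M x +\<^sub>M y)"
    using x a' c by (simp add: smult_assoc1 smult_r_distr)
   then have "(c \<otimes> a) *\<^sub>M x +\<^sub>M c *\<^sub>M y : N" using N'(4)[OF c y(2)] by simp
   then show ?thesis using c a' L'(4)[OF c y(1)] by auto
  qed
  show "-\<^sub>(reg R) a : ?I" if a: "a : ?I" for a using sm[OF _ a, of "\<ominus> \<one>"] a by (simp add: R.l_minus)
  show "a +\<^sub>(reg R) c : ?I" if a: "a : ?I" and c: "c : ?I" for a c
  proof -
   obtain y where y: "y : L" "a *\<^sub>M x +\<^sub>M y : N" and a': "a : carrier R" using a by auto
   obtain z where z: "z : L" "c *\<^sub>M x +\<^sub>M z : N" and c': "c : carrier R" using c by auto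
   have "y : carrier M" "z : carrier M" using y z L'(1) by auto
   then have "(a \<oplus> c) *\<^sub>M x +\<^sub>M (y +\<^sub>M z) = (a *\<^sub>M x +\<^sub>M y) +\<^sub>M (c *\<^sub>M x +\<^sub>M z)"
    using x a' c' by (simp add: smult_l_distr M.a_ac)
   then have "(a \<oplus> c) *\<^sub>M x +\<^sub>M (y +\<^sub>M z) : N" using N'(5)[OF y(2) z(2)] by simp
   then show ?thesis using a' c' L'(5)[OF y(1) z(1)] by auto
  qed
 qed
qed

text \<open>Induction on the number of generators of the ambient module: N is controlled by its
  ideal of x-coefficients and by its intersection with the span L of the other generators, and both
  are finitely generated.\<close>

lemma noeth_gen:
 fixes M :: "('a, 'm) module"
 assumes A: "noeth_ring A" and M: "Module.module A M" and X: "finite X" "X <= carrier M"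
  and N: "submodule N A M" "N <= gen_submodule A M X"
 shows "\<exists>S. finite S \<and> S <= N \<and> N = gen_submodule A M S" using X N
proof (induction X arbitrary: N)
 case empty
 interpret M: Module.module A M by fact
 have "submodule {0\<^sub>M} A M" by (intro M.submoduleI) auto
 then have "gen_submodule A M {} <= {0\<^sub>M}" by (intro gen_submodule_minimal M) auto
 then have "N = {0\<^sub>M}" using empty submodule_zero[OF empty(2)] by auto
 then show ?case using gen_submodule_self[OF M empty(2)] by (intro exI[of _ "{0\<^sub>M}"]) auto
next
 case (insert x X)
 interpret M: Module.module A M by fact
 have x: "x : carrier M" and X: "X <= carrier M" using insert by auto
 define L where "L = gen_submodule A M X"
 have L: "submodule L A M" unfolding L_def by (rule gen_submodule_is_submodule[OF M X])
 note L' = M.submoduleE[OF L] submodule_zero[OF L]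
 note N' = M.submoduleE[OF insert(5)] submodule_zero[OF insert(5)]
 define I where "I N = {a : carrier A. \<exists>y\<in>L. a *\<^sub>M x +\<^sub>M y : N}" for N
 have I: "submodule (I N) A (reg A)" if "submodule N A M" for N
  unfolding I_def by (rule M.lincomb_ideal[OF that L x])
 obtain T where T: "finite T" "T <= I N" "I N = gen_submodule A (reg A) T"
  using A I[OF insert(5)] unfolding noeth_ring_def by blast
 have "\<forall>t\<in>T. \<exists>y\<in>L. t *\<^sub>M x +\<^sub>M y : N" using T(2) by (auto simp: I_def)
 then obtain y where y: "\<And>t. t : T ==> y t : L \<and> t *\<^sub>M x +\<^sub>M y t : N" by metis
 obtain S0 where S0: "finite S0" "S0 <= N \<inter> L" "N \<inter> L = gen_submodule A M S0"
  using insert(3)[OF X submodule_Int[OF M insert(5) L]] unfolding L_def by blast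
 \<comment> \<open>One lift to N for each generator of the coefficient ideal, together with
   generators of the intersection of N and L.\<close>
 define S where "S = (\<lambda>t. t *\<^sub>M x +\<^sub>M y t) ` T \<union> S0"
 have S: "S <= N" "finite S" using S0 T y by (auto simp: S_def)
 define G where "G = gen_submodule A M S"
 have G: "submodule G A M" unfolding G_def by (rule gen_submodule_is_submodule[OF M]) (use S N' in auto)
 have SG: "S <= G" unfolding G_def by (rule gen_submodule_subset[OF M])
 have "t *\<^sub>M x +\<^sub>M y t : G" if "t : T" for t using SG that by (auto simp: S_def)
 then have "T <= I G" using y T(2) by (auto simp: I_def)
 then have IG: "I N <= I G" unfolding T(3)
  by (intro gen_submodule_minimal[OF reg_is_module[OF M.R.is_cring]] I[OF G])
 have "N <= G"
 proof
  fix z assume z: "z : N"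
  have "submodule {z : carrier M. \<exists>a\<in>carrier A. \<exists>y\<in>L. z = a *\<^sub>M x +\<^sub>M y} A M" (is "submodule ?K A M")
  proof (rule M.submoduleI)
   show "0\<^sub>M : ?K" using x L'(7) by (auto intro!: bexI[of _ "0\<^sub>A"] bexI[of _ "0\<^sub>M"])
   show sm: "c *\<^sub>M a : ?K" if c: "c : carrier A" and a: "a : ?K" for c a
   proof -
    obtain a' y where y: "y : L" "a = a' *\<^sub>M x +\<^sub>M y" and a': "a' : carrier A" using a by auto
    have "y : carrier M" using y L'(1) by auto
    then have "c *\<^sub>M a = (c \<otimes>\<^sub>A a') *\<^sub>M x +\<^sub>M c *\<^sub>M y"
     using x a' c y by (simp add: M.smult_assoc1 M.smult_r_distr)
    then show ?thesis using c a a' L'(4)[OF c y(1)] by blast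
   qed
   show "-\<^sub>M a : ?K" if a: "a : ?K" for a
    using sm[OF _ a, of "-\<^sub>A 1\<^sub>A"] a by (simp add: M.smult_l_minus)
   show "a +\<^sub>M c : ?K" if a: "a : ?K" and c: "c : ?K" for a c
   proof -
    obtain a' y where y: "y : L" "a = a' *\<^sub>M x +\<^sub>M y" and a': "a' : carrier A" using a by auto
    obtain c' z where z: "z : L" "c = c' *\<^sub>M x +\<^sub>M z" and c': "c' : carrier A" using c by auto
    have "y : carrier M" "z : carrier M" using y z L'(1) by auto
    then have "a +\<^sub>M c = (a' +\<^sub>A c') *\<^sub>M x +\<^sub>M (y +\<^sub>M z)"
     using x a' c' y z by (simp add: M.smult_l_distr M.M.a_ac)
    moreover have "a +\<^sub>M c : carrier M" using a c by auto
    ultimately show ?thesis using a' c' L'(5)[OF y(1) z(1)] by blast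
   qed
  qed auto
  moreover have "insert x X <= ?K"
  proof -
   have "X <= L" unfolding L_def by (rule gen_submodule_subset[OF M])
   have "w : ?K" if "w : X" for w
    using that \<open>X <= L\<close> X x by (intro CollectI conjI bexI[of _ "0\<^sub>A"] bexI[of _ w]) auto
   moreover have "x : ?K"
    using L'(7) x by (intro CollectI conjI bexI[of _ "1\<^sub>A"] bexI[of _ "0\<^sub>M"]) auto
   ultimately show ?thesis by blast
  qed
  ultimately have "z : ?K" using gen_submodule_minimal[OF M] insert(6) z by blast
  then obtain a w where a: "a : carrier A" "w : L" "z = a *\<^sub>M x +\<^sub>M w" and zc: "z : carrier M" by blast
  then have "a : I N" using z by (auto simp: I_def)
  then obtain v where v: "v : L" "a *\<^sub>M x +\<^sub>M v : G" using IG by (auto simp: I_def)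
  have vw: "v : carrier M" "w : carrier M" using v a L'(1) by auto
  have GN: "G <= N" unfolding G_def by (rule gen_submodule_minimal[OF M insert(5) S(1)])
  \<comment> \<open>The x-coefficient a of z already occurs in G, together with some v in L; the
    difference w - v then lies in N and in L, hence in G.\<close>
  have e: "z = (a *\<^sub>M x +\<^sub>M v) +\<^sub>M (w -\<^sub>M v)"
  proof -
   have "(a *\<^sub>M x +\<^sub>M v) +\<^sub>M (w -\<^sub>M v) = (a *\<^sub>M x +\<^sub>M w) +\<^sub>M (v -\<^sub>M v)"
    using vw a x by (simp add: a_minus_def M.M.a_ac)
   then show ?thesis using vw a x by (simp add: a_minus_def M.M.r_neg)
  qed
  have e2: "w -\<^sub>M v = z -\<^sub>M (a *\<^sub>M x +\<^sub>M v)"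
   using vw a x zc unfolding a(3) by (simp add: a_minus_def M.M.minus_add M.M.a_ac M.M.r_neg)
  have "w -\<^sub>M v : N \<inter> L"
   using submodule_minus[OF M L a(2) v(1)] submodule_minus[OF M insert(5) z] v(2) GN e2 by auto
  also have "\<dots> <= G" unfolding S0(3) G_def S_def by (rule gen_submodule_mono) auto
  finally show "z : G" using v(2) e M.submoduleE(5)[OF G] by metis
 qed
 moreover have "G <= N" unfolding G_def by (rule gen_submodule_minimal[OF M insert(5) S(1)])
 ultimately show ?case using S unfolding G_def by blast
qed

section \<open>Unit modules over a ring with a p-basis\<close>

text \<open>The image of the sum of the tensors of b j with y j under the linearization of
  phi.\<close>

definition bsum :: "('j => 'a) => ('m => 'm) => ('a, 'm) module => 'j set => ('j => 'm) => 'm" where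
 "bsum b \<phi> M F y = (\<Oplus>\<^bsub>M\<^esub>j\<in>F. b j *\<^sub>M \<phi> (y j))"

text \<open>The conditions say that the linearization of \<open>\<phi>\<close> is bijective, when the \<open>b j\<close> are a basis of A over its
 p-th powers.\<close>

definition unit_mod ::
 "('a, 'x) ring_scheme => nat => 'j set => ('j => 'a) => ('a, 'm) module => ('m => 'm) => bool" where
 "unit_mod A p J b M \<phi> \<longleftrightarrow> Module.module A M \<and> \<phi> : semilin A p M M \<and>
   (\<forall>x\<in>carrier M. \<exists>F y. finite F \<and> F <= J \<and> (\<forall>j. y j : carrier M) \<and> x = bsum b \<phi> M F y) \<and>
   (\<forall>F y. finite F \<longrightarrow> F <= J \<longrightarrow> (\<forall>j. y j : carrier M) \<longrightarrow> bsum b \<phi> M F y = 0\<^sub>M \<longrightarrow> (\<forall>j\<in>F. y j = 0\<^sub>M))"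

text \<open>The whole family is chosen at once and vanishes outside a finite subset of J; its
  uniqueness is \<open>D_unique\<close>. For M = A these are the p-th roots of the coordinates with
  respect to the basis b.\<close>

definition dcomp ::
 "('j set) => ('j => 'a) => ('a, 'm) module => ('m => 'm) => 'j => 'm => 'm" where
 "dcomp J b M \<phi> j x = (SOME y. (\<forall>j. y j : carrier M) \<and>
   (\<exists>F. finite F \<and> F <= J \<and> (\<forall>j. j \<notin> F \<longrightarrow> y j = 0\<^sub>M) \<and> x = bsum b \<phi> M F y)) j"

text \<open>For a submodule L this is the submodule generated by phi(L), see
  \<open>Dinv_eq_gen\<close>, written as a condition on components; on A^d it is L^[p].\<close>

definition dinv ::
 "('j set) => ('j => 'a) => ('a, 'm) module => ('m => 'm) => 'm set => 'm set" where
 "dinv J b M \<phi> L = {x : carrier M. \<forall>j\<in>J. dcomp J b M \<phi> j x : L}"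

text \<open>The smallest submodule L such that K is contained in \<open>dinv\<close> of L, see
  \<open>Dgen_le_iff\<close>; on A^d it is I_1(K).\<close>

definition dgen ::
 "('a, 'x) ring_scheme => 'j set => ('j => 'a) => ('a, 'm) module => ('m => 'm) => 'm set => 'm set" where
 "dgen A J b M \<phi> K = gen_submodule A M {dcomp J b M \<phi> j x | j x. j : J \<and> x : K}"

text \<open>The lemmas on additive maps serve maps that are not semilinear for a power of Frobenius:
  the components D j, and maps between modules over different rings.\<close>

lemma additive_zero:
 assumes "abelian_group M" "abelian_group N" "\<And>x. x : carrier M ==> f x : carrier N"
  "\<And>x y. x : carrier M ==> y : carrier M ==> f (x +\<^sub>M y) = f x +\<^sub>N f y"
 shows "f 0\<^sub>M = 0\<^sub>N"
proof -
 interpret M: abelian_group M by fact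
 interpret N: abelian_group N by fact
 have "f 0\<^sub>M +\<^sub>N f 0\<^sub>M = f 0\<^sub>M" using assms(4)[of "0\<^sub>M" "0\<^sub>M"] by simp
 then show ?thesis using assms(3)[of "0\<^sub>M"] by (metis M.zero_closed N.add.r_cancel_one')
qed

lemma additive_neg:
 assumes "abelian_group M" "abelian_group N" "\<And>x. x : carrier M ==> f x : carrier N"
  "\<And>x y. x : carrier M ==> y : carrier M ==> f (x +\<^sub>M y) = f x +\<^sub>N f y" and x: "x : carrier M"
 shows "f (-\<^sub>M x) = -\<^sub>N f x"
proof -
 interpret M: abelian_group M by fact
 interpret N: abelian_group N by fact
 have "f x +\<^sub>N f (-\<^sub>M x) = 0\<^sub>N"
  using assms(4)[of x "-\<^sub>M x"] additive_zero[OF assms(1-4)] x by (simp add: M.r_neg)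
 then show ?thesis using assms(3) x by (metis M.a_inv_closed N.a_comm N.minus_equality)
qed

lemma additive_finsum:
 assumes "abelian_group M" "abelian_group N" "\<And>x. x : carrier M ==> f x : carrier N"
  "\<And>x y. x : carrier M ==> y : carrier M ==> f (x +\<^sub>M y) = f x +\<^sub>N f y"
  and S: "finite S" "x : S \<rightarrow> carrier M"
 shows "f (\<Oplus>\<^bsub>M\<^esub>i\<in>S. x i) = (\<Oplus>\<^bsub>N\<^esub>i\<in>S. f (x i))" using S
proof (induction S)
 case empty
 interpret M: abelian_group M by fact
 interpret N: abelian_group N by fact
 show ?case using additive_zero[OF assms(1-4)] by simp
next
 case (insert s S)
 interpret M: abelian_group M by fact
 interpret N: abelian_group N by fact
 have "(\<lambda>i. f (x i)) : S \<rightarrow> carrier N" "x : S \<rightarrow> carrier M" "f (x s) : carrier N" "x s : carrier M"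
  using insert assms(3) by auto
 with insert show ?case by (simp add: assms(4))
qed

text \<open>The condition \<open>unit_reg\<close> says that the b j are a basis of A over its p-th
  powers. It also contains the additivity of x -> x^p, so the characteristic enters only through it.
  J may be infinite.\<close>

locale frob_ring = cring A for A :: "('a, 'x) ring_scheme" (structure) +
 fixes p :: nat and J :: "'j set" and b :: "'j => 'a"
 assumes b_closed: "\<And>j. j : J ==> b j : carrier A"
  and p_pos: "0 < p"
  and unit_reg: "unit_mod A p J b (reg A) (\<lambda>x. x [^] p)"
begin

lemma add_pow: "x : carrier A ==> y : carrier A ==> (x \<oplus> y) [^] p = x [^] p \<oplus> y [^] p"
 using unit_reg unfolding unit_mod_def semilin_def by auto

end

locale unit_module = frob_ring +
 fixes M :: "('a, 'm) module" and \<phi> :: "'m => 'm"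
 assumes unit: "unit_mod A p J b M \<phi>"
begin

sublocale M: Module.module A M using unit unfolding unit_mod_def by auto

abbreviation D where "D \<equiv> dcomp J b M \<phi>"
abbreviation bs where "bs \<equiv> bsum b \<phi> M"

lemma is_mod: "Module.module A M" by (rule M.module_axioms)

lemma phi: "\<phi> : semilin A p M M" using unit unfolding unit_mod_def by auto

lemmas phi_closed [simp] = semilin_closed[OF phi]
 and phi_add = semilin_add[OF phi]
 and phi_smult = semilin_smult[OF phi]
 and phi_zero [simp] = semilin_zero[OF is_mod is_mod phi]
 and phi_finsum = semilin_finsum[OF is_mod is_mod phi]
 and phi_minus = semilin_minus[OF is_mod is_mod phi]

lemma bs_term_closed: "F <= J ==> (\<And>j. j : F ==> y j : carrier M) ==> (\<lambda>j. b j *\<^sub>M \<phi> (y j)) : F \<rightarrow> carrier M"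
 using b_closed by auto

lemma bs_closed: "F <= J ==> (\<And>j. j : F ==> y j : carrier M) ==> bs F y : carrier M"
 unfolding bsum_def by (intro M.M.finsum_closed bs_term_closed)

lemma bs_cong: "(\<And>j. j : F ==> y j = z j) ==> F <= J ==> (\<And>j. j : F ==> z j : carrier M) ==> bs F y = bs F z"
 unfolding bsum_def using bs_term_closed[of F z] by (intro M.M.finsum_cong') auto

lemma bs_mono:
 assumes "finite G" "F <= G" "G <= J" "\<And>j. j : G ==> y j : carrier M" "\<And>j. j : G - F ==> y j = 0\<^sub>M"
 shows "bs F y = bs G y" unfolding bsum_def using assms b_closed
 by (intro M.M.add.finprod_mono_neutral_cong_left bs_term_closed) auto

lemma bs_add:
 assumes "F <= J" "\<And>j. j : F ==> y j : carrier M" "\<And>j. j : F ==> z j : carrier M"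
 shows "bs F (\<lambda>j. y j +\<^sub>M z j) = bs F y +\<^sub>M bs F z"
proof -
 have "bs F (\<lambda>j. y j +\<^sub>M z j) = (\<Oplus>\<^bsub>M\<^esub>j\<in>F. b j *\<^sub>M \<phi> (y j) +\<^sub>M b j *\<^sub>M \<phi> (z j))"
  unfolding bsum_def using assms b_closed
  by (intro M.M.finsum_cong') (auto simp: phi_add M.smult_r_distr)
 then show ?thesis unfolding bsum_def using assms bs_term_closed by simp
qed

lemma bs_neg:
 assumes "finite F" "F <= J" "\<And>j. j : F ==> y j : carrier M"
 shows "bs F (\<lambda>j. -\<^sub>M y j) = -\<^sub>M bs F y"
proof -
 have "bs F y +\<^sub>M bs F (\<lambda>j. -\<^sub>M y j) = bs F (\<lambda>j. y j +\<^sub>M -\<^sub>M y j)"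
  using assms by (intro bs_add[symmetric]) auto
 also have "\<dots> = bs F (\<lambda>_. 0\<^sub>M)" using assms by (intro bs_cong) (auto simp: M.M.r_neg)
 also have "\<dots> = 0\<^sub>M" unfolding bsum_def using assms b_closed by (intro M.M.add.finprod_one_eqI) auto
 finally show ?thesis using bs_closed assms by (metis M.M.a_inv_closed M.M.a_comm M.M.minus_equality)
qed

lemma bs_zero_imp:
 assumes F: "finite F" "F <= J" and y: "\<And>j. j : F ==> y j : carrier M" and "bs F y = 0\<^sub>M" and j: "j : F"
 shows "y j = 0\<^sub>M"
proof -
 \<comment> \<open>The condition in \<open>unit_mod\<close> is on families with values in M at all
   indices, so y is cut off to 0 outside F.\<close>
 define z where "z j = (if j : F then y j else 0\<^sub>M)" for j
 have "bs F z = bs F y" using F y by (intro bs_cong) (auto simp: z_def)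
 moreover have "\<forall>j. z j : carrier M" using y by (auto simp: z_def)
 ultimately have "\<forall>j\<in>F. z j = 0\<^sub>M" using unit F assms(4) unfolding unit_mod_def by metis
 then show ?thesis using j by (auto simp: z_def)
qed

lemma bs_inj:
 assumes F: "finite F" "F <= J" and y: "\<And>j. j : F ==> y j : carrier M" and z: "\<And>j. j : F ==> z j : carrier M"
  and "bs F y = bs F z" and j: "j : F"
 shows "y j = z j"
proof -
 have "bs F (\<lambda>j. y j +\<^sub>M -\<^sub>M z j) = bs F y +\<^sub>M bs F (\<lambda>j. -\<^sub>M z j)"
  using y z by (intro bs_add F) auto
 also have "\<dots> = 0\<^sub>M"
 proof -
  have c: "bs F z : carrier M" by (rule bs_closed[OF F(2)]) (rule z)
  have n: "bs F (\<lambda>j. -\<^sub>M z j) = -\<^sub>M bs F z" by (rule bs_neg[OF F]) (rule z)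
  show ?thesis unfolding n assms(5) by (rule M.M.r_neg[OF c])
 qed
 finally have "bs F (\<lambda>j. y j +\<^sub>M -\<^sub>M z j) = 0\<^sub>M" .
 then have "y j +\<^sub>M -\<^sub>M z j = 0\<^sub>M" by (rule bs_zero_imp[OF F, rotated, OF _ j]) (simp add: y z)
 then show ?thesis using y[OF j] z[OF j] by (metis M.M.a_inv_closed M.M.add.inv_inv M.M.minus_equality)
qed

lemma D_ex:
 assumes "x : carrier M"
 shows "(\<forall>j. D j x : carrier M) \<and> (\<exists>F. finite F \<and> F <= J \<and> (\<forall>j. j \<notin> F \<longrightarrow> D j x = 0\<^sub>M) \<and> x = bs F (\<lambda>j. D j x))"
proof -
 define P where "P y \<longleftrightarrow> (\<forall>j. y j : carrier M) \<and>
   (\<exists>F. finite F \<and> F <= J \<and> (\<forall>j. j \<notin> F \<longrightarrow> y j = 0\<^sub>M) \<and> x = bs F y)" for y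
 obtain F y where y: "finite F" "F <= J" "\<forall>j. y j : carrier M" "x = bs F y"
  using unit assms unfolding unit_mod_def by metis
 have "bs F (\<lambda>j. if j : F then y j else 0\<^sub>M) = bs F y" using y by (intro bs_cong) auto
 then have "x = bs F (\<lambda>j. if j : F then y j else 0\<^sub>M)" using y(4) by (rule trans[rotated, OF sym])
 then have "P (\<lambda>j. if j : F then y j else 0\<^sub>M)"
  unfolding P_def using y(1-3) by (intro conjI allI exI[of _ F]) auto
 then have "P (Eps P)" by (rule someI[of P])
 moreover have "(\<lambda>j. D j x) = Eps P" unfolding dcomp_def P_def ..
 ultimately have "P (\<lambda>j. D j x)" by simp
 then show ?thesis unfolding P_def .
qed

lemma D_closed [simp]: "x : carrier M ==> D j x : carrier M" using D_ex by blast

text \<open>The finite set can be enlarged at will; prescribing \<open>F0\<close> lets several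
  expansions, or an expansion and a given index, share one finite set.\<close>

lemma D_expand:
 assumes "x : carrier M" "finite F0" "F0 <= J"
 obtains F where "finite F" "F0 <= F" "F <= J" "\<And>j. j \<notin> F ==> D j x = 0\<^sub>M" "x = bs F (\<lambda>j. D j x)"
proof -
 obtain F where F: "finite F" "F <= J" "\<forall>j. j \<notin> F \<longrightarrow> D j x = 0\<^sub>M" "x = bs F (\<lambda>j. D j x)"
  using D_ex[OF assms(1)] by blast
 have "bs F (\<lambda>j. D j x) = bs (F \<union> F0) (\<lambda>j. D j x)" using F assms by (intro bs_mono) auto
 then show ?thesis using F assms by (intro that[of "F \<union> F0"]) auto
qed

lemma D_unique:
 assumes F: "finite F" "F <= J" and y: "\<And>j. j : F ==> y j : carrier M" and j: "j : J"
 shows "D j (bs F y) = (if j : F then y j else 0\<^sub>M)"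
proof -
 have x: "bs F y : carrier M" using bs_closed F y by simp
 obtain G where G: "finite G" "insert j F <= G" "G <= J" "bs F y = bs G (\<lambda>j. D j (bs F y))"
  by (rule D_expand[OF x, of "insert j F"]) (use F j in auto)
 define z where "z j = (if j : F then y j else 0\<^sub>M)" for j
 have "bs F y = bs F z" using F y by (intro bs_cong) (auto simp: z_def)
 also have "\<dots> = bs G z" using G y by (intro bs_mono) (auto simp: z_def)
 finally have *: "bs G (\<lambda>j. D j (bs F y)) = bs G z" using G by simp
 have "D j (bs F y) = z j" by (rule bs_inj[OF G(1,3) _ _ *]) (use G j x y in \<open>auto simp: z_def\<close>)
 then show ?thesis by (simp add: z_def)
qed

lemma D_zero [simp]: "j : J ==> D j 0\<^sub>M = 0\<^sub>M"
 using D_unique[of "{}" "\<lambda>_. 0\<^sub>M"] by (simp add: bsum_def)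

end

text \<open>Components are determined by addition, the scalars b j and phi, so a map respecting
  these commutes with D j. The base rings may differ: the lemma is used for homomorphisms, for
  coordinate projections and for localization.\<close>

lemma D_commute:
 assumes "unit_module A p J b M \<phi>" "unit_module A' p' J b' M' \<phi>'"
  and cl: "\<And>x. x : carrier M ==> h x : carrier M'"
  and add: "\<And>x y. x : carrier M ==> y : carrier M ==> h (x +\<^sub>M y) = h x +\<^sub>M' h y"
  and sm: "\<And>j x. j : J ==> x : carrier M ==> h (b j *\<^sub>M x) = b' j *\<^sub>M' h x"
  and ph: "\<And>x. x : carrier M ==> h (\<phi> x) = \<phi>' (h x)"
  and x: "x : carrier M" and j: "j : J"
 shows "dcomp J b' M' \<phi>' j (h x) = h (dcomp J b M \<phi> j x)"
proof -
 interpret M: unit_module A p J b M \<phi> by fact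
 interpret M': unit_module A' p' J b' M' \<phi>' by fact
 note ab = module_ab[OF M.is_mod] module_ab[OF M'.is_mod]
 obtain F where F: "finite F" "{j} <= F" "F <= J" "\<And>j. j \<notin> F ==> M.D j x = 0\<^sub>M" "x = M.bs F (\<lambda>j. M.D j x)"
  by (rule M.D_expand[OF x, of "{j}"]) (use j in auto)
 have "h x = h (M.bs F (\<lambda>j. M.D j x))" using F by simp
 also have "\<dots> = (\<Oplus>\<^bsub>M'\<^esub>j\<in>F. h (b j *\<^sub>M \<phi> (M.D j x)))" unfolding bsum_def
  using F x M.b_closed by (intro additive_finsum[OF ab cl add]) auto
 also have "\<dots> = M'.bs F (\<lambda>j. h (M.D j x))" unfolding bsum_def using F x M'.b_closed cl sm ph
  by (intro M'.M.M.finsum_cong') auto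
 finally show ?thesis using M'.D_unique[OF F(1,3), of "\<lambda>j. h (M.D j x)" j] F j x cl by auto
qed

context unit_module
begin

lemma D_add:
 assumes x: "x : carrier M" and y: "y : carrier M" and j: "j : J"
 shows "D j (x +\<^sub>M y) = D j x +\<^sub>M D j y"
proof -
 obtain F where F: "finite F" "{j} <= F" "F <= J" "\<And>j. j \<notin> F ==> D j x = 0\<^sub>M" "x = bs F (\<lambda>j. D j x)"
  by (rule D_expand[OF x, of "{j}"]) (use j in auto)
 obtain G where G: "finite G" "F <= G" "G <= J" "\<And>j. j \<notin> G ==> D j y = 0\<^sub>M" "y = bs G (\<lambda>j. D j y)"
  using D_expand[OF y F(1,3)] by metis
 have "bs F (\<lambda>j. D j x) = bs G (\<lambda>j. D j x)" using F G x by (intro bs_mono) auto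
 then have "x +\<^sub>M y = bs G (\<lambda>j. D j x) +\<^sub>M bs G (\<lambda>j. D j y)" using F(5) G(5) by simp
 also have "\<dots> = bs G (\<lambda>j. D j x +\<^sub>M D j y)" using G x y by (intro bs_add[symmetric]) auto
 finally show ?thesis using D_unique[OF G(1,3), of "\<lambda>j. D j x +\<^sub>M D j y" j] x y j F(2) G(2) by auto
qed

text \<open>Since a^p phi(y) = phi(a y), a p-th power leaves D j as its root. This is why
  \<open>special_prime\<close> multiplies by a^p before taking components.\<close>

lemma D_pow_smult:
 assumes a: "a : carrier A" and x: "x : carrier M" and j: "j : J"
 shows "D j ((a [^] p) *\<^sub>M x) = a *\<^sub>M D j x"
proof -
 obtain F where F: "finite F" "{j} <= F" "F <= J" "\<And>j. j \<notin> F ==> D j x = 0\<^sub>M" "x = bs F (\<lambda>j. D j x)"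
  by (rule D_expand[OF x, of "{j}"]) (use j in auto)
 have "(a [^] p) *\<^sub>M x = (a [^] p) *\<^sub>M bs F (\<lambda>j. D j x)" using F by simp
 also have "\<dots> = (\<Oplus>\<^bsub>M\<^esub>j\<in>F. (a [^] p) *\<^sub>M (b j *\<^sub>M \<phi> (D j x)))"
  unfolding bsum_def using F x a by (intro M.finsum_smult_ldistr bs_term_closed) auto
 also have "\<dots> = bs F (\<lambda>j. a *\<^sub>M D j x)" unfolding bsum_def using F x a b_closed
  by (intro M.M.finsum_cong') (auto simp: phi_smult M.smult_assoc1[symmetric] m_comm)
 finally show ?thesis using D_unique[OF F(1,3), of "\<lambda>j. a *\<^sub>M D j x" j] F j x a by auto
qed

end

lemma (in frob_ring) unit_module_reg: "unit_module A p J b (reg A) (\<lambda>x. x [^] p)"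
 by unfold_locales (rule unit_reg)

context unit_module
begin

interpretation r: unit_module A p J b "reg A" "\<lambda>x. x [^] p" by (rule unit_module_reg)

abbreviation DA where "DA \<equiv> dcomp J b (reg A) (\<lambda>x. x [^] p)"

text \<open>Expand a over the basis and move its p-th powers under phi as scalars: the components of
  a phi(x) are multiples of x.\<close>

lemma D_smult_phi:
 assumes a: "a : carrier A" and x: "x : carrier M" and j: "j : J"
 shows "D j (a *\<^sub>M \<phi> x) = DA j a *\<^sub>M x"
proof -
 obtain F where F: "finite F" "{j} <= F" "F <= J" "\<And>j. j \<notin> F ==> DA j a = \<zero>" "a = r.bs F (\<lambda>j. DA j a)"
  by (rule r.D_expand[of a "{j}"]) (use j a in auto)
 have DAc: "DA j a : carrier A" for j using r.D_closed[of a j] a by simp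
 have "a *\<^sub>M \<phi> x = r.bs F (\<lambda>j. DA j a) *\<^sub>M \<phi> x" using F by simp
 also have "\<dots> = (\<Oplus>\<^bsub>M\<^esub>j\<in>F. (b j \<otimes> (DA j a [^] p)) *\<^sub>M \<phi> x)" unfolding bsum_def using F x DAc b_closed
  by (intro trans[OF additive_finsum[OF module_ab[OF r.is_mod] module_ab[OF is_mod], of "\<lambda>a. a *\<^sub>M \<phi> x"]])
   (auto simp: M.smult_l_distr)
 also have "\<dots> = bs F (\<lambda>j. DA j a *\<^sub>M x)" unfolding bsum_def using F x DAc b_closed
  by (intro M.M.finsum_cong') (auto simp: phi_smult M.smult_assoc1)
 finally show ?thesis using D_unique[OF F(1,3), of "\<lambda>j. DA j a *\<^sub>M x" j] F j x DAc by auto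
qed

lemma D_finsum:
 assumes "finite S" "x : S \<rightarrow> carrier M" "j : J"
 shows "D j (\<Oplus>\<^bsub>M\<^esub>i\<in>S. x i) = (\<Oplus>\<^bsub>M\<^esub>i\<in>S. D j (x i))"
 using assms by (intro additive_finsum module_ab[OF is_mod] D_add) auto

text \<open>D j is not linear, but D j (a x) is a linear combination of the D i x, by
  \<open>D_smult_phi\<close> applied to the scalars a b i. This is what makes \<open>Dinv L\<close>
  a submodule.\<close>

lemma D_smult_in:
 assumes L: "submodule L A M" and x: "x : carrier M" "\<And>i. i : J ==> D i x : L"
  and a: "a : carrier A" and j: "j : J"
 shows "D j (a *\<^sub>M x) : L"
proof -
 obtain F where F: "finite F" "{j} <= F" "F <= J" "\<And>j. j \<notin> F ==> D j x = 0\<^sub>M" "x = bs F (\<lambda>j. D j x)"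
  by (rule D_expand[OF x(1), of "{j}"]) (use j in auto)
 have "a *\<^sub>M x = a *\<^sub>M bs F (\<lambda>j. D j x)" using F by simp
 also have "\<dots> = (\<Oplus>\<^bsub>M\<^esub>i\<in>F. a *\<^sub>M (b i *\<^sub>M \<phi> (D i x)))"
  unfolding bsum_def using F x a by (intro M.finsum_smult_ldistr bs_term_closed) auto
 also have "\<dots> = (\<Oplus>\<^bsub>M\<^esub>i\<in>F. (a \<otimes> b i) *\<^sub>M \<phi> (D i x))"
  using F x a b_closed by (intro M.M.finsum_cong') (auto simp: M.smult_assoc1[symmetric])
 finally have "D j (a *\<^sub>M x) = D j (\<Oplus>\<^bsub>M\<^esub>i\<in>F. (a \<otimes> b i) *\<^sub>M \<phi> (D i x))" by simp
 also have "\<dots> = (\<Oplus>\<^bsub>M\<^esub>i\<in>F. D j ((a \<otimes> b i) *\<^sub>M \<phi> (D i x)))"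
  using F x a b_closed j by (intro D_finsum) auto
 also have "\<dots> = (\<Oplus>\<^bsub>M\<^esub>i\<in>F. DA j (a \<otimes> b i) *\<^sub>M D i x)"
  using F x a b_closed j r.D_closed by (intro M.M.finsum_cong') (auto simp: D_smult_phi)
 also have "\<dots> : L"
 proof (rule submodule_finsum[OF is_mod L F(1)])
  fix i assume i: "i : F"
  have "DA j (a \<otimes> b i) : carrier A" using r.D_closed[of "a \<otimes> b i" j] a i F b_closed by auto
  then show "DA j (a \<otimes> b i) *\<^sub>M D i x : L" using M.submoduleE(4)[OF L] x(2) F i by auto
 qed
 finally show ?thesis .
qed

abbreviation Dinv where "Dinv \<equiv> dinv J b M \<phi>"
abbreviation Dgen where "Dgen \<equiv> dgen A J b M \<phi>"

lemma D_phi_in: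
 assumes L: "submodule L A M" and x: "x : L" and j: "j : J"
 shows "D j (\<phi> x) : L"
proof -
 have xc: "x : carrier M" using M.submoduleE(1)[OF L] x by auto
 have "D j (\<one> *\<^sub>M \<phi> x) = DA j \<one> *\<^sub>M x" using xc j by (intro D_smult_phi) auto
 moreover have "DA j \<one> : carrier A" using r.D_closed[of \<one> j] by simp
 ultimately show ?thesis using M.submoduleE(4)[OF L _ x] xc by simp
qed

lemma Dinv_submodule: "submodule L A M ==> submodule (Dinv L) A M"
proof -
 assume L: "submodule L A M"
 note L' = M.submoduleE[OF L] submodule_zero[OF L]
 have sm: "a *\<^sub>M x : Dinv L" if "a : carrier A" "x : Dinv L" for a x
  using that D_smult_in[OF L] by (auto simp: dinv_def)
 show ?thesis
 proof (rule M.submoduleI)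
  show "-\<^sub>M x : Dinv L" if "x : Dinv L" for x
   using sm[OF _ that, of "\<ominus> \<one>"] that by (simp add: M.smult_l_minus dinv_def)
 qed (use L' sm in \<open>auto simp: dinv_def D_add\<close>)
qed

text \<open>One inclusion holds because the components of phi(x) are multiples of x, the other
  because an element is the sum of the terms b j phi(D j x).\<close>

lemma Dinv_eq_gen: "submodule L A M ==> Dinv L = gen_submodule A M (\<phi> ` L)"
proof (intro equalityI)
 assume L: "submodule L A M"
 note L' = M.submoduleE[OF L]
 have "\<phi> ` L <= Dinv L" using L' D_phi_in[OF L] by (auto simp: dinv_def)
 then show "gen_submodule A M (\<phi> ` L) <= Dinv L"
  by (intro gen_submodule_minimal is_mod Dinv_submodule L)
 have g: "submodule (gen_submodule A M (\<phi> ` L)) A M"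
  by (rule gen_submodule_is_submodule[OF is_mod]) (use L' in auto)
 show "Dinv L <= gen_submodule A M (\<phi> ` L)"
 proof
  fix x assume x: "x : Dinv L"
  then have xc: "x : carrier M" by (auto simp: dinv_def)
  obtain F where F: "finite F" "F <= J" "x = bs F (\<lambda>j. D j x)"
   by (rule D_expand[OF xc, of "{}"]) auto
  have "bs F (\<lambda>j. D j x) : gen_submodule A M (\<phi> ` L)" unfolding bsum_def
  proof (rule submodule_finsum[OF is_mod g F(1)])
   fix i assume i: "i : F"
   then have "D i x : L" using x F by (auto simp: dinv_def)
   then have "\<phi> (D i x) : gen_submodule A M (\<phi> ` L)" using gen_submodule_subset[OF is_mod] by blast
   then show "b i *\<^sub>M \<phi> (D i x) : gen_submodule A M (\<phi> ` L)"
    using i F b_closed by (intro M.submoduleE(4)[OF g]) auto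
  qed
  then show "x : gen_submodule A M (\<phi> ` L)" using F(3) by simp
 qed
qed

text \<open>Both sides say that the components of all elements of K lie in L. The computations with
  I_e rest on this adjunction.\<close>

lemma Dgen_le_iff: "submodule L A M ==> K <= carrier M ==> Dgen K <= L \<longleftrightarrow> K <= Dinv L"
 unfolding dgen_def dinv_def by (subst gen_submodule_le_iff[OF is_mod]) blast+

lemma Dgen_submodule: "K <= carrier M ==> submodule (Dgen K) A M"
 unfolding dgen_def by (rule gen_submodule_is_submodule[OF is_mod]) auto

lemma Dgen_mono: "K <= K' ==> Dgen K <= Dgen K'"
 unfolding dgen_def by (rule gen_submodule_mono) auto

lemma Dinv_mono: "K <= K' ==> Dinv K <= Dinv K'" unfolding dinv_def by auto

text \<open>By the adjunction S lies in the submodule \<open>Dinv (Dgen S)\<close>, hence so does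
  its span.\<close>

lemma Dgen_gen:
 assumes S: "S <= carrier M"
 shows "Dgen (gen_submodule A M S) = Dgen S"
proof
 note g = gen_submodule_closed[OF is_mod S] gen_submodule_subset[OF is_mod, of S]
 show "Dgen S <= Dgen (gen_submodule A M S)" using g by (intro Dgen_mono)
 have "S <= Dinv (Dgen S)" using Dgen_le_iff[OF Dgen_submodule[OF S] S] by simp
 then have "gen_submodule A M S <= Dinv (Dgen S)"
  by (intro gen_submodule_minimal is_mod Dinv_submodule Dgen_submodule S)
 then show "Dgen (gen_submodule A M S) <= Dgen S" using Dgen_le_iff[OF Dgen_submodule[OF S]] g by simp
qed

end

subsection \<open>Constructions of unit modules\<close>

context unit_module
begin

text \<open>Stability of N under components makes the coefficients of an expansion in the quotient
  unique. The map psi is prescribed on cosets of elements because the Frobenius on cohomology is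
  given through representatives.\<close>

lemma unit_quot:
 assumes N: "submodule N A M" and phiN: "\<And>x. x : N ==> \<phi> x : N" and DN: "\<And>j x. j : J ==> x : N ==> D j x : N"
  and psi: "\<And>x. x : carrier M ==> \<psi> (N +>\<^sub>M x) = N +>\<^sub>M \<phi> x"
 shows "unit_mod A p J b (quot_module M N) \<psi>" unfolding unit_mod_def
proof (intro conjI ballI allI impI)
 let ?Q = "quot_module M N"
 let ?c = "\<lambda>x. N +>\<^sub>M x"
 note qs = quot_carrier[OF is_mod N] quot_add[OF is_mod N] quot_smult[OF is_mod N] quot_zero[OF is_mod N]
 show Q: "Module.module A ?Q" by (rule quot_is_module[OF is_mod N])
 show "\<psi> : semilin A p ?Q ?Q" by (intro semilinI) (auto simp: qs psi phi_add phi_smult)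
 have bsQ: "bsum b \<psi> ?Q F (\<lambda>j. ?c (y j)) = ?c (bs F y)" if F: "finite F" "F <= J" "\<And>j. y j : carrier M" for F y
 proof -
  have "?c (bs F y) = (\<Oplus>\<^bsub>?Q\<^esub>j\<in>F. ?c (b j *\<^sub>M \<phi> (y j)))" unfolding bsum_def using F
   by (intro semilin_finsum[OF is_mod Q quot_class_semilin[OF is_mod N]] bs_term_closed) auto
  also have "\<dots> = (\<Oplus>\<^bsub>?Q\<^esub>j\<in>F. b j *\<^sub>?Q \<psi> (?c (y j)))" using F b_closed
   by (intro abelian_monoid.finsum_cong' abelian_group.axioms module_ab[OF Q]) (auto simp: qs psi)
  finally show ?thesis unfolding bsum_def by simp
 qed
 {
  fix X assume "X : carrier ?Q"
  then obtain x where x: "x : carrier M" "X = ?c x" by (auto simp: qs)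
  obtain F where F: "finite F" "F <= J" "x = bs F (\<lambda>j. D j x)"
   by (rule D_expand[OF x(1), of "{}"]) auto
  have "X = bsum b \<psi> ?Q F (\<lambda>j. ?c (D j x))" using bsQ[OF F(1,2), of "\<lambda>j. D j x"] x F by simp
  then show "\<exists>F y. finite F \<and> F <= J \<and> (\<forall>j. y j : carrier ?Q) \<and> X = bsum b \<psi> ?Q F y"
   using F x by (intro exI[of _ F] exI[of _ "\<lambda>j. ?c (D j x)"]) (auto simp: qs)
 }
 fix F Y j assume F: "finite F" "F <= J" and Y: "\<forall>j. Y j : carrier ?Q" and z: "bsum b \<psi> ?Q F Y = 0\<^sub>?Q" and j: "j : F"
 have "\<forall>j. \<exists>y. y : carrier M \<and> Y j = ?c y" using Y by (auto simp: qs)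
 then obtain y where y: "\<And>j. y j : carrier M" "\<And>j. Y j = ?c (y j)" by metis
 have Y': "Y = (\<lambda>j. ?c (y j))" using y(2) by (rule ext)
 have "?c (bs F y) = 0\<^sub>?Q" using bsQ[OF F y(1), symmetric] z unfolding Y' by (rule trans)
 then have "?c (bs F y) = N" unfolding qs(4) .
 then have "bs F y : N" using coset_eq_N_iff[OF is_mod N] bs_closed[OF F(2)] y by auto
 then have "D j (bs F y) : N" using DN F j by auto
 then have "y j : N" using D_unique[OF F, of y j] F y j by auto
 then show "Y j = 0\<^sub>?Q" using y coset_eq_N_iff[OF is_mod N] by (auto simp: qs)
qed

lemma submod_finsum:
 assumes "submodule N A M" "finite S" "x : S \<rightarrow> N"
 shows "finsum (submod M N) x S = finsum M x S"
proof -
 have "Module.module A (submod M N)"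
  unfolding submod_def by (rule submodule.submodule_is_module[OF assms(1) is_mod])
 then have ab: "abelian_group (submod M N)" by (rule module_ab)
 have NM: "N <= carrier M" using M.submoduleE(1)[OF assms(1)] .
 show ?thesis using additive_finsum[OF ab module_ab[OF is_mod], of "\<lambda>x. x" S x] assms NM
  by (auto simp: submod_def)
qed

text \<open>Here stability under components keeps the expansions inside N, and uniqueness is
  inherited from M.\<close>

lemma unit_submod:
 assumes N: "submodule N A M" and phiN: "\<And>x. x : N ==> \<phi> x : N" and DN: "\<And>j x. j : J ==> x : N ==> D j x : N"
 shows "unit_mod A p J b (submod M N) \<phi>" unfolding unit_mod_def
proof (intro conjI ballI allI impI)
 let ?Q = "submod M N"
 have NM: "N <= carrier M" using M.submoduleE(1)[OF N] .
 show Q: "Module.module A ?Q"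
  unfolding submod_def by (rule submodule.submodule_is_module[OF N is_mod])
 have s: "carrier ?Q = N" "0\<^sub>?Q = 0\<^sub>M" by (auto simp: submod_def)
 show "\<phi> : semilin A p ?Q ?Q"
  using NM phiN by (intro semilinI) (auto simp: submod_def phi_add phi_smult subset_iff)
 have bsQ: "bsum b \<phi> ?Q F y = bs F y" if F: "finite F" "F <= J" "\<And>j. y j : N" for F y
  unfolding bsum_def using F phiN b_closed M.submoduleE(4)[OF N]
  by (subst submod_finsum[OF N, symmetric]) (auto simp: submod_def)
 {
  fix x assume "x : carrier ?Q"
  then have x: "x : N" and xc: "x : carrier M" using NM by (auto simp: s)
  obtain F where F: "finite F" "F <= J" "\<And>j. j \<notin> F ==> D j x = 0\<^sub>M" "x = bs F (\<lambda>j. D j x)"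
   by (rule D_expand[OF xc, of "{}"]) auto
  have c: "D j x : N" for j
   using DN[of j x] x F(2) F(3)[of j] submodule_zero[OF N] by (cases "j : F") auto
  show "\<exists>F y. finite F \<and> F <= J \<and> (\<forall>j. y j : carrier ?Q) \<and> x = bsum b \<phi> ?Q F y"
   using F x bsQ[OF F(1,2) c] c by (intro exI[of _ F] exI[of _ "\<lambda>j. D j x"]) (auto simp: s)
 }
 fix F y j assume F: "finite F" "F <= J" and y: "\<forall>j. y j : carrier ?Q" and z: "bsum b \<phi> ?Q F y = 0\<^sub>?Q" and j: "j : F"
 show "y j = 0\<^sub>?Q" using bs_zero_imp[OF F _ _ j, of y] y z NM F bsQ[OF F, of y] by (auto simp: s)
qed

end

text \<open>As K is finite, all coordinates of an element can be expanded over one finite subset of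
  J.\<close>

lemma (in frob_ring) unit_direct_sum:
 assumes K: "finite K" and M: "\<And>k. k : K ==> unit_mod A p J b (M k) (\<phi> k)"
 shows "unit_mod A p J b (direct_sum K M) (\<lambda>x. \<lambda>k\<in>K. \<phi> k (x k))" unfolding unit_mod_def
proof (intro conjI ballI allI impI)
 let ?S = "direct_sum K M" and ?ph = "\<lambda>x. \<lambda>k\<in>K. \<phi> k (x k)"
 have um: "unit_module A p J b (M k) (\<phi> k)" if "k : K" for k by unfold_locales (rule M[OF that])
 have mod: "Module.module A (M k)" if "k : K" for k using M[OF that] by (simp add: unit_mod_def)
 show S: "Module.module A ?S" by (rule direct_sum_is_module[OF is_cring mod])
 interpret S: Module.module A ?S by (rule S)
 have car: "x : carrier ?S \<longleftrightarrow> x : extensional K \<and> (\<forall>k\<in>K. x k : carrier (M k))" for x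
  using K by (auto simp: direct_sum_carrier)
 note ph = unit_module.phi_closed[OF um] unit_module.phi_add[OF um] unit_module.phi_smult[OF um]
 have phc: "?ph x : carrier ?S" if "x : carrier ?S" for x using that ph(1) by (auto simp: car)
 show "?ph : semilin A p ?S ?S" using ph by (intro semilinI phc) (auto simp: car)
 have bsk: "bsum b ?ph ?S F y k = bsum b (\<phi> k) (M k) F (\<lambda>j. y j k)"
  if F: "finite F" "F <= J" "\<And>j. y j : carrier ?S" and k: "k : K" for F y k
 proof -
  interpret k: unit_module A p J b "M k" "\<phi> k" by (rule um[OF k])
  have "bsum b ?ph ?S F y k = (\<Oplus>\<^bsub>M k\<^esub>j\<in>F. (b j *\<^sub>?S ?ph (y j)) k)"
   unfolding bsum_def using F b_closed phc
   by (intro direct_sum_finsum_apply[OF is_cring mod] k) (auto simp del: direct_sum_simps)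
  also have "\<dots> = bsum b (\<phi> k) (M k) F (\<lambda>j. y j k)"
   unfolding bsum_def using F k b_closed by (intro k.M.M.finsum_cong') (auto simp: car)
  finally show ?thesis .
 qed
 have bsc: "bsum b ?ph ?S F y : carrier ?S" if "F <= J" "\<And>j. y j : carrier ?S" for F y
  unfolding bsum_def using that b_closed phc by (intro S.M.finsum_closed) (auto simp del: direct_sum_simps)
 {
  fix x assume x: "x : carrier ?S"
  have xk: "x k : carrier (M k)" if "k : K" for k using x that by (auto simp: car)
  have "\<forall>k\<in>K. \<exists>F. finite F \<and> F <= J \<and> (\<forall>j. j \<notin> F \<longrightarrow> dcomp J b (M k) (\<phi> k) j (x k) = 0\<^sub>(M k)) \<and>
    x k = bsum b (\<phi> k) (M k) F (\<lambda>j. dcomp J b (M k) (\<phi> k) j (x k))"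
   using unit_module.D_ex[OF um xk] by blast
  then obtain G where G: "\<And>k. k : K ==> finite (G k) \<and> G k <= J \<and>
    (\<forall>j. j \<notin> G k \<longrightarrow> dcomp J b (M k) (\<phi> k) j (x k) = 0\<^sub>(M k)) \<and>
    x k = bsum b (\<phi> k) (M k) (G k) (\<lambda>j. dcomp J b (M k) (\<phi> k) j (x k))" by metis
  define F where "F = (\<Union>k\<in>K. G k)"
  have F: "finite F" "F <= J" using G K by (auto simp: F_def)
  define y where "y j = (\<lambda>k\<in>K. dcomp J b (M k) (\<phi> k) j (x k))" for j
  have y: "y j : carrier ?S" for j using unit_module.D_closed[OF um xk] by (auto simp: y_def car)
  have "x = bsum b ?ph ?S F y"
  proof (rule direct_sum_eqI[OF x bsc[OF F(2) y]])
   fix k assume k: "k : K"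
   interpret k: unit_module A p J b "M k" "\<phi> k" by (rule um[OF k])
   have "bsum b ?ph ?S F y k = bsum b (\<phi> k) (M k) F (\<lambda>j. dcomp J b (M k) (\<phi> k) j (x k))"
    unfolding bsk[OF F y k] using k F xk by (intro k.bs_cong) (auto simp: y_def)
   also have "\<dots> = bsum b (\<phi> k) (M k) (G k) (\<lambda>j. dcomp J b (M k) (\<phi> k) j (x k))"
    using F G[OF k] xk k by (intro k.bs_mono[symmetric]) (auto simp: F_def)
   finally show "x k = bsum b ?ph ?S F y k" using G[OF k] by simp
  qed
  then show "\<exists>F y. finite F \<and> F <= J \<and> (\<forall>j. y j : carrier ?S) \<and> x = bsum b ?ph ?S F y"
   using F y by blast
 }
 fix F y j assume F: "finite F" "F <= J" and y: "\<forall>j. y j : carrier ?S" and z: "bsum b ?ph ?S F y = 0\<^sub>?S" and j: "j : F"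
 show "y j = 0\<^sub>?S"
 proof (rule direct_sum_eqI[OF _ S.M.zero_closed])
  fix k assume k: "k : K"
  interpret k: unit_module A p J b "M k" "\<phi> k" by (rule um[OF k])
  have "bsum b (\<phi> k) (M k) F (\<lambda>j. y j k) = 0\<^sub>(M k)" using bsk[OF F _ k, of y] y z k by simp
  then have "y j k = 0\<^sub>(M k)" using k.bs_zero_imp[OF F _ _ j, of "\<lambda>j. y j k"] y k by (auto simp: car)
  then show "y j k = 0\<^sub>?S k" using k by simp
 qed (use y in auto)
qed

section \<open>Frobenius pullbacks\<close>

lemma mod_iso_inv:
 assumes M: "Module.module A M" and f: "f : mod_iso A M N"
 shows "inv_into (carrier M) f : mod_iso A N M"
proof -
 interpret M: Module.module A M by fact
 have h: "f : mod_hom A M N" and b: "bij_betw f (carrier M) (carrier N)" using f by (auto simp: mod_iso_def)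
 let ?g = "inv_into (carrier M) f"
 have inj: "inj_on f (carrier M)" and im: "f ` carrier M = carrier N" using b by (auto simp: bij_betw_def)
 have gc: "?g y : carrier M" and fg: "f (?g y) = y" if "y : carrier N" for y
  using that im by (auto simp: inv_into_into f_inv_into_f)
 have eq: "?g y = x" if "x : carrier M" "f x = y" for x y using that inj by auto
 have "?g : mod_hom A N M"
 proof (rule mod_homI)
  show "?g (x +\<^sub>N y) = ?g x +\<^sub>M ?g y" if "x : carrier N" "y : carrier N" for x y
   using that gc fg mod_homD(2)[OF h] by (intro eq) auto
  show "?g (a *\<^sub>N y) = a *\<^sub>M ?g y" if "a : carrier A" "y : carrier N" for a y
   using that gc fg mod_homD(3)[OF h] by (intro eq) auto
 qed (rule gc)
 then show ?thesis using bij_betw_inv_into[OF b] by (simp add: mod_iso_def)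
qed

lemma zero_submodule:
 assumes M: "Module.module A M" shows "submodule {0\<^sub>M} A M"
proof -
 interpret M: Module.module A M by fact
 show ?thesis by (intro M.submoduleI) auto
qed

lemma semilin_inj_onI:
 assumes M: "Module.module A M" and N: "Module.module A N" and f: "f : semilin A q M N"
  and "\<And>x. x : carrier M ==> f x = 0\<^sub>N ==> x = 0\<^sub>M"
 shows "inj_on f (carrier M)"
proof (rule inj_onI)
 interpret M: Module.module A M by fact
 interpret N: Module.module A N by fact
 fix x y assume x: "x : carrier M" "y : carrier M" "f x = f y"
 have "f (x -\<^sub>M y) = 0\<^sub>N"
  using semilin_minus[OF M N f x(1,2)] x semilin_closed[OF f] by (simp add: a_minus_def N.M.r_neg)
 then have "x -\<^sub>M y = 0\<^sub>M" using x assms(4) by auto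
 then show "x = y" using x by (metis M.M.a_inv_closed M.M.add.inv_inv M.M.minus_equality a_minus_def)
qed

lemma semilin_id: "cring A ==> (\<lambda>x. x) : mod_hom A M M" by (intro mod_homI) auto

lemma mod_hom_comp: "f : mod_hom A M N ==> g : mod_hom A N L ==> (\<lambda>x. g (f x)) : mod_hom A M L"
 unfolding mod_hom_def by (auto simp: Pi_iff)

lemma semilin_comp_hom:
 assumes "cring A" "f : mod_hom A M N" "g : semilin A r N L"
 shows "(\<lambda>x. g (f x)) : semilin A r M L"
 using semilin_comp[OF assms(1), of f 1 M N g r L] assms mod_hom_eq_semilin[OF assms(1), of M N] by auto

lemma hom_comp_semilin:
 assumes "cring A" "f : semilin A r M N" "g : mod_hom A N L"
 shows "(\<lambda>x. g (f x)) : semilin A r M L"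
 using semilin_comp[OF assms(1,2), of g 1 L] assms mod_hom_eq_semilin[OF assms(1), of N L] by auto

context
 fixes A :: "('a, 'x) ring_scheme" and M :: "('a, 'm) module" and q :: nat
 assumes M: "Module.module A M"
begin

interpretation M: Module.module A M by (fact M)

abbreviation (input) FG where "FG \<equiv> free_module A (carrier M)"
abbreviation (input) fb where "fb \<equiv> free_basis A (carrier M)"

lemma free_is_module: "Module.module A FG"
 by (rule direct_sum_is_module[OF M.R.is_cring reg_is_module[OF M.R.is_cring]])

interpretation G: Module.module A FG by (rule free_is_module)

lemma fb_closed: "m : carrier M ==> fb m : carrier FG" unfolding free_basis_def
 by (rule direct_sum_inj_closed[OF M.R.is_cring reg_is_module[OF M.R.is_cring]]) auto

definition Frob_gens where "Frob_gens =
    ({fb (m +\<^sub>M m') -\<^sub>FG (fb m +\<^sub>FG fb m') | m m'. m : carrier M \<and> m' : carrier M}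
   \<union> {fb (a *\<^sub>M m) -\<^sub>FG ((a ^\<^sub>A q) *\<^sub>FG fb m) | a m. a : carrier A \<and> m : carrier M})"

lemma Frob_rel_eq: "Frob_rel A q M = gen_submodule A FG Frob_gens"
 unfolding Frob_rel_def Frob_gens_def Let_def ..

lemma Frob_gens_closed: "Frob_gens <= carrier FG" unfolding Frob_gens_def using fb_closed
 by (auto simp del: direct_sum_simps)

lemma Frob_rel_submodule: "submodule (Frob_rel A q M) A FG"
 unfolding Frob_rel_eq by (rule gen_submodule_is_submodule[OF free_is_module Frob_gens_closed])

lemma Frob_is_module: "Module.module A (Frob A q M)"
 unfolding Frob_def by (rule quot_is_module[OF free_is_module Frob_rel_submodule])

lemmas Frob_qs = quot_carrier[OF free_is_module Frob_rel_submodule, folded Frob_def]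
 quot_add[OF free_is_module Frob_rel_submodule, folded Frob_def]
 quot_smult[OF free_is_module Frob_rel_submodule, folded Frob_def]

lemma Frob_gens_rel: "Frob_gens <= Frob_rel A q M"
 unfolding Frob_rel_eq by (rule gen_submodule_subset[OF free_is_module])

lemma one_tensor_semilin: "one_tensor A q M : semilin A q M (Frob A q M)"
proof (rule semilinI)
 fix x assume x: "x : carrier M"
 show "one_tensor A q M x : carrier (Frob A q M)"
  unfolding one_tensor_def Frob_qs using fb_closed[OF x] by blast
 {
  fix y assume y: "y : carrier M"
  have "fb (x +\<^sub>M y) -\<^sub>FG (fb x +\<^sub>FG fb y) : Frob_rel A q M"
   using x y Frob_gens_rel unfolding Frob_gens_def by blast
  then show "one_tensor A q M (x +\<^sub>M y) = one_tensor A q M x +\<^sub>(Frob A q M) one_tensor A q M y"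
   unfolding one_tensor_def using x y fb_closed
   by (simp add: Frob_qs coset_eq_iff[OF free_is_module Frob_rel_submodule] del: direct_sum_simps)
 }
 fix a assume a: "a : carrier A"
 have "fb (a *\<^sub>M x) -\<^sub>FG ((a ^\<^sub>A q) *\<^sub>FG fb x) : Frob_rel A q M"
  using x a Frob_gens_rel unfolding Frob_gens_def by blast
 then show "one_tensor A q M (a *\<^sub>M x) = (a ^\<^sub>A q) *\<^sub>(Frob A q M) one_tensor A q M x"
  unfolding one_tensor_def using x a fb_closed
  by (simp add: Frob_qs coset_eq_iff[OF free_is_module Frob_rel_submodule] del: direct_sum_simps)
qed

lemma Frob_sum_form:
 assumes "X : carrier (Frob A q M)"
 obtains S c where "finite S" "S <= carrier M" "\<And>m. m : S ==> c m : carrier A"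
  "X = (\<Oplus>\<^bsub>Frob A q M\<^esub>m\<in>S. c m *\<^sub>(Frob A q M) one_tensor A q M m)"
proof -
 obtain c where c: "c : carrier FG" "X = Frob_rel A q M +>\<^sub>FG c" using assms by (auto simp: Frob_qs)
 define S where "S = {m : carrier M. c m \<noteq> 0\<^sub>A}"
 have S: "finite S" "S <= carrier M" using c by (auto simp: S_def direct_sum_carrier)
 have cm: "c m : carrier A" if "m : carrier M" for m using c that by (auto simp: direct_sum_carrier)
 have inj: "direct_sum_inj (carrier M) (\<lambda>_. reg A) m (c m) = c m *\<^sub>FG fb m" if "m : carrier M" for m
  using cm[OF that] by (auto simp: direct_sum_inj_def free_basis_def)
 have "c = (\<Oplus>\<^bsub>FG\<^esub>m\<in>S. direct_sum_inj (carrier M) (\<lambda>_. reg A) m (c m))"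
  by (rule direct_sum_decomp[OF M.R.is_cring reg_is_module[OF M.R.is_cring] c(1) S]) (auto simp: S_def)
 also have "\<dots> = (\<Oplus>\<^bsub>FG\<^esub>m\<in>S. c m *\<^sub>FG fb m)"
  using S cm fb_closed inj by (intro G.M.finsum_cong') (auto simp del: direct_sum_simps)
 finally have ceq: "c = (\<Oplus>\<^bsub>FG\<^esub>m\<in>S. c m *\<^sub>FG fb m)" .
 have "X = Frob_rel A q M +>\<^sub>FG (\<Oplus>\<^bsub>FG\<^esub>m\<in>S. c m *\<^sub>FG fb m)" using c(2) ceq by simp
 also have "\<dots> = (\<Oplus>\<^bsub>Frob A q M\<^esub>m\<in>S. Frob_rel A q M +>\<^sub>FG (c m *\<^sub>FG fb m))" using S cm fb_closed
  by (intro semilin_finsum[OF free_is_module Frob_is_module quot_class_semilin[OF free_is_module Frob_rel_submodule, folded Frob_def]])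
   (auto simp del: direct_sum_simps)
 also have "\<dots> = (\<Oplus>\<^bsub>Frob A q M\<^esub>m\<in>S. c m *\<^sub>(Frob A q M) one_tensor A q M m)"
  using S cm fb_closed semilin_closed[OF one_tensor_semilin]
  by (intro abelian_monoid.finsum_cong' abelian_group.axioms module_ab[OF Frob_is_module])
   (auto simp: one_tensor_def Frob_qs simp del: direct_sum_simps)
 finally show ?thesis using S cm by (intro that) auto
qed

text \<open>Tensors with 1 span the pullback. Surjectivity of maps onto it and, in
  \<open>Frob_ext\<close>, equality of maps out of it are reduced to these tensors.\<close>

lemma Frob_sub_full:
 assumes N: "submodule N A (Frob A q M)" and "\<And>m. m : carrier M ==> one_tensor A q M m : N"
 shows "carrier (Frob A q M) <= N"
proof
 fix X assume "X : carrier (Frob A q M)"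
 then obtain S c where S: "finite S" "S <= carrier M" "\<And>m. m : S ==> c m : carrier A"
  "X = (\<Oplus>\<^bsub>Frob A q M\<^esub>m\<in>S. c m *\<^sub>(Frob A q M) one_tensor A q M m)" by (rule Frob_sum_form) blast
 show "X : N" unfolding S(4) using S assms(2) Module.module.submoduleE(4)[OF Frob_is_module N]
  by (intro submodule_finsum[OF Frob_is_module N]) auto
qed

text \<open>Universal property of the pullback. The case r > 1 occurs for the inner map of
  \<open>Frob_comp\<close>, which is semilinear for the outer exponent; additivity of a -> a^r then
  enters when two coefficient functions are added.\<close>

lemma Frob_lift_props:
 fixes N :: "('a, 'n) module" and r :: nat
 assumes N: "Module.module A N" and g: "g : semilin A (q * r) M N" and r: "0 < r"
  and add: "\<And>a b. a : carrier A ==> b : carrier A ==> (a +\<^sub>A b) ^\<^sub>A r = a ^\<^sub>A r +\<^sub>A b ^\<^sub>A r"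
 shows "Frob_lift A M N r g : semilin A r (Frob A q M) N"
  and "m : carrier M ==> Frob_lift A M N r g (one_tensor A q M m) = g m"
proof -
 interpret N: Module.module A N by fact
 define l where "l c = finsum N (\<lambda>m. (c m ^\<^sub>A r) *\<^sub>N g m) {m : carrier M. c m \<noteq> 0\<^sub>A}" for c
 note gc = semilin_closed[OF g]
 \<comment> \<open>As r > 0, vanishing coefficients contribute 0, so the sum may be taken over any
   finite set that contains the support.\<close>
 have z: "0\<^sub>A ^\<^sub>A r = 0\<^sub>A" using r by (simp add: M.R.nat_pow_zero)
 have lF: "l c = (\<Oplus>\<^bsub>N\<^esub>m\<in>F. (c m ^\<^sub>A r) *\<^sub>N g m)"
  if "c : carrier FG" "finite F" "F <= carrier M" "{m : carrier M. c m \<noteq> 0\<^sub>A} <= F" for c F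
  unfolding l_def using that gc z
  by (intro N.M.add.finprod_mono_neutral_cong_left) (auto simp: direct_sum_carrier)
 have supp: "finite {m : carrier M. c m \<noteq> 0\<^sub>A}" if "c : carrier FG" for c
  using that by (auto simp: direct_sum_carrier)
 have cm: "c m : carrier A" if "c : carrier FG" "m : carrier M" for c m using that by (auto simp: direct_sum_carrier)
 have lc: "l c : carrier N" if "c : carrier FG" for c
  unfolding l_def using gc cm[OF that] by (intro N.M.finsum_closed) auto
 have ls: "l : semilin A r FG N"
 proof (rule semilinI[OF lc])
  fix c c' assume c: "c : carrier FG" and c': "c' : carrier FG"
  define F where "F = {m : carrier M. c m \<noteq> 0\<^sub>A} \<union> {m : carrier M. c' m \<noteq> 0\<^sub>A}"
  have F: "finite F" "F <= carrier M" using supp[OF c] supp[OF c'] by (auto simp: F_def)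
  have s: "{m : carrier M. (c +\<^sub>FG c') m \<noteq> 0\<^sub>A} <= F" by (auto simp: F_def)
  have "l (c +\<^sub>FG c') = (\<Oplus>\<^bsub>N\<^esub>m\<in>F. ((c +\<^sub>FG c') m ^\<^sub>A r) *\<^sub>N g m)"
   by (rule lF[OF _ F s]) (rule G.M.a_closed[OF c c'])
  also have "\<dots> = (\<Oplus>\<^bsub>N\<^esub>m\<in>F. (c m ^\<^sub>A r) *\<^sub>N g m +\<^sub>N (c' m ^\<^sub>A r) *\<^sub>N g m)"
   using F cm[OF c] cm[OF c'] gc
   by (intro N.M.finsum_cong') (auto simp: add N.smult_l_distr subset_iff)
  also have "\<dots> = l c +\<^sub>N l c'"
   using F cm[OF c] cm[OF c'] gc by (subst (1 2) lF[OF _ F]) (auto simp: F_def c c')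
  finally show "l (c +\<^sub>FG c') = l c +\<^sub>N l c'" .
 next
  fix a c assume a: "a : carrier A" and c: "c : carrier FG"
  define F where "F = {m : carrier M. c m \<noteq> 0\<^sub>A}"
  have F: "finite F" "F <= carrier M" using supp[OF c] by (auto simp: F_def)
  have s: "{m : carrier M. (a *\<^sub>FG c) m \<noteq> 0\<^sub>A} <= F" using a by (auto simp: F_def)
  have "l (a *\<^sub>FG c) = (\<Oplus>\<^bsub>N\<^esub>m\<in>F. ((a *\<^sub>FG c) m ^\<^sub>A r) *\<^sub>N g m)"
   by (rule lF[OF _ F s]) (rule G.smult_closed[OF a c])
  also have "\<dots> = (\<Oplus>\<^bsub>N\<^esub>m\<in>F. (a ^\<^sub>A r) *\<^sub>N ((c m ^\<^sub>A r) *\<^sub>N g m))" using F cm[OF c] a gc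
   by (intro N.M.finsum_cong') (auto simp: M.R.nat_pow_distrib N.smult_assoc1)
  also have "\<dots> = (a ^\<^sub>A r) *\<^sub>N l c"
   unfolding l_def F_def[symmetric] using F cm[OF c] a gc by (intro N.finsum_smult_ldistr[symmetric]) auto
  finally show "l (a *\<^sub>FG c) = (a ^\<^sub>A r) *\<^sub>N l c" .
 qed
 have lb: "l (fb m) = g m" if m: "m : carrier M" for m
 proof -
  have "l (fb m) = (\<Oplus>\<^bsub>N\<^esub>k\<in>{m}. (fb m k ^\<^sub>A r) *\<^sub>N g k)"
   using m by (intro lF fb_closed) (auto simp: free_basis_def direct_sum_inj_def)
  then show ?thesis using m gc by (simp add: free_basis_def direct_sum_inj_def)
 qed
 note lm = semilin_minus[OF free_is_module N ls]
 \<comment> \<open>The map l kills the defining relations of the pullback, hence factors through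
   it.\<close>
 have "Frob_gens <= {c : carrier FG. l c : {0\<^sub>N}}"
 proof
  fix c assume cg: "c : Frob_gens"
  then have c: "c : carrier FG" using Frob_gens_closed by auto
  from cg consider m m' where "m : carrier M" "m' : carrier M" "c = fb (m +\<^sub>M m') -\<^sub>FG (fb m +\<^sub>FG fb m')"
   | a m where "a : carrier A" "m : carrier M" "c = fb (a *\<^sub>M m) -\<^sub>FG ((a ^\<^sub>A q) *\<^sub>FG fb m)"
   unfolding Frob_gens_def by blast
  then have "l c = 0\<^sub>N"
  proof cases
   case 1
   then have "l c = l (fb (m +\<^sub>M m')) -\<^sub>N (l (fb m) +\<^sub>N l (fb m'))"
    using fb_closed by (simp add: lm semilin_add[OF ls] del: direct_sum_simps)
   then show ?thesis using 1 gc by (simp add: lb semilin_add[OF g] a_minus_def N.M.r_neg)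
  next
   case 2
   then have "l c = l (fb (a *\<^sub>M m)) -\<^sub>N ((a ^\<^sub>A q) ^\<^sub>A r) *\<^sub>N l (fb m)"
    using fb_closed by (simp add: lm semilin_smult[OF ls] del: direct_sum_simps)
   then show ?thesis using 2 gc by (simp add: lb semilin_smult[OF g] a_minus_def N.M.r_neg M.R.nat_pow_pow)
  qed
  then show "c : {c : carrier FG. l c : {0\<^sub>N}}" using c by simp
 qed
 then have "Frob_rel A q M <= {c : carrier FG. l c : {0\<^sub>N}}" unfolding Frob_rel_eq
  by (intro gen_submodule_minimal[OF free_is_module] semilin_preimage[OF free_is_module N ls] zero_submodule[OF N])
 then have l0: "l c = 0\<^sub>N" if "c : Frob_rel A q M" for c using that by auto
 have lift: "Frob_lift A M N r g = (\<lambda>X. the_elem (l ` X))" unfolding Frob_lift_def l_def ..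
 show "Frob_lift A M N r g : semilin A r (Frob A q M) N"
  unfolding lift Frob_def by (rule quot_lift_semilin[OF free_is_module Frob_rel_submodule N ls l0])
 show "Frob_lift A M N r g (one_tensor A q M m) = g m" if m: "m : carrier M"
  unfolding lift one_tensor_def
  by (subst quot_lift[OF free_is_module Frob_rel_submodule N semilin_add[OF ls] lc l0 fb_closed[OF m]]) (auto simp: lb m)
qed

text \<open>The set where two maps of the same exponent agree is a submodule, and it contains the
  tensors with 1.\<close>

lemma Frob_ext:
 fixes N :: "('a, 'n) module"
 assumes N: "Module.module A N" and f: "f : semilin A r (Frob A q M) N" and f': "f' : semilin A r (Frob A q M) N"
  and eq: "\<And>m. m : carrier M ==> f (one_tensor A q M m) = f' (one_tensor A q M m)"
  and X: "X : carrier (Frob A q M)"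
 shows "f X = f' X"
proof -
 interpret N: Module.module A N by fact
 interpret F: Module.module A "Frob A q M" by (rule Frob_is_module)
 let ?E = "{X : carrier (Frob A q M). f X = f' X}"
 have "submodule ?E A (Frob A q M)"
  using semilinD[OF f] semilinD[OF f'] semilin_zero[OF Frob_is_module N f] semilin_zero[OF Frob_is_module N f']
   semilin_neg[OF Frob_is_module N f] semilin_neg[OF Frob_is_module N f']
  by (intro F.submoduleI) auto
 then have "carrier (Frob A q M) <= ?E"
  using eq semilin_closed[OF one_tensor_semilin] by (intro Frob_sub_full) auto
 then show ?thesis using X by auto
qed

end

lemma Frob_lift_hom:
 fixes N :: "('a, 'n) module" and M :: "('a, 'm) module"
 assumes M: "Module.module A M" and N: "Module.module A N" and g: "g : semilin A q M N"
 shows "Frob_lift A M N 1 g : mod_hom A (Frob A q M) N"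
  and "m : carrier M ==> Frob_lift A M N 1 g (one_tensor A q M m) = g m"
proof -
 interpret M: Module.module A M by fact
 note * = Frob_lift_props[OF M N, of g q 1]
 show "Frob_lift A M N 1 g : mod_hom A (Frob A q M) N"
  using *(1) g by (simp add: mod_hom_eq_semilin[OF M.R.is_cring])
 show "m : carrier M ==> Frob_lift A M N 1 g (one_tensor A q M m) = g m" using *(2) g by simp
qed

lemma Frob_hom_ext:
 fixes N :: "('a, 'n) module" and M :: "('a, 'm) module"
 assumes M: "Module.module A M" and N: "Module.module A N"
  and f: "f : mod_hom A (Frob A q M) N" and f': "f' : mod_hom A (Frob A q M) N"
  and eq: "\<And>m. m : carrier M ==> f (one_tensor A q M m) = f' (one_tensor A q M m)"
  and X: "X : carrier (Frob A q M)"
 shows "f X = f' X"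
 using Frob_ext[OF M N, of f 1 q f' X] assms mod_hom_eq_semilin[OF module_cring[OF M]] by blast

lemma Frob_map_hom:
 fixes N :: "('a, 'n) module" and M :: "('a, 'm) module"
 assumes M: "Module.module A M" and N: "Module.module A N" and f: "f : mod_hom A M N"
 shows "Frob_map A q M N f : mod_hom A (Frob A q M) (Frob A q N)"
  and "m : carrier M ==> Frob_map A q M N f (one_tensor A q M m) = one_tensor A q N (f m)"
proof -
 have g: "(\<lambda>m. one_tensor A q N (f m)) : semilin A q M (Frob A q N)"
  by (rule semilin_comp_hom[OF module_cring[OF M] f one_tensor_semilin[OF N]])
 show "Frob_map A q M N f : mod_hom A (Frob A q M) (Frob A q N)"
  unfolding Frob_map_def by (rule Frob_lift_hom(1)[OF M Frob_is_module[OF N] g])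
 show "m : carrier M ==> Frob_map A q M N f (one_tensor A q M m) = one_tensor A q N (f m)"
  unfolding Frob_map_def by (rule Frob_lift_hom(2)[OF M Frob_is_module[OF N] g])
qed

text \<open>The image of \<open>Frob_comp\<close> is a submodule containing the tensors with 1.
  Surjectivity allows the preimage taken by \<open>inv_into\<close> in
  \<open>gen_limit_structure\<close> to be evaluated.\<close>

lemma Frob_comp_props:
 fixes M :: "('a, 'm) module" and q q' :: nat
 assumes M: "Module.module A M" and q: "0 < q"
  and addB: "\<forall>a\<in>carrier A. \<forall>b\<in>carrier A. (a +\<^sub>A b) ^\<^sub>A q = a ^\<^sub>A q +\<^sub>A b ^\<^sub>A q"
 defines "inn \<equiv> Frob_lift A M (Frob A (q * q') M) q (one_tensor A (q * q') M)"
 shows "inn : semilin A q (Frob A q' M) (Frob A (q * q') M)"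
  and "m : carrier M ==> inn (one_tensor A q' M m) = one_tensor A (q * q') M m"
  and "Frob_comp A q q' M : mod_hom A (Frob A q (Frob A q' M)) (Frob A (q * q') M)"
  and "X : carrier (Frob A q' M) ==> Frob_comp A q q' M (one_tensor A q (Frob A q' M) X) = inn X"
  and "Frob_comp A q q' M ` carrier (Frob A q (Frob A q' M)) = carrier (Frob A (q * q') M)"
proof -
 let ?T = "Frob A (q * q') M"
 note add = addB[rule_format]
 note T = Frob_is_module[OF M, of "q * q'"] and F = Frob_is_module[OF M, of q']
 have ot: "one_tensor A (q * q') M : semilin A (q' * q) M ?T"
  using one_tensor_semilin[OF M, of "q * q'"] by (simp add: mult.commute)
 show i: "inn : semilin A q (Frob A q' M) ?T"
  unfolding inn_def by (rule Frob_lift_props(1)[OF M T ot q add])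
 show i1: "inn (one_tensor A q' M m) = one_tensor A (q * q') M m" if "m : carrier M" for m
  unfolding inn_def by (rule Frob_lift_props(2)[OF M T ot q add that])
 show h: "Frob_comp A q q' M : mod_hom A (Frob A q (Frob A q' M)) ?T"
  unfolding Frob_comp_def inn_def[symmetric] by (rule Frob_lift_hom(1)[OF F T i])
 show h1: "Frob_comp A q q' M (one_tensor A q (Frob A q' M) X) = inn X" if "X : carrier (Frob A q' M)" for X
  unfolding Frob_comp_def inn_def[symmetric] by (rule Frob_lift_hom(2)[OF F T i that])
 let ?C = "carrier (Frob A q (Frob A q' M))"
 have "submodule (Frob_comp A q q' M ` ?C) A ?T"
  by (rule mod_hom_image_submodule[OF Frob_is_module[OF F] T h Module.module.carrier_is_submodule[OF Frob_is_module[OF F]]])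
 moreover have "one_tensor A (q * q') M m : Frob_comp A q q' M ` ?C" if m: "m : carrier M" for m
 proof -
  have "one_tensor A q' M m : carrier (Frob A q' M)" using semilin_closed[OF one_tensor_semilin[OF M] m] .
  then have "one_tensor A q (Frob A q' M) (one_tensor A q' M m) : ?C"
   and "Frob_comp A q q' M (one_tensor A q (Frob A q' M) (one_tensor A q' M m)) = one_tensor A (q * q') M m"
   using semilin_closed[OF one_tensor_semilin[OF F]] h1 i1 m by auto
  then show ?thesis by (metis image_eqI)
 qed
 ultimately have "carrier ?T <= Frob_comp A q q' M ` ?C" by (rule Frob_sub_full[OF M])
 then show "Frob_comp A q q' M ` ?C = carrier ?T" using mod_homD(1)[OF h] by auto
qed

text \<open>Each coefficient is expanded over the basis of A, and its p-th powers are moved across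
  the tensor sign.\<close>

lemma (in frob_ring) Frob_basis_form:
 fixes M :: "('a, 'm) module"
 assumes M: "Module.module A M" and X: "X : carrier (Frob A p M)"
 obtains F y where "finite F" "F <= J" "\<And>j. y j : carrier M"
  "X = (\<Oplus>\<^bsub>Frob A p M\<^esub>j\<in>F. b j *\<^sub>(Frob A p M) one_tensor A p M (y j))"
proof -
 interpret M: Module.module A M by fact
 interpret F: Module.module A "Frob A p M" by (rule Frob_is_module[OF M])
 interpret r: unit_module A p J b "reg A" "\<lambda>x. x [^] p" by (rule unit_module_reg)
 let ?T = "Frob A p M" and ?o = "one_tensor A p M"
 note os = one_tensor_semilin[OF M, of p]
 note oc = semilin_closed[OF os]
 have oz: "?o 0\<^sub>M = 0\<^sub>?T" by (rule semilin_zero[OF M Frob_is_module[OF M] os])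
 let ?P = "\<lambda>X. \<exists>F y. finite F \<and> F <= J \<and> (\<forall>j. y j : carrier M) \<and> X = (\<Oplus>\<^bsub>?T\<^esub>j\<in>F. b j *\<^sub>?T ?o (y j))"
 have P0: "?P 0\<^sub>?T" by (rule exI[of _ "{}"], rule exI[of _ "\<lambda>_. 0\<^sub>M"]) auto
 have Pa: "?P (X +\<^sub>?T Y)" if PX: "?P X" and PY: "?P Y" for X Y
 proof -
  obtain F y where F: "finite F" "F <= J" "\<And>j. y j : carrier M" "X = (\<Oplus>\<^bsub>?T\<^esub>j\<in>F. b j *\<^sub>?T ?o (y j))" using PX by blast
  obtain G z where G: "finite G" "G <= J" "\<And>j. z j : carrier M" "Y = (\<Oplus>\<^bsub>?T\<^esub>j\<in>G. b j *\<^sub>?T ?o (z j))" using PY by blast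
  let ?y = "\<lambda>j. if j : F then y j else 0\<^sub>M" and ?z = "\<lambda>j. if j : G then z j else 0\<^sub>M"
  have tc: "(\<lambda>j. b j *\<^sub>?T ?o (?y j)) : F \<union> G \<rightarrow> carrier ?T" "(\<lambda>j. b j *\<^sub>?T ?o (?z j)) : F \<union> G \<rightarrow> carrier ?T"
   using F G b_closed oc by auto
  have "X = (\<Oplus>\<^bsub>?T\<^esub>j\<in>F\<union>G. b j *\<^sub>?T ?o (?y j))"
   unfolding F(4) using F G b_closed oc oz by (intro F.M.add.finprod_mono_neutral_cong_left) auto
  moreover have "Y = (\<Oplus>\<^bsub>?T\<^esub>j\<in>F\<union>G. b j *\<^sub>?T ?o (?z j))"
   unfolding G(4) using F G b_closed oc oz by (intro F.M.add.finprod_mono_neutral_cong_left) auto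
  ultimately have "X +\<^sub>?T Y = (\<Oplus>\<^bsub>?T\<^esub>j\<in>F\<union>G. b j *\<^sub>?T ?o (?y j) +\<^sub>?T b j *\<^sub>?T ?o (?z j))"
   by (simp only: F.M.finsum_addf[OF tc])
  also have "\<dots> = (\<Oplus>\<^bsub>?T\<^esub>j\<in>F\<union>G. b j *\<^sub>?T ?o (?y j +\<^sub>M ?z j))"
   using F G b_closed oc by (intro F.M.finsum_cong') (auto simp: semilin_add[OF os] F.smult_r_distr subset_iff)
  finally have "X +\<^sub>?T Y = (\<Oplus>\<^bsub>?T\<^esub>j\<in>F\<union>G. b j *\<^sub>?T ?o (?y j +\<^sub>M ?z j))" .
  then show ?thesis using F(1-3) G(1-3)
   by (intro exI[of _ "F \<union> G"] exI[of _ "\<lambda>j. ?y j +\<^sub>M ?z j"] conjI) auto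
 qed
 have Pg: "?P (a *\<^sub>?T ?o m)" if a: "a : carrier A" and m: "m : carrier M" for a m
 proof -
  obtain F where F: "finite F" "F <= J" "a = r.bs F (\<lambda>j. r.D j a)"
   by (rule r.D_expand[of a "{}"]) (use a in auto)
  have Dc: "r.D j a : carrier A" for j using r.D_closed[of a j] a by simp
  have "a *\<^sub>?T ?o m = r.bs F (\<lambda>j. r.D j a) *\<^sub>?T ?o m" using F by simp
  also have "\<dots> = (\<Oplus>\<^bsub>?T\<^esub>j\<in>F. (b j \<otimes> (r.D j a [^] p)) *\<^sub>?T ?o m)"
   unfolding bsum_def using F m Dc b_closed oc
   by (intro trans[OF additive_finsum[OF module_ab[OF r.is_mod] module_ab[OF F.module_axioms], of "\<lambda>a. a *\<^sub>?T ?o m"]])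
    (auto simp: F.smult_l_distr)
  also have "\<dots> = (\<Oplus>\<^bsub>?T\<^esub>j\<in>F. b j *\<^sub>?T ?o (r.D j a *\<^sub>M m))" using F m Dc b_closed oc
   by (intro F.M.finsum_cong') (auto simp: semilin_smult[OF os] F.smult_assoc1)
  finally show ?thesis using F m Dc by (intro exI[of _ F] exI[of _ "\<lambda>j. r.D j a *\<^sub>M m"] conjI) auto
 qed
 obtain S c where S: "finite S" "S <= carrier M" "\<And>m. m : S ==> c m : carrier A"
  "X = (\<Oplus>\<^bsub>?T\<^esub>m\<in>S. c m *\<^sub>?T ?o m)" by (rule Frob_sum_form[OF M X]) blast
 have "?P (\<Oplus>\<^bsub>?T\<^esub>m\<in>S. c m *\<^sub>?T ?o m)" using S(1-3)
 proof (induction S)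
  case empty
  show ?case using P0 by simp
 next
  case (insert s S)
  have "(\<Oplus>\<^bsub>?T\<^esub>m\<in>insert s S. c m *\<^sub>?T ?o m) = c s *\<^sub>?T ?o s +\<^sub>?T (\<Oplus>\<^bsub>?T\<^esub>m\<in>S. c m *\<^sub>?T ?o m)"
   using insert oc by (intro F.M.finsum_insert) auto
  moreover have "?P (c s *\<^sub>?T ?o s +\<^sub>?T (\<Oplus>\<^bsub>?T\<^esub>m\<in>S. c m *\<^sub>?T ?o m))"
   using insert by (intro Pa Pg) auto
  ultimately show ?case by (simp only:)
 qed
 then have "?P X" by (simp only: S(4))
 then show ?thesis using that by blast
qed

text \<open>An element of the pullback is a sum of tensors of b j with y j, and its image is an
  expansion in M; uniqueness of expansions gives injectivity. This takes the place of exactness of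
  the Frobenius functor.\<close>

lemma (in unit_module) Frob_lift_phi:
 fixes N :: "('a, 'n) module"
 assumes N: "Module.module A N" and f: "f : mod_hom A N M"
 defines "\<Lambda> \<equiv> Frob_lift A N M 1 (\<lambda>x. \<phi> (f x))"
 shows "\<Lambda> : mod_hom A (Frob A p N) M"
  and "\<And>x. x : carrier N ==> \<Lambda> (one_tensor A p N x) = \<phi> (f x)"
  and "inj_on f (carrier N) ==> inj_on \<Lambda> (carrier (Frob A p N))"
  and "f ` carrier N = carrier M ==> \<Lambda> ` carrier (Frob A p N) = carrier M"
proof -
 interpret N: Module.module A N by fact
 note T = Frob_is_module[OF N, of p]
 have s: "(\<lambda>x. \<phi> (f x)) : semilin A p N M" by (rule semilin_comp_hom[OF is_cring f phi])
 show h: "\<Lambda> : mod_hom A (Frob A p N) M" unfolding \<Lambda>_def by (rule Frob_lift_hom(1)[OF N is_mod s])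
 show h1: "\<Lambda> (one_tensor A p N x) = \<phi> (f x)" if "x : carrier N" for x
  unfolding \<Lambda>_def by (rule Frob_lift_hom(2)[OF N is_mod s that])
 have h': "\<Lambda> : semilin A 1 (Frob A p N) M" using h mod_hom_eq_semilin[OF is_cring] by blast
 have f': "f : semilin A 1 N M" using f mod_hom_eq_semilin[OF is_cring] by blast
 note oc = semilin_closed[OF one_tensor_semilin[OF N, of p]]
 have \<Lambda>_sum: "\<Lambda> (\<Oplus>\<^bsub>Frob A p N\<^esub>j\<in>F. b j *\<^sub>(Frob A p N) one_tensor A p N (y j)) = bs F (\<lambda>j. f (y j))"
  and cl: "(\<Oplus>\<^bsub>Frob A p N\<^esub>j\<in>F. b j *\<^sub>(Frob A p N) one_tensor A p N (y j)) : carrier (Frob A p N)"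
  if F: "finite F" "F <= J" "\<And>j. y j : carrier N" for F y
 proof -
  interpret T: Module.module A "Frob A p N" by (rule T)
  have *: "(\<lambda>j. b j *\<^sub>(Frob A p N) one_tensor A p N (y j)) : F \<rightarrow> carrier (Frob A p N)"
   using F b_closed oc by auto
  then show "(\<Oplus>\<^bsub>Frob A p N\<^esub>j\<in>F. b j *\<^sub>(Frob A p N) one_tensor A p N (y j)) : carrier (Frob A p N)"
   by (rule T.M.finsum_closed)
  have "\<Lambda> (\<Oplus>\<^bsub>Frob A p N\<^esub>j\<in>F. b j *\<^sub>(Frob A p N) one_tensor A p N (y j))
   = (\<Oplus>\<^bsub>M\<^esub>j\<in>F. \<Lambda> (b j *\<^sub>(Frob A p N) one_tensor A p N (y j)))"
   by (rule semilin_finsum[OF T is_mod h' F(1) *])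
  also have "\<dots> = bs F (\<lambda>j. f (y j))"
   unfolding bsum_def using F b_closed oc mod_homD(3)[OF h] mod_homD(1)[OF f] h1
   by (intro M.M.finsum_cong') auto
  finally show "\<Lambda> (\<Oplus>\<^bsub>Frob A p N\<^esub>j\<in>F. b j *\<^sub>(Frob A p N) one_tensor A p N (y j)) = bs F (\<lambda>j. f (y j))" .
 qed
 {
  assume inj: "inj_on f (carrier N)"
  show "inj_on \<Lambda> (carrier (Frob A p N))"
  proof (rule semilin_inj_onI[OF T is_mod h'])
   interpret T: Module.module A "Frob A p N" by (rule T)
   fix X assume X: "X : carrier (Frob A p N)" and z: "\<Lambda> X = 0\<^sub>M"
   obtain F y where F: "finite F" "F <= J" "\<And>j. y j : carrier N"
    "X = (\<Oplus>\<^bsub>Frob A p N\<^esub>j\<in>F. b j *\<^sub>(Frob A p N) one_tensor A p N (y j))" by (rule Frob_basis_form[OF N X]) blast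
   have *: "bs F (\<lambda>j. f (y j)) = 0\<^sub>M" using \<Lambda>_sum[OF F(1-3)] z F(4) by simp
   have "f (y j) = 0\<^sub>M" if "j : F" for j
    by (rule bs_zero_imp[OF F(1,2) _ *]) (use F(3) mod_homD(1)[OF f] that in auto)
   then have "y j = 0\<^sub>N" if "j : F" for j
    using inj F(3) semilin_zero[OF N is_mod f'] that by (metis N.M.zero_closed inj_onD)
   then show "X = 0\<^sub>(Frob A p N)"
    unfolding F(4) using F(2) b_closed semilin_zero[OF N T one_tensor_semilin[OF N]]
    by (intro T.M.add.finprod_one_eqI) auto
  qed
 next
  assume im: "f ` carrier N = carrier M"
  show "\<Lambda> ` carrier (Frob A p N) = carrier M"
  proof (intro equalityI subsetI)
   fix x assume x: "x : carrier M"
   obtain F where F: "finite F" "F <= J" "x = bs F (\<lambda>j. D j x)" by (rule D_expand[OF x, of "{}"]) auto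
   have "\<forall>j. \<exists>y\<in>carrier N. f y = D j x" using D_closed[OF x] im by (metis imageE)
   then obtain y where y: "\<And>j. y j : carrier N" "\<And>j. f (y j) = D j x" by metis
   have "x = bs F (\<lambda>j. f (y j))" unfolding y(2) by (rule F(3))
   then have "x = \<Lambda> (\<Oplus>\<^bsub>Frob A p N\<^esub>j\<in>F. b j *\<^sub>(Frob A p N) one_tensor A p N (y j))"
    unfolding \<Lambda>_sum[OF F(1,2) y(1)] .
   then show "x : \<Lambda> ` carrier (Frob A p N)" by (rule image_eqI) (rule cl[OF F(1,2) y(1)])
  qed (use mod_homD(1)[OF h] in auto)
 }
qed

section \<open>Direct limits and root morphisms\<close>

context
 fixes A :: "('a, 'x) ring_scheme" and M :: "nat => ('a, 'm) module" and t :: "nat => 'm => 'm"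
 assumes A: "cring A" and M: "\<And>j. Module.module A (M j)" and t: "\<And>j. t j : mod_hom A (M j) (M (Suc j))"
begin

interpretation A: cring A by (fact A)

abbreviation (input) DS where "DS \<equiv> direct_sum UNIV M"
abbreviation (input) inj where "inj \<equiv> direct_sum_inj UNIV M"

lemma DS_module: "Module.module A DS" by (rule direct_sum_is_module[OF A M])

interpretation DS: Module.module A DS by (rule DS_module)

lemma inj_hom: "inj j : mod_hom A (M j) DS" by (rule direct_sum_inj_hom[OF A M]) auto

lemma dirlim_gens_closed:
 "{inj j x -\<^sub>DS inj (Suc j) (t j x) | j x. x : carrier (M j)} <= carrier DS"
proof -
 have "inj j x -\<^sub>DS inj (Suc j) (t j x) : carrier DS" if "x : carrier (M j)" for j x
  by (rule DS.M.minus_closed[OF mod_homD(1)[OF inj_hom that] mod_homD(1)[OF inj_hom mod_homD(1)[OF t that]]])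
 then show ?thesis by blast
qed

lemma dirlim_rel_submodule: "submodule (dirlim_rel A M t) A DS"
 unfolding dirlim_rel_def by (rule gen_submodule_is_submodule[OF DS_module dirlim_gens_closed])

lemma dirlim_is_module: "Module.module A (dirlim A M t)"
 unfolding dirlim_def by (rule quot_is_module[OF DS_module dirlim_rel_submodule])

lemma dirlim_map_hom: "dirlim_map A M t j : mod_hom A (M j) (dirlim A M t)"
 unfolding dirlim_map_def dirlim_def
 by (rule mod_hom_comp[OF inj_hom quot_class_hom[OF DS_module dirlim_rel_submodule]])

lemma dirlim_map_step: "x : carrier (M j) ==> dirlim_map A M t j x = dirlim_map A M t (Suc j) (t j x)"
proof -
 assume x: "x : carrier (M j)"
 have "inj j x -\<^sub>DS inj (Suc j) (t j x) : dirlim_rel A M t"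
  unfolding dirlim_rel_def by (rule subsetD[OF gen_submodule_subset[OF DS_module]]) (rule CollectI, rule exI[of _ j], rule exI[of _ x], rule conjI[OF refl x])
 then show ?thesis unfolding dirlim_map_def
  by (rule iffD2[OF coset_eq_iff[OF DS_module dirlim_rel_submodule mod_homD(1)[OF inj_hom x] mod_homD(1)[OF inj_hom mod_homD(1)[OF t x]]]])
qed

lemma dirlim_rep_later:
 assumes x: "x : carrier (M j)" and "j \<le> n"
 shows "\<exists>y\<in>carrier (M n). dirlim_map A M t j x = dirlim_map A M t n y" using assms(2)
proof (induction n rule: dec_induct)
 case base
 then show ?case using x by auto
next
 case (step n)
 then obtain y where "y : carrier (M n)" "dirlim_map A M t j x = dirlim_map A M t n y" by auto
 then show ?case using dirlim_map_step mod_homD(1)[OF t] by metis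
qed

text \<open>The finitely many coordinates of a representative are moved to a common later
  stage.\<close>

lemma dirlim_rep:
 assumes "X : carrier (dirlim A M t)"
 shows "\<exists>n. \<exists>y\<in>carrier (M n). X = dirlim_map A M t n y"
proof -
 let ?L = "dirlim A M t" and ?m = "dirlim_map A M t"
 interpret L: Module.module A ?L by (rule dirlim_is_module)
 interpret M: Module.module A "M j" for j by (rule M)
 note hom = mod_homD[OF dirlim_map_hom]
 let ?Q = "\<lambda>X. \<exists>n. \<exists>y\<in>carrier (M n). X = ?m n y"
 have z: "?Q 0\<^sub>?L"
  using additive_zero[OF module_ab[OF M] module_ab[OF dirlim_is_module] hom(1,2), of 0] M.M.zero_closed by metis
 have add: "?Q (X +\<^sub>?L Y)" if X: "?Q X" and Y: "?Q Y" for X Y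
 proof -
  obtain n y k w where y: "y : carrier (M n)" "X = ?m n y" and w: "w : carrier (M k)" "Y = ?m k w" using X Y by blast
  obtain y' where y': "y' : carrier (M (max n k))" "X = ?m (max n k) y'"
   using dirlim_rep_later[OF y(1), of "max n k"] y(2) by auto
  obtain w' where w': "w' : carrier (M (max n k))" "Y = ?m (max n k) w'"
   using dirlim_rep_later[OF w(1), of "max n k"] w(2) by auto
  show ?thesis using hom(2)[OF y'(1) w'(1)] y' w' M.M.a_closed by metis
 qed
 obtain x where x: "x : carrier DS" "X = dirlim_rel A M t +>\<^sub>DS x"
  using assms unfolding dirlim_def quot_carrier[OF DS_module dirlim_rel_submodule] by auto
 define F where "F = {j. x j \<noteq> 0\<^sub>(M j)}"
 have F: "finite F" "\<And>j. x j : carrier (M j)" using x by (auto simp: F_def direct_sum_carrier)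
 have xe: "x = (\<Oplus>\<^bsub>DS\<^esub>j\<in>F. inj j (x j))"
  by (rule direct_sum_decomp[OF A M x(1) F(1)]) (auto simp: F_def)
 have "X = (\<Oplus>\<^bsub>?L\<^esub>j\<in>F. ?m j (x j))" unfolding x(2) dirlim_map_def by (subst xe, unfold dirlim_def)
    (rule semilin_finsum[OF DS_module _ quot_class_semilin[OF DS_module dirlim_rel_submodule] F(1)],
    use mod_homD(1)[OF inj_hom] F(2) dirlim_is_module in \<open>auto simp: dirlim_def\<close>)
 moreover have "?Q (\<Oplus>\<^bsub>?L\<^esub>j\<in>F'. ?m j (x j))" if "finite F'" for F' using that
 proof (induction F')
  case (insert j F')
  then have "(\<Oplus>\<^bsub>?L\<^esub>j\<in>insert j F'. ?m j (x j)) = ?m j (x j) +\<^sub>?L (\<Oplus>\<^bsub>?L\<^esub>j\<in>F'. ?m j (x j))"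
   using hom(1) F(2) by (intro L.M.finsum_insert) auto
  moreover have "?Q (?m j (x j))" using F(2) by blast
  ultimately show ?case using add insert.IH by simp
 qed (use z in simp)
 ultimately show ?thesis using F(1) by simp
qed

text \<open>Every element of the limit comes from a single stage (\<open>dirlim_rep\<close>), so
  injectivity at each stage gives injectivity on the limit.\<close>

lemma dirlim_iso:
 fixes H :: "('a, 'n) module"
 assumes H: "Module.module A H" and psi: "\<And>j. \<psi> j : mod_hom A (M j) H"
  and step: "\<And>j x. x : carrier (M j) ==> \<psi> (Suc j) (t j x) = \<psi> j x"
  and inj: "\<And>j. inj_on (\<psi> j) (carrier (M j))"
  and surj: "\<And>y. y : carrier H ==> \<exists>j. \<exists>x\<in>carrier (M j). y = \<psi> j x"
 obtains \<Psi> where "\<Psi> : mod_iso A (dirlim A M t) H"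
  "\<And>j x. x : carrier (M j) ==> \<Psi> (dirlim_map A M t j x) = \<psi> j x"
proof -
 interpret H: Module.module A H by (rule H)
 interpret M: Module.module A "M j" for j by (rule M)
 have psi': "\<psi> j : semilin A 1 (M j) H" for j using psi mod_hom_eq_semilin[OF A] by blast
 note hom = mod_homD[OF psi] semilin_zero[OF M H psi'] semilin_minus[OF M H psi']
 define l where "l x = finsum H (\<lambda>j. \<psi> j (x j)) {j. x j \<noteq> 0\<^sub>(M j)}" for x
 have xc: "x j : carrier (M j)" if "x : carrier DS" for x j using that by (auto simp: direct_sum_carrier)
 have lF: "l x = (\<Oplus>\<^bsub>H\<^esub>j\<in>F. \<psi> j (x j))"
  if "x : carrier DS" "finite F" "{j. x j \<noteq> 0\<^sub>(M j)} <= F" for x F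
  unfolding l_def using that hom xc[OF that(1)]
  by (intro H.M.add.finprod_mono_neutral_cong_left) auto
 have supp: "finite {j. x j \<noteq> 0\<^sub>(M j)}" if "x : carrier DS" for x
  using that by (auto simp: direct_sum_carrier)
 have ls: "l : mod_hom A DS H"
 proof (rule mod_homI)
  show "l x : carrier H" if "x : carrier DS" for x
   unfolding l_def using hom(1) xc[OF that] by (intro H.M.finsum_closed) auto
  fix x y assume x: "x : carrier DS" and y: "y : carrier DS"
  define F where "F = {j. x j \<noteq> 0\<^sub>(M j)} \<union> {j. y j \<noteq> 0\<^sub>(M j)}"
  have F: "finite F" using supp[OF x] supp[OF y] by (auto simp: F_def)
  have s: "{j. (x +\<^sub>DS y) j \<noteq> 0\<^sub>(M j)} <= F" by (auto simp: F_def)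
  have "l (x +\<^sub>DS y) = (\<Oplus>\<^bsub>H\<^esub>j\<in>F. \<psi> j ((x +\<^sub>DS y) j))"
   by (rule lF[OF _ F s]) (rule DS.M.a_closed[OF x y])
  also have "\<dots> = (\<Oplus>\<^bsub>H\<^esub>j\<in>F. \<psi> j (x j) +\<^sub>H \<psi> j (y j))"
   using xc[OF x] xc[OF y] hom by (intro H.M.finsum_cong') auto
  also have "\<dots> = l x +\<^sub>H l y"
   using xc[OF x] xc[OF y] hom by (subst (1 2) lF[OF _ F]) (auto simp: F_def x y)
  finally show "l (x +\<^sub>DS y) = l x +\<^sub>H l y" .
 next
  fix a x assume a: "a : carrier A" and x: "x : carrier DS"
  define F where "F = {j. x j \<noteq> 0\<^sub>(M j)}"
  have F: "finite F" using supp[OF x] by (auto simp: F_def)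
  have s: "{j. (a *\<^sub>DS x) j \<noteq> 0\<^sub>(M j)} <= F" using a by (auto simp: F_def)
  have "l (a *\<^sub>DS x) = (\<Oplus>\<^bsub>H\<^esub>j\<in>F. \<psi> j ((a *\<^sub>DS x) j))"
   by (rule lF[OF _ F s]) (rule DS.smult_closed[OF a x])
  also have "\<dots> = (\<Oplus>\<^bsub>H\<^esub>j\<in>F. a *\<^sub>H \<psi> j (x j))" using xc[OF x] a hom by (intro H.M.finsum_cong') auto
  also have "\<dots> = a *\<^sub>H l x"
   unfolding l_def F_def[symmetric] using F xc[OF x] a hom by (intro H.finsum_smult_ldistr[symmetric]) auto
  finally show "l (a *\<^sub>DS x) = a *\<^sub>H l x" .
 qed
 then have ls': "l : semilin A 1 DS H" using mod_hom_eq_semilin[OF A] by blast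
 have li: "l (direct_sum_inj UNIV M j x) = \<psi> j x" if x: "x : carrier (M j)" for j x
 proof -
  have "l (direct_sum_inj UNIV M j x) = (\<Oplus>\<^bsub>H\<^esub>k\<in>{j}. \<psi> k (direct_sum_inj UNIV M j x k))"
   using mod_homD(1)[OF inj_hom x] by (intro lF) (auto simp: direct_sum_inj_def)
  then show ?thesis using hom x by (simp add: direct_sum_inj_def)
 qed
 have "{direct_sum_inj UNIV M j x -\<^sub>DS direct_sum_inj UNIV M (Suc j) (t j x) | j x. x : carrier (M j)}
  <= {x : carrier DS. l x : {0\<^sub>H}}" (is "?G <= _")
 proof
  fix z assume z: "z : ?G"
  then obtain j x where x: "x : carrier (M j)" "z = direct_sum_inj UNIV M j x -\<^sub>DS direct_sum_inj UNIV M (Suc j) (t j x)" by blast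
  have "l z = \<psi> j x -\<^sub>H \<psi> (Suc j) (t j x)" unfolding x(2)
   semilin_minus[OF DS_module H ls' mod_homD(1)[OF inj_hom x(1)] mod_homD(1)[OF inj_hom mod_homD(1)[OF t x(1)]]]
   li[OF x(1)] li[OF mod_homD(1)[OF t x(1)]] ..
  then show "z : {x : carrier DS. l x : {0\<^sub>H}}"
   using z dirlim_gens_closed step[OF x(1)] hom(1)[OF x(1)] by (auto simp: a_minus_def H.M.r_neg)
 qed
 then have "dirlim_rel A M t <= {x : carrier DS. l x : {0\<^sub>H}}" unfolding dirlim_rel_def
  by (intro gen_submodule_minimal[OF DS_module] semilin_preimage[OF DS_module H ls'] zero_submodule[OF H])
 then have l0: "l x = 0\<^sub>H" if "x : dirlim_rel A M t" for x using that by auto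
 define \<Psi> where "\<Psi> X = the_elem (l ` X)" for X
 have h': "\<Psi> : semilin A 1 (dirlim A M t) H"
  unfolding \<Psi>_def dirlim_def by (rule quot_lift_semilin[OF DS_module dirlim_rel_submodule H ls' l0])
 then have h: "\<Psi> : mod_hom A (dirlim A M t) H" using mod_hom_eq_semilin[OF A] by blast
 have h1: "\<Psi> (dirlim_map A M t j x) = \<psi> j x" if x: "x : carrier (M j)" for j x
  unfolding \<Psi>_def dirlim_map_def
  by (rule trans[OF quot_lift[OF DS_module dirlim_rel_submodule H semilin_add[OF ls'] semilin_closed[OF ls'] l0 mod_homD(1)[OF inj_hom x]] li[OF x]])
 have "inj_on \<Psi> (carrier (dirlim A M t))"
 proof (rule semilin_inj_onI[OF dirlim_is_module H h'])
  fix X assume X: "X : carrier (dirlim A M t)" "\<Psi> X = 0\<^sub>H"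
  obtain n y where y: "y : carrier (M n)" "X = dirlim_map A M t n y" using dirlim_rep[OF X(1)] by blast
  then have "\<psi> n y = \<psi> n 0\<^sub>(M n)" using X(2) h1 hom(4) by simp
  then have "y = 0\<^sub>(M n)" using inj_onD[OF inj] y by auto
  moreover have "dirlim_map A M t n : semilin A 1 (M n) (dirlim A M t)"
   using dirlim_map_hom mod_hom_eq_semilin[OF A] by blast
  ultimately show "X = 0\<^sub>(dirlim A M t)" using semilin_zero[OF M dirlim_is_module] y by simp
 qed
 moreover have "\<Psi> ` carrier (dirlim A M t) = carrier H"
 proof (intro equalityI subsetI)
  fix y assume "y : carrier H"
  then obtain j x where x: "x : carrier (M j)" "y = \<psi> j x" using surj by blast
  then show "y : \<Psi> ` carrier (dirlim A M t)"
   using h1[OF x(1)] mod_homD(1)[OF dirlim_map_hom x(1)] by (metis image_eqI)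
 qed (use mod_homD(1)[OF h] in auto)
 ultimately have "\<Psi> : mod_iso A (dirlim A M t) H" using h by (auto simp: mod_iso_def bij_betw_def)
 then show ?thesis using h1 that by blast
qed

end

lemma (in frob_ring) add_pow_pow:
 "x : carrier A ==> y : carrier A ==> (x \<oplus> y) [^] (p ^ j) = x [^] (p ^ j) \<oplus> y [^] (p ^ j)"
proof (induction j)
 case (Suc j)
 have e: "z [^] (p ^ Suc j) = (z [^] (p ^ j)) [^] p" if "z : carrier A" for z
  using that by (simp add: nat_pow_pow mult.commute)
 show ?case using Suc by (simp only: e a_closed add_pow nat_pow_closed)
qed simp

lemma (in frob_ring) add_pow_pow_ball:
 "\<forall>x\<in>carrier A. \<forall>y\<in>carrier A. (x \<oplus> y) [^] (p ^ j) = x [^] (p ^ j) \<oplus> y [^] (p ^ j)"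
 using add_pow_pow by blast

lemma (in frob_ring) add_pow_ball:
 "\<forall>x\<in>carrier A. \<forall>y\<in>carrier A. (x \<oplus> y) [^] p = x [^] p \<oplus> y [^] p" using add_pow by blast

section \<open>Limits of Frobenius pullbacks, computed inside a unit module\<close>

context unit_module
begin

lemma DinvD: "x : Dinv L ==> j : J ==> D j x : L" by (auto simp: dinv_def)

lemma phi_pow_semilin: "(\<phi> ^^ j) : semilin A (p ^ j) M M"
proof (induction j)
 case 0
 show ?case by (intro semilinI) auto
next
 case (Suc j)
 have "(\<lambda>x. \<phi> ((\<phi> ^^ j) x)) : semilin A (p ^ j * p) M M" by (rule semilin_comp[OF is_cring Suc phi])
 then show ?case by (simp add: mult.commute)
qed

text \<open>The F-module structure attached to phi: the inverse of the isomorphism from the pullback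
  to M that sends the tensor of a and x to a phi(x).\<close>

abbreviation Frob_inv where "Frob_inv \<equiv> inv_into (carrier (Frob A p M)) (Frob_lift A M M 1 \<phi>)"

lemma Frob_lift_iso: "Frob_lift A M M 1 \<phi> : mod_iso A (Frob A p M) M"
 using Frob_lift_phi[OF is_mod semilin_id[OF is_cring]] by (auto simp: mod_iso_def bij_betw_def)

lemma F_module_Frob_inv: "F_module A p M Frob_inv"
 unfolding F_module_def using is_mod mod_iso_inv[OF Frob_is_module[OF is_mod] Frob_lift_iso] by blast

context
 fixes M0 :: "('a, 'n) module" and f :: "'n => 'm" and \<beta>
 assumes M0: "Module.module A M0" and f: "f : mod_hom A M0 M" and finj: "inj_on f (carrier M0)"
  and \<beta>: "\<beta> : mod_hom A M0 (Frob A p M0)"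
  and f\<beta>: "\<And>m. m : carrier M0 ==> Frob_lift A M0 M 1 (\<lambda>x. \<phi> (f x)) (\<beta> m) = f m"
begin

text \<open>The j-th pullback of \<open>M0\<close> realised inside M: the tensor of a and m goes to
  a phi^j(f m). Under the assumption of \<open>root_morphismI\<close> these images exhaust M, so the
  limit in the definition of a root can be identified with M.\<close>

definition frob_emb :: "nat => ('n => 'a) set => 'm" where
 "frob_emb j = Frob_lift A M0 M 1 (\<lambda>x. (\<phi> ^^ j) (f x))"

lemma phif_semilin: "(\<lambda>x. (\<phi> ^^ j) (f x)) : semilin A (p ^ j) M0 M"
 by (rule semilin_comp_hom[OF is_cring f phi_pow_semilin])

lemma frob_emb_hom: "frob_emb j : mod_hom A (Frob A (p ^ j) M0) M"
 and frob_emb_one: "m : carrier M0 ==> frob_emb j (one_tensor A (p ^ j) M0 m) = (\<phi> ^^ j) (f m)"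
 unfolding frob_emb_def by (rule Frob_lift_hom[OF M0 is_mod phif_semilin], assumption?)+

lemma frob_emb_semilin: "frob_emb j : semilin A 1 (Frob A (p ^ j) M0) M"
 using frob_emb_hom mod_hom_eq_semilin[OF is_cring] by blast

text \<open>The next map, on the pullback of the j-th pullback, before \<open>Frob_comp\<close>
  identifies this module with the pullback for p^(j+1).\<close>

definition emb_next :: "nat => (('n => 'a) set => 'a) set => 'm" where
 "emb_next j = Frob_lift A (Frob A (p ^ j) M0) M 1 (\<lambda>X. \<phi> (frob_emb j X))"

lemmas emb_next = Frob_lift_phi[OF Frob_is_module[OF M0] frob_emb_hom, folded emb_next_def]

lemma Fmod: "Module.module A (Frob A q M0)" by (rule Frob_is_module[OF M0])

lemma p_pow_pos: "0 < p ^ j" using p_pos by simp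

lemmas comp1 = Frob_comp_props[OF M0 p_pos add_pow_ball]
lemmas comp2 = Frob_comp_props[OF M0 p_pow_pos add_pow_pow_ball]

text \<open>Two semilinear maps out of a pullback are compared on the tensors with 1.\<close>

lemma frob_emb_Suc_comp:
 assumes "Y : carrier (Frob A p (Frob A (p ^ j) M0))"
 shows "frob_emb (Suc j) (Frob_comp A p (p ^ j) M0 Y) = emb_next j Y"
proof (rule Frob_hom_ext[OF Fmod is_mod _ emb_next(1) _ assms])
 note k = comp1[where q' = "p ^ j", folded power_Suc]
 show "(\<lambda>Y. frob_emb (Suc j) (Frob_comp A p (p ^ j) M0 Y)) : mod_hom A (Frob A p (Frob A (p ^ j) M0)) M"
  by (rule mod_hom_comp[OF k(3) frob_emb_hom])
 fix X assume X: "X : carrier (Frob A (p ^ j) M0)"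
 let ?i = "Frob_lift A M0 (Frob A (p ^ Suc j) M0) p (one_tensor A (p ^ Suc j) M0)"
 have "frob_emb (Suc j) (?i X) = \<phi> (frob_emb j X)"
  by (rule Frob_ext[OF M0 is_mod hom_comp_semilin[OF is_cring k(1) frob_emb_hom]
     semilin_comp_hom[OF is_cring frob_emb_hom phi] _ X])
   (simp add: k(2) frob_emb_one del: power_Suc)
 then show "frob_emb (Suc j) (Frob_comp A p (p ^ j) M0 (one_tensor A p (Frob A (p ^ j) M0) X)) =
    emb_next j (one_tensor A p (Frob A (p ^ j) M0) X)" using k(4)[OF X] emb_next(2)[OF X] by simp
qed

lemma frob_emb_phi:
 assumes X: "X : carrier (Frob A (p ^ j) M0)"
 obtains Y where "Y : carrier (Frob A (p ^ Suc j) M0)" "frob_emb (Suc j) Y = \<phi> (frob_emb j X)"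
proof -
 note k = comp1[where q' = "p ^ j", folded power_Suc]
 let ?o = "one_tensor A p (Frob A (p ^ j) M0) X"
 have o: "?o : carrier (Frob A p (Frob A (p ^ j) M0))" by (rule semilin_closed[OF one_tensor_semilin[OF Fmod] X])
 show ?thesis
  by (rule that[OF mod_homD(1)[OF k(3) o]]) (simp add: frob_emb_Suc_comp[OF o] emb_next(2)[OF X])
qed

text \<open>Induction on j: \<open>Frob_comp\<close> is onto, so an element of the next pullback has
  a preimage in the pullback of the j-th one, and there \<open>Frob_lift_phi\<close> gives
  injectivity.\<close>

lemma frob_emb_inj: "inj_on (frob_emb j) (carrier (Frob A (p ^ j) M0))"
proof (induction j)
 case 0
 interpret M0: Module.module A M0 by (rule M0)
 interpret F: Module.module A "Frob A (p ^ 0) M0" by (rule Fmod)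
 let ?o = "one_tensor A (p ^ 0) M0"
 have os: "?o : mod_hom A M0 (Frob A (p ^ 0) M0)"
  using one_tensor_semilin[OF M0, of "p ^ 0"] mod_hom_eq_semilin[OF is_cring] by auto
 \<comment> \<open>The 0-th pullback is built from generators and relations and is not
   \<open>M0\<close> itself. For exponent 1 the tensors with 1 form a submodule, hence are
   everything.\<close>
 have "carrier (Frob A (p ^ 0) M0) <= ?o ` carrier M0"
  by (rule Frob_sub_full[OF M0 mod_hom_image_submodule[OF M0 Fmod os M0.carrier_is_submodule]]) blast
 note full = this
 show ?case
 proof (rule inj_onI)
  fix X Y assume X: "X : carrier (Frob A (p ^ 0) M0)" and Y: "Y : carrier (Frob A (p ^ 0) M0)"
   and eq: "frob_emb 0 X = frob_emb 0 Y"
  obtain x where x: "x : carrier M0" "X = ?o x" using full X by blast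
  obtain y where y: "y : carrier M0" "Y = ?o y" using full Y by blast
  have "f x = f y" using eq frob_emb_one[OF x(1), of 0] frob_emb_one[OF y(1), of 0] x y by simp
  then show "X = Y" using inj_onD[OF finj] x y by blast
 qed
next
 case (Suc j)
 note k = comp1[where q' = "p ^ j", folded power_Suc]
 have k': "Frob_comp A p (p ^ j) M0 : semilin A 1 (Frob A p (Frob A (p ^ j) M0)) (Frob A (p ^ Suc j) M0)"
  using k(3) mod_hom_eq_semilin[OF is_cring] by blast
 have e': "emb_next j : semilin A 1 (Frob A p (Frob A (p ^ j) M0)) M"
  using emb_next(1) mod_hom_eq_semilin[OF is_cring] by blast
 show ?case
 proof (rule semilin_inj_onI[OF Fmod is_mod frob_emb_semilin])
  interpret FF: Module.module A "Frob A p (Frob A (p ^ j) M0)" by (rule Frob_is_module[OF Fmod])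
  fix X assume X: "X : carrier (Frob A (p ^ Suc j) M0)" "frob_emb (Suc j) X = 0\<^sub>M"
  obtain Y where Y: "Y : carrier (Frob A p (Frob A (p ^ j) M0))" "X = Frob_comp A p (p ^ j) M0 Y"
   using k(5) X(1) by blast
  have "emb_next j Y = emb_next j 0\<^sub>(Frob A p (Frob A (p ^ j) M0))"
   using frob_emb_Suc_comp[OF Y(1)] X(2) Y(2) semilin_zero[OF Frob_is_module[OF Fmod] is_mod e'] by simp
  then have "Y = 0\<^sub>(Frob A p (Frob A (p ^ j) M0))"
   using inj_onD[OF emb_next(3)[OF Suc]] Y(1) by auto
  then show "X = 0\<^sub>(Frob A (p ^ Suc j) M0)" using semilin_zero[OF Frob_is_module[OF Fmod] Fmod k'] Y(2) by simp
 qed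
qed

lemma gen_step_hom: "gen_step A p M0 \<beta> j : mod_hom A (Frob A (p ^ j) M0) (Frob A (p ^ Suc j) M0)"
 and frob_emb_step: "X : carrier (Frob A (p ^ j) M0) ==> frob_emb (Suc j) (gen_step A p M0 \<beta> j X) = frob_emb j X"
proof -
 have e: "p ^ j * p = p ^ Suc j" by simp
 note k = comp2[where j = j and q' = p, unfolded e]
 note m = Frob_map_hom[OF M0 Fmod \<beta>, where q = "p ^ j"]
 show h: "gen_step A p M0 \<beta> j : mod_hom A (Frob A (p ^ j) M0) (Frob A (p ^ Suc j) M0)"
  unfolding gen_step_def[abs_def] by (rule mod_hom_comp[OF m(1) k(3)])
 let ?i = "Frob_lift A M0 (Frob A (p ^ Suc j) M0) (p ^ j) (one_tensor A (p ^ Suc j) M0)"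
 let ?e1 = "Frob_lift A M0 M 1 (\<lambda>x. \<phi> (f x))"
 note e1 = Frob_lift_hom[OF M0 is_mod semilin_comp_hom[OF is_cring f phi]]
 assume X: "X : carrier (Frob A (p ^ j) M0)"
 \<comment> \<open>Here the pullback by p^j is the outer one, contrary to
   \<open>frob_emb_Suc_comp\<close>. The inner map is semilinear for p^j and corresponds to phi^j
   applied after the map induced by phi f.\<close>
 have i: "frob_emb (Suc j) (?i Y) = (\<phi> ^^ j) (?e1 Y)" if Y: "Y : carrier (Frob A p M0)" for Y
 proof (rule Frob_ext[OF M0 is_mod hom_comp_semilin[OF is_cring k(1) frob_emb_hom]
    semilin_comp_hom[OF is_cring e1(1) phi_pow_semilin] _ Y])
  fix m assume m: "m : carrier M0"
  show "frob_emb (Suc j) (?i (one_tensor A p M0 m)) = (\<phi> ^^ j) (?e1 (one_tensor A p M0 m))"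
   by (simp only: k(2)[OF m] frob_emb_one[OF m] e1(2)[OF m] funpow.simps comp_apply funpow_swap1)
 qed
 show "frob_emb (Suc j) (gen_step A p M0 \<beta> j X) = frob_emb j X"
 proof (rule Frob_hom_ext[OF M0 is_mod mod_hom_comp[OF h frob_emb_hom] frob_emb_hom _ X])
  fix x assume x: "x : carrier M0"
  have "frob_emb (Suc j) (gen_step A p M0 \<beta> j (one_tensor A (p ^ j) M0 x)) = frob_emb (Suc j) (?i (\<beta> x))"
   unfolding gen_step_def using m(2)[OF x] k(4)[OF mod_homD(1)[OF \<beta> x]] by simp
  also have "\<dots> = (\<phi> ^^ j) (f x)" using i[OF mod_homD(1)[OF \<beta> x]] f\<beta>[OF x] by simp
  finally show "frob_emb (Suc j) (gen_step A p M0 \<beta> j (one_tensor A (p ^ j) M0 x)) = frob_emb j (one_tensor A (p ^ j) M0 x)"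
   using frob_emb_one[OF x] by simp
 qed
qed

text \<open>The components of x lie in the j-th image, phi carries that image into the next one, and
  x is a combination of the values.\<close>

lemma Dinv_pow_frob_emb: "(Dinv ^^ j) (f ` carrier M0) <= frob_emb j ` carrier (Frob A (p ^ j) M0)"
proof (induction j)
 case 0
 show ?case
 proof
  fix y assume "y : (Dinv ^^ 0) (f ` carrier M0)"
  then obtain m where "m : carrier M0" "y = f m" by auto
  then show "y : frob_emb 0 ` carrier (Frob A (p ^ 0) M0)"
   using frob_emb_one[of m 0] semilin_closed[OF one_tensor_semilin[OF M0]] by (metis funpow_0 image_eqI)
 qed
next
 case (Suc j)
 interpret F: Module.module A "Frob A (p ^ Suc j) M0" by (rule Fmod)
 let ?I = "frob_emb (Suc j) ` carrier (Frob A (p ^ Suc j) M0)"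
 have I: "submodule ?I A M" by (rule mod_hom_image_submodule[OF Fmod is_mod frob_emb_hom F.carrier_is_submodule])
 show ?case
 proof
  fix x assume "x : (Dinv ^^ Suc j) (f ` carrier M0)"
  then have xD: "x : Dinv ((Dinv ^^ j) (f ` carrier M0))" by simp
  have x: "x : carrier M" using xD unfolding dinv_def by blast
  have Dx: "D i x : frob_emb j ` carrier (Frob A (p ^ j) M0)" if "i : J" for i
   using subsetD[OF Suc DinvD[OF xD that]] .
  obtain F where F: "finite F" "F <= J" "x = bs F (\<lambda>j. D j x)" by (rule D_expand[OF x, of "{}"]) auto
  have "bs F (\<lambda>j. D j x) : ?I" unfolding bsum_def
  proof (rule submodule_finsum[OF is_mod I F(1)])
   fix i assume i: "i : F"
   then obtain X where X: "X : carrier (Frob A (p ^ j) M0)" "D i x = frob_emb j X" using Dx F(2) by blast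
   then have "\<phi> (D i x) : ?I" using frob_emb_phi[OF X(1)] by (metis image_eqI)
   then show "b i *\<^sub>M \<phi> (D i x) : ?I" using M.submoduleE(4)[OF I] b_closed i F(2) by blast
  qed
  then show "x : ?I" using F(3) by simp
 qed
qed

text \<open>The images of the pullbacks exhaust M, so M is the limit. Identities between maps out of
  pullbacks are checked after composition with an injective map to M.\<close>

lemma root_morphismI:
 assumes fg: "fin_gen A M0" and gen: "\<And>x. x : carrier M ==> \<exists>j. x : (Dinv ^^ j) (f ` carrier M0)"
 shows "root_morphism A p M0 \<beta> M Frob_inv"
proof -
 have e: "p ^ j * p = p ^ Suc j" for j by simp
 let ?L = "gen_limit A p M0 \<beta>" and ?lm = "gen_limit_map A p M0 \<beta>"
 have surj: "\<exists>j. \<exists>X\<in>carrier (Frob A (p ^ j) M0). y = frob_emb j X" if "y : carrier M" for y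
  using gen[OF that] Dinv_pow_frob_emb by blast
 obtain \<Psi> where \<Psi>: "\<Psi> : mod_iso A ?L M" and \<Psi>m: "\<And>j x. x : carrier (Frob A (p ^ j) M0) ==> \<Psi> (?lm j x) = frob_emb j x"
  using dirlim_iso[of A "\<lambda>j. Frob A (p ^ j) M0", OF is_cring Fmod gen_step_hom is_mod frob_emb_hom frob_emb_step frob_emb_inj surj]
  unfolding gen_limit_def[symmetric] gen_limit_map_def[symmetric] by metis
 have L: "Module.module A ?L" unfolding gen_limit_def by (rule dirlim_is_module; intro is_cring Fmod gen_step_hom)
 have lm: "?lm j : mod_hom A (Frob A (p ^ j) M0) ?L" for j unfolding gen_limit_def gen_limit_map_def
  by (rule dirlim_map_hom[of A "\<lambda>j. Frob A (p ^ j) M0"]; intro is_cring Fmod gen_step_hom)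
 have \<Psi>h: "\<Psi> : mod_hom A ?L M" and \<Psi>b: "inj_on \<Psi> (carrier ?L)" "\<Psi> ` carrier ?L = carrier M"
  using \<Psi> by (auto simp: mod_iso_def bij_betw_def)
 define \<Lambda>L where "\<Lambda>L = Frob_lift A ?L M 1 (\<lambda>x. \<phi> (\<Psi> x))"
 note \<Lambda>L = Frob_lift_phi[OF L \<Psi>h, folded \<Lambda>L_def]
 have \<Lambda>L_iso: "\<Lambda>L : mod_iso A (Frob A p ?L) M"
  using \<Lambda>L(1) \<Lambda>L(3)[OF \<Psi>b(1)] \<Lambda>L(4)[OF \<Psi>b(2)] by (auto simp: mod_iso_def bij_betw_def)
 \<comment> \<open>The structure map of the limit is obtained by transport from M.\<close>
 define \<theta>L where "\<theta>L X = inv_into (carrier (Frob A p ?L)) \<Lambda>L (\<Psi> X)" for X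
 have inv: "inv_into (carrier (Frob A p ?L)) \<Lambda>L : mod_hom A M (Frob A p ?L)"
  using mod_iso_inv[OF Frob_is_module[OF L] \<Lambda>L_iso] by (auto simp: mod_iso_def)
 have \<theta>Lh: "\<theta>L : mod_hom A ?L (Frob A p ?L)" unfolding \<theta>L_def[abs_def] by (rule mod_hom_comp[OF \<Psi>h inv])
 have \<Lambda>\<theta>: "\<Lambda>L (\<theta>L X) = \<Psi> X" if "X : carrier ?L" for X
  unfolding \<theta>L_def using \<Lambda>L(4)[OF \<Psi>b(2)] mod_homD(1)[OF \<Psi>h that] by (intro f_inv_into_f) auto
 have eqI: "X = Y" if "X : carrier (Frob A p ?L)" "Y : carrier (Frob A p ?L)" "\<Lambda>L X = \<Lambda>L Y" for X Y
  using \<Lambda>L(3)[OF \<Psi>b(1)] that by (auto dest: inj_onD)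
 have "gen_limit_structure A p M0 \<beta> \<theta>L" unfolding gen_limit_structure_def Let_def
 proof (intro conjI \<theta>Lh allI ballI)
  fix j x assume x: "x : carrier (Frob A (p ^ j) M0)"
  let ?Y = "inv_into (carrier (Frob A p (Frob A (p ^ j) M0))) (Frob_comp A p (p ^ j) M0) (gen_step A p M0 \<beta> j x)"
  let ?m = "Frob_map A p (Frob A (p ^ j) M0) ?L (?lm j)"
  note k = comp1[where q' = "p ^ j", folded power_Suc]
  have gs: "gen_step A p M0 \<beta> j x : Frob_comp A p (p ^ j) M0 ` carrier (Frob A p (Frob A (p ^ j) M0))"
   using k(5) mod_homD(1)[OF gen_step_hom x] by simp
  have Y: "?Y : carrier (Frob A p (Frob A (p ^ j) M0))" by (rule inv_into_into[OF gs])
  have kY: "Frob_comp A p (p ^ j) M0 ?Y = gen_step A p M0 \<beta> j x" by (rule f_inv_into_f[OF gs])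
  note m = Frob_map_hom[OF Fmod L lm, where q = p]
  \<comment> \<open>The two sides of the required equation are compared by their images under the
    injective map \<open>\<Lambda>L\<close>; both images turn out to be
    \<open>frob_emb j x\<close>.\<close>
  have "\<Lambda>L (?m ?Y) = emb_next j ?Y"
   by (rule Frob_hom_ext[OF Fmod is_mod mod_hom_comp[OF m(1) \<Lambda>L(1)] emb_next(1) _ Y])
    (simp add: m(2) \<Lambda>L(2) mod_homD(1)[OF lm] \<Psi>m emb_next(2))
  also have "\<dots> = frob_emb j x" using frob_emb_Suc_comp[OF Y] kY frob_emb_step[OF x] by simp
  finally have "\<Lambda>L (?m ?Y) = \<Lambda>L (\<theta>L (?lm j x))" using \<Lambda>\<theta>[OF mod_homD(1)[OF lm x]] \<Psi>m[OF x] by simp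
  then show "\<theta>L (?lm j x) = ?m ?Y"
   using mod_homD(1)[OF \<theta>Lh mod_homD(1)[OF lm x]] mod_homD(1)[OF m(1) Y] by (intro eqI) auto
 qed
 moreover have "\<Psi> : F_module_iso A p ?L \<theta>L M Frob_inv" unfolding F_module_iso_def
 proof (intro CollectI conjI \<Psi> ballI)
  fix X assume X: "X : carrier ?L"
  let ?\<Lambda> = "Frob_lift A M M 1 \<phi>"
  note m = Frob_map_hom[OF L is_mod \<Psi>h, where q = p]
  note fl = Frob_lift_phi[OF is_mod semilin_id[OF is_cring]]
  have t: "\<theta>L X : carrier (Frob A p ?L)" by (rule mod_homD(1)[OF \<theta>Lh X])
  have "?\<Lambda> (Frob_map A p ?L M \<Psi> (\<theta>L X)) = \<Lambda>L (\<theta>L X)"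
   by (rule Frob_hom_ext[OF L is_mod mod_hom_comp[OF m(1) fl(1)] \<Lambda>L(1) _ t])
    (simp add: m(2) \<Lambda>L(2) fl(2)[unfolded One_nat_def] mod_homD(1)[OF \<Psi>h])
  then have "?\<Lambda> (Frob_map A p ?L M \<Psi> (\<theta>L X)) = \<Psi> X" using \<Lambda>\<theta>[OF X] by simp
  then show "Frob_inv (\<Psi> X) = Frob_map A p ?L M \<Psi> (\<theta>L X)"
   using fl(3) mod_homD(1)[OF m(1) t] by (intro inv_into_f_eq) auto
 qed
 moreover have "inj_on \<beta> (carrier M0)"
 proof (rule inj_onI)
  fix x y assume xy: "x : carrier M0" "y : carrier M0" "\<beta> x = \<beta> y"
  then have "f x = f y" using f\<beta>[OF xy(1)] f\<beta>[OF xy(2)] by simp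
  then show "x = y" using inj_onD[OF finj] xy by blast
 qed
 ultimately show ?thesis unfolding root_morphism_def using M0 fg \<beta> F_module_Frob_inv by blast
qed

end

end

section \<open>Matrices and the stable submodule\<close>

lemma vecs_carrier:
 "v : carrier (vecs A d) \<longleftrightarrow> v : extensional {..<d} \<and> (\<forall>i<d. v i : carrier A)"
 by (auto simp: direct_sum_carrier)

lemma vecs_eqI:
 "v : carrier (vecs A d) ==> w : carrier (vecs A d) ==> (\<And>i. i < d ==> v i = w i) ==> v = w"
 by (rule direct_sum_eqI) auto

context cring
begin

lemma vecs_is_module: "Module.module R (vecs R d)"
 by (rule direct_sum_is_module[OF is_cring reg_is_module[OF is_cring]])

abbreviation (input) unitv :: "nat => nat => nat => 'a" where "unitv d \<equiv> free_basis R {..<d}"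

lemma unitv_closed: "i < d ==> unitv d i : carrier (vecs R d)"
 by (auto simp: vecs_carrier free_basis_def direct_sum_inj_def)

lemma unitv_apply: "i < d ==> k < d ==> unitv d i k = (if i = k then \<one> else \<zero>)"
 by (auto simp: free_basis_def direct_sum_inj_def)

lemma vecs_decomp:
 assumes v: "v : carrier (vecs R d)"
 shows "v = (\<Oplus>\<^bsub>vecs R d\<^esub>i\<in>{..<d}. v i *\<^sub>(vecs R d) unitv d i)"
proof -
 interpret V: Module.module R "vecs R d" by (rule vecs_is_module)
 have "v = (\<Oplus>\<^bsub>vecs R d\<^esub>i\<in>{..<d}. direct_sum_inj {..<d} (\<lambda>_. reg R) i (v i))"
  by (rule direct_sum_decomp[OF is_cring reg_is_module[OF is_cring] v]) auto
 also have "\<dots> = (\<Oplus>\<^bsub>vecs R d\<^esub>i\<in>{..<d}. v i *\<^sub>(vecs R d) unitv d i)"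
 proof (rule V.M.finsum_cong'[OF refl])
  show "(\<lambda>i. v i *\<^sub>(vecs R d) unitv d i) : {..<d} \<rightarrow> carrier (vecs R d)"
   using v unitv_closed by (auto simp: vecs_carrier simp del: direct_sum_simps)
  show "direct_sum_inj {..<d} (\<lambda>_. reg R) i (v i) = v i *\<^sub>(vecs R d) unitv d i" if "i : {..<d}" for i
   using v that by (auto simp: vecs_carrier direct_sum_inj_def free_basis_def intro!: restrict_ext)
 qed
 finally show ?thesis .
qed

lemma vecs_gen: "gen_submodule R (vecs R d) (unitv d ` {..<d}) = carrier (vecs R d)"
proof
 have S: "unitv d ` {..<d} <= carrier (vecs R d)" using unitv_closed by auto
 show "gen_submodule R (vecs R d) (unitv d ` {..<d}) <= carrier (vecs R d)"
  by (rule gen_submodule_closed[OF vecs_is_module S])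
 note G = gen_submodule_is_submodule[OF vecs_is_module S]
 show "carrier (vecs R d) <= gen_submodule R (vecs R d) (unitv d ` {..<d})"
 proof
  fix v assume v: "v : carrier (vecs R d)"
  have "(\<Oplus>\<^bsub>vecs R d\<^esub>i\<in>{..<d}. v i *\<^sub>(vecs R d) unitv d i) : gen_submodule R (vecs R d) (unitv d ` {..<d})"
  proof (rule submodule_finsum[OF vecs_is_module G], simp)
   fix i assume i: "i : {..<d}"
   have "unitv d i : gen_submodule R (vecs R d) (unitv d ` {..<d})"
    by (rule subsetD[OF gen_submodule_subset[OF vecs_is_module] imageI[OF i]])
   then show "v i *\<^sub>(vecs R d) unitv d i : gen_submodule R (vecs R d) (unitv d ` {..<d})"
    using v i by (intro Module.module.submoduleE(4)[OF vecs_is_module G]) (auto simp: vecs_carrier)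
  qed
  then show "v : gen_submodule R (vecs R d) (unitv d ` {..<d})" using vecs_decomp[OF v] by simp
 qed
qed

lemma vecs_hom_ext:
 fixes N :: "('a, 'n) module"
 assumes N: "Module.module R N" and f: "f : mod_hom R (vecs R d) N" and f': "f' : mod_hom R (vecs R d) N"
  and eq: "\<And>i. i < d ==> f (unitv d i) = f' (unitv d i)" and v: "v : carrier (vecs R d)"
 shows "f v = f' v"
proof -
 interpret N: Module.module R N by fact
 interpret V: Module.module R "vecs R d" by (rule vecs_is_module)
 have s: "f : semilin R 1 (vecs R d) N" "f' : semilin R 1 (vecs R d) N"
  using f f' mod_hom_eq_semilin[OF is_cring] by blast+
 let ?E = "{v : carrier (vecs R d). f v = f' v}"
 have E: "submodule ?E R (vecs R d)"
  using mod_homD[OF f] mod_homD[OF f'] semilin_zero[OF vecs_is_module N s(1)] semilin_zero[OF vecs_is_module N s(2)]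
   semilin_neg[OF vecs_is_module N s(1)] semilin_neg[OF vecs_is_module N s(2)]
  by (intro V.submoduleI) (auto simp del: direct_sum_simps)
 have "gen_submodule R (vecs R d) (unitv d ` {..<d}) <= ?E"
  using eq unitv_closed by (intro gen_submodule_minimal[OF vecs_is_module E]) auto
 then show ?thesis using v unfolding vecs_gen by blast
qed

lemma lincomb_hom:
 fixes M :: "('a, 'm) module"
 assumes M: "Module.module R M" and x: "\<And>i. i < d ==> x i : carrier M"
 shows "(\<lambda>v. \<Oplus>\<^bsub>M\<^esub>i\<in>{..<d}. v i *\<^sub>M x i) : mod_hom R (vecs R d) M"
proof (rule mod_homI)
 interpret M: Module.module R M by fact
 fix v assume v: "v : carrier (vecs R d)"
 then show "(\<Oplus>\<^bsub>M\<^esub>i\<in>{..<d}. v i *\<^sub>M x i) : carrier M"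
  using x by (intro M.M.finsum_closed) (auto simp: vecs_carrier)
 {
  fix w assume w: "w : carrier (vecs R d)"
  have "(\<Oplus>\<^bsub>M\<^esub>i\<in>{..<d}. (v +\<^sub>(vecs R d) w) i *\<^sub>M x i) = (\<Oplus>\<^bsub>M\<^esub>i\<in>{..<d}. v i *\<^sub>M x i +\<^sub>M w i *\<^sub>M x i)"
   using v w x by (intro M.M.finsum_cong') (auto simp: vecs_carrier M.smult_l_distr)
  also have "\<dots> = (\<Oplus>\<^bsub>M\<^esub>i\<in>{..<d}. v i *\<^sub>M x i) +\<^sub>M (\<Oplus>\<^bsub>M\<^esub>i\<in>{..<d}. w i *\<^sub>M x i)"
   using v w x by (intro M.M.finsum_addf) (auto simp: vecs_carrier)
  finally show "(\<Oplus>\<^bsub>M\<^esub>i\<in>{..<d}. (v +\<^sub>(vecs R d) w) i *\<^sub>M x i) =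
    (\<Oplus>\<^bsub>M\<^esub>i\<in>{..<d}. v i *\<^sub>M x i) +\<^sub>M (\<Oplus>\<^bsub>M\<^esub>i\<in>{..<d}. w i *\<^sub>M x i)" .
 }
 fix a assume a: "a : carrier R"
 have "(\<Oplus>\<^bsub>M\<^esub>i\<in>{..<d}. (a *\<^sub>(vecs R d) v) i *\<^sub>M x i) = (\<Oplus>\<^bsub>M\<^esub>i\<in>{..<d}. a *\<^sub>M (v i *\<^sub>M x i))"
  using v a x by (intro M.M.finsum_cong') (auto simp: vecs_carrier M.smult_assoc1)
 also have "\<dots> = a *\<^sub>M (\<Oplus>\<^bsub>M\<^esub>i\<in>{..<d}. v i *\<^sub>M x i)"
  using v a x by (intro M.finsum_smult_ldistr[symmetric]) (auto simp: vecs_carrier)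
 finally show "(\<Oplus>\<^bsub>M\<^esub>i\<in>{..<d}. (a *\<^sub>(vecs R d) v) i *\<^sub>M x i) = a *\<^sub>M (\<Oplus>\<^bsub>M\<^esub>i\<in>{..<d}. v i *\<^sub>M x i)" .
qed

lemma lincomb_unitv:
 fixes d :: nat and M :: "('a, 'm) module"
 assumes M: "Module.module R M" and x: "\<And>i. i < d ==> x i : carrier M" and i: "i < d"
 shows "(\<Oplus>\<^bsub>M\<^esub>k\<in>{..<d}. unitv d i k *\<^sub>M x k) = x i"
proof -
 interpret M: Module.module R M by fact
 have "(\<Oplus>\<^bsub>M\<^esub>k\<in>{..<d}. unitv d i k *\<^sub>M x k) = (\<Oplus>\<^bsub>M\<^esub>k\<in>{..<d}. if i = k then x k else 0\<^sub>M)"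
  using x i by (intro M.M.finsum_cong') (auto simp: unitv_apply)
 also have "\<dots> = x i" using i x by (intro M.M.finsum_singleton) auto
 finally show ?thesis .
qed

lemma lincomb_image:
 fixes M :: "('a, 'm) module"
 assumes M: "Module.module R M" and x: "\<And>i. i < d ==> x i : carrier M"
 shows "(\<lambda>v. \<Oplus>\<^bsub>M\<^esub>i\<in>{..<d}. v i *\<^sub>M x i) ` carrier (vecs R d) = gen_submodule R M (x ` {..<d})"
proof -
 have "(\<lambda>v. \<Oplus>\<^bsub>M\<^esub>i\<in>{..<d}. v i *\<^sub>M x i) ` carrier (vecs R d)
  = gen_submodule R M ((\<lambda>v. \<Oplus>\<^bsub>M\<^esub>i\<in>{..<d}. v i *\<^sub>M x i) ` (unitv d ` {..<d}))"
  unfolding vecs_gen[symmetric]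
  using unitv_closed by (intro mod_hom_image_gen[OF vecs_is_module M lincomb_hom[OF M x]]) auto
 also have "(\<lambda>v. \<Oplus>\<^bsub>M\<^esub>i\<in>{..<d}. v i *\<^sub>M x i) ` (unitv d ` {..<d}) = x ` {..<d}"
  unfolding image_image using lincomb_unitv[OF M x] by (intro image_cong) auto
 finally show ?thesis .
qed

lemma mat_vec_hom:
 assumes B: "is_matrix R r c B"
 shows "mat_vec R r c B : mod_hom R (vecs R c) (vecs R r)"
proof -
 have Bc: "B i j : carrier R" if "i < r" "j < c" for i j using B that by (auto simp: is_matrix_def)
 have h: "(\<lambda>v. \<Oplus>j\<in>{..<c}. B i j \<otimes> v j) : mod_hom R (vecs R c) (reg R)" if i: "i < r" for i
 proof -
  have "(\<lambda>v. \<Oplus>\<^bsub>reg R\<^esub>j\<in>{..<c}. v j *\<^sub>(reg R) B i j) : mod_hom R (vecs R c) (reg R)"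
   using Bc[OF i] by (intro lincomb_hom reg_is_module is_cring) auto
  moreover have "(\<Oplus>\<^bsub>reg R\<^esub>j\<in>{..<c}. v j *\<^sub>(reg R) B i j) = (\<Oplus>j\<in>{..<c}. B i j \<otimes> v j)" if "v : carrier (vecs R c)" for v
   unfolding finsum_reg using that Bc[OF i] by (intro finsum_cong') (auto simp: vecs_carrier m_comm)
  ultimately have *: "\<And>v. v : carrier (vecs R c) ==> (\<Oplus>j\<in>{..<c}. B i j \<otimes> v j) = (\<lambda>v. \<Oplus>\<^bsub>reg R\<^esub>j\<in>{..<c}. v j *\<^sub>(reg R) B i j) v"
   and h: "(\<lambda>v. \<Oplus>\<^bsub>reg R\<^esub>j\<in>{..<c}. v j *\<^sub>(reg R) B i j) : mod_hom R (vecs R c) (reg R)" by simp_all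
  note cl = Module.module.smult_closed[OF vecs_is_module] abelian_groupE(1)[OF module_ab[OF vecs_is_module]]
  show ?thesis
   by (rule mod_homI) (simp_all only: * cl mod_homD(1)[OF h] mod_homD(2)[OF h] mod_homD(3)[OF h])
 qed
 show ?thesis
 proof (rule mod_homI)
  fix v assume v: "v : carrier (vecs R c)"
  show "mat_vec R r c B v : carrier (vecs R r)"
   using mod_homD(1)[OF h v] by (auto simp: mat_vec_def vecs_carrier)
  show "mat_vec R r c B (v +\<^sub>(vecs R c) w) = mat_vec R r c B v +\<^sub>(vecs R r) mat_vec R r c B w" if "w : carrier (vecs R c)" for w
   unfolding mat_vec_def using mod_homD(2)[OF h v that] by (intro ext) (auto simp del: direct_sum_simps(2) simp: direct_sum_simps(2)[of "{..<r}"])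
  show "mat_vec R r c B (a *\<^sub>(vecs R c) v) = a *\<^sub>(vecs R r) mat_vec R r c B v" if "a : carrier R" for a
   unfolding mat_vec_def using mod_homD(3)[OF h that v] by (intro ext) (auto simp del: direct_sum_simps(3) simp: direct_sum_simps(3)[of "{..<r}"])
 qed
qed

lemma mat_vec_unitv:
 assumes B: "is_matrix R r c B" and j: "j < c"
 shows "mat_vec R r c B (unitv c j) = (\<lambda>i\<in>{..<r}. B i j)"
proof -
 have Bc: "B i j : carrier R" if "i < r" "j < c" for i j using B that by (auto simp: is_matrix_def)
 have "(\<Oplus>k\<in>{..<c}. B i k \<otimes> unitv c j k) = B i j" if i: "i < r" for i
 proof -
  have "(\<Oplus>k\<in>{..<c}. B i k \<otimes> unitv c j k) = (\<Oplus>k\<in>{..<c}. if j = k then B i k else \<zero>)"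
   using Bc[OF i] j by (intro finsum_cong') (auto simp: unitv_apply)
  also have "\<dots> = B i j" using j Bc[OF i] by (intro finsum_singleton) auto
  finally show ?thesis .
 qed
 then show ?thesis unfolding mat_vec_def by (intro restrict_ext) auto
qed

lemma mat_image_columns:
 assumes s: "\<And>j. j < c ==> s j : carrier (vecs R r)"
 shows "is_matrix R r c (\<lambda>i j. s j i)"
  and "mat_image R r c (\<lambda>i j. s j i) = gen_submodule R (vecs R r) (s ` {..<c})"
proof -
 show B: "is_matrix R r c (\<lambda>i j. s j i)" using s by (auto simp: is_matrix_def vecs_carrier)
 have "mat_image R r c (\<lambda>i j. s j i) = gen_submodule R (vecs R r) (mat_vec R r c (\<lambda>i j. s j i) ` unitv c ` {..<c})"
  unfolding mat_image_def vecs_gen[symmetric]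
  using unitv_closed by (intro mod_hom_image_gen[OF vecs_is_module vecs_is_module mat_vec_hom[OF B]]) auto
 also have "mat_vec R r c (\<lambda>i j. s j i) ` unitv c ` {..<c} = s ` {..<c}" unfolding image_image
 proof (rule image_cong[OF refl])
  fix j assume "j : {..<c}"
  then show "mat_vec R r c (\<lambda>i j. s j i) (unitv c j) = s j"
   using mat_vec_unitv[OF B, of j] s[of j] by (auto simp: vecs_carrier extensional_restrict)
 qed
 finally show "mat_image R r c (\<lambda>i j. s j i) = gen_submodule R (vecs R r) (s ` {..<c})" .
qed

end

context unit_module
begin

lemma gen_phi_gen:
 assumes S: "S <= carrier M"
 shows "gen_submodule A M (\<phi> ` gen_submodule A M S) = gen_submodule A M (\<phi> ` S)"
proof
 have pS: "\<phi> ` S <= carrier M" using S by auto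
 have "gen_submodule A M S <= {x : carrier M. \<phi> x : gen_submodule A M (\<phi> ` S)}"
  using S gen_submodule_subset[OF is_mod, of "\<phi> ` S"]
  by (intro gen_submodule_minimal[OF is_mod] semilin_preimage[OF is_mod is_mod phi] gen_submodule_is_submodule[OF is_mod pS]) auto
 then show "gen_submodule A M (\<phi> ` gen_submodule A M S) <= gen_submodule A M (\<phi> ` S)"
  by (intro gen_submodule_minimal[OF is_mod] gen_submodule_is_submodule[OF is_mod pS]) auto
 show "gen_submodule A M (\<phi> ` S) <= gen_submodule A M (\<phi> ` gen_submodule A M S)"
  using gen_submodule_subset[OF is_mod, of S] by (intro gen_submodule_mono) auto
qed

lemma Dinv_pow_submodule: "submodule L A M ==> submodule ((Dinv ^^ e) L) A M"
 by (induction e) (auto intro: Dinv_submodule)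

lemma Dinv_pow_mono: "K <= L ==> (Dinv ^^ e) K <= (Dinv ^^ e) L"
 by (induction e) (auto dest: Dinv_mono)

lemma Dinv_pow_eq_gen:
 assumes L: "submodule L A M"
 shows "(Dinv ^^ e) L = gen_submodule A M ((\<phi> ^^ e) ` L)"
proof (induction e)
 case 0
 show ?case using gen_submodule_self[OF is_mod L] by simp
next
 case (Suc e)
 have c: "(\<phi> ^^ e) ` L <= carrier M" using semilin_closed[OF phi_pow_semilin] M.submoduleE(1)[OF L] by blast
 have "(Dinv ^^ Suc e) L = gen_submodule A M (\<phi> ` ((Dinv ^^ e) L))"
  using Dinv_eq_gen[OF Dinv_pow_submodule[OF L]] by simp
 also have "\<dots> = gen_submodule A M (\<phi> ` (\<phi> ^^ e) ` L)" unfolding Suc by (rule gen_phi_gen[OF c])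
 also have "\<phi> ` (\<phi> ^^ e) ` L = (\<phi> ^^ Suc e) ` L" by (simp add: image_image)
 finally show ?case .
qed

end

text \<open>One step applies U and then I_1. By \<open>I_op_iter_image\<close> the e-th member is
  I_e of the image of the e-fold product, so the chain of the theorem is computed without entrywise
  powers of U.\<close>

primrec stab_seq :: "('a, 'x) ring_scheme => nat => 'j set => ('j => 'a) => nat => (nat => nat => 'a) => nat => (nat => 'a) set" where
 "stab_seq A p J b d U 0 = carrier (vecs A d)"
| "stab_seq A p J b d U (Suc e) = dgen A J b (vecs A d) (vec_pow A d p) (mat_vec A d d U ` stab_seq A p J b d U e)"

section \<open>The operators I_e on free modules in terms of components\<close>

context frob_ring
begin

lemma unit_vecs: "unit_module A p J b (vecs A d) (vec_pow A d p)"
proof -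
 have "unit_mod A p J b (vecs A d) (\<lambda>x. \<lambda>k\<in>{..<d}. x k [^] p)"
  by (rule unit_direct_sum[OF _ unit_reg]) auto
 moreover have "(\<lambda>x. \<lambda>k\<in>{..<d}. x k [^] p) = vec_pow A d p" unfolding vec_pow_def ..
 ultimately have "unit_mod A p J b (vecs A d) (vec_pow A d p)" by simp
 then show ?thesis by unfold_locales
qed

abbreviation DV where "DV d \<equiv> dcomp J b (vecs A d) (vec_pow A d p)"
abbreviation DR where "DR \<equiv> dcomp J b (reg A) (\<lambda>x. x [^] p)"

lemma DV_apply:
 assumes v: "v : carrier (vecs A d)" and i: "i < d" and j: "j : J"
 shows "DV d j v i = DR j (v i)"
 by (rule D_commute[OF unit_vecs unit_module_reg, of d "\<lambda>v. v i", symmetric])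
  (use assms in \<open>auto simp: vecs_carrier vec_pow_def\<close>)

lemma DR_finsum:
 "finite S ==> x : S \<rightarrow> carrier A ==> j : J ==> DR j (\<Oplus>i\<in>S. x i) = (\<Oplus>i\<in>S. DR j (x i))"
 using unit_module.D_finsum[OF unit_module_reg, of S x j] by simp

lemma DR_closed: "x : carrier A ==> DR j x : carrier A"
 using unit_module.D_closed[OF unit_module_reg, of x j] by simp

lemma DR_pow_mult: "a : carrier A ==> x : carrier A ==> j : J ==> DR j (a [^] p \<otimes> x) = a \<otimes> DR j x"
 using unit_module.D_pow_smult[OF unit_module_reg, of a x j] by simp

lemma DV_closed: "v : carrier (vecs A d) ==> DV d j v : carrier (vecs A d)"
 by (rule unit_module.D_closed[OF unit_vecs])

text \<open>By \<open>DR_pow_mult\<close>, D j takes the entries of B' out as their p-th roots, so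
  multiplication by the entrywise power becomes multiplication by B.\<close>

lemma DV_mat_vec:
 assumes B: "is_matrix A r c B" and B': "\<And>i k. i < r ==> k < c ==> B' i k = B i k [^] p"
  and v: "v : carrier (vecs A c)" and j: "j : J"
 shows "DV r j (mat_vec A r c B' v) = mat_vec A r c B (DV c j v)"
proof (rule vecs_eqI)
 have Bc: "B i k : carrier A" if "i < r" "k < c" for i k using B that by (auto simp: is_matrix_def)
 have m': "is_matrix A r c B'" using B' Bc by (auto simp: is_matrix_def)
 note c' = mod_homD(1)[OF mat_vec_hom[OF m'] v]
 show "DV r j (mat_vec A r c B' v) : carrier (vecs A r)" by (rule DV_closed[OF c'])
 show "mat_vec A r c B (DV c j v) : carrier (vecs A r)" by (rule mod_homD(1)[OF mat_vec_hom[OF B] DV_closed[OF v]])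
 fix i assume i: "i < r"
 have "DV r j (mat_vec A r c B' v) i = DR j (\<Oplus>k\<in>{..<c}. B' i k \<otimes> v k)"
  using i by (simp add: DV_apply[OF c' i j]) (simp add: mat_vec_def)
 also have "\<dots> = (\<Oplus>k\<in>{..<c}. DR j (B' i k \<otimes> v k))"
  using v Bc[OF i] B'[OF i] by (intro DR_finsum j) (auto simp: vecs_carrier)
 also have "\<dots> = (\<Oplus>k\<in>{..<c}. B i k \<otimes> DV c j v k)"
  using v Bc[OF i] B'[OF i] by (intro finsum_cong') (auto simp: vecs_carrier DR_pow_mult DV_apply j DR_closed)
 finally show "DV r j (mat_vec A r c B' v) i = mat_vec A r c B (DV c j v) i" using i by (simp add: mat_vec_def)
qed

lemma vec_pow_funpow:
 "v : carrier (vecs A d) ==> (vec_pow A d p ^^ e) v = vec_pow A d (p ^ e) v"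
proof (induction e)
 case 0
 then show ?case by (auto simp: vec_pow_def vecs_carrier extensional_def)
next
 case (Suc e)
 then show ?case by (auto simp: vec_pow_def vecs_carrier nat_pow_pow mult.commute)
qed

text \<open>L^[p^e] is generated by the iterated p-th powers of the elements of L, and each
  iteration is one application of \<open>Dinv\<close>.\<close>

lemma submod_pow_eq:
 assumes L: "submodule L A (vecs A d)"
 shows "submod_pow A d (p ^ e) L = (dinv J b (vecs A d) (vec_pow A d p) ^^ e) L"
proof -
 interpret V: unit_module A p J b "vecs A d" "vec_pow A d p" by (rule unit_vecs)
 have "(vec_pow A d p ^^ e) ` L = vec_pow A d (p ^ e) ` L"
  using vec_pow_funpow V.M.submoduleE(1)[OF L] by (intro image_cong) auto
 then show ?thesis unfolding submod_pow_def V.Dinv_pow_eq_gen[OF L] by simp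
qed

context
 fixes d :: nat and U :: "nat => nat => 'a"
 assumes U: "is_matrix A d d U"
begin

interpretation V: unit_module A p J b "vecs A d" "vec_pow A d p" by (rule unit_vecs)

abbreviation (input) Umap where "Umap \<equiv> mat_vec A d d U"
abbreviation (input) Lseq where "Lseq \<equiv> stab_seq A p J b d U"

lemma U_hom: "Umap : mod_hom A (vecs A d) (vecs A d)" by (rule mat_vec_hom[OF U])

lemma U_semilin: "Umap : semilin A 1 (vecs A d) (vecs A d)"
 using U_hom mod_hom_eq_semilin[OF is_cring] by blast

lemma U_pow_matrix: "is_matrix A d d (mat_pow A q U)"
 using U by (auto simp: is_matrix_def mat_pow_def)

lemma Lseq_submodule: "submodule (Lseq e) A (vecs A d)"
proof (induction e)
 case 0
 show ?case using V.M.carrier_is_submodule by simp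
next
 case (Suc e)
 then show ?case using mod_homD(1)[OF U_hom] V.M.submoduleE(1)[OF Suc]
  by (auto intro!: V.Dgen_submodule)
qed

text \<open>Flatness of Frobenius in elementary form: taking components e times turns U^[p^e] into
  U, by \<open>DV_mat_vec\<close>.\<close>

lemma mat_pow_Dinv_iff:
 assumes "w : carrier (vecs A d)"
 shows "mat_vec A d d (mat_pow A (p ^ e) U) w : (V.Dinv ^^ e) L \<longleftrightarrow>
  w : (V.Dinv ^^ e) {w : carrier (vecs A d). Umap w : L}" using assms
proof (induction e arbitrary: w)
 case 0
 have "mat_vec A d d (mat_pow A 1 U) w = Umap w"
  using U 0 unfolding mat_vec_def mat_pow_def is_matrix_def
  by (intro restrict_ext finsum_cong') (auto simp: vecs_carrier)
 then show ?case using 0 by simp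
next
 case (Suc e)
 have B': "mat_pow A (p ^ Suc e) U i k = mat_pow A (p ^ e) U i k [^] p" if "i < d" "k < d" for i k
  using U that by (auto simp: mat_pow_def is_matrix_def nat_pow_pow mult.commute)
 have D: "DV d j (mat_vec A d d (mat_pow A (p ^ Suc e) U) w) = mat_vec A d d (mat_pow A (p ^ e) U) (DV d j w)" if "j : J" for j
  by (rule DV_mat_vec[OF U_pow_matrix B' Suc.prems that])
 have c: "mat_vec A d d (mat_pow A (p ^ Suc e) U) w : carrier (vecs A d)"
  by (rule mod_homD(1)[OF mat_vec_hom[OF U_pow_matrix] Suc.prems])
 let ?W = "{w : carrier (vecs A d). Umap w : L}"
 have "mat_vec A d d (mat_pow A (p ^ Suc e) U) w : V.Dinv ((V.Dinv ^^ e) L) \<longleftrightarrow>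
   (\<forall>j\<in>J. mat_vec A d d (mat_pow A (p ^ e) U) (DV d j w) : (V.Dinv ^^ e) L)"
  unfolding dinv_def[of J b "vecs A d" _ "(V.Dinv ^^ e) L"] using c D by (auto simp del: power_Suc)
 also have "\<dots> \<longleftrightarrow> (\<forall>j\<in>J. DV d j w : (V.Dinv ^^ e) ?W)"
  using Suc.IH[OF DV_closed[OF Suc.prems]] by blast
 also have "\<dots> \<longleftrightarrow> w : V.Dinv ((V.Dinv ^^ e) ?W)"
  unfolding dinv_def[of J b "vecs A d" _ "(V.Dinv ^^ e) ?W"] using Suc.prems by blast
 finally show ?case by simp
qed

lemma iter_image_closed: "iter_image A p d U e <= carrier (vecs A d)"
proof (induction e)
 case (Suc e)
 then show ?case using mod_homD(1)[OF mat_vec_hom[OF U_pow_matrix]] by auto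
qed simp

text \<open>The outermost factor U^[p^e] is moved to the other side by
  \<open>mat_pow_Dinv_iff\<close>. The induction hypothesis is then applied to the inverse image of
  \<open>Dinv L\<close> under U, which is why L is arbitrary.\<close>

lemma iter_image_adj:
 assumes "submodule L A (vecs A d)"
 shows "iter_image A p d U e <= (V.Dinv ^^ e) L \<longleftrightarrow> Lseq e <= L" using assms
proof (induction e arbitrary: L)
 case 0
 then show ?case by simp
next
 case (Suc e)
 let ?W = "{w : carrier (vecs A d). Umap w : V.Dinv L}"
 have W: "submodule ?W A (vecs A d)"
  by (rule semilin_preimage[OF V.is_mod V.is_mod U_semilin V.Dinv_submodule[OF Suc.prems]])
 have Lc: "Lseq e <= carrier (vecs A d)" using V.M.submoduleE(1)[OF Lseq_submodule] .
 have ULc: "Umap ` Lseq e <= carrier (vecs A d)" using Lc mod_homD(1)[OF U_hom] by blast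
 have "iter_image A p d U (Suc e) <= (V.Dinv ^^ Suc e) L \<longleftrightarrow>
  (\<forall>w\<in>iter_image A p d U e. mat_vec A d d (mat_pow A (p ^ e) U) w : (V.Dinv ^^ e) (V.Dinv L))"
  by (simp add: funpow_swap1 image_subset_iff)
 also have "\<dots> \<longleftrightarrow> iter_image A p d U e <= (V.Dinv ^^ e) ?W"
  using mat_pow_Dinv_iff iter_image_closed by blast
 also have "\<dots> \<longleftrightarrow> Lseq e <= ?W" by (rule Suc.IH[OF W])
 also have "\<dots> \<longleftrightarrow> Umap ` Lseq e <= V.Dinv L" using Lc by blast
 also have "\<dots> \<longleftrightarrow> Lseq (Suc e) <= L" using V.Dgen_le_iff[OF Suc.prems ULc] by simp
 finally show ?case .
qed

text \<open>By the two adjunctions, the submodules among which I_e takes the smallest are exactly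
  those containing \<open>Lseq e\<close>.\<close>

lemma I_op_iter_image: "I_op A p d e (iter_image A p d U e) = Lseq e"
proof -
 let ?Q = "\<lambda>L. submodule L A (vecs A d) \<and> iter_image A p d U e <= submod_pow A d (p ^ e) L"
 have Q: "?Q L \<longleftrightarrow> submodule L A (vecs A d) \<and> Lseq e <= L" for L
  using submod_pow_eq iter_image_adj by metis
 have "is_smallest ?Q (Lseq e)" unfolding is_smallest_def Q using Lseq_submodule by blast
 moreover have "L = Lseq e" if "is_smallest ?Q L" for L
  using that calculation unfolding is_smallest_def by blast
 ultimately show ?thesis unfolding I_op_def by (rule the_equality)
qed

lemma stable_K_eq:
 assumes "\<And>e. e \<ge> e0 ==> Lseq e = Lseq e0"
 shows "stable_K A p d U = Lseq e0" unfolding stable_K_def stable_value_def I_op_iter_image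
proof (rule the_equality)
 show "\<exists>e1. \<forall>e\<ge>e1. Lseq e = Lseq e0" using assms by blast
 fix K assume "\<exists>e1. \<forall>e\<ge>e1. Lseq e = K"
 then obtain e1 where "\<forall>e\<ge>e1. Lseq e = K" by blast
 then have "Lseq (max e0 e1) = K" by simp
 then show "K = Lseq e0" using assms[of "max e0 e1"] by simp
qed

lemma Lseq_decreasing: "Lseq (Suc e) <= Lseq e"
proof (induction e)
 case 0
 show ?case using V.M.submoduleE(1)[OF Lseq_submodule[of "Suc 0"]] by simp
next
 case (Suc e)
 then have "V.Dgen (Umap ` Lseq (Suc e)) <= V.Dgen (Umap ` Lseq e)"
  by (intro V.Dgen_mono image_mono)
 then show ?case by simp
qed

end

end

section \<open>Roots given by generators\<close>

lemma noeth_vecs: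
 assumes A: "noeth_ring A" and N: "submodule N A (vecs A d)"
 shows "\<exists>s c. (\<forall>j<c. s j : N) \<and> N = gen_submodule A (vecs A d) (s ` {..<c::nat})"
proof -
 interpret cring A using A by (simp add: noeth_ring_def)
 have "\<exists>S. finite S \<and> S <= N \<and> N = gen_submodule A (vecs A d) S"
 proof (rule noeth_gen[OF A vecs_is_module _ _ N])
  show "N <= gen_submodule A (vecs A d) (free_basis A {..<d} ` {..<d})"
   unfolding vecs_gen using Module.module.submoduleE(1)[OF vecs_is_module N] .
 qed (use unitv_closed in auto)
 then obtain S where S: "finite S" "S <= N" "N = gen_submodule A (vecs A d) S" by blast
 obtain c s where "S = s ` {i::nat. i < c}" using finite_imp_nat_seg_image_inj_on[OF S(1)] by blast
 then have "S = s ` {..<c}" by (simp add: lessThan_def)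
 then show ?thesis using S by (intro exI[of _ s] exI[of _ c]) auto
qed

context unit_module
begin

context
 fixes d :: nat and x :: "nat => 'm" and U :: "nat => nat => 'a"
 assumes x: "\<And>i. i < d ==> x i : carrier M" and U: "is_matrix A d d U"
  and xU: "\<And>i. i < d ==> x i = (\<Oplus>\<^bsub>M\<^esub>j\<in>{..<d}. U j i *\<^sub>M \<phi> (x j))"
begin

interpretation V: unit_module A p J b "vecs A d" "vec_pow A d p" by (rule unit_vecs)

abbreviation (input) Uv where "Uv \<equiv> mat_vec A d d U"

definition gmap :: "(nat => 'a) => 'm" where "gmap v = (\<Oplus>\<^bsub>M\<^esub>i\<in>{..<d}. v i *\<^sub>M x i)"

lemma gmap_hom: "gmap : mod_hom A (vecs A d) M"
 unfolding gmap_def[abs_def] by (rule lincomb_hom[OF is_mod x])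

lemma gmap_semilin: "gmap : semilin A 1 (vecs A d) M"
 using gmap_hom mod_hom_eq_semilin[OF is_cring] by blast

lemma gmap_unitv: "i < d ==> gmap (free_basis A {..<d} i) = x i"
 unfolding gmap_def by (rule lincomb_unitv[OF is_mod x])

lemma gmap_image: "gmap ` carrier (vecs A d) = gen_submodule A M (x ` {..<d})"
 unfolding gmap_def[abs_def] by (rule lincomb_image[OF is_mod x])

lemma Uv_hom: "Uv : mod_hom A (vecs A d) (vecs A d)" by (rule mat_vec_hom[OF U])

text \<open>Both sides are linear in v and agree on the unit vectors by \<open>xU\<close>: the
  coordinates of U v are coefficients with respect to the phi (x j).\<close>

lemma gmap_U:
 assumes v: "v : carrier (vecs A d)"
 shows "gmap v = (\<Oplus>\<^bsub>M\<^esub>j\<in>{..<d}. Uv v j *\<^sub>M \<phi> (x j))"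
proof (rule vecs_hom_ext[OF is_mod gmap_hom _ _ v])
 have h: "(\<lambda>w. \<Oplus>\<^bsub>M\<^esub>j\<in>{..<d}. w j *\<^sub>M \<phi> (x j)) : mod_hom A (vecs A d) M"
  by (rule lincomb_hom[OF is_mod]) (use x in auto)
 show "(\<lambda>v. \<Oplus>\<^bsub>M\<^esub>j\<in>{..<d}. Uv v j *\<^sub>M \<phi> (x j)) : mod_hom A (vecs A d) M"
  by (rule mod_hom_comp[OF Uv_hom h])
 fix i assume i: "i < d"
 have "(\<Oplus>\<^bsub>M\<^esub>j\<in>{..<d}. Uv (free_basis A {..<d} i) j *\<^sub>M \<phi> (x j)) = (\<Oplus>\<^bsub>M\<^esub>j\<in>{..<d}. U j i *\<^sub>M \<phi> (x j))"
  using x U i by (intro M.M.finsum_cong') (auto simp: mat_vec_unitv[OF U i] is_matrix_def)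
 then show "gmap (free_basis A {..<d} i) = (\<Oplus>\<^bsub>M\<^esub>j\<in>{..<d}. Uv (free_basis A {..<d} i) j *\<^sub>M \<phi> (x j))"
  using gmap_unitv[OF i] xU[OF i] by simp
qed

text \<open>From \<open>gmap_U\<close> the components are read off by \<open>D_smult_phi\<close>.
  This is the relation through which U on A^d models the components on M.\<close>

lemma D_gmap:
 assumes v: "v : carrier (vecs A d)" and j: "j : J"
 shows "D j (gmap v) = gmap (DV d j (Uv v))"
proof -
 note c = mod_homD(1)[OF Uv_hom v]
 have ck: "Uv v k : carrier A" if "k < d" for k using c that by (auto simp: vecs_carrier)
 have "D j (gmap v) = (\<Oplus>\<^bsub>M\<^esub>k\<in>{..<d}. D j (Uv v k *\<^sub>M \<phi> (x k)))"
  unfolding gmap_U[OF v] using ck x by (intro D_finsum j) auto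
 also have "\<dots> = (\<Oplus>\<^bsub>M\<^esub>k\<in>{..<d}. DV d j (Uv v) k *\<^sub>M x k)"
  using ck x DR_closed by (intro M.M.finsum_cong') (auto simp: D_smult_phi j DV_apply[OF c _ j])
 finally show ?thesis unfolding gmap_def .
qed

lemma gmap_Dgen:
 assumes L: "L <= carrier (vecs A d)"
 shows "gmap ` V.Dgen (Uv ` L) = Dgen (gmap ` L)"
proof -
 have c: "{V.D j w | j w. j : J \<and> w : Uv ` L} <= carrier (vecs A d)"
  using L mod_homD(1)[OF Uv_hom] V.D_closed by blast
 have "gmap ` V.Dgen (Uv ` L) = gen_submodule A M (gmap ` {V.D j w | j w. j : J \<and> w : Uv ` L})"
  unfolding dgen_def by (rule mod_hom_image_gen[OF V.is_mod is_mod gmap_hom c])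
 also have "gmap ` {V.D j w | j w. j : J \<and> w : Uv ` L} = {D j y | j y. j : J \<and> y : gmap ` L}" (is "?a = ?b")
 proof (intro equalityI subsetI)
  fix y assume "y : ?a"
  then obtain j v where "j : J" "v : L" "y = gmap (V.D j (Uv v))" by blast
  then have "y = D j (gmap v)" using D_gmap L by auto
  then show "y : ?b" using \<open>j : J\<close> \<open>v : L\<close> by (intro CollectI exI[of _ j] exI[of _ "gmap v"] conjI imageI)
 next
  fix y assume "y : ?b"
  then obtain j v where "j : J" "v : L" "y = D j (gmap v)" by blast
  then have "y = gmap (V.D j (Uv v))" using D_gmap L by auto
  moreover have "V.D j (Uv v) : {V.D j w | j w. j : J \<and> w : Uv ` L}"
   using \<open>j : J\<close> \<open>v : L\<close> by (intro CollectI exI[of _ j] exI[of _ "Uv v"] conjI refl imageI)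
  ultimately show "y : ?a" by (rule image_eqI)
 qed
 finally show ?thesis unfolding dgen_def .
qed

text \<open>Stabilisation is proved on A^d by bounding degrees; this transfers it to the chain of
  the \<open>(Dgen ^^ e)\<close> in M.\<close>

lemma gmap_stab_seq:
 "gmap ` stab_seq A p J b d U e = (Dgen ^^ e) (gmap ` carrier (vecs A d))"
proof (induction e)
 case (Suc e)
 show ?case using gmap_Dgen[OF V.M.submoduleE(1)[OF Lseq_submodule[OF U]]] Suc by simp
qed simp

definition gker where "gker = {v : carrier (vecs A d). gmap v : {0\<^sub>M}}"

lemma gker_submodule: "submodule gker A (vecs A d)"
 unfolding gker_def by (rule semilin_preimage[OF V.is_mod is_mod gmap_semilin zero_submodule[OF is_mod]])

definition gbar where "gbar X = the_elem (gmap ` X)"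

lemma gker_zero: "v : gker ==> gmap v = 0\<^sub>M" by (simp add: gker_def)

abbreviation (input) CK where "CK \<equiv> quot_module (vecs A d) gker"
abbreviation (input) cls where "cls v \<equiv> gker +>\<^sub>(vecs A d) v"

lemma CK_module: "Module.module A CK" by (rule quot_is_module[OF V.is_mod gker_submodule])

lemma cls_hom: "cls : mod_hom A (vecs A d) CK" by (rule quot_class_hom[OF V.is_mod gker_submodule])

lemma gbar_hom: "gbar : mod_hom A CK M"
 using quot_lift_semilin[OF V.is_mod gker_submodule is_mod gmap_semilin gker_zero] mod_hom_eq_semilin[OF is_cring]
 unfolding gbar_def[abs_def] by blast

lemma gbar_cls: "v : carrier (vecs A d) ==> gbar (cls v) = gmap v" unfolding gbar_def
 by (rule quot_lift[OF V.is_mod gker_submodule is_mod];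
   (rule semilin_add[OF gmap_semilin] semilin_closed[OF gmap_semilin] gker_zero)?; assumption)

lemma gbar_inj: "inj_on gbar (carrier CK)"
proof (rule semilin_inj_onI[OF CK_module is_mod])
 show "gbar : semilin A 1 CK M" using gbar_hom mod_hom_eq_semilin[OF is_cring] by blast
 fix X assume X: "X : carrier CK" and z: "gbar X = 0\<^sub>M"
 then obtain v where v: "v : carrier (vecs A d)" "X = cls v" by (auto simp: quot_carrier[OF V.is_mod gker_submodule])
 then have "v : gker" using z gbar_cls by (simp add: gker_def)
 then show "X = 0\<^sub>CK" using v coset_eq_N_iff[OF V.is_mod gker_submodule] by (simp add: quot_zero[OF V.is_mod gker_submodule])
qed

lemma gbar_image: "gbar ` carrier CK = gmap ` carrier (vecs A d)"
 unfolding quot_carrier[OF V.is_mod gker_submodule] image_image using gbar_cls by auto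

lemma vec_pow_unitv: "i < d ==> vec_pow A d p (free_basis A {..<d} i) = free_basis A {..<d} i"
 using p_pos by (auto simp: vec_pow_def free_basis_def direct_sum_inj_def nat_pow_zero)

text \<open>A matrix B presents the kernel of g, and the cokernel of B embeds into M as a root. The
  root morphism is constructed on A^d and descends to the cokernel because its composition with an
  injective map to M is g.\<close>

lemma represents_rootI:
 assumes N: "noeth_ring A"
  and gen: "\<And>y. y : carrier M ==> \<exists>e. y : (Dinv ^^ e) (gmap ` carrier (vecs A d))"
 shows "represents_root A p d U M Frob_inv"
proof -
 have "\<exists>s c. (\<forall>j<c. s j : gker) \<and> gker = gen_submodule A (vecs A d) (s ` {..<c::nat})"
  by (rule noeth_vecs[OF N gker_submodule])
 then obtain s and c :: nat where "\<forall>j<c. s j : gker" and sg: "gker = gen_submodule A (vecs A d) (s ` {..<c})"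
  by (elim exE conjE)
 then have s: "s j : gker" if "j < c" for j using that by blast
 have sc: "s j : carrier (vecs A d)" if "j < c" for j using s[OF that] V.M.submoduleE(1)[OF gker_submodule] by blast
 define B where "B = (\<lambda>i j. s j i)"
 have B: "is_matrix A d c B" and imB: "mat_image A d c B = gker"
  using mat_image_columns[of c s d] sc unfolding B_def sg by auto
 define s' where "s' j = vec_pow A d p (s j)" for j
 have s'c: "s' j : carrier (vecs A d)" if "j < c" for j unfolding s'_def by (rule V.phi_closed[OF sc[OF that]])
 define K' where "K' = mat_image A d c (mat_pow A p B)"
 \<comment> \<open>The columns of the power matrix are the p-th powers of the columns of B, so its
   image is generated by the p-th powers of the chosen generators of the kernel.\<close>
 have "mat_image A d c (mat_pow A p B) = mat_image A d c (\<lambda>i j. s' j i)"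
  unfolding mat_image_def mat_vec_def using sc by (intro image_cong refl restrict_ext finsum_cong')
   (auto simp: s'_def B_def mat_pow_def vec_pow_def vecs_carrier)
 then have K'g: "K' = gen_submodule A (vecs A d) (s' ` {..<c})"
  unfolding K'_def using mat_image_columns(2)[of c s' d] s'c by simp
 have K': "submodule K' A (vecs A d)" unfolding K'g
  by (rule gen_submodule_is_submodule[OF V.is_mod]) (use s'c in auto)
 have powK: "vec_pow A d p v : K'" if v: "v : gker" for v
 proof -
  have "gker <= {v : carrier (vecs A d). vec_pow A d p v : K'}" unfolding sg
  proof (rule gen_submodule_minimal[OF V.is_mod semilin_preimage[OF V.is_mod V.is_mod V.phi K']])
   show "s ` {..<c} <= {v : carrier (vecs A d). vec_pow A d p v : K'}"
   proof
    fix v assume "v : s ` {..<c}"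
    then obtain j where j: "j < c" "v = s j" by auto
    have "s' j : K'" unfolding K'g by (rule subsetD[OF gen_submodule_subset[OF V.is_mod]]) (use j in auto)
    then show "v : {v : carrier (vecs A d). vec_pow A d p v : K'}" using sc j by (simp add: s'_def)
   qed
  qed
  then show ?thesis using v by blast
 qed
 have K'le: "gen_submodule A (vecs A d) (vec_pow A d p ` gker) <= K'"
  by (rule gen_submodule_minimal[OF V.is_mod K']) (use powK in auto)
 \<comment> \<open>For w in the kernel, g sends D j (U w) to D j (g w) = 0. So U w has all its
   components in the kernel, and \<open>Dinv\<close> of the kernel is generated by p-th powers of
   its elements.\<close>
 have UK: "Uv w : K'" if w: "w : gker" for w
 proof -
  have wc: "w : carrier (vecs A d)" using w by (simp add: gker_def)
  note Uc = mod_homD(1)[OF Uv_hom wc]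
  have "V.D j (Uv w) : gker" if j: "j : J" for j
   using D_gmap[OF wc j] gker_zero[OF w] j V.D_closed[OF Uc] by (simp add: gker_def)
  then have "Uv w : V.Dinv gker" using Uc by (simp add: dinv_def)
  then show ?thesis using V.Dinv_eq_gen[OF gker_submodule] K'le by blast
 qed
 let ?T = "Frob A p CK"
 let ?o = "\<lambda>j. one_tensor A p CK (cls (free_basis A {..<d} j))"
 note T = Frob_is_module[OF CK_module, of p]
 have oc: "?o j : carrier ?T" if "j < d" for j
  by (rule semilin_closed[OF one_tensor_semilin[OF CK_module] mod_homD(1)[OF cls_hom unitv_closed[OF that]]])
 define \<Lambda> where "\<Lambda> = Frob_lift A CK M 1 (\<lambda>x. \<phi> (gbar x))"
 note \<Lambda> = Frob_lift_phi[OF CK_module gbar_hom, folded \<Lambda>_def]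
 have \<Lambda>': "\<Lambda> : semilin A 1 ?T M" using \<Lambda>(1) mod_hom_eq_semilin[OF is_cring] by blast
 have \<Lambda>o: "\<Lambda> (?o j) = \<phi> (x j)" if "j < d" for j
  using \<Lambda>(2)[OF mod_homD(1)[OF cls_hom unitv_closed[OF that]]] gbar_cls[OF unitv_closed[OF that]] gmap_unitv[OF that] by simp
 \<comment> \<open>On A^d the root morphism sends v to the sum of (U v)_j times the tensor of 1 and
   the class of the j-th unit vector, which is the shape that \<open>represents_root\<close> asks
   for.\<close>
 define \<beta>0 where "\<beta>0 v = (\<Oplus>\<^bsub>?T\<^esub>j\<in>{..<d}. Uv v j *\<^sub>?T ?o j)" for v
 have \<beta>0: "\<beta>0 : mod_hom A (vecs A d) ?T"
  unfolding \<beta>0_def[abs_def] by (rule mod_hom_comp[OF Uv_hom lincomb_hom[OF T oc]])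
 have \<beta>0': "\<beta>0 : semilin A 1 (vecs A d) ?T" using \<beta>0 mod_hom_eq_semilin[OF is_cring] by blast
 have Uck: "Uv v k : carrier A" if "v : carrier (vecs A d)" "k < d" for v k
  using mod_homD(1)[OF Uv_hom that(1)] that(2) by (auto simp: vecs_carrier)
 have \<Lambda>\<beta>0: "\<Lambda> (\<beta>0 v) = gmap v" if v: "v : carrier (vecs A d)" for v
 proof -
  have "\<Lambda> (\<beta>0 v) = (\<Oplus>\<^bsub>M\<^esub>j\<in>{..<d}. \<Lambda> (Uv v j *\<^sub>?T ?o j))"
   unfolding \<beta>0_def using Uck[OF v] oc Module.module.smult_closed[OF T]
   by (intro semilin_finsum[OF T is_mod \<Lambda>']) auto
  also have "\<dots> = (\<Oplus>\<^bsub>M\<^esub>j\<in>{..<d}. Uv v j *\<^sub>M \<phi> (x j))"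
   using Uck[OF v] oc x by (intro M.M.finsum_cong') (auto simp: mod_homD(3)[OF \<Lambda>(1)] \<Lambda>o)
  finally show ?thesis using gmap_U[OF v] by simp
 qed
 \<comment> \<open>Vanishing on the kernel is seen after applying the injective map \<Lambda>, where
   the composition is g.\<close>
 have \<beta>00: "\<beta>0 v = 0\<^sub>?T" if v: "v : gker" for v
 proof -
  have vc: "v : carrier (vecs A d)" using v by (simp add: gker_def)
  have "\<Lambda> (\<beta>0 v) = \<Lambda> 0\<^sub>?T" using \<Lambda>\<beta>0[OF vc] gker_zero[OF v] semilin_zero[OF T is_mod \<Lambda>'] by simp
  then show ?thesis
   using inj_onD[OF \<Lambda>(3)[OF gbar_inj]] mod_homD(1)[OF \<beta>0 vc] abelian_groupE(2)[OF module_ab[OF T]] by blast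
 qed
 define \<beta> where "\<beta> X = the_elem (\<beta>0 ` X)" for X
 have \<beta>: "\<beta> : mod_hom A CK ?T"
  using quot_lift_semilin[OF V.is_mod gker_submodule T \<beta>0' \<beta>00] mod_hom_eq_semilin[OF is_cring]
  unfolding \<beta>_def[abs_def] by blast
 have \<beta>c: "\<beta> (cls v) = \<beta>0 v" if "v : carrier (vecs A d)" for v unfolding \<beta>_def
  by (rule quot_lift[OF V.is_mod gker_submodule T semilin_add[OF \<beta>0'] semilin_closed[OF \<beta>0'] \<beta>00 that])
 have \<Lambda>\<beta>: "\<Lambda> (\<beta> X) = gbar X" if X: "X : carrier CK" for X
 proof -
  obtain v where "v : carrier (vecs A d)" "X = cls v" using X by (auto simp: quot_carrier[OF V.is_mod gker_submodule])
  then show ?thesis using \<beta>c \<Lambda>\<beta>0 gbar_cls by simp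
 qed
 have fg: "fin_gen A CK"
 proof -
  let ?E = "free_basis A {..<d} ` {..<d}"
  have E: "?E <= carrier (vecs A d)" using unitv_closed by auto
  have "carrier CK = cls ` gen_submodule A (vecs A d) ?E" unfolding vecs_gen by (rule quot_carrier[OF V.is_mod gker_submodule])
  also have "\<dots> = gen_submodule A CK (cls ` ?E)" by (rule mod_hom_image_gen[OF V.is_mod CK_module cls_hom E])
  finally show ?thesis unfolding fin_gen_def using E mod_homD(1)[OF cls_hom]
   by (intro exI[of _ "cls ` ?E"] conjI) auto
 qed
 have coker: "coker A d c B = CK" unfolding coker_def imB ..
 have ccls: "coker_class A d c B v = cls v" for v unfolding coker_class_def imB ..
 have root: "root_morphism A p (coker A d c B) \<beta> M Frob_inv" unfolding coker
  by (rule root_morphismI[OF CK_module gbar_hom gbar_inj \<beta> \<Lambda>\<beta>[unfolded \<Lambda>_def] fg]) (use gen in \<open>auto simp: gbar_image\<close>)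
 let ?C' = "quot_module (vecs A d) K'"
 let ?cls' = "\<lambda>v. K' +>\<^sub>(vecs A d) v"
 note C' = quot_is_module[OF V.is_mod K'] and cls'_hom = quot_class_hom[OF V.is_mod K']
 have cls'_s: "?cls' : semilin A 1 (vecs A d) ?C'" using cls'_hom mod_hom_eq_semilin[OF is_cring] by blast
 define \<gamma>0 where "\<gamma>0 v = ?cls' (vec_pow A d p v)" for v
 have \<gamma>0: "\<gamma>0 : semilin A p (vecs A d) ?C'"
  unfolding \<gamma>0_def[abs_def] by (rule hom_comp_semilin[OF is_cring V.phi cls'_hom])
 have \<gamma>00: "\<gamma>0 v = 0\<^sub>?C'" if "v : gker" for v unfolding \<gamma>0_def quot_zero[OF V.is_mod K']
  by (rule iffD2[OF coset_eq_N_iff[OF V.is_mod K'] powK[OF that]])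
    (use powK[OF that] V.M.submoduleE(1)[OF K'] in blast)
 define \<gamma> where "\<gamma> X = the_elem (\<gamma>0 ` X)" for X
 have \<gamma>: "\<gamma> : semilin A p CK ?C'"
  unfolding \<gamma>_def[abs_def] by (rule quot_lift_semilin[OF V.is_mod gker_submodule C' \<gamma>0 \<gamma>00])
 have \<gamma>c: "\<gamma> (cls v) = \<gamma>0 v" if "v : carrier (vecs A d)" for v
  unfolding \<gamma>_def by (rule quot_lift[OF V.is_mod gker_submodule C' semilin_add[OF \<gamma>0] semilin_closed[OF \<gamma>0] \<gamma>00 that])
 have FC: "Frob_coker A p d c B = Frob_lift A CK ?C' 1 \<gamma>"
  unfolding Frob_coker_def coker_def coker_class_def imB K'_def[symmetric] \<gamma>_def[abs_def] \<gamma>0_def[abs_def] ..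
 note fl = Frob_lift_hom[OF CK_module C' \<gamma>]
 have fl': "Frob_lift A CK ?C' 1 \<gamma> : semilin A 1 ?T ?C'" using fl(1) mod_hom_eq_semilin[OF is_cring] by blast
 have fo: "Frob_lift A CK ?C' 1 \<gamma> (?o j) = ?cls' (free_basis A {..<d} j)" if j: "j < d" for j
  unfolding fl(2)[OF mod_homD(1)[OF cls_hom unitv_closed[OF j]]] \<gamma>c[OF unitv_closed[OF j]] \<gamma>0_def vec_pow_unitv[OF j] ..
 have main: "Frob_coker A p d c B (\<beta> (cls v)) = ?cls' (Uv v)" if v: "v : carrier (vecs A d)" for v
 proof -
  note Uc = mod_homD(1)[OF Uv_hom v]
  note cl' = mod_homD(1)[OF cls'_hom unitv_closed]
  have "Frob_coker A p d c B (\<beta> (cls v)) = (\<Oplus>\<^bsub>?C'\<^esub>j\<in>{..<d}. Frob_lift A CK ?C' 1 \<gamma> (Uv v j *\<^sub>?T ?o j))"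
   unfolding FC \<beta>c[OF v] \<beta>0_def using Uck[OF v] oc Module.module.smult_closed[OF T]
   by (intro semilin_finsum[OF T C' fl']) auto
  also have "\<dots> = (\<Oplus>\<^bsub>?C'\<^esub>j\<in>{..<d}. Uv v j *\<^sub>?C' ?cls' (free_basis A {..<d} j))"
   using Uck[OF v] oc fo mod_homD(3)[OF fl(1)] cl' Module.module.smult_closed[OF C']
   by (intro abelian_monoid.finsum_cong' abelian_group.axioms module_ab[OF C']) (auto simp del: One_nat_def)
  also have "\<dots> = (\<Oplus>\<^bsub>?C'\<^esub>j\<in>{..<d}. ?cls' (Uv v j *\<^sub>(vecs A d) free_basis A {..<d} j))"
   using Uck[OF v] mod_homD(3)[OF cls'_hom _ unitv_closed] mod_homD(1)[OF cls'_hom V.M.smult_closed[OF _ unitv_closed]]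
   by (intro abelian_monoid.finsum_cong' abelian_group.axioms module_ab[OF C']) (auto simp del: direct_sum_simps)
  also have "\<dots> = ?cls' (\<Oplus>\<^bsub>vecs A d\<^esub>j\<in>{..<d}. Uv v j *\<^sub>(vecs A d) free_basis A {..<d} j)"
   using Uck[OF v] V.M.smult_closed[OF _ unitv_closed]
   by (intro semilin_finsum[OF V.is_mod C' cls'_s, symmetric]) (auto simp del: direct_sum_simps)
  finally show ?thesis using vecs_decomp[OF Uc] by simp
 qed
 show ?thesis unfolding represents_root_def
 proof (intro exI conjI ballI)
  show "mat_vec A d d U ` mat_image A d c B <= mat_image A d c (mat_pow A p B)"
   unfolding imB K'_def[symmetric] using UK by auto
  show "Frob_coker A p d c B (\<beta> (coker_class A d c B v)) = coker_class A d c (mat_pow A p B) (mat_vec A d d U v)"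
   if "v : carrier (vecs A d)" for v
   using main[OF that] unfolding ccls unfolding coker_class_def K'_def by simp
 qed (rule B root)+
qed

end

text \<open>\<open>Dinv\<close> of the span of the x j is generated by the phi (x j), and
  coefficients of x i give the i-th column of U.\<close>

lemma Frob_matrix_exists:
 assumes x: "\<And>i. i < d ==> x i : carrier M"
  and D: "\<And>i. i < d ==> x i : Dinv (gen_submodule A M (x ` {..<d::nat}))"
 obtains U where "is_matrix A d d U" "\<And>i. i < d ==> x i = (\<Oplus>\<^bsub>M\<^esub>j\<in>{..<d}. U j i *\<^sub>M \<phi> (x j))"
proof -
 have xs: "x ` {..<d} <= carrier M" using x by auto
 have px: "(\<lambda>j. \<phi> (x j)) : {..<d} \<rightarrow> carrier M" using x by auto
 have "Dinv (gen_submodule A M (x ` {..<d})) = gen_submodule A M ((\<lambda>j. \<phi> (x j)) ` {..<d})"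
  using Dinv_eq_gen[OF gen_submodule_is_submodule[OF is_mod xs]] gen_phi_gen[OF xs] by (simp add: image_image)
 also have "\<dots> = {\<Oplus>\<^bsub>M\<^esub>j\<in>{..<d}. v j *\<^sub>M \<phi> (x j) | v. v : {..<d} \<rightarrow> carrier A}"
  by (rule gen_submodule_lincomb[OF is_mod _ px]) simp
 finally have "\<forall>i. i < d \<longrightarrow> (\<exists>v. v : {..<d} \<rightarrow> carrier A \<and> x i = (\<Oplus>\<^bsub>M\<^esub>j\<in>{..<d}. v j *\<^sub>M \<phi> (x j)))"
  using D by blast
 then obtain v where v: "\<And>i. i < d ==> v i : {..<d} \<rightarrow> carrier A \<and> x i = (\<Oplus>\<^bsub>M\<^esub>j\<in>{..<d}. v i j *\<^sub>M \<phi> (x j))"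
  by metis
 show ?thesis by (rule that[of "\<lambda>j i. v i j"]) (use v in \<open>auto simp: is_matrix_def\<close>)
qed

lemma Dgen_pow_submodule: "submodule L A M ==> submodule ((Dgen ^^ e) L) A M"
 using M.submoduleE(1) by (induction e) (auto intro!: Dgen_submodule)

lemma Dgen_pow_le_iff:
 assumes L: "submodule L A M" shows "submodule K A M ==> (Dgen ^^ e) K <= L \<longleftrightarrow> K <= (Dinv ^^ e) L"
proof (induction e arbitrary: K)
 case (Suc e)
 note Kc = M.submoduleE(1)[OF Suc.prems]
 have "(Dgen ^^ Suc e) K <= L \<longleftrightarrow> (Dgen ^^ e) (Dgen K) <= L" by (simp add: funpow_swap1)
 also have "\<dots> \<longleftrightarrow> Dgen K <= (Dinv ^^ e) L" by (rule Suc.IH[OF Dgen_submodule[OF Kc]])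
 also have "\<dots> \<longleftrightarrow> K <= Dinv ((Dinv ^^ e) L)" by (rule Dgen_le_iff[OF Dinv_pow_submodule[OF L] Kc])
 finally show ?case by simp
qed simp

text \<open>The root is replaced by the stable member of the chain of its submodules \<open>(Dgen ^^ e) M0\<close>; this is
 the smallest root, and the only one whose generators are all needed modulo a prime.\<close>

lemma minimal_root_exists:
 assumes N: "noeth_ring A"
  and stab: "\<And>d U. is_matrix A d d U ==> \<exists>e0. \<forall>e\<ge>e0. stab_seq A p J b d U e = stab_seq A p J b d U e0"
  and S: "finite S" "S <= carrier M" and SD: "S <= Dinv (gen_submodule A M S)"
  and gen: "\<And>y. y : carrier M ==> \<exists>e. y : (Dinv ^^ e) (gen_submodule A M S)"
 obtains d U x g where "1 \<le> d" "is_matrix A d d U" "represents_root A p d U M Frob_inv"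
  "\<And>i. i < d ==> x i : carrier M"
  "g : mod_hom A (vecs A d) M" "g ` carrier (vecs A d) = gen_submodule A M (x ` {..<d})"
  "\<And>v j. v : carrier (vecs A d) ==> j : J ==> D j (g v) = g (DV d j (mat_vec A d d U v))"
  "\<And>y. y : carrier M ==> \<exists>e. y : (Dinv ^^ e) (gen_submodule A M (x ` {..<d}))"
  "g ` stable_K A p d U = gen_submodule A M (x ` {..<d})"
proof -
 define M0 where "M0 = gen_submodule A M S"
 have M0: "submodule M0 A M" unfolding M0_def by (rule gen_submodule_is_submodule[OF is_mod S(2)])
 obtain n x0 where "S = x0 ` {i::nat. i < n}" using finite_imp_nat_seg_image_inj_on[OF S(1)] by blast
 then have Sx: "S = x0 ` {..<n}" by (simp add: lessThan_def)
 have x0: "x0 i : carrier M" if "i < n" for i using S(2) Sx that by auto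
 obtain U0 where U0: "is_matrix A n n U0" "\<And>i. i < n ==> x0 i = (\<Oplus>\<^bsub>M\<^esub>j\<in>{..<n}. U0 j i *\<^sub>M \<phi> (x0 j))"
  using Frob_matrix_exists[of n x0] x0 SD unfolding Sx by blast
 \<comment> \<open>Stabilisation is applied to the matrix \<open>U0\<close> of the given root, and
   \<open>gmap\<close> transports it to M. The matrix U of the smaller root is chosen only
   afterwards.\<close>
 obtain e0 where e0: "\<And>e. e \<ge> e0 ==> stab_seq A p J b n U0 e = stab_seq A p J b n U0 e0"
  using stab[OF U0(1)] by blast
 define M1 where "M1 = (Dgen ^^ e0) M0"
 have gM0: "gmap n x0 ` carrier (vecs A n) = M0" unfolding M0_def Sx by (rule gmap_image[OF x0 U0])
 have gs: "gmap n x0 ` stab_seq A p J b n U0 e = (Dgen ^^ e) M0" for e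
  unfolding gM0[symmetric] by (rule gmap_stab_seq[OF x0 U0])
 have M1: "submodule M1 A M" unfolding M1_def by (rule Dgen_pow_submodule[OF M0])
 have D1: "Dgen M1 = M1" using gs[of "Suc e0"] gs[of e0] e0[of "Suc e0"] unfolding M1_def by simp
 have "Dgen M0 <= M0"
 proof -
  have "Dgen S <= M0" using Dgen_le_iff[OF M0 S(2)] SD unfolding M0_def by simp
  then show ?thesis unfolding M0_def using Dgen_gen[OF S(2)] by simp
 qed
 have M1M0: "M1 <= M0"
 proof -
  have "(Dgen ^^ e) M0 <= M0" for e
   by (induction e) (use \<open>Dgen M0 <= M0\<close> Dgen_mono in \<open>auto, blast\<close>)
  then show ?thesis unfolding M1_def .
 qed
 obtain T where T: "finite T" "T <= M1" "M1 = gen_submodule A M T"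
  using noeth_gen[OF N is_mod S M1 M1M0[unfolded M0_def]] by blast
 \<comment> \<open>Adding 0 to the generators ensures that there is at least one, also for the zero
   module, so that d >= 1.\<close>
 define T' where "T' = insert 0\<^sub>M T"
 have T': "finite T'" "T' <= M1" "T' \<noteq> {}" using T submodule_zero[OF M1] by (auto simp: T'_def)
 have M1T': "M1 = gen_submodule A M T'"
 proof
  show "M1 <= gen_submodule A M T'" using T(3) gen_submodule_mono[of T T' A M] by (auto simp: T'_def)
  show "gen_submodule A M T' <= M1" by (rule gen_submodule_minimal[OF is_mod M1 T'(2)])
 qed
 obtain d x where "T' = x ` {i::nat. i < d}" using finite_imp_nat_seg_image_inj_on[OF T'(1)] by blast
 then have Tx: "T' = x ` {..<d}" by (simp add: lessThan_def)
 have d: "1 \<le> d" using T'(3) Tx by (cases d) auto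
 have x: "x i : carrier M" if "i < d" for i using T'(2) M.submoduleE(1)[OF M1] Tx that by blast
 have M1x: "M1 = gen_submodule A M (x ` {..<d})" using M1T' Tx by simp
 have "M1 <= Dinv M1" using Dgen_le_iff[OF M1 M.submoduleE(1)[OF M1]] D1 by simp
 then have xD: "x i : Dinv (gen_submodule A M (x ` {..<d}))" if "i < d" for i
  using T'(2) Tx that unfolding M1x[symmetric] by blast
 obtain U where U: "is_matrix A d d U" "\<And>i. i < d ==> x i = (\<Oplus>\<^bsub>M\<^esub>j\<in>{..<d}. U j i *\<^sub>M \<phi> (x j))"
  using Frob_matrix_exists[OF x xD] by blast
 obtain e1 where e1: "\<And>e. e \<ge> e1 ==> stab_seq A p J b d U e = stab_seq A p J b d U e1"
  using stab[OF U(1)] by blast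
 have gM1: "gmap d x ` carrier (vecs A d) = M1" unfolding M1x by (rule gmap_image[OF x U])
 \<comment> \<open>As \<open>Dgen M1 = M1\<close>, every member of the chain for U, the stable one
   included, is mapped onto M1.\<close>
 have K: "gmap d x ` stable_K A p d U = M1"
 proof -
  have "(Dgen ^^ e) M1 = M1" for e by (induction e) (use D1 in auto)
  moreover have "stable_K A p d U = stab_seq A p J b d U e1" by (rule stable_K_eq[OF U(1)]) (rule e1)
  ultimately show ?thesis by (simp add: gmap_stab_seq[OF x U] gM1)
 qed
 have gen1: "\<exists>e. y : (Dinv ^^ e) M1" if y: "y : carrier M" for y
 proof -
  obtain e where e: "y : (Dinv ^^ e) M0" using gen[OF y] unfolding M0_def by blast
  \<comment> \<open>M1 is \<open>Dgen\<close> applied e0 times to M0; by the adjunction M0 lies in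
    \<open>Dinv\<close> applied e0 times to M1, so the smaller module still generates M.\<close>
  have "M0 <= (Dinv ^^ e0) M1" using Dgen_pow_le_iff[OF M1 M0, of e0] unfolding M1_def by simp
  then have "y : (Dinv ^^ e) ((Dinv ^^ e0) M1)" using Dinv_pow_mono e by blast
  then have "y : (Dinv ^^ (e + e0)) M1" by (simp add: funpow_add)
  then show ?thesis by blast
 qed
 have rep: "represents_root A p d U M Frob_inv"
  by (rule represents_rootI[OF x U N]) (use gen1 gM1 in auto)
 show ?thesis
  by (rule that[OF d U(1) rep x gmap_hom[OF x U] gmap_image[OF x U]]) (use D_gmap[OF x U] gen1 K M1x in auto)
qed

end

section \<open>Localization\<close>

locale localization = cring A for A :: "('a, 'x) ring_scheme" (structure) +
 fixes S :: "'a set"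
 assumes S_sub: "S <= carrier A" and one_S [simp]: "\<one> : S"
  and mult_S [simp]: "\<And>s t. s : S ==> t : S ==> s \<otimes> t : S"
begin

lemma S_closed [simp]: "s : S ==> s : carrier A" using S_sub by auto

lemma pow_S [simp]: "s : S ==> s [^] (n::nat) : S" by (induction n) auto

abbreviation fr where "fr \<equiv> fraction A S (reg A)"
abbreviation L where "L \<equiv> loc_ring A S"

lemma fr_mem_iff: "(b, t) : fr a s \<longleftrightarrow> b : carrier A \<and> t : S \<and> (\<exists>u\<in>S. u \<otimes> (t \<otimes> a) = u \<otimes> (s \<otimes> b))"
 by (auto simp: fraction_def)

lemma fr_rel_trans:
 assumes "u : S" "u \<otimes> (t \<otimes> a) = u \<otimes> (s \<otimes> b)" "v : S" "v \<otimes> (r \<otimes> b) = v \<otimes> (t \<otimes> c)"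
  "a : carrier A" "b : carrier A" "c : carrier A" "s : S" "t : S" "r : S"
 shows "\<exists>w\<in>S. w \<otimes> (r \<otimes> a) = w \<otimes> (s \<otimes> c)"
proof
 \<comment> \<open>The factor t eliminates the middle fraction b/t.\<close>
 show "u \<otimes> v \<otimes> t : S" using assms by simp
 note cl = assms(1,3,5-)
 have "(u \<otimes> v \<otimes> t) \<otimes> (r \<otimes> a) = (v \<otimes> r) \<otimes> (u \<otimes> (t \<otimes> a))" using cl by (simp add: m_ac)
 also have "\<dots> = (u \<otimes> s) \<otimes> (v \<otimes> (r \<otimes> b))" unfolding assms(2) using cl by (simp add: m_ac)
 also have "\<dots> = (u \<otimes> v \<otimes> t) \<otimes> (s \<otimes> c)" unfolding assms(4) using cl by (simp add: m_ac)
 finally show "(u \<otimes> v \<otimes> t) \<otimes> (r \<otimes> a) = (u \<otimes> v \<otimes> t) \<otimes> (s \<otimes> c)" .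
qed

lemma fr_eq_iff:
 assumes "a : carrier A" "b : carrier A" "s : S" "t : S"
 shows "fr a s = fr b t \<longleftrightarrow> (\<exists>u\<in>S. u \<otimes> (t \<otimes> a) = u \<otimes> (s \<otimes> b))"
proof
 assume "fr a s = fr b t"
 moreover have "(b, t) : fr b t" unfolding fr_mem_iff using assms by auto
 ultimately have "(b, t) : fr a s" by simp
 then show "\<exists>u\<in>S. u \<otimes> (t \<otimes> a) = u \<otimes> (s \<otimes> b)" unfolding fr_mem_iff by blast
next
 assume *: "\<exists>u\<in>S. u \<otimes> (t \<otimes> a) = u \<otimes> (s \<otimes> b)"
 have "(c, r) : fr a s \<longleftrightarrow> (c, r) : fr b t" for c r
 proof (cases "c : carrier A \<and> r : S")
  case True
  obtain u where u: "u : S" "u \<otimes> (t \<otimes> a) = u \<otimes> (s \<otimes> b)" using * by auto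
  show ?thesis
  proof
   assume "(c, r) : fr a s"
   then obtain v where "v : S" "v \<otimes> (r \<otimes> a) = v \<otimes> (s \<otimes> c)" by (auto simp: fr_mem_iff)
   then have "\<exists>w\<in>S. w \<otimes> (r \<otimes> b) = w \<otimes> (t \<otimes> c)"
    using fr_rel_trans[of u s b t a v r c] u True assms by metis
   then show "(c, r) : fr b t" using True by (auto simp: fr_mem_iff)
  next
   assume "(c, r) : fr b t"
   then obtain v where "v : S" "v \<otimes> (r \<otimes> b) = v \<otimes> (t \<otimes> c)" by (auto simp: fr_mem_iff)
   then have "\<exists>w\<in>S. w \<otimes> (r \<otimes> a) = w \<otimes> (s \<otimes> c)"
    using fr_rel_trans[of u t a s b v r c] u True assms by metis
   then show "(c, r) : fr a s" using True by (auto simp: fr_mem_iff)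
  qed
 qed (auto simp: fr_mem_iff)
 then show "fr a s = fr b t" by auto
qed

lemma fr_eqI:
 "a : carrier A ==> b : carrier A ==> s : S ==> t : S ==> t \<otimes> a = s \<otimes> b ==> fr a s = fr b t"
 by (subst fr_eq_iff) auto

lemma fr_mem_self: "a : carrier A ==> s : S ==> (a, s) : fr a s" by (auto simp: fr_mem_iff)

text \<open>The operations of \<open>loc_ring\<close> are unions over all representatives; such a
  union is evaluated once its members are known to agree.\<close>

lemma fr_UN:
 assumes "a : carrier A" "s : S"
  and "\<And>b t. b : carrier A ==> t : S ==> fr b t = fr a s ==> F b t = c"
 shows "(\<Union>(b, t)\<in>fr a s. F b t) = c"
proof -
 have "F b t = c" if "(b, t) : fr a s" for b t
 proof -
  have bt: "b : carrier A" "t : S" "\<exists>u\<in>S. u \<otimes> (t \<otimes> a) = u \<otimes> (s \<otimes> b)" using that by (auto simp: fr_mem_iff)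
  then have "fr a s = fr b t" using assms(1,2) by (subst fr_eq_iff) auto
  then show ?thesis using assms(3) bt by auto
 qed
 then show ?thesis using fr_mem_self[OF assms(1,2)] by fastforce
qed

lemma L_carrier: "X : carrier L \<longleftrightarrow> (\<exists>a\<in>carrier A. \<exists>s\<in>S. X = fr a s)"
 by (auto simp: loc_ring_def loc_module_def)

lemma fr_closed [simp]: "a : carrier A ==> s : S ==> fr a s : carrier L" by (auto simp: L_carrier)

lemma L_zero: "0\<^sub>L = fr \<zero> \<one>" by (simp add: loc_ring_def loc_module_def)

lemma L_one: "1\<^sub>L = fr \<one> \<one>" by (simp add: loc_ring_def)

lemma fr_add_wd:
 assumes "a : carrier A" "a' : carrier A" "b : carrier A" "s : S" "s' : S" "t : S" "fr a' s' = fr a s"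
 shows "fr (t \<otimes> a' \<oplus> s' \<otimes> b) (s' \<otimes> t) = fr (t \<otimes> a \<oplus> s \<otimes> b) (s \<otimes> t)"
proof -
 obtain u where u: "u : S" "u \<otimes> (s \<otimes> a') = u \<otimes> (s' \<otimes> a)" using assms fr_eq_iff by blast
 have "u \<otimes> ((s \<otimes> t) \<otimes> (t \<otimes> a' \<oplus> s' \<otimes> b)) = t \<otimes> t \<otimes> (u \<otimes> (s \<otimes> a')) \<oplus> u \<otimes> s \<otimes> t \<otimes> s' \<otimes> b"
  using u(1) assms by (simp add: r_distr m_ac)
 also have "\<dots> = u \<otimes> ((s' \<otimes> t) \<otimes> (t \<otimes> a \<oplus> s \<otimes> b))"
  unfolding u(2) using u(1) assms by (simp add: r_distr m_ac)
 finally show ?thesis using u(1) assms by (subst fr_eq_iff) auto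
qed

lemma fr_add:
 assumes "a : carrier A" "b : carrier A" "s : S" "t : S"
 shows "fr a s +\<^sub>L fr b t = fr (t \<otimes> a \<oplus> s \<otimes> b) (s \<otimes> t)"
proof -
 have "fr a s +\<^sub>L fr b t = (\<Union>(a', s')\<in>fr a s. \<Union>(b', t')\<in>fr b t. fr (t' \<otimes> a' \<oplus> s' \<otimes> b') (s' \<otimes> t'))"
  by (simp add: loc_ring_def loc_module_def)
 also have "\<dots> = fr (t \<otimes> a \<oplus> s \<otimes> b) (s \<otimes> t)"
 proof (rule fr_UN[OF assms(1,3)], rule fr_UN[OF assms(2,4)])
  fix a' s' b' t' assume a': "a' : carrier A" "s' : S" "fr a' s' = fr a s" and b': "b' : carrier A" "t' : S" "fr b' t' = fr b t"
  have "fr (t' \<otimes> a' \<oplus> s' \<otimes> b') (s' \<otimes> t') = fr (t' \<otimes> a \<oplus> s \<otimes> b') (s \<otimes> t')"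
   using a' b' assms by (intro fr_add_wd) auto
  also have "\<dots> = fr (s \<otimes> b' \<oplus> t' \<otimes> a) (t' \<otimes> s)" using b' assms by (simp add: a_comm m_comm)
  also have "\<dots> = fr (s \<otimes> b \<oplus> t \<otimes> a) (t \<otimes> s)" using b' assms by (intro fr_add_wd) auto
  also have "\<dots> = fr (t \<otimes> a \<oplus> s \<otimes> b) (s \<otimes> t)" using assms by (simp add: a_comm m_comm)
  finally show "fr (t' \<otimes> a' \<oplus> s' \<otimes> b') (s' \<otimes> t') = fr (t \<otimes> a \<oplus> s \<otimes> b) (s \<otimes> t)" .
 qed
 finally show ?thesis .
qed

lemma fr_smult:
 assumes "a : carrier A" "x : carrier A" "s : S"
 shows "x *\<^sub>L fr a s = fr (x \<otimes> a) s"
proof -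
 have "x *\<^sub>L fr a s = (\<Union>(a', s')\<in>fr a s. fr (x \<otimes> a') s')" by (simp add: loc_ring_def loc_module_def)
 also have "\<dots> = fr (x \<otimes> a) s"
 proof (rule fr_UN[OF assms(1,3)])
  fix a' s' assume a': "a' : carrier A" "s' : S" "fr a' s' = fr a s"
  then obtain u where u: "u : S" "u \<otimes> (s \<otimes> a') = u \<otimes> (s' \<otimes> a)" using assms fr_eq_iff by blast
  have "u \<otimes> (s \<otimes> (x \<otimes> a')) = x \<otimes> (u \<otimes> (s \<otimes> a'))" using u(1) a' assms by (simp add: m_ac)
  also have "\<dots> = u \<otimes> (s' \<otimes> (x \<otimes> a))" unfolding u(2) using u(1) a' assms by (simp add: m_ac)
  finally show "fr (x \<otimes> a') s' = fr (x \<otimes> a) s" using u(1) a' assms by (subst fr_eq_iff) auto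
 qed
 finally show ?thesis .
qed

lemma fr_mult_wd:
 assumes "a : carrier A" "a' : carrier A" "b : carrier A" "s : S" "s' : S" "t : S" "fr a' s' = fr a s"
 shows "fr (a' \<otimes> b) (s' \<otimes> t) = fr (a \<otimes> b) (s \<otimes> t)"
proof -
 obtain u where u: "u : S" "u \<otimes> (s \<otimes> a') = u \<otimes> (s' \<otimes> a)" using assms fr_eq_iff by blast
 have "u \<otimes> ((s \<otimes> t) \<otimes> (a' \<otimes> b)) = t \<otimes> b \<otimes> (u \<otimes> (s \<otimes> a'))" using u(1) assms by (simp add: m_ac)
 also have "\<dots> = u \<otimes> ((s' \<otimes> t) \<otimes> (a \<otimes> b))" unfolding u(2) using u(1) assms by (simp add: m_ac)
 finally show ?thesis using u(1) assms by (subst fr_eq_iff) auto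
qed

lemma fr_mult:
 assumes "a : carrier A" "b : carrier A" "s : S" "t : S"
 shows "fr a s \<otimes>\<^sub>L fr b t = fr (a \<otimes> b) (s \<otimes> t)"
proof -
 have "fr a s \<otimes>\<^sub>L fr b t = (\<Union>(a', s')\<in>fr a s. \<Union>(b', t')\<in>fr b t. fr (a' \<otimes> b') (s' \<otimes> t'))"
  by (simp add: loc_ring_def)
 also have "\<dots> = fr (a \<otimes> b) (s \<otimes> t)"
 proof (rule fr_UN[OF assms(1,3)], rule fr_UN[OF assms(2,4)])
  fix a' s' b' t' assume a': "a' : carrier A" "s' : S" "fr a' s' = fr a s" and b': "b' : carrier A" "t' : S" "fr b' t' = fr b t"
  have "fr (a' \<otimes> b') (s' \<otimes> t') = fr (a \<otimes> b') (s \<otimes> t')" using a' b' assms by (intro fr_mult_wd) auto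
  also have "\<dots> = fr (b' \<otimes> a) (t' \<otimes> s)" using b' assms by (simp add: m_comm)
  also have "\<dots> = fr (b \<otimes> a) (t \<otimes> s)" using b' assms by (intro fr_mult_wd) auto
  also have "\<dots> = fr (a \<otimes> b) (s \<otimes> t)" using assms by (simp add: m_comm)
  finally show "fr (a' \<otimes> b') (s' \<otimes> t') = fr (a \<otimes> b) (s \<otimes> t)" .
 qed
 finally show ?thesis .
qed

lemma fr_cancel: "a : carrier A ==> s : S ==> t : S ==> fr (t \<otimes> a) (t \<otimes> s) = fr a s"
 by (rule fr_eqI) (auto simp: m_ac)

lemma fr_add_same: "a : carrier A ==> b : carrier A ==> s : S ==> fr a s +\<^sub>L fr b s = fr (a \<oplus> b) s"
 using fr_cancel[of "a \<oplus> b" s s] by (simp add: fr_add r_distr)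

lemma fr_zero: "s : S ==> fr \<zero> s = 0\<^sub>L" unfolding L_zero by (rule fr_eqI) auto

lemma fr_eq_zero_iff: "a : carrier A ==> s : S ==> fr a s = 0\<^sub>L \<longleftrightarrow> (\<exists>u\<in>S. u \<otimes> a = \<zero>)"
 unfolding L_zero by (subst fr_eq_iff) auto

lemma common_denom2:
 assumes "X : carrier L" "Y : carrier L"
 obtains a b s where "a : carrier A" "b : carrier A" "s : S" "X = fr a s" "Y = fr b s"
proof -
 obtain a s b t where "a : carrier A" "s : S" "X = fr a s" "b : carrier A" "t : S" "Y = fr b t"
  using assms by (auto simp: L_carrier)
 then show ?thesis using that[of "t \<otimes> a" "s \<otimes> b" "t \<otimes> s"] fr_cancel[of a s t] fr_cancel[of b t s] by (simp add: m_comm)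
qed

text \<open>Serves for common denominators and also, with Q j u saying that u kills the j-th
  coordinate, for common annihilators.\<close>

lemma common_multiple:
 assumes "finite F" "\<And>j. j : F ==> \<exists>s\<in>S. Q j s" "\<And>j s r. j : F ==> s : S ==> r : S ==> Q j s ==> Q j (r \<otimes> s)"
 shows "\<exists>s\<in>S. \<forall>j\<in>F. Q j s" using assms
proof (induction F)
 case empty
 show ?case using one_S by blast
next
 case (insert k F)
 obtain s where s: "s : S" "\<forall>j\<in>F. Q j s" using insert by auto
 obtain t where t: "t : S" "Q k t" using insert.prems(1) by auto
 show ?case using s t insert.prems(2)[OF _ s(1) t(1)] insert.prems(2)[OF _ t(1) s(1)] m_comm[of s t]
  by (intro bexI[of _ "t \<otimes> s"]) auto
qed

lemma common_denom:
 assumes "finite F" "\<And>j. j : F ==> y j : carrier L"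
 shows "\<exists>s\<in>S. \<exists>a. \<forall>j\<in>F. a j : carrier A \<and> y j = fr (a j) s"
proof -
 have "\<exists>s\<in>S. \<forall>j\<in>F. \<exists>c. c : carrier A \<and> y j = fr c s"
 proof (rule common_multiple[OF assms(1)])
  show "\<exists>s\<in>S. \<exists>c. c : carrier A \<and> y j = fr c s" if "j : F" for j using assms(2)[OF that] by (auto simp: L_carrier)
  show "\<exists>c. c : carrier A \<and> y j = fr c (r \<otimes> s)"
   if "s : S" "r : S" "\<exists>c. c : carrier A \<and> y j = fr c s" for j s r
   using that fr_cancel[of _ s r] by (metis S_closed m_closed)
 qed
 then show ?thesis by metis
qed

lemma L_ab: "abelian_group L"
proof (rule abelian_groupI)
 fix X Y Z assume X: "X : carrier L" and Y: "Y : carrier L" and Z: "Z : carrier L"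
 obtain a s b t c r where e: "a : carrier A" "s : S" "X = fr a s" "b : carrier A" "t : S" "Y = fr b t"
  "c : carrier A" "r : S" "Z = fr c r" using X Y Z by (auto simp: L_carrier)
 show "X +\<^sub>L Y +\<^sub>L Z = X +\<^sub>L (Y +\<^sub>L Z)" unfolding e(3,6,9) using e(1,2,4,5,7,8)
  by (simp add: fr_add r_distr m_ac a_ac)
next
 fix X Y assume X: "X : carrier L" and Y: "Y : carrier L"
 then obtain a s b t where e: "a : carrier A" "s : S" "X = fr a s" "b : carrier A" "t : S" "Y = fr b t"
  by (auto simp: L_carrier)
 show "X +\<^sub>L Y : carrier L" using e by (simp add: fr_add)
 show "X +\<^sub>L Y = Y +\<^sub>L X" using e by (simp add: fr_add m_comm a_comm)
next
 show "0\<^sub>L : carrier L" by (simp add: L_zero)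
 fix X assume X: "X : carrier L"
 then obtain a s where e: "a : carrier A" "s : S" "X = fr a s" by (auto simp: L_carrier)
 show "0\<^sub>L +\<^sub>L X = X" using e by (simp add: L_zero fr_add)
 show "\<exists>Y\<in>carrier L. Y +\<^sub>L X = 0\<^sub>L"
  using e by (intro bexI[of _ "fr (\<ominus> a) s"]) (auto simp: fr_add_same l_neg fr_zero)
qed

lemma L_cring: "cring L"
proof (rule cringI[OF L_ab])
 show "comm_monoid L"
 proof (rule comm_monoidI)
  fix X Y Z assume X: "X : carrier L" and Y: "Y : carrier L" and Z: "Z : carrier L"
  obtain a s b t c r where e: "a : carrier A" "s : S" "X = fr a s" "b : carrier A" "t : S" "Y = fr b t"
   "c : carrier A" "r : S" "Z = fr c r" using X Y Z by (auto simp: L_carrier)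
  show "X \<otimes>\<^sub>L Y \<otimes>\<^sub>L Z = X \<otimes>\<^sub>L (Y \<otimes>\<^sub>L Z)" unfolding e(3,6,9) using e(1,2,4,5,7,8)
   by (simp add: fr_mult m_ac)
 next
  fix X Y assume X: "X : carrier L" and Y: "Y : carrier L"
  then obtain a s b t where e: "a : carrier A" "s : S" "X = fr a s" "b : carrier A" "t : S" "Y = fr b t"
   by (auto simp: L_carrier)
  show "X \<otimes>\<^sub>L Y : carrier L" using e by (simp add: fr_mult)
  show "X \<otimes>\<^sub>L Y = Y \<otimes>\<^sub>L X" using e by (simp add: fr_mult m_comm)
 next
  show "1\<^sub>L : carrier L" by (simp add: L_one)
  fix X assume X: "X : carrier L"
  then obtain a s where e: "a : carrier A" "s : S" "X = fr a s" by (auto simp: L_carrier)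
  show "1\<^sub>L \<otimes>\<^sub>L X = X" using e by (simp add: L_one fr_mult)
 qed
 fix X Y Z assume X: "X : carrier L" and Y: "Y : carrier L" and Z: "Z : carrier L"
 obtain a b s where e: "a : carrier A" "b : carrier A" "s : S" "X = fr a s" "Y = fr b s"
  using common_denom2[OF X Y] .
 obtain c r where e': "c : carrier A" "r : S" "Z = fr c r" using Z by (auto simp: L_carrier)
 show "(X +\<^sub>L Y) \<otimes>\<^sub>L Z = X \<otimes>\<^sub>L Z +\<^sub>L Y \<otimes>\<^sub>L Z"
  unfolding e(4,5) e'(3) using e(1-3) e'(1,2) by (simp add: fr_mult fr_add_same l_distr)
qed

lemma L_module: "Module.module A L"
proof (rule moduleI[OF is_cring L_ab])
 fix x y X assume x: "x : carrier A" and y: "y : carrier A" and X: "X : carrier L"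
 then obtain a s where e: "a : carrier A" "s : S" "X = fr a s" by (auto simp: L_carrier)
 show "(x \<oplus> y) *\<^sub>L X = x *\<^sub>L X +\<^sub>L y *\<^sub>L X" using e x y by (simp add: fr_smult fr_add_same l_distr)
 show "x \<otimes> y *\<^sub>L X = x *\<^sub>L (y *\<^sub>L X)" using e x y by (simp add: fr_smult m_assoc)
next
 fix x X Y assume x: "x : carrier A" and X: "X : carrier L" and Y: "Y : carrier L"
 obtain a b s where e: "a : carrier A" "b : carrier A" "s : S" "X = fr a s" "Y = fr b s"
  using common_denom2[OF X Y] .
 show "x *\<^sub>L (X +\<^sub>L Y) = x *\<^sub>L X +\<^sub>L x *\<^sub>L Y" using e x by (simp add: fr_smult fr_add_same r_distr)
next
 fix x X assume x: "x : carrier A" and X: "X : carrier L"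
 then obtain a s where e: "a : carrier A" "s : S" "X = fr a s" by (auto simp: L_carrier)
 show "x *\<^sub>L X : carrier L" using e x by (simp add: fr_smult)
next
 fix X assume X: "X : carrier L"
 then obtain a s where e: "a : carrier A" "s : S" "X = fr a s" by (auto simp: L_carrier)
 show "\<one> *\<^sub>L X = X" using e by (simp add: fr_smult)
qed

lemma loc_map_closed: "a : carrier A ==> loc_map A S a : carrier L" by (simp add: loc_map_def)

lemma loc_map_mult: "a : carrier A ==> X : carrier L ==> loc_map A S a \<otimes>\<^sub>L X = a *\<^sub>L X"
 by (auto simp: L_carrier loc_map_def fr_mult fr_smult)

lemma loc_map_hom: "loc_map A S : ring_hom A L"
 by (rule ring_hom_memI) (auto simp: loc_map_def fr_mult fr_add_same L_one)

lemma fr_pow: "a : carrier A ==> s : S ==> fr a s ^\<^sub>L (n::nat) = fr (a [^] n) (s [^] n)"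
proof (induction n)
 case 0
 then show ?case by (simp add: L_one)
next
 case (Suc n)
 then show ?case by (simp add: fr_mult)
qed

lemma fr_finsum:
 assumes "finite F" "\<And>j. j : F ==> a j : carrier A" "s : S"
 shows "(\<Oplus>\<^bsub>L\<^esub>j\<in>F. fr (a j) s) = fr (\<Oplus>j\<in>F. a j) s"
 by (rule additive_finsum[OF is_abelian_group L_ab, symmetric]) (use assms in \<open>auto simp: fr_add_same\<close>)

end

locale frob_localization = localization A S + frob_ring A p J b
 for A :: "('a, 'x) ring_scheme" (structure) and S p and J :: "'j set" and b
begin

lemma L_frob_semilin: "(\<lambda>X. X ^\<^sub>L p) : semilin A p L L"
proof (rule semilinI)
 fix X Y assume X: "X : carrier L" and Y: "Y : carrier L"
 obtain a b s where e: "a : carrier A" "b : carrier A" "s : S" "X = fr a s" "Y = fr b s"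
  using common_denom2[OF X Y] .
 show "(X +\<^sub>L Y) ^\<^sub>L p = X ^\<^sub>L p +\<^sub>L Y ^\<^sub>L p" using e by (simp add: fr_add_same fr_pow add_pow)
next
 fix X assume X: "X : carrier L"
 then obtain a s where e: "a : carrier A" "s : S" "X = fr a s" by (auto simp: L_carrier)
 show "X ^\<^sub>L p : carrier L" using e by (simp add: fr_pow)
 show "(x *\<^sub>L X) ^\<^sub>L p = (x [^] p) *\<^sub>L X ^\<^sub>L p" if "x : carrier A" for x
  using e that by (simp add: fr_smult fr_pow nat_pow_distrib)
qed

lemma bsum_fr:
 assumes F: "finite F" "F <= J" and a: "\<And>j. j : F ==> a j : carrier A" and s: "s : S"
 shows "bsum b (\<lambda>X. X ^\<^sub>L p) L F (\<lambda>j. fr (a j) s) = fr (\<Oplus>j\<in>F. b j \<otimes> a j [^] p) (s [^] p)"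
proof -
 have "bsum b (\<lambda>X. X ^\<^sub>L p) L F (\<lambda>j. fr (a j) s) = (\<Oplus>\<^bsub>L\<^esub>j\<in>F. fr (b j \<otimes> a j [^] p) (s [^] p))"
  unfolding bsum_def using assms b_closed
  by (intro abelian_monoid.finsum_cong' abelian_group.axioms L_ab) (auto simp: fr_smult fr_pow)
 also have "\<dots> = fr (\<Oplus>j\<in>F. b j \<otimes> a j [^] p) (s [^] p)" using assms b_closed by (intro fr_finsum) auto
 finally show ?thesis .
qed

lemma unit_loc: "unit_mod A p J b L (\<lambda>X. X ^\<^sub>L p)" unfolding unit_mod_def
proof (intro conjI L_module L_frob_semilin ballI allI impI)
 interpret r: unit_module A p J b "reg A" "\<lambda>x. x [^] p" by (rule unit_module_reg)
 {
  fix X assume "X : carrier L"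
  then obtain a s where e: "a : carrier A" "s : S" "X = fr a s" by (auto simp: L_carrier)
  \<comment> \<open>The fraction a/s is rewritten as (a s^(p-1))/s^p, so that after expanding the
    numerator each p-th power takes one factor s into its own denominator.\<close>
  define a' where "a' = a \<otimes> s [^] (p - 1)"
  have a': "a' : carrier A" using e by (simp add: a'_def)
  have sp: "s [^] p = s \<otimes> s [^] (p - 1)" using p_pos e(2) nat_pow_Suc2[of s "p - 1"] by simp
  have Xa: "X = fr a' (s [^] p)" unfolding a'_def sp using e fr_cancel[of a s "s [^] (p - 1)"] by (simp add: m_comm)
  obtain F where F: "finite F" "F <= J" "a' = r.bs F (\<lambda>j. r.D j a')"
   by (rule r.D_expand[of a' "{}"]) (use a' in auto)
  have D: "r.D j a' : carrier A" for j using r.D_closed[of a' j] a' by simp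
  have "bsum b (\<lambda>X. X ^\<^sub>L p) L F (\<lambda>j. fr (r.D j a') s) = X"
   using bsum_fr[OF F(1,2), of "\<lambda>j. r.D j a'" s] D e(2) F(3) Xa by (simp add: bsum_def)
  then show "\<exists>F y. finite F \<and> F <= J \<and> (\<forall>j. y j : carrier L) \<and> X = bsum b (\<lambda>X. X ^\<^sub>L p) L F y"
   using F D e(2) by (intro exI[of _ F] exI[of _ "\<lambda>j. fr (r.D j a') s"]) auto
 }
 fix F y j assume F: "finite F" "F <= J" and y: "\<forall>j. y j : carrier L"
  and z: "bsum b (\<lambda>X. X ^\<^sub>L p) L F y = 0\<^sub>L" and j: "j : F"
 obtain s a where s: "s : S" and a: "\<And>j. j : F ==> a j : carrier A \<and> y j = fr (a j) s"
  using common_denom[OF F(1), of y] y by blast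
 have "bsum b (\<lambda>X. X ^\<^sub>L p) L F y = bsum b (\<lambda>X. X ^\<^sub>L p) L F (\<lambda>j. fr (a j) s)"
  unfolding bsum_def using a s F b_closed semilin_closed[OF L_frob_semilin] Module.module.smult_closed[OF L_module]
  by (intro abelian_monoid.finsum_cong' abelian_group.axioms L_ab) auto
 also have "\<dots> = fr (\<Oplus>j\<in>F. b j \<otimes> a j [^] p) (s [^] p)" using bsum_fr[OF F, of a s] a s by auto
 finally have "fr (\<Oplus>j\<in>F. b j \<otimes> a j [^] p) (s [^] p) = 0\<^sub>L" using z by simp
 moreover have c: "(\<lambda>j. b j \<otimes> a j [^] p) : F \<rightarrow> carrier A" using F a b_closed by auto
 ultimately obtain u where u: "u : S" "u \<otimes> (\<Oplus>j\<in>F. b j \<otimes> a j [^] p) = \<zero>"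
  using s fr_eq_zero_iff[of "\<Oplus>j\<in>F. b j \<otimes> a j [^] p" "s [^] p"] by auto
 \<comment> \<open>Multiplying by u^p instead of u allows the factor to be moved into the
   components, where independence over A applies.\<close>
 have up: "u [^] p = u [^] (p - 1) \<otimes> u" using p_pos by (cases p) auto
 have "r.bs F (\<lambda>j. u \<otimes> a j) = (\<Oplus>j\<in>F. u [^] p \<otimes> (b j \<otimes> a j [^] p))"
  unfolding bsum_def finsum_reg using u F a b_closed
  by (intro finsum_cong') (auto simp: nat_pow_distrib m_ac)
 also have "\<dots> = u [^] p \<otimes> (\<Oplus>j\<in>F. b j \<otimes> a j [^] p)"
  using Module.module.finsum_smult_ldistr[OF reg_is_module[OF is_cring] F(1), of "u [^] p" "\<lambda>j. b j \<otimes> a j [^] p"] c u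
  by simp
 also have "\<dots> = \<zero>" unfolding up using u finsum_closed[OF c] by (simp add: m_assoc)
 finally have *: "r.bs F (\<lambda>j. u \<otimes> a j) = 0\<^sub>(reg A)" by simp
 have "u \<otimes> a j = 0\<^sub>(reg A)" by (rule r.bs_zero_imp[OF F _ * j]) (use a u in auto)
 then show "y j = 0\<^sub>L" using a[OF j] s u fr_eq_zero_iff by auto
qed

text \<open>The same expansions read over two rings: b j acts on the localization as its image does,
  so the basis of A becomes a basis of the localized ring over its p-th powers.\<close>

lemma frob_ring_loc: "frob_ring L p J (\<lambda>j. loc_map A S (b j))"
proof (intro frob_ring.intro L_cring frob_ring_axioms.intro p_pos)
 interpret l: unit_module A p J b L "\<lambda>X. X ^\<^sub>L p" by unfold_locales (rule unit_loc)
 let ?b = "\<lambda>j. loc_map A S (b j)" and ?ph = "\<lambda>X. X ^\<^sub>L p"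
 interpret Lr: cring L by (rule L_cring)
 show "loc_map A S (b j) : carrier L" if "j : J" for j using b_closed[OF that] by (rule loc_map_closed)
 have bs: "bsum ?b ?ph (reg L) F y = l.bs F y" if "F <= J" "\<And>j. j : F ==> y j : carrier L" for F y
  unfolding bsum_def finsum_reg using that b_closed
  by (intro l.M.M.finsum_cong') (auto simp: loc_map_mult)
 show "unit_mod L p J ?b (reg L) ?ph" unfolding unit_mod_def
 proof (intro conjI reg_is_module L_cring ballI allI impI)
  show "?ph : semilin L p (reg L) (reg L)"
   using semilinD[OF L_frob_semilin] by (intro semilinI) (auto simp: Lr.nat_pow_distrib)
  fix X assume X: "X : carrier (reg L)"
  then have "X : carrier L" by simp
  then obtain F where F: "finite F" "F <= J" "X = l.bs F (\<lambda>j. l.D j X)" by (rule l.D_expand[of X "{}"]) auto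
  have D: "l.D j X : carrier L" for j using X by simp
  show "\<exists>F y. finite F \<and> F <= J \<and> (\<forall>j. y j : carrier (reg L)) \<and> X = bsum ?b ?ph (reg L) F y"
   using F bs[OF F(2), of "\<lambda>j. l.D j X"] D by (intro exI[of _ F] exI[of _ "\<lambda>j. l.D j X"]) auto
 next
  fix F y j assume F: "finite F" "F <= J" and y: "\<forall>j. y j : carrier (reg L)"
   and z: "bsum ?b ?ph (reg L) F y = 0\<^sub>(reg L)" and j: "j : F"
  have *: "l.bs F y = 0\<^sub>L" using z bs[OF F(2), of y] y by simp
  have "y j = 0\<^sub>L" by (rule l.bs_zero_imp[OF F _ * j]) (use y in auto)
  then show "y j = 0\<^sub>(reg L)" by simp
 qed
qed

end

section \<open>The Cech complex\<close>

text \<open>One construction for two purposes: for l the identity it is the restriction map of the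
  Cech complex (\<open>res_eq\<close>), for l a localization map it compares the complexes before
  and after localizing.\<close>

definition loc_lift ::
 "('a => 'c) => ('c, 'y) ring_scheme => 'c set => ('a \<times> 'a) set => ('c \<times> 'c) set" where
 "loc_lift l A' S' X = (\<Union>(a, s)\<in>X. fraction A' S' (reg A') (l a) (l s))"

lemma loc_lift_fr:
 assumes "localization A S" "localization A' S'" and l: "l : ring_hom A A'" and lS: "\<And>s. s : S ==> l s : S'"
  and a: "a : carrier A" and s: "s : S"
 shows "loc_lift l A' S' (fraction A S (reg A) a s) = fraction A' S' (reg A') (l a) (l s)"
proof -
 interpret A: localization A S by fact
 interpret A': localization A' S' by fact
 note lc = ring_hom_closed[OF l] and lm = ring_hom_mult[OF l]
 show ?thesis unfolding loc_lift_def
 proof (rule A.fr_UN[OF a s])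
  fix b t assume b: "b : carrier A" "t : S" "A.fr b t = A.fr a s"
  then obtain u where u: "u : S" "u \<otimes>\<^sub>A (s \<otimes>\<^sub>A b) = u \<otimes>\<^sub>A (t \<otimes>\<^sub>A a)" using A.fr_eq_iff[OF b(1) a b(2) s] by auto
  have "l u \<otimes>\<^sub>A' (l s \<otimes>\<^sub>A' l b) = l (u \<otimes>\<^sub>A (s \<otimes>\<^sub>A b))" using u(1) s b by (simp add: lm)
  also have "\<dots> = l u \<otimes>\<^sub>A' (l t \<otimes>\<^sub>A' l a)" unfolding u(2) using u(1) a b by (simp add: lm)
  finally show "A'.fr (l b) (l t) = A'.fr (l a) (l s)"
   using u(1) lS lc a b s by (subst A'.fr_eq_iff) auto
 qed
qed

context
 fixes A :: "('a, 'x) ring_scheme" and S and A' :: "('c, 'y) ring_scheme" and S' and l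
 assumes A: "localization A S" and A': "localization A' S'" and l: "l : ring_hom A A'"
  and lS: "\<And>s. s : S ==> l s : S'"
begin

interpretation A: localization A S by (fact A)
interpretation A': localization A' S' by (fact A')

lemmas ll_fr = loc_lift_fr[OF A A' l lS]

lemma loc_lift_closed: "X : carrier (loc_ring A S) ==> loc_lift l A' S' X : carrier (loc_ring A' S')"
 using ring_hom_closed[OF l] lS by (auto simp: A.L_carrier ll_fr)

lemma loc_lift_add:
 assumes "X : carrier (loc_ring A S)" "Y : carrier (loc_ring A S)"
 shows "loc_lift l A' S' (X +\<^sub>(loc_ring A S) Y) = loc_lift l A' S' X +\<^sub>(loc_ring A' S') loc_lift l A' S' Y"
proof -
 obtain a b s where e: "a : carrier A" "b : carrier A" "s : S" "X = A.fr a s" "Y = A.fr b s"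
  using A.common_denom2[OF assms] .
 show ?thesis unfolding e(4,5) using e(1-3) ring_hom_closed[OF l] lS
  by (simp add: ll_fr A.fr_add_same A'.fr_add_same ring_hom_add[OF l])
qed

lemma loc_lift_smult:
 assumes "x : carrier A" "X : carrier (loc_ring A S)"
 shows "loc_lift l A' S' (x *\<^sub>(loc_ring A S) X) = l x *\<^sub>(loc_ring A' S') loc_lift l A' S' X"
proof -
 obtain a s where e: "a : carrier A" "s : S" "X = A.fr a s" using assms by (auto simp: A.L_carrier)
 show ?thesis unfolding e(3) using e(1,2) assms(1) ring_hom_closed[OF l] lS
  by (simp add: ll_fr A.fr_smult A'.fr_smult ring_hom_mult[OF l])
qed

lemma ring_hom_nat_pow: "a : carrier A ==> l (a ^\<^sub>A (n::nat)) = l a ^\<^sub>A' n"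
 by (induction n) (auto simp: ring_hom_one[OF l] ring_hom_mult[OF l])

lemma loc_lift_pow:
 assumes "X : carrier (loc_ring A S)"
 shows "loc_lift l A' S' (X ^\<^sub>(loc_ring A S) (n::nat)) = loc_lift l A' S' X ^\<^sub>(loc_ring A' S') n"
proof -
 obtain a s where e: "a : carrier A" "s : S" "X = A.fr a s" using assms by (auto simp: A.L_carrier)
 show ?thesis unfolding e(3) using e(1,2) ring_hom_closed[OF l] lS
  by (simp add: ll_fr A.fr_pow A'.fr_pow ring_hom_nat_pow)
qed

end

lemma id_ring_hom: "cring A ==> (\<lambda>x. x) : ring_hom A A" by (rule ring_hom_memI) auto

definition sg :: "nat => ('a, 'm) module => 'm => 'm" where
 "sg n M y = (if even n then y else -\<^sub>M y)"

context
 fixes A :: "('a, 'x) ring_scheme" and M :: "('a, 'm) module"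
 assumes M: "Module.module A M"
begin

interpretation M: Module.module A M by (fact M)

lemma sg_closed [simp]: "y : carrier M ==> sg n M y : carrier M" by (simp add: sg_def)

lemma sg_add_exp: "y : carrier M ==> sg m M (sg n M y) = sg (m + n) M y" by (auto simp: sg_def)

lemma sg_Suc: "y : carrier M ==> sg (Suc n) M y = -\<^sub>M sg n M y" by (auto simp: sg_def)

lemma sg_hom: "sg n M : mod_hom A M M"
 by (rule mod_homI) (auto simp: sg_def M.smult_r_minus M.M.minus_add)

text \<open>The terms cancel in pairs. The induction matches the new row with the new column, so
  there is no division by 2, which would fail in characteristic 2.\<close>

lemma antisymmetric_sum:
 assumes "finite T" "\<And>j l. c j l : carrier M" "\<And>j l. j : T ==> l : T ==> j \<noteq> l ==> c j l = -\<^sub>M c l j"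
 shows "(\<Oplus>\<^bsub>M\<^esub>j\<in>T. \<Oplus>\<^bsub>M\<^esub>l\<in>T - {j}. c j l) = 0\<^sub>M" using assms(1,3)
proof (induction T)
 case (insert t T)
 have cc: "c j l : carrier M" for j l by (rule assms(2))
 have IH: "(\<Oplus>\<^bsub>M\<^esub>j\<in>T. \<Oplus>\<^bsub>M\<^esub>l\<in>T - {j}. c j l) = 0\<^sub>M" using insert by blast
 have "(\<Oplus>\<^bsub>M\<^esub>j\<in>insert t T. \<Oplus>\<^bsub>M\<^esub>l\<in>insert t T - {j}. c j l)
  = (\<Oplus>\<^bsub>M\<^esub>l\<in>insert t T - {t}. c t l) +\<^sub>M (\<Oplus>\<^bsub>M\<^esub>j\<in>T. \<Oplus>\<^bsub>M\<^esub>l\<in>insert t T - {j}. c j l)"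
  using insert(1,2) cc by (intro M.M.finsum_insert) auto
 also have "insert t T - {t} = T" using insert(2) by auto
 also have "(\<Oplus>\<^bsub>M\<^esub>j\<in>T. \<Oplus>\<^bsub>M\<^esub>l\<in>insert t T - {j}. c j l) = (\<Oplus>\<^bsub>M\<^esub>j\<in>T. c j t +\<^sub>M (\<Oplus>\<^bsub>M\<^esub>l\<in>T - {j}. c j l))"
 proof (rule M.M.finsum_cong'[OF refl])
  fix j assume j: "j : T"
  then have "insert t T - {j} = insert t (T - {j})" using insert(2) by auto
  then show "(\<Oplus>\<^bsub>M\<^esub>l\<in>insert t T - {j}. c j l) = c j t +\<^sub>M (\<Oplus>\<^bsub>M\<^esub>l\<in>T - {j}. c j l)"
   using insert(1,2) cc by simp
 qed (use cc in \<open>auto intro!: M.M.finsum_closed\<close>)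
 also have "\<dots> = (\<Oplus>\<^bsub>M\<^esub>j\<in>T. c j t)" using IH cc by (subst M.M.finsum_addf) auto
 also have "(\<Oplus>\<^bsub>M\<^esub>l\<in>T. c t l) +\<^sub>M (\<Oplus>\<^bsub>M\<^esub>j\<in>T. c j t) = (\<Oplus>\<^bsub>M\<^esub>j\<in>T. c t j +\<^sub>M c j t)"
  using cc by (subst M.M.finsum_addf) auto
 also have "\<dots> = 0\<^sub>M"
 proof (rule M.M.add.finprod_one_eqI)
  fix j assume j: "j : T"
  then have "j \<noteq> t" using insert(2) by auto
  then have "c t j = -\<^sub>M c j t" using insert(4)[of t j] j by auto
  then show "c t j +\<^sub>M c j t = 0\<^sub>M" using cc by (simp add: M.M.l_neg)
 qed
 finally show ?case .
qed simp

lemma finsum_hom: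
 fixes N :: "('a, 'n) module"
 assumes N: "Module.module A N" and T: "finite T" and h: "\<And>j. j : T ==> h j : mod_hom A M N"
 shows "(\<lambda>x. \<Oplus>\<^bsub>N\<^esub>j\<in>T. h j x) : mod_hom A M N"
proof -
 interpret N: Module.module A N by fact
 note hh = mod_homD[OF h]
 show ?thesis
 proof (rule mod_homI)
  fix x assume x: "x : carrier M"
  show "(\<Oplus>\<^bsub>N\<^esub>j\<in>T. h j x) : carrier N" using x hh by (intro N.M.finsum_closed) auto
  show "(\<Oplus>\<^bsub>N\<^esub>j\<in>T. h j (a *\<^sub>M x)) = a *\<^sub>N (\<Oplus>\<^bsub>N\<^esub>j\<in>T. h j x)" if a: "a : carrier A" for a
  proof -
   have "(\<Oplus>\<^bsub>N\<^esub>j\<in>T. h j (a *\<^sub>M x)) = (\<Oplus>\<^bsub>N\<^esub>j\<in>T. a *\<^sub>N h j x)"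
    using x hh a by (intro N.M.finsum_cong') auto
   also have "\<dots> = a *\<^sub>N (\<Oplus>\<^bsub>N\<^esub>j\<in>T. h j x)" using x hh a by (intro N.finsum_smult_ldistr[symmetric] T) auto
   finally show ?thesis .
  qed
  fix y assume y: "y : carrier M"
  have "(\<Oplus>\<^bsub>N\<^esub>j\<in>T. h j (x +\<^sub>M y)) = (\<Oplus>\<^bsub>N\<^esub>j\<in>T. h j x +\<^sub>N h j y)"
   using x y hh by (intro N.M.finsum_cong') auto
  also have "\<dots> = (\<Oplus>\<^bsub>N\<^esub>j\<in>T. h j x) +\<^sub>N (\<Oplus>\<^bsub>N\<^esub>j\<in>T. h j y)" using x y hh by (intro N.M.finsum_addf) auto
  finally show "(\<Oplus>\<^bsub>N\<^esub>j\<in>T. h j (x +\<^sub>M y)) = (\<Oplus>\<^bsub>N\<^esub>j\<in>T. h j x) +\<^sub>N (\<Oplus>\<^bsub>N\<^esub>j\<in>T. h j y)" .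
 qed
qed

lemma direct_sum_map_hom:
 assumes K: "finite K" and h: "\<And>k. k : K ==> h k : mod_hom A M (N k)"
 shows "(\<lambda>x. \<lambda>k\<in>K. h k x) : mod_hom A M (direct_sum K N)"
 using K mod_homD[OF h] by (intro mod_homI) (auto simp: direct_sum_carrier)

end

lemma cech_denoms_localization:
 assumes A: "cring A" and fs: "set fs <= carrier A" and S: "S <= {..<length fs}"
 shows "localization A (cech_denoms A fs S)"
proof -
 interpret cring A by fact
 have S': "finite S" using S finite_subset by blast
 have f: "fs ! j : carrier A" if "j : S" for j using that S fs by (meson lessThan_iff nth_mem subsetD)
 show ?thesis
 proof (intro localization.intro A localization_axioms.intro)
  show "cech_denoms A fs S <= carrier A" using f by (auto simp: cech_denoms_def)
  show "1\<^sub>A : cech_denoms A fs S" unfolding cech_denoms_def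
   by (rule CollectI, rule exI[of _ "\<lambda>_. 0"]) auto
  fix s t assume "s : cech_denoms A fs S" "t : cech_denoms A fs S"
  then obtain e e' :: "nat => nat" where e: "s = finprod A (\<lambda>j. fs ! j ^\<^sub>A e j) S" "t = finprod A (\<lambda>j. fs ! j ^\<^sub>A e' j) S"
   by (auto simp: cech_denoms_def)
  have "s \<otimes>\<^sub>A t = finprod A (\<lambda>j. fs ! j ^\<^sub>A e j \<otimes>\<^sub>A fs ! j ^\<^sub>A e' j) S"
   unfolding e using f by (intro finprod_multf[symmetric]) auto
  also have "\<dots> = finprod A (\<lambda>j. fs ! j ^\<^sub>A (e j + e' j)) S"
   using f by (intro finprod_cong') (auto simp: nat_pow_mult)
  finally show "s \<otimes>\<^sub>A t : cech_denoms A fs S" unfolding cech_denoms_def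
   by (intro CollectI exI[of _ "\<lambda>j. e j + e' j"] conjI TrueI)
 qed
qed

locale cech_complex = frob_ring A p J b
 for A :: "('a, 'x) ring_scheme" (structure) and p and J :: "'j set" and b +
 fixes fs :: "'a list"
 assumes fs: "set fs <= carrier A"
begin

abbreviation Den where "Den \<equiv> cech_denoms A fs"
abbreviation LS where "LS \<equiv> cech_loc A fs"
abbreviation Ix where "Ix \<equiv> cech_index fs"
abbreviation C where "C \<equiv> cech A fs"
abbreviation res where "res \<equiv> cech_res A fs"
abbreviation d where "d \<equiv> cech_diff A fs"
abbreviation frL where "frL S \<equiv> fraction A (Den S) (reg A)"

lemma Ix_D: "S : Ix i ==> S <= {..<length fs}" "S : Ix i ==> finite S" "S : Ix i ==> card S = i"
 by (auto simp: cech_index_def finite_subset[OF _ finite_lessThan])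

lemma Ix_finite [simp]: "finite (Ix i)"
 by (rule finite_subset[of _ "Pow {..<length fs}"]) (auto simp: cech_index_def)

lemma Ix_remove: "T : Ix (Suc i) ==> j : T ==> T - {j} : Ix i" by (auto simp: cech_index_def)

lemma fs_closed: "j < length fs ==> fs ! j : carrier A" using fs nth_mem by blast

lemma loc: "S <= {..<length fs} ==> localization A (Den S)"
 by (rule cech_denoms_localization[OF is_cring fs])

lemma floc: "S <= {..<length fs} ==> frob_localization A (Den S) p J b"
proof -
 assume "S <= {..<length fs}"
 then interpret localization A "Den S" by (rule loc)
 show ?thesis by unfold_locales
qed

lemma LS_module: "S <= {..<length fs} ==> Module.module A (LS S)"
 by (rule localization.L_module[OF loc])

lemma Den_mono: "S <= T ==> T <= {..<length fs} ==> Den S <= Den T"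
proof
 fix s assume ST: "S <= T" "T <= {..<length fs}" and s: "s : Den S"
 then obtain e :: "nat => nat" where e: "s = finprod A (\<lambda>j. fs ! j [^] e j) S" by (auto simp: cech_denoms_def)
 have fT: "finite T" using ST finite_subset by blast
 have fc: "fs ! j : carrier A" if "j : T" for j using that ST fs_closed by auto
 have "s = finprod A (\<lambda>j. fs ! j [^] (if j : S then e j else 0)) T"
  unfolding e using ST fT fc by (intro finprod_mono_neutral_cong_left) auto
 then show "s : Den T" unfolding cech_denoms_def by (intro CollectI exI[of _ "\<lambda>j. if j : S then e j else 0"]) auto
qed

lemma res_eq: "res T = loc_lift (\<lambda>x. x) A (Den T)" unfolding cech_res_def loc_lift_def ..

lemma res_fr:
 assumes "S <= T" "T <= {..<length fs}" "a : carrier A" "s : Den S"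
 shows "res T (frL S a s) = frL T a s" unfolding res_eq using assms Den_mono[OF assms(1,2)]
 by (intro loc_lift_fr[OF loc loc id_ring_hom[OF is_cring]]) auto

lemma res_hom: "S <= T ==> T <= {..<length fs} ==> res T : mod_hom A (LS S) (LS T)"
 unfolding res_eq using Den_mono[of S T]
 by (intro mod_homI loc_lift_closed[OF loc loc id_ring_hom[OF is_cring]] loc_lift_add[OF loc loc id_ring_hom[OF is_cring]]
  loc_lift_smult[OF loc loc id_ring_hom[OF is_cring]]) auto

lemma res_pow: "S <= T ==> T <= {..<length fs} ==> X : carrier (LS S) ==> res T (X ^\<^sub>(LS S) (n::nat)) = res T X ^\<^sub>(LS T) n"
 unfolding res_eq using Den_mono[of S T]
 by (intro loc_lift_pow[OF loc loc id_ring_hom[OF is_cring]]) auto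

lemma res_res:
 assumes "S <= T" "T <= T'" "T' <= {..<length fs}" "X : carrier (LS S)"
 shows "res T' (res T X) = res T' X"
proof -
 interpret l: localization A "Den S" using assms by (intro loc) auto
 obtain a s where X: "a : carrier A" "s : Den S" "X = frL S a s" using assms(4) l.L_carrier by auto
 have "s : Den T" using Den_mono[of S T] X assms by auto
 moreover have "res T X = frL T a s" unfolding X(3) using assms X(1,2) by (intro res_fr) auto
 moreover have "res T' (frL T a s) = frL T' a s" using assms X calculation(1) by (intro res_fr) auto
 moreover have "res T' X = frL T' a s" unfolding X(3) using assms X by (intro res_fr) auto
 ultimately show ?thesis by simp
qed

lemma C_module: "Module.module A (C i)"
 unfolding cech_def using Ix_D by (intro direct_sum_is_module is_cring LS_module) auto

lemma C_carrier: "x : carrier (C i) \<longleftrightarrow> x : extensional (Ix i) \<and> (\<forall>S\<in>Ix i. x S : carrier (LS S))"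
 unfolding cech_def by (auto simp: direct_sum_carrier)

lemma C_eqI: "x : carrier (C i) ==> y : carrier (C i) ==> (\<And>S. S : Ix i ==> x S = y S) ==> x = y"
 unfolding cech_def by (rule direct_sum_eqI)

lemma C_proj_hom: "S : Ix i ==> (\<lambda>x. x S) : mod_hom A (C i) (LS S)"
 unfolding cech_def using Ix_D by (intro direct_sum_proj_hom is_cring LS_module) auto

definition dterm :: "nat set => nat => (nat set => ('a \<times> 'a) set) => ('a \<times> 'a) set" where
 "dterm T j x = sg (card {l : T. l < j}) (LS T) (res T (x (T - {j})))"

lemma dterm_hom: "T : Ix (Suc i) ==> j : T ==> dterm T j : mod_hom A (C i) (LS T)"
 unfolding dterm_def[abs_def] using Ix_D(1)[of T "Suc i"] Ix_remove[of T i j]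
 by (intro mod_hom_comp[OF mod_hom_comp[OF C_proj_hom res_hom] sg_hom] LS_module) auto

lemma d_eq: "d i = (\<lambda>x. \<lambda>T\<in>Ix (Suc i). \<Oplus>\<^bsub>LS T\<^esub>j\<in>T. dterm T j x)"
 unfolding cech_diff_def[abs_def] dterm_def sg_def Let_def ..

lemma d_apply: "T : Ix (Suc i) ==> d i x T = (\<Oplus>\<^bsub>LS T\<^esub>j\<in>T. dterm T j x)" unfolding d_eq by simp

lemma d_hom: "d i : mod_hom A (C i) (C (Suc i))" unfolding d_eq cech_def[of _ _ "Suc i"]
 by (rule direct_sum_map_hom[OF C_module Ix_finite], rule finsum_hom[OF C_module LS_module])
  (use Ix_D dterm_hom in auto)

lemma d_semilin: "d i : semilin A 1 (C i) (C (Suc i))"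
 using d_hom mod_hom_eq_semilin[OF is_cring] by blast

lemma d_closed: "x : carrier (C i) ==> d i x : carrier (C (Suc i))" by (rule mod_homD(1)[OF d_hom])

lemma C_zero_apply: "S : Ix i ==> 0\<^sub>(C i) S = 0\<^sub>(LS S)" unfolding cech_def by simp

lemma res_sg:
 assumes "S <= T" "T <= {..<length fs}" "X : carrier (LS S)"
 shows "res T (sg n (LS S) X) = sg n (LS T) (res T X)"
 using semilin_neg[OF LS_module LS_module, of S T "res T" 1 X] res_hom[OF assms(1,2)]
  mod_hom_eq_semilin[OF is_cring, of "LS S" "LS T"] assms by (auto simp: sg_def)

text \<open>Removing j lowers the position of a later l by one, while removing l leaves that of j
  unchanged: the source of the sign in d d = 0.\<close>

lemma sg_swap_parity:
 fixes T :: "nat set"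
 assumes "finite T" "j : T" "l : T" "j < l"
 shows "card {k : T. k < l} = Suc (card {k : T - {j}. k < l})" "{k : T - {l}. k < j} = {k : T. k < j}"
proof -
 have "{k : T. k < l} = insert j {k : T - {j}. k < l}" using assms by auto
 then show "card {k : T. k < l} = Suc (card {k : T - {j}. k < l})" by simp
 show "{k : T - {l}. k < j} = {k : T. k < j}" using assms by auto
qed

lemma d_d_zero:
 assumes x: "x : carrier (C i)"
 shows "d (Suc i) (d i x) = 0\<^sub>(C (Suc (Suc i)))"
proof (rule C_eqI[OF d_closed[OF d_closed[OF x]]])
 show "0\<^sub>(C (Suc (Suc i))) : carrier (C (Suc (Suc i)))" using abelian_groupE(2)[OF module_ab[OF C_module]] .
 fix T assume T: "T : Ix (Suc (Suc i))"
 note T' = Ix_D[OF T]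
 interpret L: Module.module A "LS T" by (rule LS_module[OF T'(1)])
 \<comment> \<open>The value 0 off the relevant pairs is there because
   \<open>antisymmetric_sum\<close> wants values in the module at all indices.\<close>
 define c where "c j l = (if j : T \<and> l : T \<and> j \<noteq> l then
   sg (card {k : T. k < j}) (LS T) (sg (card {k : T - {j}. k < l}) (LS T) (res T (x (T - {j} - {l})))) else 0\<^sub>(LS T))" for j l
 have rc: "x (T - {j} - {l}) : carrier (LS (T - {j} - {l}))" "res T (x (T - {j} - {l})) : carrier (LS T)"
  if "j : T" "l : T" "j \<noteq> l" for j l
 proof -
  have "T - {j} - {l} : Ix i" using that T by (intro Ix_remove) auto
  then show 1: "x (T - {j} - {l}) : carrier (LS (T - {j} - {l}))" using x by (auto simp: C_carrier)
  show "res T (x (T - {j} - {l})) : carrier (LS T)"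
   by (rule mod_homD(1)[OF res_hom 1]) (use T' in auto)
 qed
 have cc: "c j l : carrier (LS T)" for j l
  using rc[of j l] sg_closed[OF L.module_axioms] by (auto simp: c_def)
 have anti: "c j l = -\<^sub>(LS T) c l j" if jl: "j : T" "l : T" "j < l" for j l
 proof -
  let ?y = "res T (x (T - {j} - {l}))"
  have y: "?y : carrier (LS T)" using rc jl by auto
  have "T - {l} - {j} = T - {j} - {l}" by auto
  then have "c l j = sg (card {k : T. k < l} + card {k : T - {l}. k < j}) (LS T) ?y"
   using jl sg_add_exp[OF L.module_axioms y] by (auto simp: c_def)
  also have "\<dots> = sg (Suc (card {k : T. k < j} + card {k : T - {j}. k < l})) (LS T) ?y"
   using sg_swap_parity[OF T'(2) jl] by (simp add: add.commute)
  also have "\<dots> = -\<^sub>(LS T) c j l"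
   using jl sg_add_exp[OF L.module_axioms y] sg_Suc[OF L.module_axioms y] by (simp add: c_def)
  finally show ?thesis using cc by simp
 qed
 have "d (Suc i) (d i x) T = (\<Oplus>\<^bsub>LS T\<^esub>j\<in>T. \<Oplus>\<^bsub>LS T\<^esub>l\<in>T - {j}. c j l)" unfolding d_apply[OF T]
 proof (rule L.M.finsum_cong'[OF refl])
  fix j assume j: "j : T"
  let ?S = "T - {j}"
  have S: "?S : Ix (Suc i)" by (rule Ix_remove[OF T j])
  have rs: "res T : semilin A 1 (LS ?S) (LS T)"
   using res_hom[of ?S T] T' mod_hom_eq_semilin[OF is_cring] by blast
  have tc: "dterm ?S l x : carrier (LS ?S)" if "l : ?S" for l by (rule mod_homD(1)[OF dterm_hom[OF S that] x])
  have tl: "res T (dterm ?S l x) = sg (card {k : T - {j}. k < l}) (LS T) (res T (x (T - {j} - {l})))" if "l : ?S" for l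
  proof -
   have c1: "x (?S - {l}) : carrier (LS (?S - {l}))" using rc[of j l] j that by auto
   have c2: "res ?S (x (?S - {l})) : carrier (LS ?S)"
    by (rule mod_homD(1)[OF res_hom c1]) (use T' in auto)
   have "res T (dterm ?S l x) = sg (card {k : ?S. k < l}) (LS T) (res T (res ?S (x (?S - {l}))))"
    unfolding dterm_def by (rule res_sg[OF _ _ c2]) (use T' in auto)
   also have "res T (res ?S (x (?S - {l}))) = res T (x (?S - {l}))"
    by (rule res_res[OF _ _ _ c1]) (use T' in auto)
   finally show ?thesis .
  qed
  have "res T (d i x ?S) = (\<Oplus>\<^bsub>LS T\<^esub>l\<in>?S. res T (dterm ?S l x))"
   unfolding d_apply[OF S] using tc T' by (intro semilin_finsum[OF LS_module LS_module rs]) auto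
  also have "\<dots> = (\<Oplus>\<^bsub>LS T\<^esub>l\<in>?S. sg (card {k : T - {j}. k < l}) (LS T) (res T (x (T - {j} - {l}))))"
   using tl rc[OF j] sg_closed[OF L.module_axioms] by (intro L.M.finsum_cong') auto
  finally have r: "res T (d i x ?S) = (\<Oplus>\<^bsub>LS T\<^esub>l\<in>?S. sg (card {k : T - {j}. k < l}) (LS T) (res T (x (T - {j} - {l}))))" .
  have sgs: "sg (card {k : T. k < j}) (LS T) : semilin A 1 (LS T) (LS T)"
   using sg_hom[OF L.module_axioms] mod_hom_eq_semilin[OF is_cring] by blast
  have "dterm T j (d i x) = (\<Oplus>\<^bsub>LS T\<^esub>l\<in>?S. sg (card {k : T. k < j}) (LS T) (sg (card {k : T - {j}. k < l}) (LS T) (res T (x (T - {j} - {l})))))"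
   unfolding dterm_def r using T' rc[OF j] sg_closed[OF L.module_axioms]
   by (intro semilin_finsum[OF L.module_axioms L.module_axioms sgs]) auto
  also have "\<dots> = (\<Oplus>\<^bsub>LS T\<^esub>l\<in>?S. c j l)"
  proof (rule L.M.finsum_cong'[OF refl])
   show "c j : ?S \<rightarrow> carrier (LS T)" using cc by blast
  qed (use j in \<open>auto simp: c_def\<close>)
  finally show "dterm T j (d i x) = (\<Oplus>\<^bsub>LS T\<^esub>l\<in>?S. c j l)" .
 qed (use cc in \<open>auto intro!: L.M.finsum_closed\<close>)
 also have "\<dots> = 0\<^sub>(LS T)"
 proof (rule antisymmetric_sum[OF L.module_axioms T'(2) cc])
  fix j l assume "j : T" "l : T" "j \<noteq> l"
  then show "c j l = -\<^sub>(LS T) c l j" using anti[of j l] anti[of l j] cc by (cases "j < l") auto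
 qed
 finally show "d (Suc i) (d i x) T = 0\<^sub>(C (Suc (Suc i))) T" using C_zero_apply[OF T] by simp
qed

subsection \<open>The Frobenius on the complex and its cohomology\<close>

definition phC :: "nat => (nat set => ('a \<times> 'a) set) => nat set => ('a \<times> 'a) set" where
 "phC i z = (\<lambda>S\<in>Ix i. z S ^\<^sub>(LS S) p)"

lemma C_unit: "unit_module A p J b (C i) (phC i)"
proof -
 have "unit_mod A p J b (C i) (phC i)" unfolding cech_def phC_def[abs_def]
  by (rule unit_direct_sum[OF Ix_finite]) (rule frob_localization.unit_loc[OF floc], auto dest: Ix_D)
 then show ?thesis by unfold_locales
qed

text \<open>The p-th power is additive, hence respects sums and signs alike; this covers p = 2
  without a distinction of parity.\<close>

lemma d_phC:
 assumes x: "x : carrier (C i)"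
 shows "d i (phC i x) = phC (Suc i) (d i x)"
proof (rule C_eqI)
 interpret Ci: unit_module A p J b "C i" "phC i" by (rule C_unit)
 interpret Cs: unit_module A p J b "C (Suc i)" "phC (Suc i)" by (rule C_unit)
 show "d i (phC i x) : carrier (C (Suc i))" using d_closed x by simp
 show "phC (Suc i) (d i x) : carrier (C (Suc i))" using d_closed x by simp
 fix T assume T: "T : Ix (Suc i)"
 note T' = Ix_D[OF T]
 interpret l: frob_localization A "Den T" p J b by (rule floc[OF T'(1)])
 note ps = l.L_frob_semilin
 have tc: "dterm T j x : carrier (LS T)" if "j : T" for j by (rule mod_homD(1)[OF dterm_hom[OF T that] x])
 have "phC (Suc i) (d i x) T = (\<Oplus>\<^bsub>LS T\<^esub>j\<in>T. dterm T j x) ^\<^sub>(LS T) p"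
  using T by (simp add: phC_def d_apply[OF T])
 also have "\<dots> = (\<Oplus>\<^bsub>LS T\<^esub>j\<in>T. dterm T j x ^\<^sub>(LS T) p)"
  using tc T' by (intro semilin_finsum[OF LS_module LS_module ps]) auto
 also have "\<dots> = (\<Oplus>\<^bsub>LS T\<^esub>j\<in>T. dterm T j (phC i x))"
 proof (rule abelian_monoid.finsum_cong'[OF abelian_group.axioms(1)[OF l.L_ab] refl])
  fix j assume j: "j : T"
  have S: "T - {j} : Ix i" by (rule Ix_remove[OF T j])
  have xc: "x (T - {j}) : carrier (LS (T - {j}))" using x S by (auto simp: C_carrier)
  have rc: "res T (x (T - {j})) : carrier (LS T)" by (rule mod_homD(1)[OF res_hom xc]) (use T' in auto)
  have "dterm T j (phC i x) = sg (card {l : T. l < j}) (LS T) (res T (x (T - {j})) ^\<^sub>(LS T) p)"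
   unfolding dterm_def phC_def using S T' xc by (simp add: res_pow)
  also have "\<dots> = dterm T j x ^\<^sub>(LS T) p"
   using semilin_neg[OF LS_module LS_module ps rc] T' by (auto simp: dterm_def sg_def)
  finally show "dterm T j x ^\<^sub>(LS T) p = dterm T j (phC i x)" by simp
 qed (use mod_homD(1)[OF dterm_hom[OF T]] x in auto)
 finally show "d i (phC i x) T = phC (Suc i) (d i x) T" using d_apply[OF T] by simp
qed

abbreviation Z where "Z \<equiv> cech_cycles A fs"
abbreviation Bd where "Bd \<equiv> cech_boundaries A fs"
abbreviation H where "H \<equiv> cech_cohomology A fs"

lemma Z_eq: "Z i = {x : carrier (C i). d i x : {0\<^sub>(C (Suc i))}}" by (simp add: cech_cycles_def)

lemma Z_submodule: "submodule (Z i) A (C i)"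
 unfolding Z_eq by (rule semilin_preimage[OF C_module C_module d_semilin zero_submodule[OF C_module]])

lemma Bd_submodule: "submodule (Bd i) A (C i)"
proof (cases i)
 case 0
 then show ?thesis using zero_submodule[OF C_module] by (simp add: cech_boundaries_def)
next
 case (Suc k)
 then show ?thesis
  using mod_hom_image_submodule[OF C_module C_module d_hom Module.module.carrier_is_submodule[OF C_module], of k]
  by (simp add: cech_boundaries_def)
qed

lemma Bd_Z: "Bd i <= Z i"
proof (cases i)
 case 0
 then show ?thesis using submodule_zero[OF Z_submodule] by (simp add: cech_boundaries_def)
next
 case (Suc k)
 then show ?thesis using d_d_zero d_closed by (auto simp: cech_boundaries_def cech_cycles_def)
qed

abbreviation DC where "DC i \<equiv> dcomp J b (C i) (phC i)"

lemma d_DC: "x : carrier (C i) ==> j : J ==> DC (Suc i) j (d i x) = d i (DC i j x)"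
 by (rule D_commute[OF C_unit C_unit]) (use mod_homD[OF d_hom] d_phC b_closed in auto)

lemma C_D_closed: "x : carrier (C i) ==> DC i j x : carrier (C i)"
 by (rule unit_module.D_closed[OF C_unit])

lemma C_D_zero: "j : J ==> DC i j 0\<^sub>(C i) = 0\<^sub>(C i)" by (rule unit_module.D_zero[OF C_unit])

lemma phC_closed: "x : carrier (C i) ==> phC i x : carrier (C i)"
 by (rule unit_module.phi_closed[OF C_unit])

lemma phC_zero: "phC i 0\<^sub>(C i) = 0\<^sub>(C i)" by (rule unit_module.phi_zero[OF C_unit])

lemma Z_phC: "x : Z i ==> phC i x : Z i"
 using d_phC phC_closed phC_zero by (auto simp: cech_cycles_def)

lemma Z_DC: "j : J ==> x : Z i ==> DC i j x : Z i"
 using d_DC[of x i j] C_D_closed C_D_zero by (auto simp: cech_cycles_def)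

lemma Bd_phC: "x : Bd i ==> phC i x : Bd i"
 using phC_zero d_phC[symmetric] phC_closed by (cases i) (auto simp: cech_boundaries_def)

lemma Bd_DC: "j : J ==> x : Bd i ==> DC i j x : Bd i"
 using C_D_zero d_DC C_D_closed by (cases i) (auto simp: cech_boundaries_def)

lemma Zmod_unit: "unit_module A p J b (submod (C i) (Z i)) (phC i)"
 by unfold_locales (rule unit_module.unit_submod[OF C_unit Z_submodule Z_phC Z_DC])

lemma Z_closed: "x : Z i ==> x : carrier (C i)" by (simp add: cech_cycles_def)

lemma Zmod_D: "j : J ==> x : Z i ==> dcomp J b (submod (C i) (Z i)) (phC i) j x = DC i j x"
 by (rule D_commute[OF Zmod_unit C_unit, where h = "\<lambda>x. x", symmetric]) (auto simp: submod_def Z_closed)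

lemma Bd_submodule_Z: "submodule (Bd i) A (submod (C i) (Z i))"
proof -
 interpret Ci: Module.module A "C i" by (rule C_module)
 interpret Zi: Module.module A "submod (C i) (Z i)" by (rule unit_module.is_mod[OF Zmod_unit])
 note B = Ci.submoduleE[OF Bd_submodule] submodule_zero[OF Bd_submodule]
 \<comment> \<open>Negation in \<open>submod\<close> is a description over the smaller carrier and
   has to be compared with negation in the complex.\<close>
 have neg: "-\<^sub>(submod (C i) (Z i)) x = -\<^sub>(C i) x" if "x : Bd i" for x
 proof -
  have x: "x : Z i" "x : carrier (C i)" using that Bd_Z B(1) by auto
  then have "-\<^sub>(C i) x : Z i" using Ci.submoduleE(3)[OF Z_submodule] by auto
  then show ?thesis using x Ci.M.l_neg[OF x(2)] by (intro Zi.M.minus_equality) (auto simp: submod_def)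
 qed
 show ?thesis by (rule Zi.submoduleI) (use B Bd_Z neg in \<open>auto simp: submod_def\<close>)
qed

abbreviation cl where "cl i z \<equiv> Bd i +>\<^sub>(submod (C i) (Z i)) z"

lemma cl_eq: "Bd i +>\<^sub>(C i) z = cl i z" by (simp add: a_r_coset_def' submod_def)

lemma H_quot: "H i = quot_module (submod (C i) (Z i)) (Bd i)" by (simp add: cech_cohomology_def)

lemma Zc: "carrier (submod (C i) (Z i)) = Z i" by (simp add: submod_def)

lemma Zmod: "Module.module A (submod (C i) (Z i))" by (rule unit_module.is_mod[OF Zmod_unit])

lemma H_module: "Module.module A (H i)"
 unfolding H_quot by (rule quot_is_module[OF Zmod Bd_submodule_Z])

lemma H_carrier: "carrier (H i) = cl i ` Z i"
 unfolding H_quot using quot_carrier[OF Zmod Bd_submodule_Z] by (simp add: Zc)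

lemma cl_hom: "cl i : mod_hom A (submod (C i) (Z i)) (H i)"
 unfolding H_quot by (rule quot_class_hom[OF Zmod Bd_submodule_Z])

lemma cl_closed: "z : Z i ==> cl i z : carrier (H i)" using H_carrier by auto

lemma cl_add: "x : Z i ==> y : Z i ==> cl i (x +\<^sub>(C i) y) = cl i x +\<^sub>(H i) cl i y"
 using mod_homD(2)[OF cl_hom] by (simp add: submod_def)

lemma cl_smult: "a : carrier A ==> x : Z i ==> cl i (a *\<^sub>(C i) x) = a *\<^sub>(H i) cl i x"
 using mod_homD(3)[OF cl_hom] by (simp add: submod_def)

lemma cl_zero_iff: "z : Z i ==> cl i z = 0\<^sub>(H i) \<longleftrightarrow> z : Bd i"
 unfolding H_quot quot_zero[OF Zmod Bd_submodule_Z]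
 by (rule coset_eq_N_iff[OF Zmod Bd_submodule_Z]) (simp add: Zc)

lemma cech_frob_cl:
 assumes z: "z : Z i"
 shows "cech_frob A p fs i (cl i z) = cl i (phC i z)"
proof -
 interpret Zi: unit_module A p J b "submod (C i) (Z i)" "phC i" by (rule Zmod_unit)
 have s: "(\<lambda>z. cl i (phC i z)) : semilin A p (submod (C i) (Z i)) (H i)"
  by (rule hom_comp_semilin[OF is_cring Zi.phi cl_hom])
 have "cech_frob A p fs i (cl i z) = the_elem ((\<lambda>z. cl i (phC i z)) ` cl i z)"
  unfolding cech_frob_def cl_eq phC_def ..
 also have "\<dots> = cl i (phC i z)"
 proof (rule quot_lift[OF Zmod Bd_submodule_Z H_module])
  show "cl i (phC i x) = 0\<^sub>(H i)" if "x : Bd i" for x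
   using that Bd_phC Bd_Z cl_zero_iff[of "phC i x" i] by blast
 qed (use semilinD[OF s] z Zc in auto)
 finally show ?thesis .
qed

text \<open>Cocycles form a unit module and boundaries a stable submodule of it, because the
  differential commutes with the p-th power and hence, by \<open>D_commute\<close>, with the
  components.\<close>

lemma H_unit: "unit_module A p J b (H i) (cech_frob A p fs i)"
proof -
 have "unit_mod A p J b (quot_module (submod (C i) (Z i)) (Bd i)) (cech_frob A p fs i)"
  by (rule unit_module.unit_quot[OF Zmod_unit Bd_submodule_Z Bd_phC])
   (use Zmod_D Bd_DC Bd_Z cech_frob_cl in \<open>auto simp: Zc subset_iff\<close>)
 then show ?thesis unfolding H_quot by unfold_locales
qed

abbreviation DH where "DH i \<equiv> dcomp J b (H i) (cech_frob A p fs i)"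

lemma DH_cl:
 assumes j: "j : J" and z: "z : Z i"
 shows "DH i j (cl i z) = cl i (DC i j z)"
proof -
 have "DH i j (cl i z) = cl i (dcomp J b (submod (C i) (Z i)) (phC i) j z)"
  by (rule D_commute[OF Zmod_unit H_unit])
   (use mod_homD[OF cl_hom] cech_frob_cl b_closed j z in \<open>simp_all add: Zc\<close>)
 then show ?thesis using Zmod_D[OF j z] by simp
qed

lemma cech_structure_eq: "cech_structure A p fs i = unit_module.Frob_inv A p (H i) (cech_frob A p fs i)"
 unfolding cech_structure_def Let_def ..

end

subsection \<open>A finitely generated submodule generating the cohomology\<close>

lemma (in cring) finprod_pow:
 assumes "finite S" "g : S \<rightarrow> carrier R"
 shows "finprod R g S [^] (q::nat) = finprod R (\<lambda>j. g j [^] q) S"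
proof (induction q)
 case 0
 show ?case by simp
next
 case (Suc q)
 have "finprod R g S [^] Suc q = finprod R (\<lambda>j. g j [^] q) S \<otimes> finprod R g S" using Suc by simp
 also have "\<dots> = finprod R (\<lambda>j. g j [^] q \<otimes> g j) S" using assms by (intro finprod_multf[symmetric]) auto
 finally show ?case by simp
qed

lemma pow_ge:
 assumes "1 < (p::nat)" shows "\<exists>e. N \<le> p ^ e" using assms by (intro exI[of _ N]) auto

context frob_localization
begin

text \<open>Dividing the expansion of a by s^p divides each component by s, so components lower pole
  orders by the factor p.\<close>

lemma D_fr:
 assumes a: "a : carrier A" and s: "s : S" and j: "j : J"
 shows "dcomp J b L (\<lambda>X. X ^\<^sub>L p) j (fr a (s [^] p)) = fr (DR j a) s"
proof -
 interpret l: unit_module A p J b L "\<lambda>X. X ^\<^sub>L p" by unfold_locales (rule unit_loc)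
 interpret r: unit_module A p J b "reg A" "\<lambda>x. x [^] p" by (rule unit_module_reg)
 obtain F where F: "finite F" "{j} <= F" "F <= J" "a = r.bs F (\<lambda>j. DR j a)"
  by (rule r.D_expand[of a "{j}"]) (use a j in auto)
 have D: "DR j a : carrier A" for j using DR_closed[OF a] .
 have "fr a (s [^] p) = l.bs F (\<lambda>j. fr (DR j a) s)"
  using bsum_fr[OF F(1,3), of "\<lambda>j. DR j a" s] D s F(4) by (simp add: bsum_def)
 then show ?thesis using l.D_unique[OF F(1,3), of "\<lambda>j. fr (DR j a) s" j] D s F(2) j by auto
qed

end

context cech_complex
begin

definition fden :: "nat set => 'a" where "fden S = finprod A (\<lambda>j. fs ! j) S"

lemma fden_Den: "S <= {..<length fs} ==> fden S : Den S"
proof -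
 assume S: "S <= {..<length fs}"
 have "fden S = finprod A (\<lambda>j. fs ! j [^] (1::nat)) S"
  unfolding fden_def using S fs_closed by (intro finprod_cong') auto
 then show ?thesis unfolding cech_denoms_def by (intro CollectI exI[of _ "\<lambda>_. 1"]) auto
qed

lemma Den_dvd:
 assumes S: "S <= {..<length fs}" and s: "s : Den S"
 shows "\<exists>N::nat. \<forall>q\<ge>N. \<exists>c\<in>carrier A. fden S [^] q = c \<otimes> s"
proof -
 obtain e :: "nat => nat" where e: "s = finprod A (\<lambda>j. fs ! j [^] e j) S" using s by (auto simp: cech_denoms_def)
 have fS: "finite S" using S finite_subset by blast
 have f: "fs ! j : carrier A" if "j : S" for j using that S fs_closed by auto
 show ?thesis
 proof (intro exI allI impI)
  fix q assume q: "(\<Sum>j\<in>S. e j) \<le> q"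
  have eq: "e j \<le> q" if "j : S" for j using q member_le_sum[OF that, of e] fS by auto
  have "fden S [^] q = finprod A (\<lambda>j. fs ! j [^] q) S" unfolding fden_def using f fS by (intro finprod_pow) auto
  also have "\<dots> = finprod A (\<lambda>j. fs ! j [^] (q - e j) \<otimes> fs ! j [^] e j) S"
   using f eq by (intro finprod_cong') (auto simp: nat_pow_mult)
  also have "\<dots> = finprod A (\<lambda>j. fs ! j [^] (q - e j)) S \<otimes> s" unfolding e using f by (intro finprod_multf) auto
  finally have "fden S [^] q = finprod A (\<lambda>j. fs ! j [^] (q - e j)) S \<otimes> s" .
  then show "\<exists>c\<in>carrier A. fden S [^] q = c \<otimes> s" by (rule bexI) (use f in \<open>auto \<close>)
 qed
qed

text \<open>The filtration of the complex by pole order: coordinates can be written with the q-th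
  power of the product of the generators in S as denominator.\<close>

definition W :: "nat => nat => (nat set => ('a \<times> 'a) set) set" where
 "W q i = {x : carrier (C i). \<forall>S\<in>Ix i. \<exists>a\<in>carrier A. x S = frL S a (fden S [^] q)}"

lemma W_submodule: "submodule (W q i) A (C i)"
proof -
 interpret C: Module.module A "C i" by (rule C_module)
 have ca: "(x +\<^sub>(C i) y) S = x S +\<^sub>(LS S) y S" "(a *\<^sub>(C i) x) S = a *\<^sub>(LS S) x S" if "S : Ix i" for x y a S
  using that by (auto simp: cech_def)
 have sm: "a *\<^sub>(C i) x : W q i" if a: "a : carrier A" and x: "x : W q i" for a x
 proof -
  have "\<exists>c\<in>carrier A. (a *\<^sub>(C i) x) S = frL S c (fden S [^] q)" if S: "S : Ix i" for S
  proof -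
   interpret l: localization A "Den S" by (rule loc[OF Ix_D(1)[OF S]])
   obtain c where "c : carrier A" "x S = frL S c (fden S [^] q)" using x S by (auto simp: W_def)
   then show ?thesis using a ca(2)[OF S] fden_Den[OF Ix_D(1)[OF S]] l.fr_smult[of c a "fden S [^] q"]
    by (intro bexI[of _ "a \<otimes> c"]) auto
  qed
  then show ?thesis using x a by (auto simp: W_def)
 qed
 show ?thesis
 proof (rule C.submoduleI)
  show "W q i <= carrier (C i)" by (auto simp: W_def)
  show "a *\<^sub>(C i) x : W q i" if "a : carrier A" "x : W q i" for a x using sm that .
  show "-\<^sub>(C i) x : W q i" if x: "x : W q i" for x
   using sm[OF _ x, of "\<ominus> \<one>"] x by (simp add: C.smult_l_minus W_def)
  show "0\<^sub>(C i) : W q i"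
  proof -
   have "0\<^sub>(C i) S = frL S \<zero> (fden S [^] q)" if S: "S : Ix i" for S
    using C_zero_apply[OF S] localization.fr_zero[OF loc[OF Ix_D(1)[OF S]]]
     localization.pow_S[OF loc[OF Ix_D(1)[OF S]] fden_Den[OF Ix_D(1)[OF S]]] by simp
   then show ?thesis by (auto simp: W_def)
  qed
  show "x +\<^sub>(C i) y : W q i" if x: "x : W q i" and y: "y : W q i" for x y
  proof -
   have "\<exists>c\<in>carrier A. (x +\<^sub>(C i) y) S = frL S c (fden S [^] q)" if S: "S : Ix i" for S
   proof -
    interpret l: localization A "Den S" by (rule loc[OF Ix_D(1)[OF S]])
    obtain c where c: "c : carrier A" "x S = frL S c (fden S [^] q)" using x S by (auto simp: W_def)
    obtain c' where c': "c' : carrier A" "y S = frL S c' (fden S [^] q)" using y S by (auto simp: W_def)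
    show ?thesis using c c' ca(1)[OF S] fden_Den[OF Ix_D(1)[OF S]] l.fr_add_same[of c c' "fden S [^] q"]
     by (intro bexI[of _ "c \<oplus> c'"]) auto
   qed
   then show ?thesis using x y by (auto simp: W_def)
  qed
 qed
qed

lemma W_fin_gen: "\<exists>X. finite X \<and> X <= carrier (C i) \<and> W 1 i <= gen_submodule A (C i) X"
proof -
 let ?e = "\<lambda>S. direct_sum_inj (Ix i) LS S (frL S \<one> (fden S))"
 have LM: "\<And>S. S : Ix i ==> Module.module A (LS S)" using LS_module Ix_D by auto
 have ih: "direct_sum_inj (Ix i) LS S : mod_hom A (LS S) (C i)" if "S : Ix i" for S
  unfolding cech_def by (rule direct_sum_inj_hom[OF is_cring LM that])
 have fc: "frL S a (fden S) : carrier (LS S)" if "S : Ix i" "a : carrier A" for S a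
  by (rule localization.fr_closed[OF loc[OF Ix_D(1)[OF that(1)]] that(2) fden_Den[OF Ix_D(1)[OF that(1)]]])
 have ec: "?e ` Ix i <= carrier (C i)"
 proof (rule image_subsetI)
  fix S assume S: "S : Ix i"
  show "?e S : carrier (C i)" by (rule mod_homD(1)[OF ih[OF S] fc[OF S one_closed]])
 qed
 have g: "submodule (gen_submodule A (C i) (?e ` Ix i)) A (C i)" by (rule gen_submodule_is_submodule[OF C_module ec])
 have "W 1 i <= gen_submodule A (C i) (?e ` Ix i)"
 proof
  fix x assume x: "x : W 1 i"
  then have xc: "x : carrier (C i)" by (simp add: W_def)
  have "x = (\<Oplus>\<^bsub>C i\<^esub>S\<in>Ix i. direct_sum_inj (Ix i) LS S (x S))"
   unfolding cech_def by (rule direct_sum_decomp[OF is_cring LM]) (use xc in \<open>auto simp: cech_def\<close>)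
  also have "\<dots> : gen_submodule A (C i) (?e ` Ix i)"
  proof (rule submodule_finsum[OF C_module g Ix_finite])
   fix S assume S: "S : Ix i"
   interpret l: localization A "Den S" by (rule loc[OF Ix_D(1)[OF S]])
   have fd: "fden S : Den S" by (rule fden_Den[OF Ix_D(1)[OF S]])
   obtain a where a: "a : carrier A" "x S = frL S a (fden S [^] (1::nat))" using x S unfolding W_def by blast
   have "x S = a *\<^sub>(LS S) frL S \<one> (fden S)" using a fd by (simp add: l.fr_smult)
   then have "direct_sum_inj (Ix i) LS S (x S) = a *\<^sub>(C i) ?e S"
    using mod_homD(3)[OF ih[OF S] a(1) fc[OF S]] by simp
   moreover have "?e S : gen_submodule A (C i) (?e ` Ix i)"
    by (rule subsetD[OF gen_submodule_subset[OF C_module] imageI[OF S]])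
   ultimately show "direct_sum_inj (Ix i) LS S (x S) : gen_submodule A (C i) (?e ` Ix i)"
    using Module.module.submoduleE(4)[OF C_module g a(1)] by simp
  qed
  finally show "x : gen_submodule A (C i) (?e ` Ix i)" .
 qed
 then show ?thesis using ec by (intro exI[of _ "?e ` Ix i"] conjI finite_imageI Ix_finite)
qed

lemma W_exhaust:
 assumes x: "x : carrier (C i)"
 shows "\<exists>N. \<forall>q\<ge>N. x : W q i"
proof -
 have "\<forall>S\<in>Ix i. \<exists>N::nat. \<forall>q\<ge>N. \<exists>a\<in>carrier A. x S = frL S a (fden S [^] q)"
 proof
  fix S assume S: "S : Ix i"
  interpret l: localization A "Den S" by (rule loc[OF Ix_D(1)[OF S]])
  have "x S : carrier (LS S)" using x S by (simp add: C_carrier)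
  then obtain a s where a: "a : carrier A" "s : Den S" "x S = frL S a s" by (auto simp: l.L_carrier)
  obtain N :: nat where N: "\<forall>q\<ge>N. \<exists>c\<in>carrier A. fden S [^] q = c \<otimes> s" using Den_dvd[OF Ix_D(1)[OF S] a(2)] by blast
  show "\<exists>N::nat. \<forall>q\<ge>N. \<exists>a\<in>carrier A. x S = frL S a (fden S [^] q)"
  proof (intro exI allI impI)
   fix q assume "N \<le> q"
   then obtain c where c: "c : carrier A" "fden S [^] q = c \<otimes> s" using N by blast
   have f: "fden S [^] q : Den S" using fden_Den[OF Ix_D(1)[OF S]] by simp
   have "x S = frL S (c \<otimes> a) (fden S [^] q)" unfolding a(3)
    by (rule l.fr_eqI) (use a c f in \<open>auto simp: m_ac\<close>)
   then show "\<exists>a\<in>carrier A. x S = frL S a (fden S [^] q)" using a c by (intro bexI[of _ "c \<otimes> a"]) auto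
  qed
 qed
 then obtain N :: "nat set => nat" where N: "\<And>S q. S : Ix i ==> q \<ge> N S ==> \<exists>a\<in>carrier A. x S = frL S a (fden S [^] q)" by metis
 have "N S \<le> (\<Sum>S\<in>Ix i. N S)" if "S : Ix i" for S using that by (intro member_le_sum) auto
 then have "\<exists>a\<in>carrier A. x S = frL S a (fden S [^] q)" if "(\<Sum>S\<in>Ix i. N S) \<le> q" "S : Ix i" for q S
  using N[OF that(2) order_trans[OF _ that(1)]] that(2) by blast
 then show ?thesis using x unfolding W_def by (intro exI[of _ "\<Sum>S\<in>Ix i. N S"]) auto
qed

lemma C_D_apply: "x : carrier (C i) ==> S : Ix i ==> j : J ==>
 DC i j x S = dcomp J b (LS S) (\<lambda>X. X ^\<^sub>(LS S) p) j (x S)"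
proof -
 assume x: "x : carrier (C i)" and S: "S : Ix i" and j: "j : J"
 interpret fl: frob_localization A "Den S" p J b by (rule floc[OF Ix_D(1)[OF S]])
 have um: "unit_module A p J b (LS S) (\<lambda>X. X ^\<^sub>(LS S) p)" by unfold_locales (rule fl.unit_loc)
 show ?thesis by (rule D_commute[OF C_unit um, where h = "\<lambda>x. x S", symmetric])
   (use mod_homD[OF C_proj_hom[OF S]] S b_closed x j in \<open>auto simp: phC_def\<close>)
qed

lemma W_D:
 assumes x: "x : W (q * p) i" and j: "j : J"
 shows "DC i j x : W q i"
proof -
 have xc: "x : carrier (C i)" using x by (simp add: W_def)
 have "\<exists>a\<in>carrier A. DC i j x S = frL S a (fden S [^] q)" if S: "S : Ix i" for S
 proof -
  interpret fl: frob_localization A "Den S" p J b by (rule floc[OF Ix_D(1)[OF S]])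
  have fd: "fden S : Den S" by (rule fden_Den[OF Ix_D(1)[OF S]])
  obtain a where a: "a : carrier A" "x S = frL S a (fden S [^] (q * p))" using x S unfolding W_def by blast
  have "fden S [^] (q * p) = (fden S [^] q) [^] p" using fd by (simp add: nat_pow_pow)
  then have "DC i j x S = frL S (DR j a) (fden S [^] q)"
   unfolding C_D_apply[OF xc S j] a(2) using fl.D_fr[OF a(1) _ j, of "fden S [^] q"] fd by simp
  then show ?thesis using DR_closed[OF a(1)] by blast
 qed
 then show ?thesis using C_D_closed[OF xc] by (auto simp: W_def)
qed

lemma W_mono:
 assumes "q \<le> r" shows "W q i <= W r i"
proof
 fix x assume x: "x : W q i"
 have "\<exists>a\<in>carrier A. x S = frL S a (fden S [^] r)" if S: "S : Ix i" for S
 proof -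
  interpret l: localization A "Den S" by (rule loc[OF Ix_D(1)[OF S]])
  have fd: "fden S : Den S" by (rule fden_Den[OF Ix_D(1)[OF S]])
  obtain a where a: "a : carrier A" "x S = frL S a (fden S [^] q)" using x S unfolding W_def by blast
  have "fden S [^] r = fden S [^] (r - q) \<otimes> fden S [^] q" using fd assms by (simp add: nat_pow_mult)
  then have "x S = frL S (fden S [^] (r - q) \<otimes> a) (fden S [^] r)"
   unfolding a(2) using fd a(1) l.fr_cancel[of a "fden S [^] q" "fden S [^] (r - q)"] by simp
  then show ?thesis using fd a(1) by (intro bexI[of _ "fden S [^] (r - q) \<otimes> a"]) auto
 qed
 then show "x : W r i" using x by (auto simp: W_def)
qed

text \<open>V consists of the cocycles with poles of order at most one. As \<open>W 1\<close> lies
  in \<open>W p\<close>, components map V to itself, and e successive components map a cocycle with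
  poles of order p^e into V; so the classes of V generate a root.\<close>

lemma H_root_generators:
 assumes N: "noeth_ring A" and p: "1 < p"
 obtains X where "finite X" "X <= carrier (H i)"
  "X <= dinv J b (H i) (cech_frob A p fs i) (gen_submodule A (H i) X)"
  "\<And>y. y : carrier (H i) ==> \<exists>e. y : (dinv J b (H i) (cech_frob A p fs i) ^^ e) (gen_submodule A (H i) X)"
proof -
 interpret H: unit_module A p J b "H i" "cech_frob A p fs i" by (rule H_unit)
 define V where "V = Z i \<inter> W 1 i"
 have V: "submodule V A (C i)" unfolding V_def by (rule submodule_Int[OF C_module Z_submodule W_submodule])
 obtain Y0 where Y0: "finite Y0" "Y0 <= carrier (C i)" "W 1 i <= gen_submodule A (C i) Y0" using W_fin_gen by blast
 obtain Y where Y: "finite Y" "Y <= V" "V = gen_submodule A (C i) Y"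
  using noeth_gen[OF N C_module Y0(1,2) V] Y0(3) unfolding V_def by blast
 have VZ: "V <= Z i" by (auto simp: V_def)
 have YZ: "Y <= carrier (submod (C i) (Z i))" using Y(2) VZ by (simp add: Zc)
 have VC: "V <= carrier (C i)" using VZ Z_closed by blast
 \<comment> \<open>A generated submodule refers to its ambient module, so the generators found in
   the complex have to be carried over to the module of cocycles.\<close>
 have Vg: "V = gen_submodule A (submod (C i) (Z i)) Y"
 proof
  interpret Ci: Module.module A "C i" by (rule C_module)
  interpret Zi: Module.module A "submod (C i) (Z i)" by (rule Zmod)
  let ?G = "gen_submodule A (submod (C i) (Z i)) Y"
  have G: "submodule ?G A (submod (C i) (Z i))" by (rule gen_submodule_is_submodule[OF Zmod YZ])
  note G' = Zi.submoduleE[OF G] submodule_zero[OF G]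
  have GC: "?G <= carrier (C i)" using G'(1) Z_closed by (auto simp: Zc)
  have "submodule ?G A (C i)"
  proof (rule Ci.submoduleI[OF GC])
   show sm: "a *\<^sub>(C i) x : ?G" if "a : carrier A" "x : ?G" for a x using G'(4)[OF that] by (simp add: submod_def)
   show "-\<^sub>(C i) x : ?G" if x: "x : ?G" for x
    using sm[OF _ x, of "\<ominus> \<one>"] x GC by (auto simp: Ci.smult_l_minus)
  qed (use G' in \<open>auto simp: submod_def\<close>)
  then show "V <= ?G" unfolding Y(3) by (rule gen_submodule_minimal[OF C_module]) (rule gen_submodule_subset[OF Zmod])
  have "submodule V A (submod (C i) (Z i))"
  proof (rule Zi.submoduleI)
   show sm: "a *\<^sub>(submod (C i) (Z i)) x : V" if "a : carrier A" "x : V" for a x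
    using Ci.submoduleE(4)[OF V that] by (simp add: submod_def)
   show "-\<^sub>(submod (C i) (Z i)) x : V" if x: "x : V" for x
    using sm[OF _ x, of "\<ominus> \<one>"] x VZ by (auto simp: Zi.smult_l_minus Zc)
  qed (use VZ Ci.submoduleE(5)[OF V] submodule_zero[OF V] in \<open>auto simp: submod_def\<close>)
  then show "?G <= V" by (rule gen_submodule_minimal[OF Zmod _ Y(2)])
 qed
 define X where "X = cl i ` Y"
 have gX: "gen_submodule A (H i) X = cl i ` V"
  unfolding X_def Vg by (rule mod_hom_image_gen[OF Zmod H_module cl_hom YZ, symmetric])
 have XH: "X <= carrier (H i)" using mod_homD(1)[OF cl_hom] YZ unfolding X_def by auto
 have DV: "DC i j z : V" if "z : V" "j : J" for z j
  using that Z_DC W_D[of z 1 i j] W_mono[of 1 p i] p by (auto simp: V_def)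
 have inV: "cl i z : (H.Dinv ^^ e) (cl i ` V)" if "z : Z i" "z : W (p ^ e) i" for z e using that
 proof (induction e arbitrary: z)
  case 0
  then show ?case by (auto simp: V_def)
 next
  case (Suc e)
  have "H.D j (cl i z) : (H.Dinv ^^ e) (cl i ` V)" if j: "j : J" for j
   unfolding DH_cl[OF j Suc.prems(1)]
   using Suc.prems j by (intro Suc.IH Z_DC W_D) (auto simp: mult.commute)
  then show ?case using cl_closed[OF Suc.prems(1)] by (simp add: dinv_def[of J b "H i" _ "(H.Dinv ^^ e) (cl i ` V)"])
 qed
 show ?thesis
 proof (rule that[of X])
  show "finite X" using Y(1) by (simp add: X_def)
  show "X <= carrier (H i)" by (rule XH)
  show "X <= H.Dinv (gen_submodule A (H i) X)"
  proof
   fix y assume y: "y : X"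
   then obtain z where z: "z : Y" "y = cl i z" by (auto simp: X_def)
   then have zV: "z : V" using Y(2) by blast
   have "H.D j y : cl i ` V" if j: "j : J" for j
    unfolding z(2) using DH_cl[OF j] DV[OF zV j] zV VZ by auto
   then show "y : H.Dinv (gen_submodule A (H i) X)" unfolding gX dinv_def using y XH by auto
  qed
  fix y assume "y : carrier (H i)"
  then obtain z where z: "z : Z i" "y = cl i z" by (auto simp: H_carrier)
  obtain n where n: "\<forall>q\<ge>n. z : W q i" using W_exhaust[OF Z_closed[OF z(1)]] by blast
  obtain e where "n \<le> p ^ e" using pow_ge[OF p] by blast
  then show "\<exists>e. y : (H.Dinv ^^ e) (gen_submodule A (H i) X)"
   unfolding gX using inV[OF z(1), of e] n z(2) by blast
 qed
qed

end

subsection \<open>Independence of the generators\<close>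

lemma sg_twice: "Module.module A M ==> y : carrier M ==> sg n M (sg n M y) = y"
 by (simp only: sg_add_exp) (simp add: sg_def)

lemma submodule_reg_iff_ideal:
 assumes "cring A" shows "submodule I A (reg A) \<longleftrightarrow> ideal I A"
proof
 interpret cring A by fact
 assume I: "submodule I A (reg A)"
 note I' = Module.module.submoduleE[OF reg_is_module[OF assms] I] submodule_zero[OF I]
 have "subgroup I (add_monoid A)" using I' by (intro add.subgroupI) auto
 moreover have "a \<otimes>\<^sub>A x : I" if "a : I" "x : carrier A" for a x
  using I'(4)[OF that(2,1)] m_comm[of a x] that I'(1) by auto
 ultimately show "ideal I A" using I'(4) by (intro idealI ring_axioms) auto
next
 interpret cring A by fact
 assume "ideal I A"
 then interpret ideal I A .
 show "submodule I A (reg A)"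
  by (rule Module.module.submoduleI[OF reg_is_module[OF assms]]) (auto simp: I_l_closed)
qed

context cech_complex
begin

lemma pow_Den:
 assumes "S <= {..<length fs}" "j : S" shows "fs ! j [^] (e::nat) : Den S"
proof -
 have "fs ! j : carrier A" using assms fs_closed by auto
 then have "fs ! j [^] e = finprod A (\<lambda>k. fs ! k [^] e) {j}" by simp
 then have "fs ! j [^] e : Den {j}" unfolding cech_denoms_def by (intro CollectI exI[of _ "\<lambda>_. e"] conjI TrueI)
 then show ?thesis using Den_mono[of "{j}" S] assms by auto
qed

lemma Den_split:
 assumes S: "S <= {..<length fs}" and j: "j < length fs" "j \<notin> S" and d: "d0 : Den (insert j S)"
 shows "\<exists>e::nat. \<exists>d'\<in>Den S. d0 = fs ! j [^] e \<otimes> d'"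
proof -
 obtain e :: "nat => nat" where e: "d0 = finprod A (\<lambda>k. fs ! k [^] e k) (insert j S)" using d by (auto simp: cech_denoms_def)
 have "finite S" using S finite_subset by blast
 then have "d0 = fs ! j [^] e j \<otimes> finprod A (\<lambda>k. fs ! k [^] e k) S"
  unfolding e using j S fs_closed by (intro finprod_insert) auto
 moreover have "finprod A (\<lambda>k. fs ! k [^] e k) S : Den S"
  unfolding cech_denoms_def by (intro CollectI exI[of _ e] conjI TrueI refl)
 ultimately show ?thesis by blast
qed

text \<open>A denominator over \<open>insert j S\<close> is f_j^e times one over S, and
  multiplication by f_j^M with M >= e removes the first factor. All larger exponents are allowed, so
  that one exponent can serve finitely many S.\<close>

lemma res_lift:
 assumes S: "S <= {..<length fs}" and j: "j < length fs" "j \<notin> S" and X: "X : carrier (LS (insert j S))"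
 shows "\<exists>N::nat. \<forall>M\<ge>N. \<exists>w\<in>carrier (LS S). res (insert j S) w = (fs ! j [^] M) *\<^sub>(LS (insert j S)) X"
proof -
 have jS: "insert j S <= {..<length fs}" using S j by auto
 interpret T: localization A "Den (insert j S)" by (rule loc[OF jS])
 interpret S: localization A "Den S" by (rule loc[OF S])
 have f: "fs ! j : carrier A" by (rule fs_closed[OF j(1)])
 obtain a d0 where a: "a : carrier A" "d0 : Den (insert j S)" "X = frL (insert j S) a d0" using X by (auto simp: T.L_carrier)
 obtain e d' where d': "d' : Den S" "d0 = fs ! j [^] (e::nat) \<otimes> d'" using Den_split[OF S j a(2)] by blast
 have d'T: "d' : Den (insert j S)" using d'(1) Den_mono[of S "insert j S"] jS by auto
 show ?thesis
 proof (intro exI allI impI)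
  fix M assume M: "e \<le> M"
  let ?w = "frL S (fs ! j [^] (M - e) \<otimes> a) d'"
  have "res (insert j S) ?w = frL (insert j S) (fs ! j [^] (M - e) \<otimes> a) d'"
   using jS f a d'(1) by (intro res_fr) auto
  also have "\<dots> = frL (insert j S) (fs ! j [^] M \<otimes> a) d0"
  proof (rule T.fr_eqI)
   have "fs ! j [^] M = fs ! j [^] (M - e) \<otimes> fs ! j [^] e" using f M by (simp add: nat_pow_mult)
   then show "d0 \<otimes> (fs ! j [^] (M - e) \<otimes> a) = d' \<otimes> (fs ! j [^] M \<otimes> a)"
    unfolding d'(2) using f a(1) d'(1) by (simp add: m_ac)
  qed (use f a d'T in auto)
  also have "\<dots> = (fs ! j [^] M) *\<^sub>(LS (insert j S)) X" using f a by (simp add: T.fr_smult)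
  finally show "\<exists>w\<in>carrier (LS S). res (insert j S) w = (fs ! j [^] M) *\<^sub>(LS (insert j S)) X"
   using f a d'(1) by (intro bexI[of _ ?w]) auto
 qed
qed

text \<open>The numerator has an annihilator of the form f_j^e times a denominator over S, and the
  second factor is already invertible there.\<close>

lemma res_zero:
 assumes S: "S <= {..<length fs}" and j: "j < length fs" "j \<notin> S" and X: "X : carrier (LS S)"
  and z: "res (insert j S) X = 0\<^sub>(LS (insert j S))"
 shows "\<exists>N::nat. \<forall>M\<ge>N. (fs ! j [^] M) *\<^sub>(LS S) X = 0\<^sub>(LS S)"
proof -
 have jS: "insert j S <= {..<length fs}" using S j by auto
 interpret T: localization A "Den (insert j S)" by (rule loc[OF jS])
 interpret S: localization A "Den S" by (rule loc[OF S])
 have f: "fs ! j : carrier A" by (rule fs_closed[OF j(1)])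
 obtain a s where a: "a : carrier A" "s : Den S" "X = frL S a s" using X by (auto simp: S.L_carrier)
 have sT: "s : Den (insert j S)" using a(2) Den_mono[of S "insert j S"] jS by auto
 have "frL (insert j S) a s = 0\<^sub>(LS (insert j S))" using z jS a(1,2) unfolding a(3) by (subst (asm) res_fr) auto
 then obtain u where u: "u : Den (insert j S)" "u \<otimes> a = \<zero>" using T.fr_eq_zero_iff[OF a(1) sT] by auto
 obtain e d' where d': "d' : Den S" "u = fs ! j [^] (e::nat) \<otimes> d'" using Den_split[OF S j u(1)] by blast
 show ?thesis
 proof (intro exI allI impI)
  fix M assume M: "e \<le> M"
  have "fs ! j [^] M = fs ! j [^] (M - e) \<otimes> fs ! j [^] e" using f M by (simp add: nat_pow_mult)
  then have "d' \<otimes> (fs ! j [^] M \<otimes> a) = fs ! j [^] (M - e) \<otimes> (u \<otimes> a)"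
   unfolding d'(2) using f a(1) d'(1) by (simp add: m_ac)
  also have "\<dots> = \<zero>" using u f by simp
  finally have "frL S (fs ! j [^] M \<otimes> a) s = 0\<^sub>(LS S)" using d'(1) a f by (subst S.fr_eq_zero_iff) auto
  then show "(fs ! j [^] M) *\<^sub>(LS S) X = 0\<^sub>(LS S)" using f a by (simp add: S.fr_smult)
 qed
qed

context
 fixes t :: nat
 assumes t: "t < length fs"
begin

text \<open>The kernel of restriction to the complex without the t-th generator
  (\<open>rho_zero_iff\<close>); it is a subcomplex by \<open>d_K\<close>.\<close>

definition K :: "nat => (nat set => ('a \<times> 'a) set) set" where
 "K i = {x : carrier (C i). \<forall>S\<in>Ix i. t \<notin> S \<longrightarrow> x S = 0\<^sub>(LS S)}"

lemma C_ops: "S : Ix i ==> (x +\<^sub>(C i) y) S = x S +\<^sub>(LS S) y S"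
 "S : Ix i ==> (a *\<^sub>(C i) x) S = a *\<^sub>(LS S) x S" by (auto simp: cech_def)

lemma K_submodule: "submodule (K i) A (C i)"
proof -
 interpret C: Module.module A "C i" by (rule C_module)
 have LM: "Module.module A (LS S)" if "S : Ix i" for S using LS_module Ix_D that by auto
 have sm: "a *\<^sub>(C i) x : K i" if "a : carrier A" "x : K i" for a x
  using that Module.module.smult_r_null[OF LM] by (auto simp: K_def C_ops)
 show ?thesis
 proof (rule C.submoduleI)
  show "-\<^sub>(C i) x : K i" if x: "x : K i" for x
   using sm[OF _ x, of "\<ominus> \<one>"] x by (simp add: C.smult_l_minus K_def)
  show "x +\<^sub>(C i) y : K i" if "x : K i" "y : K i" for x y
   using that abelian_groupE(5)[OF module_ab[OF LM] abelian_groupE(2)[OF module_ab[OF LM]]] by (auto simp: K_def C_ops)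
 qed (use sm in \<open>auto simp: K_def C_zero_apply\<close>)
qed

lemma K_closed: "x : K i ==> x : carrier (C i)" by (simp add: K_def)

lemma dterm_zero:
 assumes T: "T : Ix (Suc i)" and j: "j : T" and z: "x (T - {j}) = 0\<^sub>(LS (T - {j}))"
 shows "dterm T j x = 0\<^sub>(LS T)"
proof -
 note T' = Ix_D[OF T]
 have TM: "Module.module A (LS T)" "Module.module A (LS (T - {j}))" using LS_module T'(1) by (blast, blast)
 have "res T : semilin A 1 (LS (T - {j})) (LS T)"
  using res_hom[of "T - {j}" T] T' mod_hom_eq_semilin[OF is_cring] by blast
 then have "res T 0\<^sub>(LS (T - {j})) = 0\<^sub>(LS T)" by (rule semilin_zero[OF TM(2,1)])
 then show ?thesis unfolding dterm_def z sg_def using abelian_group_minus_zero[OF module_ab[OF TM(1)]] by simp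
qed

lemma d_K: "x : K i ==> d i x : K (Suc i)"
proof -
 assume x: "x : K i"
 have "d i x T = 0\<^sub>(LS T)" if T: "T : Ix (Suc i)" and tT: "t \<notin> T" for T
 proof -
  interpret L: Module.module A "LS T" using LS_module Ix_D[OF T] by auto
  have "dterm T j x = 0\<^sub>(LS T)" if j: "j : T" for j
   using x Ix_remove[OF T j] tT by (intro dterm_zero[OF T j]) (auto simp: K_def)
  then show ?thesis unfolding d_apply[OF T] by (intro L.M.add.finprod_one_eqI) auto
 qed
 then show ?thesis using d_closed[OF K_closed[OF x]] by (auto simp: K_def)
qed

text \<open>The part of the complex indexed by the sets containing t becomes exact after inverting any other
 \<open>fs ! j\<close>: a null homotopy is given by removing j from the index set.\<close>

lemma K_pow_homotopy:
 assumes j: "j < length fs" "j \<noteq> t" and z: "z : K (Suc k)" and dz: "d (Suc k) z = 0\<^sub>(C (Suc (Suc k)))"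
 shows "\<exists>N::nat. \<exists>y\<in>K k. (fs ! j [^] N) *\<^sub>(C (Suc k)) z = d k y"
proof -
 let ?f = "fs ! j"
 have f: "?f : carrier A" by (rule fs_closed[OF j(1)])
 interpret Ck: Module.module A "C k" by (rule C_module)
 interpret Cs: Module.module A "C (Suc k)" by (rule C_module)
 have zc: "z : carrier (C (Suc k))" by (rule K_closed[OF z])
 have zS: "z S : carrier (LS S)" if "S : Ix (Suc k)" for S using zc that by (auto simp: C_carrier)
 have z0: "z S = 0\<^sub>(LS S)" if "S : Ix (Suc k)" "t \<notin> S" for S using z that by (auto simp: K_def)
 have ins: "insert j S : Ix (Suc i)" if "S : Ix i" "j \<notin> S" for S i
  using that j(1) Ix_D(2)[OF that(1)] by (auto simp: cech_index_def)
 have "\<forall>S\<in>{S : Ix k. j \<notin> S}. \<exists>N::nat. \<forall>M\<ge>N. \<exists>w\<in>carrier (LS S). res (insert j S) w = (?f [^] M) *\<^sub>(LS (insert j S)) z (insert j S)"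
  using res_lift[OF Ix_D(1) j(1) _ zS[OF ins]] by blast
 from bchoice[OF this] obtain N0 :: "nat set => nat" where N0: "\<forall>S\<in>{S : Ix k. j \<notin> S}. \<forall>M\<ge>N0 S.
   \<exists>w\<in>carrier (LS S). res (insert j S) w = (?f [^] M) *\<^sub>(LS (insert j S)) z (insert j S)" by blast
 \<comment> \<open>The sum dominates the exponents chosen for the single S, and
   \<open>res_lift\<close> holds for all larger exponents.\<close>
 define N where "N = (\<Sum>S\<in>Ix k. N0 S)"
 have "N0 S \<le> N" if "S : Ix k" for S unfolding N_def using that by (intro member_le_sum) auto
 then have "\<forall>S\<in>{S : Ix k. j \<notin> S}. \<exists>w\<in>carrier (LS S). res (insert j S) w = (?f [^] N) *\<^sub>(LS (insert j S)) z (insert j S)"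
  using N0 by blast
 from bchoice[OF this[unfolded Bex_def]] obtain w where w: "\<forall>S\<in>{S : Ix k. j \<notin> S}. w S : carrier (LS S) \<and>
   res (insert j S) (w S) = (?f [^] N) *\<^sub>(LS (insert j S)) z (insert j S)" by blast
 have wc: "w S : carrier (LS S)" and wr: "res (insert j S) (w S) = (?f [^] N) *\<^sub>(LS (insert j S)) z (insert j S)"
  if "S : Ix k" "j \<notin> S" for S using w that by blast+
 \<comment> \<open>The homotopy: y at S is a lift to S of f_j^N times z at
   \<open>insert j S\<close>, with the sign given by the position of j.\<close>
 define y where "y = (\<lambda>S\<in>Ix k. if t : S \<and> j \<notin> S then sg (card {l : S. l < j}) (LS S) (w S) else 0\<^sub>(LS S))"
 have LM: "Module.module A (LS S)" if "S : Ix i" for S i using LS_module Ix_D that by auto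
 have Lz: "0\<^sub>(LS S) : carrier (LS S)" if "S : Ix i" for S i using abelian_groupE(2)[OF module_ab[OF LM[OF that]]] .
 have yK: "y : K k" using wc sg_closed[OF LM] Lz by (auto simp: K_def y_def C_carrier)
 have yS: "y S : carrier (LS S)" if "S : Ix k" for S using K_closed[OF yK] that by (auto simp: C_carrier)
 \<comment> \<open>The defect of the homotopy. It is a cocycle and vanishes on the sets containing
   j; this forces it to be killed by a power of f_j on the other sets.\<close>
 let ?x = "d k y -\<^sub>(C (Suc k)) (?f [^] N) *\<^sub>(C (Suc k)) z"
 have fz: "(?f [^] N) *\<^sub>(C (Suc k)) z : carrier (C (Suc k))" using f zc by simp
 have dyc: "d k y : carrier (C (Suc k))" by (rule d_closed[OF K_closed[OF yK]])
 have xc: "?x : carrier (C (Suc k))" using dyc fz by simp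
 have proj: "(\<lambda>x. x T) : semilin A 1 (C (Suc k)) (LS T)" if "T : Ix (Suc k)" for T
  using C_proj_hom[OF that] mod_hom_eq_semilin[OF is_cring] by blast
 have xT: "?x T = d k y T -\<^sub>(LS T) (?f [^] N) *\<^sub>(LS T) z T" if T: "T : Ix (Suc k)" for T
  using semilin_minus[OF C_module LM[OF T] proj[OF T] dyc fz] C_ops(2)[OF T] by simp
 have dx: "d (Suc k) ?x = 0\<^sub>(C (Suc (Suc k)))"
  unfolding semilin_minus[OF C_module C_module d_semilin dyc fz] d_d_zero[OF K_closed[OF yK]] mod_homD(3)[OF d_hom nat_pow_closed[OF f] zc] dz
  using Module.module.smult_r_null[OF C_module nat_pow_closed[OF f]] abelian_group_minus_zero[OF module_ab[OF C_module]]
   abelian_groupE(2,5)[OF module_ab[OF C_module]] by (simp add: a_minus_def)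
 have xj: "?x T = 0\<^sub>(LS T)" if T: "T : Ix (Suc k)" and jT: "j : T" for T
 proof -
  note T' = Ix_D[OF T]
  interpret L: Module.module A "LS T" by (rule LM[OF T])
  have "d k y T = (?f [^] N) *\<^sub>(LS T) z T"
  proof (cases "t : T")
   case False
   then have "d k y T = 0\<^sub>(LS T)" using d_K[OF yK] T by (auto simp: K_def)
   then show ?thesis using z0[OF T False] f by simp
  next
   case True
   have S: "T - {j} : Ix k" by (rule Ix_remove[OF T jT])
   have iT: "insert j (T - {j}) = T" using jT by auto
   \<comment> \<open>Removing j does not change the number of elements below j, so the two signs
     cancel.\<close>
   have cs: "{l : T - {j}. l < j} = {l : T. l < j}" by auto
   have wc': "w (T - {j}) : carrier (LS (T - {j}))" using wc[OF S] by simp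
   have rc: "res T (w (T - {j})) : carrier (LS T)" by (rule mod_homD(1)[OF res_hom wc']) (use T' in auto)
   \<comment> \<open>Removing some l other than j leaves a set that contains j, where y is 0; only
     the term of j remains.\<close>
   have "d k y T = (\<Oplus>\<^bsub>LS T\<^esub>l\<in>T. if j = l then dterm T l y else 0\<^sub>(LS T))" unfolding d_apply[OF T]
   proof (rule L.M.finsum_cong'[OF refl])
    show "(\<lambda>l. if j = l then dterm T l y else 0\<^sub>(LS T)) : T \<rightarrow> carrier (LS T)"
     using mod_homD(1)[OF dterm_hom[OF T]] K_closed[OF yK] by auto
    fix l assume l: "l : T"
    show "dterm T l y = (if j = l then dterm T l y else 0\<^sub>(LS T))"
    proof (cases "j = l")
     case False
     then have "y (T - {l}) = 0\<^sub>(LS (T - {l}))" using Ix_remove[OF T l] jT by (auto simp: y_def)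
     then show ?thesis using dterm_zero[OF T l] by simp
    qed simp
   qed
   also have "\<dots> = dterm T j y"
    using T'(2) jT mod_homD(1)[OF dterm_hom[OF T]] K_closed[OF yK] by (intro L.M.finsum_singleton) auto
   also have "\<dots> = sg (card {l : T. l < j}) (LS T) (res T (sg (card {l : T. l < j}) (LS (T - {j})) (w (T - {j}))))"
    unfolding dterm_def using S True jT j(2) cs by (simp add: y_def)
   also have "\<dots> = res T (w (T - {j}))"
    using T' by (subst res_sg[OF _ _ wc']) (auto simp: sg_twice[OF LM[OF T] rc])
   also have "\<dots> = (?f [^] N) *\<^sub>(LS T) z T" using wr[OF S] iT by simp
   finally show ?thesis .
  qed
  then show ?thesis unfolding xT[OF T] using f zS[OF T] by (simp add: a_minus_def L.M.r_neg)
 qed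
 have "\<forall>T\<in>Ix (Suc k). \<exists>N'::nat. \<forall>M\<ge>N'. (?f [^] M) *\<^sub>(LS T) ?x T = 0\<^sub>(LS T)"
 proof
  fix T assume T: "T : Ix (Suc k)"
  note T' = Ix_D[OF T]
  interpret L: Module.module A "LS T" by (rule LM[OF T])
  show "\<exists>N'::nat. \<forall>M\<ge>N'. (?f [^] M) *\<^sub>(LS T) ?x T = 0\<^sub>(LS T)"
  proof (cases "j : T")
   case True
   then show ?thesis using xj[OF T] f by auto
  next
   case False
   let ?T = "insert j T"
   have T2: "?T : Ix (Suc (Suc k))" by (rule ins[OF T False])
   interpret L2: Module.module A "LS ?T" by (rule LM[OF T2])
   have eq: "?T - {j} = T" using False by auto
   have dc: "dterm ?T l ?x : carrier (LS ?T)" if "l : ?T" for l by (rule mod_homD(1)[OF dterm_hom[OF T2 that] xc])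
   \<comment> \<open>In the equation d x = 0 at \<open>insert j T\<close> all terms other than that
     of j vanish by \<open>xj\<close>, so x at T becomes 0 after f_j is inverted.\<close>
   have z: "dterm ?T l ?x = 0\<^sub>(LS ?T)" if l: "l : T" for l
    using l False by (intro dterm_zero[OF T2] xj Ix_remove[OF T2]) auto
   have "0\<^sub>(LS ?T) = (\<Oplus>\<^bsub>LS ?T\<^esub>l\<in>?T. dterm ?T l ?x)"
    unfolding d_apply[OF T2, symmetric] dx using C_zero_apply[OF T2] by simp
   also have "\<dots> = dterm ?T j ?x +\<^sub>(LS ?T) (\<Oplus>\<^bsub>LS ?T\<^esub>l\<in>T. dterm ?T l ?x)"
    using dc by (intro L2.M.finsum_insert[OF T'(2) False]) auto
   also have "(\<Oplus>\<^bsub>LS ?T\<^esub>l\<in>T. dterm ?T l ?x) = 0\<^sub>(LS ?T)" using z by (intro L2.M.add.finprod_one_eqI) auto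
   finally have "dterm ?T j ?x = 0\<^sub>(LS ?T)" using dc[of j] by simp
   moreover have xTc: "?x T : carrier (LS T)" using xc T by (auto simp: C_carrier)
   moreover have "res ?T (?x T) : carrier (LS ?T)" by (rule mod_homD(1)[OF res_hom xTc]) (use Ix_D[OF T2] in auto)
   ultimately have "res ?T (?x T) = 0\<^sub>(LS ?T)"

    unfolding dterm_def eq by (auto simp: sg_def split: if_splits)
   then show ?thesis using res_zero[OF T'(1) j(1) False xTc] by blast
  qed
 qed
 from bchoice[OF this] obtain N1 :: "nat set => nat" where N1': "\<forall>T\<in>Ix (Suc k). \<forall>M\<ge>N1 T. (?f [^] M) *\<^sub>(LS T) ?x T = 0\<^sub>(LS T)"
  by blast
 have N1: "(?f [^] M) *\<^sub>(LS T) ?x T = 0\<^sub>(LS T)" if "T : Ix (Suc k)" "N1 T \<le> M" for T M using N1' that by blast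
 define N' where "N' = (\<Sum>T\<in>Ix (Suc k). N1 T)"
 have N'le: "N1 T \<le> N'" if "T : Ix (Suc k)" for T unfolding N'_def using that by (intro member_le_sum) auto
 have fN: "?f [^] N' : carrier A" using f by simp
 have "(?f [^] N') *\<^sub>(C (Suc k)) ?x = 0\<^sub>(C (Suc k))"
  by (rule C_eqI[of _ "Suc k"]) (use Cs.smult_closed[OF fN xc] C_ops(2) C_zero_apply N1[OF _ N'le] in auto)
 moreover have "(?f [^] N') *\<^sub>(C (Suc k)) ?x =
   (?f [^] N') *\<^sub>(C (Suc k)) d k y -\<^sub>(C (Suc k)) (?f [^] N') *\<^sub>(C (Suc k)) ((?f [^] N) *\<^sub>(C (Suc k)) z)"
  using fN dyc fz by (simp add: a_minus_def Cs.smult_r_distr Cs.smult_r_minus)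
 moreover have "(?f [^] N') *\<^sub>(C (Suc k)) ((?f [^] N) *\<^sub>(C (Suc k)) z) = (?f [^] (N' + N)) *\<^sub>(C (Suc k)) z"
  using f zc by (simp add: Cs.smult_assoc1[symmetric] nat_pow_mult)
 moreover have "(?f [^] N') *\<^sub>(C (Suc k)) d k y = d k ((?f [^] N') *\<^sub>(C k) y)"
  using mod_homD(3)[OF d_hom fN K_closed[OF yK]] by simp
 ultimately have e: "d k ((?f [^] N') *\<^sub>(C k) y) -\<^sub>(C (Suc k)) (?f [^] (N' + N)) *\<^sub>(C (Suc k)) z = 0\<^sub>(C (Suc k))" by simp
 have yy: "(?f [^] N') *\<^sub>(C k) y : K k" using Ck.submoduleE(4)[OF K_submodule fN yK] .
 have c1: "d k ((?f [^] N') *\<^sub>(C k) y) : carrier (C (Suc k))" by (rule d_closed[OF K_closed[OF yy]])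
 have c2: "(?f [^] (N' + N)) *\<^sub>(C (Suc k)) z : carrier (C (Suc k))" using f zc by simp
 have "(?f [^] (N' + N)) *\<^sub>(C (Suc k)) z = d k ((?f [^] N') *\<^sub>(C k) y)"
  using e c1 c2 by (metis Cs.M.a_inv_closed Cs.M.add.inv_inv Cs.M.minus_equality a_minus_def)
 then show ?thesis using yy by blast
qed

end

end

context cech_complex
begin

context
 fixes t :: nat
 assumes t: "t < length fs"
begin

text \<open>On the sets containing t the element f_t is invertible, and on the other sets the
  members of K are 0. The same reason gives \<open>K_cancel\<close>.\<close>

lemma K_divide:
 assumes y: "y : K t k"
 shows "\<exists>y'\<in>K t k. (fs ! t [^] (M::nat)) *\<^sub>(C k) y' = y"
proof -
 have f: "fs ! t : carrier A" by (rule fs_closed[OF t])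
 have "\<exists>Y\<in>carrier (LS S). (fs ! t [^] M) *\<^sub>(LS S) Y = y S" if S: "S : Ix k" "t : S" for S
 proof -
  note S' = Ix_D(1)[OF S(1)]
  interpret l: localization A "Den S" by (rule loc[OF S'])
  have "y S : carrier (LS S)" using K_closed[OF t y] S by (auto simp: C_carrier)
  then obtain a s where a: "a : carrier A" "s : Den S" "y S = frL S a s" by (auto simp: l.L_carrier)
  have fM: "fs ! t [^] M : Den S" by (rule pow_Den[OF S' S(2)])
  show ?thesis
   using l.fr_smult[of a "fs ! t [^] M" "fs ! t [^] M \<otimes> s"] l.fr_cancel[OF a(1,2) fM] a f fM
   by (intro bexI[of _ "frL S a (fs ! t [^] M \<otimes> s)"]) auto
 qed
 then have "\<forall>S\<in>{S : Ix k. t : S}. \<exists>Y. Y : carrier (LS S) \<and> (fs ! t [^] M) *\<^sub>(LS S) Y = y S" by blast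
 from bchoice[OF this] obtain Y where Y: "\<forall>S\<in>{S : Ix k. t : S}. Y S : carrier (LS S) \<and> (fs ! t [^] M) *\<^sub>(LS S) Y S = y S" by blast
 define y' where "y' = (\<lambda>S\<in>Ix k. if t : S then Y S else 0\<^sub>(LS S))"
 have LM: "Module.module A (LS S)" if "S : Ix k" for S using LS_module Ix_D that by auto
 have z: "0\<^sub>(LS S) : carrier (LS S)" if "S : Ix k" for S using abelian_groupE(2)[OF module_ab[OF LM[OF that]]] .
 have y'K: "y' : K t k" using Y z unfolding K_def[OF t] by (auto simp: y'_def C_carrier)
 have "(fs ! t [^] M) *\<^sub>(C k) y' = y"
 proof (rule C_eqI[OF _ K_closed[OF t y]])
  show "(fs ! t [^] M) *\<^sub>(C k) y' : carrier (C k)"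
   using Module.module.smult_closed[OF C_module _ K_closed[OF t y'K]] f by simp
  show "((fs ! t [^] M) *\<^sub>(C k) y') S = y S" if S: "S : Ix k" for S
   unfolding C_ops(2)[OF t S] using Y S y f Module.module.smult_r_null[OF LM[OF S]]
   unfolding K_def[OF t] by (auto simp: y'_def)
 qed
 then show ?thesis using y'K by blast
qed

lemma K_cancel:
 assumes x: "x : K t i" and z: "(fs ! t [^] (M::nat)) *\<^sub>(C i) x = 0\<^sub>(C i)"
 shows "x = 0\<^sub>(C i)"
proof (rule C_eqI[OF K_closed[OF t x] abelian_groupE(2)[OF module_ab[OF C_module]]])
 have f: "fs ! t : carrier A" by (rule fs_closed[OF t])
 fix S assume S: "S : Ix i"
 note S' = Ix_D(1)[OF S]
 interpret l: localization A "Den S" by (rule loc[OF S'])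
 show "x S = 0\<^sub>(C i) S"
 proof (cases "t : S")
  case True
  have "x S : carrier (LS S)" using K_closed[OF t x] S by (auto simp: C_carrier)
  then obtain a s where a: "a : carrier A" "s : Den S" "x S = frL S a s" by (auto simp: l.L_carrier)
  have fM: "fs ! t [^] M : Den S" by (rule pow_Den[OF S' True])
  have "(fs ! t [^] M) *\<^sub>(LS S) x S = 0\<^sub>(LS S)" using arg_cong[OF z, of "\<lambda>x. x S"] C_ops(2)[OF t S] C_zero_apply[OF S] by simp
  then have "frL S (fs ! t [^] M \<otimes> a) s = 0\<^sub>(LS S)" using a f by (simp add: l.fr_smult)
  then obtain u where u: "u : Den S" "u \<otimes> (fs ! t [^] M \<otimes> a) = \<zero>" using l.fr_eq_zero_iff[of "fs ! t [^] M \<otimes> a" s] a f by auto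
  then have "(u \<otimes> fs ! t [^] M) \<otimes> a = \<zero>" using a f by (simp add: m_assoc)
  then have "frL S a s = 0\<^sub>(LS S)" using l.fr_eq_zero_iff[OF a(1,2)] l.mult_S[OF u(1) fM] by blast
  then show ?thesis using a(3) C_zero_apply[OF S] by simp
 next
  case False
  then show ?thesis using x S C_zero_apply[OF S] unfolding K_def[OF t] by simp
 qed
qed

text \<open>Each other generator has a power in the ideal I of those a for which a z is the
  differential of a member of K. Since f_t lies in the ideal of the other generators, a power of f_t
  is in I too, and this power can be divided out in K.\<close>

lemma K_acyclic:
 assumes p: "1 < p" and ft: "fs ! t : genideal A {fs ! j | j. j < length fs \<and> j \<noteq> t}"
  and z: "z : K t (Suc k)" and dz: "d (Suc k) z = 0\<^sub>(C (Suc (Suc k)))"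
 shows "\<exists>y\<in>K t k. z = d k y"
proof -
 interpret Cs: Module.module A "C (Suc k)" by (rule C_module)
 interpret Ck: Module.module A "C k" by (rule C_module)
 have zc: "z : carrier (C (Suc k))" by (rule K_closed[OF t z])
 define I where "I = {a : carrier A. a *\<^sub>(C (Suc k)) z : d k ` K t k}"
 have dK: "submodule (d k ` K t k) A (C (Suc k))"
  by (rule mod_hom_image_submodule[OF C_module C_module d_hom K_submodule[OF t]])
 have h: "(\<lambda>a. a *\<^sub>(C (Suc k)) z) : semilin A 1 (reg A) (C (Suc k))"
  using zc by (intro semilinI) (auto simp: Cs.smult_l_distr Cs.smult_assoc1)
 have I: "ideal I A"
  using semilin_preimage[OF reg_is_module[OF is_cring] C_module h dK] submodule_reg_iff_ideal[OF is_cring]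
  unfolding I_def by simp
 interpret I: ideal I A by (rule I)
 \<comment> \<open>Some p^e-th power has to lie in I: by additivity of these powers the set is an
   ideal, without binomial expansions.\<close>
 define rad where "rad = {a : carrier A. \<exists>e. a [^] (p ^ e) : I}"
 have up: "a [^] (p ^ e') : I" if "a : carrier A" "a [^] (n::nat) : I" "n \<le> p ^ e'" for a n e'
 proof -
  have "a [^] (p ^ e') = a [^] (p ^ e' - n) \<otimes> a [^] n" using that by (simp add: nat_pow_mult)
  then show ?thesis using that I.I_l_closed by simp
 qed
 have rad: "ideal rad A"
 proof (rule idealI[OF ring_axioms])
  have mult: "x \<otimes> a : rad" if a: "a : rad" and x: "x : carrier A" for a x
  proof -
   obtain e where "a [^] (p ^ e) : I" using a by (auto simp: rad_def)
   then have "x [^] (p ^ e) \<otimes> a [^] (p ^ e) : I" using x by (intro I.I_l_closed) auto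
   then have "(x \<otimes> a) [^] (p ^ e) : I" using x a by (simp add: rad_def nat_pow_distrib)
   then show ?thesis using x a by (auto simp: rad_def)
  qed
  show "subgroup rad (add_monoid A)"
  proof (rule add.subgroupI)
   show "rad \<noteq> {}" using p_pos by (auto simp: rad_def nat_pow_zero)
   show "\<ominus> a : rad" if "a : rad" for a
    using mult[OF that, of "\<ominus> \<one>"] that by (simp add: rad_def l_minus)
   fix a b assume a: "a : rad" and b: "b : rad"
   then obtain e e' where e: "a [^] (p ^ e) : I" "b [^] (p ^ e') : I" and ab: "a : carrier A" "b : carrier A"
    by (auto simp: rad_def)
   have le: "p ^ e \<le> p ^ max e e'" "p ^ e' \<le> p ^ max e e'" using p by auto
   have "(a \<oplus> b) [^] (p ^ max e e') = a [^] (p ^ max e e') \<oplus> b [^] (p ^ max e e')"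
    using ab by (rule add_pow_pow)
   also have "\<dots> : I" using up[OF ab(1) e(1) le(1)] up[OF ab(2) e(2) le(2)] by (rule I.a_closed)
   finally show "a \<oplus> b : rad" using ab by (auto simp: rad_def)
  qed (auto simp: rad_def)
  show "x \<otimes> a : rad" if "a : rad" "x : carrier A" for a x by (rule mult[OF that])
  show "a \<otimes> x : rad" if "a : rad" "x : carrier A" for a x
   using mult[OF that] that by (simp add: rad_def m_comm)
 qed
 have "{fs ! j | j. j < length fs \<and> j \<noteq> t} <= rad"
 proof
  fix g assume "g : {fs ! j | j. j < length fs \<and> j \<noteq> t}"
  then obtain j where j: "j < length fs" "j \<noteq> t" "g = fs ! j" by blast
  obtain N :: nat and y where y: "y : K t k" "(fs ! j [^] N) *\<^sub>(C (Suc k)) z = d k y"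
   using K_pow_homotopy[OF t j(1,2) z dz] by blast
  have fj: "fs ! j : carrier A" by (rule fs_closed[OF j(1)])
  have "fs ! j [^] N : I" using y fj unfolding I_def by (intro CollectI conjI) (simp, rule image_eqI)
  moreover obtain e where "N \<le> p ^ e" using pow_ge[OF p] by blast
  ultimately show "g : rad" using up[OF fj] fj j(3) by (auto simp: rad_def)
 qed
 then have "fs ! t : rad" using ft genideal_minimal[OF rad] by blast
 then obtain e where e: "fs ! t [^] (p ^ e) : I" by (auto simp: rad_def)
 let ?f = "fs ! t [^] (p ^ e)"
 have f: "?f : carrier A" using fs_closed[OF t] by simp
 obtain y where y: "y : K t k" "?f *\<^sub>(C (Suc k)) z = d k y" using e unfolding I_def by blast
 obtain y' where y': "y' : K t k" "?f *\<^sub>(C k) y' = y" using K_divide[OF y(1)] by blast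
 have "d k y = ?f *\<^sub>(C (Suc k)) d k y'" using mod_homD(3)[OF d_hom f K_closed[OF t y'(1)]] y'(2) by simp
 then have "?f *\<^sub>(C (Suc k)) (z -\<^sub>(C (Suc k)) d k y') = 0\<^sub>(C (Suc k))"
  using y(2) f zc d_closed[OF K_closed[OF t y'(1)]]
  by (simp add: a_minus_def Cs.smult_r_distr Cs.smult_r_minus Cs.M.r_neg)
 moreover have "z -\<^sub>(C (Suc k)) d k y' : K t (Suc k)"
  by (rule submodule_minus[OF C_module K_submodule[OF t] z d_K[OF t y'(1)]])
 ultimately have "z -\<^sub>(C (Suc k)) d k y' = 0\<^sub>(C (Suc k))" by (rule K_cancel[rotated])
 then have "z = d k y'" using zc d_closed[OF K_closed[OF t y'(1)]]
  by (metis Cs.M.a_inv_closed Cs.M.add.inv_inv Cs.M.minus_equality a_minus_def)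
 then show ?thesis using y'(1) by blast
qed

text \<open>The only index in degree 0 is the empty set, which does not contain t. In this degree it
  replaces \<open>K_acyclic\<close>.\<close>

lemma K_zero_degree: "z : K t 0 ==> z = 0\<^sub>(C 0)"
proof -
 assume z: "z : K t 0"
 have e: "t \<notin> S" if "S : Ix 0" for S
 proof -
  have "finite S" "card S = 0" using that finite_subset[of S "{..<length fs}"] by (auto simp: cech_index_def)
  then show ?thesis by simp
 qed
 show ?thesis
 proof (rule C_eqI[OF K_closed[OF t z] abelian_groupE(2)[OF module_ab[OF C_module]]])
  show "z S = 0\<^sub>(C 0) S" if S: "S : Ix 0" for S
   using z e[OF S] S C_zero_apply[OF S] unfolding K_def[OF t] by simp
 qed
qed

end

end

section \<open>Removing a redundant generator\<close>

text \<open>An isomorphism of F-modules expressed by the Frobenius maps, instead of the structure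
  maps with values in pullbacks.\<close>

definition coh_iso :: "('a, 'x) ring_scheme => nat => nat => 'a list => 'a list => bool" where
 "coh_iso A p i fs gs \<longleftrightarrow> (\<exists>\<psi>\<in>mod_iso A (cech_cohomology A fs i) (cech_cohomology A gs i).
   \<forall>X\<in>carrier (cech_cohomology A fs i). \<psi> (cech_frob A p fs i X) = cech_frob A p gs i (\<psi> X))"

locale cech_removal = F: cech_complex A p J b fs for A :: "('a, 'x) ring_scheme" (structure) and p
 and J :: "'j set" and b and fs +
 fixes t :: nat
 assumes t: "t < length fs" and p1: "1 < p"
  and ft: "fs ! t : genideal A {fs ! j | j. j < length fs \<and> j \<noteq> t}"
begin

definition gs where "gs = take t fs @ drop (Suc t) fs"
text \<open>The increasing enumeration of the positions other than t.\<close>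

definition skip :: "nat => nat" where "skip j = (if j < t then j else Suc j)"

lemma len: "length fs = Suc (length gs)" using t by (simp add: gs_def)

lemma gs_nth: "j < length gs ==> gs ! j = fs ! skip j"
 using t by (auto simp: gs_def skip_def nth_append)

sublocale G: cech_complex A p J b gs
 using F.fs t by unfold_locales (auto simp: gs_def dest: in_set_takeD in_set_dropD)

lemma skip_mono: "skip j < skip l \<longleftrightarrow> j < l" by (auto simp: skip_def)
lemma skip_inj: "inj_on skip X" by (auto simp: inj_on_def skip_def)
lemma skip_eq: "skip j = skip l \<longleftrightarrow> j = l" using skip_inj[of UNIV] by (auto dest: injD)
lemma skip_ne: "skip j \<noteq> t" by (auto simp: skip_def)
lemma skip_less: "j < length gs ==> skip j < length fs" using len by (auto simp: skip_def)

lemma skip_surj: "l < length fs ==> l \<noteq> t ==> \<exists>j<length gs. l = skip j"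
 using len t by (intro exI[of _ "if l < t then l else l - 1"]) (auto simp: skip_def)

lemma vimage_skip: "skip -` (skip ` S) = S" using skip_eq by auto

lemma Ix_skip: "S : G.Ix i ==> skip ` S : F.Ix i" "S : G.Ix i ==> t \<notin> skip ` S"
 using skip_less card_image[OF skip_inj] by (auto simp: cech_index_def) (metis skip_ne)

lemma Ix_not_t:
 assumes "S : F.Ix i" "t \<notin> S" shows "\<exists>S'\<in>G.Ix i. S = skip ` S'"
proof -
 have S: "S <= {..<length fs}" "card S = i" using assms by (auto simp: cech_index_def)
 have e: "S = skip ` (skip -` S)"
 proof
  show "S <= skip ` (skip -` S)"
  proof
   fix l assume l: "l : S"
   then obtain j where "l = skip j" using skip_surj[of l] S(1) assms(2) by (metis lessThan_iff subsetD)
   then show "l : skip ` (skip -` S)" using l by auto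
  qed
 qed auto
 have "skip -` S <= {..<length gs}"
 proof
  fix j assume "j : skip -` S"
  then have "skip j < length fs" using S(1) by auto
  then show "j : {..<length gs}" using len t by (auto simp: skip_def split: if_splits)
 qed
 moreover have "card (skip -` S) = i" using card_image[OF skip_inj, of "skip -` S"] e S(2) by simp
 ultimately show ?thesis using e by (auto simp: cech_index_def)
qed

lemma Den_skip:
 assumes S: "S <= {..<length gs}" shows "cech_denoms A gs S = cech_denoms A fs (skip ` S)"
proof -
 have gc: "gs ! j : carrier A" if "j : S" for j using that S G.fs_closed by auto
 have eq: "finprod A (\<lambda>l. fs ! l [^] e l) (skip ` S) = finprod A (\<lambda>j. gs ! j [^] e (skip j)) S" for e :: "nat => nat"
 proof -
  have "finprod A (\<lambda>l. fs ! l [^] e l) (skip ` S) = finprod A (\<lambda>j. fs ! skip j [^] e (skip j)) S"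
   using S skip_less F.fs_closed by (intro F.finprod_reindex skip_inj) auto
  also have "\<dots> = finprod A (\<lambda>j. gs ! j [^] e (skip j)) S"
   using gc S gs_nth by (intro F.finprod_cong') auto
  finally show ?thesis .
 qed
 have "finprod A (\<lambda>j. gs ! j [^] e j) S = finprod A (\<lambda>l. fs ! l [^] e (the_inv skip l)) (skip ` S)" for e :: "nat => nat"
  unfolding eq by (simp add: the_inv_f_f[OF skip_inj])
 then have a1: "\<exists>e'. finprod A (\<lambda>j. gs ! j [^] (e j :: nat)) S = finprod A (\<lambda>l. fs ! l [^] (e' l :: nat)) (skip ` S)" for e
  by (intro exI[of _ "\<lambda>l. e (the_inv skip l)"])
 have a2: "\<exists>e'. finprod A (\<lambda>l. fs ! l [^] (e l :: nat)) (skip ` S) = finprod A (\<lambda>j. gs ! j [^] (e' j :: nat)) S" for e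
  using eq by (intro exI[of _ "\<lambda>j. e (skip j)"])
 show ?thesis unfolding cech_denoms_def by (auto simp: a1 a2)
qed

lemma LS_skip: "S <= {..<length gs} ==> G.LS S = F.LS (skip ` S)" using Den_skip by simp

lemma res_skip: "S <= {..<length gs} ==> G.res S = F.res (skip ` S)"
 unfolding cech_res_def using Den_skip by simp

definition rho where "rho i x = (\<lambda>S\<in>G.Ix i. x (skip ` S))"
text \<open>Extension by 0, a section of \<open>rho\<close> on cochains. It need not commute with
  the differential, but the discrepancy lies in K.\<close>

definition ext where "ext i x = (\<lambda>S\<in>F.Ix i. if t : S then 0\<^sub>(F.LS S) else x (skip -` S))"

lemma rho_hom: "rho i : mod_hom A (F.C i) (G.C i)"
 using Ix_skip(1)[of _ i] LS_skip[OF G.Ix_D(1)] F.C_ops[OF t]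
 apply (intro mod_homI)
 subgoal by (auto simp: rho_def F.C_carrier G.C_carrier)
 subgoal by (auto simp: rho_def fun_eq_iff cech_def)
 subgoal by (auto simp: rho_def fun_eq_iff cech_def)
 done

lemma rho_semilin: "rho i : semilin A 1 (F.C i) (G.C i)"
 using rho_hom mod_hom_eq_semilin[OF F.is_cring] by blast

lemma ext_closed:
 assumes x: "x : carrier (G.C i)" shows "ext i x : carrier (F.C i)"
proof -
 have "ext i x S : carrier (F.LS S)" if S: "S : F.Ix i" for S
 proof (cases "t : S")
  case True
  then show ?thesis using S abelian_groupE(2)[OF module_ab[OF F.LS_module[OF F.Ix_D(1)[OF S]]]] by (simp add: ext_def)
 next
  case False
  then obtain S' where S': "S' : G.Ix i" "S = skip ` S'" using Ix_not_t S by blast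
  have "x S' : carrier (G.LS S')" using x S' by (auto simp: G.C_carrier)
  then show ?thesis using S False LS_skip[OF G.Ix_D(1)[OF S'(1)]] unfolding S'(2) by (simp add: ext_def vimage_skip)
 qed
 then show ?thesis by (auto simp: F.C_carrier ext_def)
qed

lemma rho_ext: "x : carrier (G.C i) ==> rho i (ext i x) = x"
 by (rule G.C_eqI[OF mod_homD(1)[OF rho_hom ext_closed]])
  (use Ix_skip in \<open>auto simp: rho_def ext_def vimage_skip\<close>)

lemma rho_zero_iff:
 assumes x: "x : carrier (F.C i)" shows "rho i x = 0\<^sub>(G.C i) \<longleftrightarrow> x : F.K t i"
proof
 assume r: "rho i x = 0\<^sub>(G.C i)"
 have "x S = 0\<^sub>(F.LS S)" if S: "S : F.Ix i" "t \<notin> S" for S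
 proof -
  obtain S' where S': "S' : G.Ix i" "S = skip ` S'" using Ix_not_t S by blast
  have "rho i x S' = 0\<^sub>(G.LS S')" unfolding r using G.C_zero_apply[OF S'(1)] .
  then show ?thesis using S' LS_skip[OF G.Ix_D(1)[OF S'(1)]] by (simp add: rho_def)
 qed
 then show "x : F.K t i" using x unfolding F.K_def[OF t] by blast
next
 assume K: "x : F.K t i"
 show "rho i x = 0\<^sub>(G.C i)"
 proof (rule G.C_eqI[OF mod_homD(1)[OF rho_hom x] abelian_groupE(2)[OF module_ab[OF G.C_module]]])
  fix S assume S: "S : G.Ix i"
  then show "rho i x S = 0\<^sub>(G.C i) S"
   using K Ix_skip[OF S] LS_skip[OF G.Ix_D(1)[OF S]] G.C_zero_apply[OF S] unfolding F.K_def[OF t] by (simp add: rho_def)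
 qed
qed

lemma dterm_rho:
 assumes T: "T : G.Ix (Suc i)" and j: "j : T"
 shows "G.dterm T j (rho i x) = F.dterm (skip ` T) (skip j) x"
proof -
 have e: "skip ` T - {skip j} = skip ` (T - {j})" using skip_eq by auto
 have "{l : skip ` T. l < skip j} = skip ` {l : T. l < j}" using skip_mono by auto
 then have c: "card {l : skip ` T. l < skip j} = card {l : T. l < j}" by (simp add: card_image[OF skip_inj])
 show ?thesis
  unfolding G.dterm_def F.dterm_def c e LS_skip[OF G.Ix_D(1)[OF T]] res_skip[OF G.Ix_D(1)[OF T]]
  using G.Ix_remove[OF T j] by (simp add: rho_def)
qed

lemma d_rho:
 assumes x: "x : carrier (F.C i)" shows "G.d i (rho i x) = rho (Suc i) (F.d i x)"
proof (rule G.C_eqI[OF G.d_closed[OF mod_homD(1)[OF rho_hom x]] mod_homD(1)[OF rho_hom F.d_closed[OF x]]])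
 fix T assume T: "T : G.Ix (Suc i)"
 interpret L: Module.module A "F.LS (skip ` T)" by (rule F.LS_module[OF F.Ix_D(1)[OF Ix_skip(1)[OF T]]])
 have tc: "F.dterm (skip ` T) l x : carrier (F.LS (skip ` T))" if "l : skip ` T" for l
  by (rule mod_homD(1)[OF F.dterm_hom[OF Ix_skip(1)[OF T] that] x])
 have "rho (Suc i) (F.d i x) T = (\<Oplus>\<^bsub>F.LS (skip ` T)\<^esub>l\<in>skip ` T. F.dterm (skip ` T) l x)"
  using T F.d_apply[OF Ix_skip(1)[OF T]] by (simp add: rho_def)
 also have "\<dots> = (\<Oplus>\<^bsub>F.LS (skip ` T)\<^esub>j\<in>T. F.dterm (skip ` T) (skip j) x)"
  using tc by (intro L.M.add.finprod_reindex skip_inj) auto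
 also have "\<dots> = (\<Oplus>\<^bsub>F.LS (skip ` T)\<^esub>j\<in>T. G.dterm T j (rho i x))"
  using tc dterm_rho[OF T] by (intro L.M.finsum_cong') auto
 also have "\<dots> = G.d i (rho i x) T" unfolding G.d_apply[OF T] LS_skip[OF G.Ix_D(1)[OF T]] ..
 finally show "G.d i (rho i x) T = rho (Suc i) (F.d i x) T" by simp
qed

lemma phC_rho: "rho i (F.phC i x) = G.phC i (rho i x)"
 using Ix_skip(1) LS_skip G.Ix_D(1) by (auto simp: rho_def F.phC_def G.phC_def intro!: restrict_ext)

lemma rho_Z: "z : F.Z i ==> rho i z : G.Z i"
 using d_rho mod_homD(1)[OF rho_hom] semilin_zero[OF F.C_module G.C_module rho_semilin] by (auto simp: cech_cycles_def)

lemma rho_Bd: "z : F.Bd i ==> rho i z : G.Bd i"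
proof (cases i)
 case 0
 assume "z : F.Bd i"
 then show ?thesis using 0 semilin_zero[OF F.C_module G.C_module rho_semilin] by (simp add: cech_boundaries_def)
next
 case (Suc k)
 assume "z : F.Bd i"
 then obtain w where "w : carrier (F.C k)" "z = F.d k w" using Suc by (auto simp: cech_boundaries_def)
 then show ?thesis unfolding Suc cech_boundaries_def using d_rho[of w k] mod_homD(1)[OF rho_hom]
  by (auto intro!: image_eqI[of _ _ "rho k w"])
qed

text \<open>A primitive of the restriction is extended by 0; z minus the differential of this
  extension is a cocycle in K, hence a boundary.\<close>

lemma rho_Bd_imp:
 assumes z: "z : F.Z i" and r: "rho i z : G.Bd i" shows "z : F.Bd i"
proof (cases i)
 case 0
 have "rho 0 z = 0\<^sub>(G.C 0)" using r 0 by (simp add: cech_boundaries_def)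
 then have "z : F.K t 0" using rho_zero_iff[of z 0] F.Z_closed[OF z] 0 by simp
 then show ?thesis using F.K_zero_degree[OF t] 0 by (simp add: cech_boundaries_def)
next
 case (Suc k)
 interpret Fi: Module.module A "F.C (Suc k)" by (rule F.C_module)
 interpret Fk: Module.module A "F.C k" by (rule F.C_module)
 interpret Gi: Module.module A "G.C (Suc k)" by (rule G.C_module)
 have zc: "z : carrier (F.C (Suc k))" and dz: "F.d (Suc k) z = 0\<^sub>(F.C (Suc (Suc k)))"
  using z Suc by (auto simp: cech_cycles_def)
 obtain w' where w': "w' : carrier (G.C k)" "rho (Suc k) z = G.d k w'" using r Suc by (auto simp: cech_boundaries_def)
 define w where "w = ext k w'"
 have w: "w : carrier (F.C k)" "rho k w = w'" using ext_closed rho_ext w' by (auto simp: w_def)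
 note dw = F.d_closed[OF w(1)]
 have "rho (Suc k) (z -\<^sub>(F.C (Suc k)) F.d k w) = 0\<^sub>(G.C (Suc k))"
  unfolding semilin_minus[OF F.C_module G.C_module rho_semilin zc dw] d_rho[OF w(1), symmetric] w(2) w'(2)
  using G.d_closed[OF w'(1)] by (simp add: a_minus_def Gi.M.r_neg)
 then have K: "z -\<^sub>(F.C (Suc k)) F.d k w : F.K t (Suc k)" using rho_zero_iff zc dw by simp
 have "F.d (Suc k) (z -\<^sub>(F.C (Suc k)) F.d k w) = 0\<^sub>(F.C (Suc (Suc k)))"
  unfolding semilin_minus[OF F.C_module F.C_module F.d_semilin zc dw] dz F.d_d_zero[OF w(1)]
  using abelian_group_minus_zero[OF module_ab[OF F.C_module]] abelian_groupE(2,5)[OF module_ab[OF F.C_module]] by (simp add: a_minus_def)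
 then obtain y where y: "y : F.K t k" "z -\<^sub>(F.C (Suc k)) F.d k w = F.d k y" using F.K_acyclic[OF t p1 ft K] by blast
 have yc: "y : carrier (F.C k)" by (rule F.K_closed[OF t y(1)])
 have "z = F.d k y +\<^sub>(F.C (Suc k)) F.d k w" unfolding y(2)[symmetric] using zc dw
  by (simp add: a_minus_def Fi.M.a_assoc Fi.M.l_neg)
 also have "\<dots> = F.d k (y +\<^sub>(F.C k) w)" using mod_homD(2)[OF F.d_hom yc w(1)] by simp
 finally show ?thesis using Suc yc w(1) by (auto simp: cech_boundaries_def)
qed

text \<open>The differential of the extension by 0 is a cocycle in K, so it is also the differential
  of a member of K, which is subtracted.\<close>

lemma rho_surj:
 assumes z: "z : G.Z i" shows "\<exists>x\<in>F.Z i. rho i x = z"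
proof -
 interpret Fs: Module.module A "F.C (Suc i)" by (rule F.C_module)
 interpret Fi: Module.module A "F.C i" by (rule F.C_module)
 interpret Gi: Module.module A "G.C i" by (rule G.C_module)
 define x where "x = ext i z"
 have x: "x : carrier (F.C i)" "rho i x = z" using ext_closed rho_ext G.Z_closed[OF z] by (auto simp: x_def)
 note dx = F.d_closed[OF x(1)]
 have "rho (Suc i) (F.d i x) = 0\<^sub>(G.C (Suc i))" using d_rho[OF x(1)] x(2) z by (simp add: cech_cycles_def)
 then have K: "F.d i x : F.K t (Suc i)" using rho_zero_iff[OF dx] by simp
 obtain y where y: "y : F.K t i" "F.d i x = F.d i y" using F.K_acyclic[OF t p1 ft K F.d_d_zero[OF x(1)]] by blast
 have yc: "y : carrier (F.C i)" by (rule F.K_closed[OF t y(1)])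
 have "F.d i (x -\<^sub>(F.C i) y) = 0\<^sub>(F.C (Suc i))"
  unfolding semilin_minus[OF F.C_module F.C_module F.d_semilin x(1) yc] y(2)
  using F.d_closed[OF yc] by (simp add: a_minus_def Fs.M.r_neg)
 then have "x -\<^sub>(F.C i) y : F.Z i" using x(1) yc by (simp add: cech_cycles_def)
 moreover have "rho i (x -\<^sub>(F.C i) y) = z"
  unfolding semilin_minus[OF F.C_module G.C_module rho_semilin x(1) yc] x(2)
  using rho_zero_iff[OF yc] y(1) G.Z_closed[OF z] by (simp add: a_minus_def)
 ultimately show ?thesis by blast
qed

lemma coh_iso_removal: "coh_iso A p i fs gs"
proof -
 define f where "f z = G.cl i (rho i z)" for z
 have fs: "f : semilin A 1 (submod (F.C i) (F.Z i)) (G.H i)"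
 proof (rule semilinI)
  fix x assume "x : carrier (submod (F.C i) (F.Z i))"
  then have x: "x : F.Z i" by (simp add: F.Zc)
  note xc = F.Z_closed[OF x]
  show "f x : carrier (G.H i)" unfolding f_def by (rule G.cl_closed[OF rho_Z[OF x]])
  show "f (a *\<^sub>(submod (F.C i) (F.Z i)) x) = (a [^] (1::nat)) *\<^sub>(G.H i) f x" if "a : carrier A" for a
   using mod_homD(3)[OF rho_hom that xc] G.cl_smult[OF that rho_Z[OF x]] that by (simp add: f_def submod_def)
  fix y assume "y : carrier (submod (F.C i) (F.Z i))"
  then have y: "y : F.Z i" by (simp add: F.Zc)
  show "f (x +\<^sub>(submod (F.C i) (F.Z i)) y) = f x +\<^sub>(G.H i) f y"
   using mod_homD(2)[OF rho_hom xc F.Z_closed[OF y]] G.cl_add[OF rho_Z[OF x] rho_Z[OF y]] by (simp add: f_def submod_def)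
 qed
 have f0: "f x = 0\<^sub>(G.H i)" if "x : F.Bd i" for x
  unfolding f_def using G.cl_zero_iff[OF rho_Z] rho_Bd[OF that] F.Bd_Z that by blast
 define \<psi> where "\<psi> X = the_elem (f ` X)" for X
 have \<psi>: "\<psi> : semilin A 1 (F.H i) (G.H i)"
  unfolding \<psi>_def[abs_def] F.H_quot by (rule quot_lift_semilin[OF F.Zmod F.Bd_submodule_Z G.H_module fs f0])
 have \<psi>c: "\<psi> (F.cl i z) = G.cl i (rho i z)" if "z : F.Z i" for z unfolding \<psi>_def f_def[symmetric]
  using quot_lift[where f = f, OF F.Zmod F.Bd_submodule_Z[of i] G.H_module semilin_add[OF fs] _ f0, of z] semilin_closed[OF fs] that
  by (simp add: F.Zc)
 have inj: "inj_on \<psi> (carrier (F.H i))"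
 proof (rule semilin_inj_onI[OF F.H_module G.H_module \<psi>])
  fix X assume "X : carrier (F.H i)" and z0: "\<psi> X = 0\<^sub>(G.H i)"
  then obtain z where z: "z : F.Z i" "X = F.cl i z" by (auto simp: F.H_carrier)
  then have "rho i z : G.Bd i" using z0 \<psi>c G.cl_zero_iff[OF rho_Z[OF z(1)]] by simp
  then show "X = 0\<^sub>(F.H i)" using rho_Bd_imp[OF z(1)] F.cl_zero_iff[OF z(1)] z(2) by simp
 qed
 have surj: "\<psi> ` carrier (F.H i) = carrier (G.H i)"
 proof (intro equalityI subsetI)
  fix Y assume "Y : carrier (G.H i)"
  then obtain z where z: "z : G.Z i" "Y = G.cl i z" by (auto simp: G.H_carrier)
  obtain x where "x : F.Z i" "rho i x = z" using rho_surj[OF z(1)] by blast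
  then show "Y : \<psi> ` carrier (F.H i)" using \<psi>c z(2) F.cl_closed by (metis image_eqI)
 qed (use semilin_closed[OF \<psi>] in auto)
 have frob: "\<psi> (cech_frob A p fs i X) = cech_frob A p gs i (\<psi> X)" if X: "X : carrier (F.H i)" for X
 proof -
  obtain z where z: "z : F.Z i" "X = F.cl i z" using X by (auto simp: F.H_carrier)
  show ?thesis unfolding z(2) F.cech_frob_cl[OF z(1)] \<psi>c[OF z(1)] \<psi>c[OF F.Z_phC[OF z(1)]] G.cech_frob_cl[OF rho_Z[OF z(1)]] phC_rho ..
 qed
 have "\<psi> : mod_iso A (F.H i) (G.H i)"
  using \<psi>[folded mod_hom_eq_semilin[OF F.is_cring]] inj surj by (simp add: mod_iso_def bij_betw_def)
 then show ?thesis using frob unfolding coh_iso_def by blast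
qed

end

context frob_ring
begin

lemma cech: "set fs <= carrier A ==> cech_complex A p J b fs" by unfold_locales

lemma coh_iso_refl: "coh_iso A p i fs fs"
 unfolding coh_iso_def by (rule bexI[of _ "\<lambda>x. x"]) (auto simp: mod_iso_def semilin_id[OF is_cring] bij_betw_def)

lemma coh_iso_sym:
 assumes fs: "set fs <= carrier A" and "coh_iso A p i fs gs"
 shows "coh_iso A p i gs fs"
proof -
 interpret F: cech_complex A p J b fs by (rule cech[OF fs])
 interpret H: unit_module A p J b "F.H i" "cech_frob A p fs i" by (rule F.H_unit)
 obtain \<psi> where \<psi>: "\<psi> : mod_iso A (cech_cohomology A fs i) (cech_cohomology A gs i)"
  and fr: "\<And>X. X : carrier (F.H i) ==> \<psi> (cech_frob A p fs i X) = cech_frob A p gs i (\<psi> X)"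
  using assms(2) unfolding coh_iso_def by blast
 let ?g = "inv_into (carrier (F.H i)) \<psi>"
 have bij: "inj_on \<psi> (carrier (F.H i))" "\<psi> ` carrier (F.H i) = carrier (cech_cohomology A gs i)"
  using \<psi> by (auto simp: mod_iso_def bij_betw_def)
 have "?g (cech_frob A p gs i Y) = cech_frob A p fs i (?g Y)" if Y: "Y : carrier (cech_cohomology A gs i)" for Y
 proof -
  obtain X where X: "X : carrier (F.H i)" "Y = \<psi> X" using Y bij(2) by blast
  show ?thesis unfolding X(2) fr[OF X(1), symmetric] using X(1) bij(1) by simp
 qed
 then show ?thesis unfolding coh_iso_def using mod_iso_inv[OF F.H_module \<psi>] by blast
qed

lemma coh_iso_trans:
 assumes "coh_iso A p i fs gs" "coh_iso A p i gs hs"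
 shows "coh_iso A p i fs hs"
proof -
 obtain \<psi> where \<psi>: "\<psi> : mod_iso A (cech_cohomology A fs i) (cech_cohomology A gs i)"
  "\<And>X. X : carrier (cech_cohomology A fs i) ==> \<psi> (cech_frob A p fs i X) = cech_frob A p gs i (\<psi> X)"
  using assms(1) unfolding coh_iso_def by blast
 obtain \<chi> where \<chi>: "\<chi> : mod_iso A (cech_cohomology A gs i) (cech_cohomology A hs i)"
  "\<And>X. X : carrier (cech_cohomology A gs i) ==> \<chi> (cech_frob A p gs i X) = cech_frob A p hs i (\<chi> X)"
  using assms(2) unfolding coh_iso_def by blast
 have "(\<lambda>x. \<chi> (\<psi> x)) : mod_iso A (cech_cohomology A fs i) (cech_cohomology A hs i)"
  using \<psi>(1) \<chi>(1) mod_hom_comp[of \<psi> A _ _ \<chi>] bij_betw_trans[of \<psi> _ _ \<chi>] unfolding mod_iso_def by (auto simp: o_def)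
 moreover have "\<psi> X : carrier (cech_cohomology A gs i)" if "X : carrier (cech_cohomology A fs i)" for X
  using \<psi>(1) that mod_homD(1)[of \<psi>] by (auto simp: mod_iso_def)
 ultimately show ?thesis unfolding coh_iso_def using \<psi>(2) \<chi>(2) by (metis (lifting))
qed

lemma genideal_mono: "S <= T ==> T <= carrier A ==> genideal A S <= genideal A T"
 using genideal_minimal[OF genideal_ideal] genideal_self by (meson order_trans)

lemma coh_iso_remove:
 assumes "1 < p" "set (us @ g # vs) <= carrier A" "g : genideal A (set (us @ vs))"
 shows "coh_iso A p i (us @ g # vs) (us @ vs)"
proof -
 interpret cech_complex A p J b "us @ g # vs" by (rule cech[OF assms(2)])
 let ?l = "us @ g # vs" and ?t = "length us"
 have "set (us @ vs) <= {?l ! j | j. j < length ?l \<and> j \<noteq> ?t}"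
 proof
  fix x assume "x : set (us @ vs)"
  then consider k where "k < length us" "x = us ! k" | k where "k < length vs" "x = vs ! k"
   by (auto simp: in_set_conv_nth)
  then show "x : {?l ! j | j. j < length ?l \<and> j \<noteq> ?t}"
  proof cases
   case 1
   then show ?thesis by (intro CollectI exI[of _ k]) (auto simp: nth_append)
  next
   case 2
   then show ?thesis by (intro CollectI exI[of _ "Suc (length us + k)"]) (auto simp: nth_append)
  qed
 qed
 moreover have "{?l ! j | j. j < length ?l \<and> j \<noteq> ?t} <= carrier A"
  using subsetD[OF assms(2) nth_mem] by blast
 ultimately have "?l ! ?t : genideal A {?l ! j | j. j < length ?l \<and> j \<noteq> ?t}"
  using subsetD[OF genideal_mono assms(3)] by simp
 then interpret r: cech_removal A p J b ?l ?t by unfold_locales (use assms(1) in auto)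
 have "r.gs = us @ vs" by (simp add: r.gs_def)
 then show ?thesis using r.coh_iso_removal[of i] by simp
qed

lemma coh_iso_append:
 assumes p: "1 < p" and fs: "set fs <= carrier A" and gs: "set gs <= genideal A (set fs)"
 shows "coh_iso A p i (fs @ gs) fs" "coh_iso A p i (gs @ fs) fs"
proof -
 have I: "genideal A (set fs) <= carrier A" using ideal.Icarr[OF genideal_ideal[OF fs]] by (rule subsetI)
 show "coh_iso A p i (fs @ gs) fs" using gs
 proof (induction gs rule: rev_induct)
  case Nil
  then show ?case using coh_iso_refl by simp
 next
  case (snoc g gs)
  have sub: "set (fs @ gs) <= carrier A" using fs snoc.prems I by auto
  have "g : genideal A (set (fs @ gs))" using snoc.prems genideal_mono[of "set fs" "set (fs @ gs)"] sub by auto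
  then have "coh_iso A p i ((fs @ gs) @ g # []) ((fs @ gs) @ [])"
   using sub snoc.prems I by (intro coh_iso_remove p) auto
  then show ?case using coh_iso_trans snoc by auto
 qed
 show "coh_iso A p i (gs @ fs) fs" using gs
 proof (induction gs)
  case Nil
  then show ?case using coh_iso_refl by simp
 next
  case (Cons g gs)
  have sub: "set (gs @ fs) <= carrier A" using fs Cons.prems I by auto
  have "g : genideal A (set (gs @ fs))" using Cons.prems genideal_mono[of "set fs" "set (gs @ fs)"] sub by auto
  then have "coh_iso A p i ([] @ g # (gs @ fs)) ([] @ (gs @ fs))"
   using sub Cons.prems I by (intro coh_iso_remove p) auto
  then show ?case using coh_iso_trans Cons by auto
 qed
qed

text \<open>Both lists are compared with their concatenation, from which the members of either list
  can be removed one at a time, being redundant.\<close>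

theorem cech_generators_iso:
 assumes "1 < p" "set fs <= carrier A" "set gs <= carrier A" "genideal A (set fs) = genideal A (set gs)"
 shows "coh_iso A p i fs gs"
proof -
 have "set gs <= genideal A (set fs)" "set fs <= genideal A (set gs)" using genideal_self assms by metis+
 then have "coh_iso A p i (fs @ gs) fs" "coh_iso A p i (fs @ gs) gs" using coh_iso_append assms by auto
 then show ?thesis using coh_iso_sym[of "fs @ gs"] coh_iso_trans assms(2,3) by (metis set_append Un_subset_iff)
qed

end

section \<open>A basis of a field over its p-th powers\<close>

text \<open>The field is a vector space over itself when the scalar c acts as multiplication by c^p;
  B is a basis of this space, and it may be infinite.\<close>

lemma frobenius_basis:
 assumes p: "prime p" and ch: "CHAR('k::field) = p"
 shows "\<exists>B::'k set. (\<forall>a. \<exists>F c. finite F \<and> F <= B \<and> a = (\<Sum>\<beta>\<in>F. c \<beta> ^ p * \<beta>)) \<and>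
   (\<forall>F c. finite F \<longrightarrow> F <= B \<longrightarrow> (\<Sum>\<beta>\<in>F. c \<beta> ^ p * \<beta>) = 0 \<longrightarrow> (\<forall>\<beta>\<in>F. c \<beta> = 0))"
proof -
 interpret V: vector_space "\<lambda>c x::'k. c ^ p * x"
  using p ch by unfold_locales (auto simp: algebra_simps freshmans_dream)
 define B where "B = V.extend_basis {}"
 have B: "\<not> V.dependent B" "V.span B = UNIV"
  using V.independent_extend_basis V.independent_empty by (auto simp: B_def)
 have "\<exists>F c. finite F \<and> F <= B \<and> a = (\<Sum>\<beta>\<in>F. c \<beta> ^ p * \<beta>)" for a
 proof -
  have "a : V.span B" using B(2) by simp
  then show ?thesis unfolding V.span_explicit by blast
 qed
 moreover have "\<forall>F c. finite F \<longrightarrow> F <= B \<longrightarrow> (\<Sum>\<beta>\<in>F. c \<beta> ^ p * \<beta>) = 0 \<longrightarrow> (\<forall>\<beta>\<in>F. c \<beta> = 0)"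
  using B(1) unfolding V.independent_explicit_module by blast
 ultimately show ?thesis by blast
qed

subsection \<open>Monomials\<close>

abbreviation keys where "keys \<equiv> Poly_Mapping.keys"
abbreviation lookup where "lookup \<equiv> Poly_Mapping.lookup"
abbreviation monom where "monom \<equiv> Poly_Mapping.single"

definition mons :: "nat => (nat \<Rightarrow>\<^sub>0 nat) set" where "mons n = {m. keys m <= {..<n}}"

definition pmap :: "(nat => nat) => (nat \<Rightarrow>\<^sub>0 nat) => nat \<Rightarrow>\<^sub>0 nat" where "pmap = Poly_Mapping.map"

lemma lookup_pmap: "f 0 = 0 ==> lookup (pmap f m) k = f (lookup m k)"
 by (simp add: pmap_def Poly_Mapping.map.rep_eq when_def)

lemma mons_iff: "m : mons n \<longleftrightarrow> (\<forall>i\<ge>n. lookup m i = 0)"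
 by (auto simp: mons_def in_keys_iff) (metis less_irrefl linorder_not_less)+

lemma power_monom: "monom m c ^ e = monom (pmap ((*) e) m) (c ^ e :: 'k::field)"
proof (induction e)
 case 0
 have "pmap ((*) 0) m = 0" by (rule poly_mapping_eqI) (simp add: lookup_pmap)
 then show ?case by (simp only: power_0 single_one)
next
 case (Suc e)
 have "m + pmap ((*) e) m = pmap ((*) (Suc e)) m" by (rule poly_mapping_eqI) (simp add: lookup_pmap lookup_add)
 then show ?case by (simp only: power_Suc Suc mult_single)
qed

lemma sum_monoms: "f = (\<Sum>m\<in>keys f. monom m (lookup f m))"
 by (rule poly_mapping_eqI) (auto simp: lookup_sum lookup_single when_def in_keys_iff)

lemma CHAR_mpoly: assumes ch: "CHAR('k::field) = p" shows "CHAR('k mpoly) = p"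
proof -
 have "of_nat k = (monom 0 (of_nat k) :: 'k mpoly)" for k by simp
 then have c: "(of_nat k :: 'k mpoly) = 0 \<longleftrightarrow> p dvd k" for k
  using ch of_nat_eq_0_iff_char_dvd[of k, where 'a = 'k] inj_single[of "0 :: nat \<Rightarrow>\<^sub>0 nat"] single_zero[of "0 :: nat \<Rightarrow>\<^sub>0 nat"]
  unfolding inj_on_def by (metis UNIV_I)
 show ?thesis by (rule CHAR_eqI) (simp_all only: c dvd_refl)
qed

lemma mpoly_power_p:
 assumes p: "prime p" and ch: "CHAR('k::field) = p"
 shows "(f :: 'k mpoly) ^ p = (\<Sum>m\<in>keys f. monom (pmap ((*) p) m) (lookup f m ^ p))"
proof -
 have "(\<Sum>m\<in>keys f. monom m (lookup f m)) ^ p = (\<Sum>m\<in>keys f. monom m (lookup f m) ^ p)"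
  by (rule freshmans_dream_sum) (simp_all only: CHAR_mpoly[OF ch] p)
 then show ?thesis unfolding sum_monoms[of f, symmetric] power_monom .
qed

definition box :: "nat => nat => (nat \<Rightarrow>\<^sub>0 nat) set" where
 "box n \<delta> = {m : mons n. \<forall>i. lookup m i \<le> \<delta>}"

lemma finite_box: "finite (box n \<delta>)"
proof (rule inj_on_finite)
 show "inj_on (\<lambda>m. restrict (lookup m) {..<n}) (box n \<delta>)"
 proof (rule inj_onI)
  fix m m' assume m: "m : box n \<delta>" "m' : box n \<delta>" and e: "restrict (lookup m) {..<n} = restrict (lookup m') {..<n}"
  have "lookup m i = lookup m' i" for i
   using m fun_cong[OF e, of i] by (cases "i < n") (auto simp: box_def mons_iff)
  then show "m = m'" by (rule poly_mapping_eqI)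
 qed
 show "(\<lambda>m. restrict (lookup m) {..<n}) ` box n \<delta> <= {..<n} \<rightarrow>\<^sub>E {..\<delta>}" by (auto simp: box_def intro!: restrict_PiE_iff[THEN iffD2])
qed (simp add: finite_PiE)

lemma keys_box: "f : carrier (poly_ring n) ==> \<exists>\<delta>. keys f <= box n \<delta>"
proof -
 assume f: "f : carrier (poly_ring n)"
 let ?X = "insert 0 (\<Union>m\<in>keys f. lookup m ` {..<n})"
 have "lookup m i \<le> Max ?X" if "m : keys f" for m i
 proof (cases "i < n")
  case True
  then show ?thesis using that by (intro Max_ge) auto
 next
  case False
  then have "lookup m i = 0" using f that by (auto simp: poly_ring_def in_keys_iff subset_iff)
  then show ?thesis by simp
 qed
 then show ?thesis using f by (intro exI[of _ "Max ?X"]) (auto simp: box_def mons_def poly_ring_def)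
qed

lemma keys_box_mult: "keys f <= box n \<delta> ==> keys g <= box n \<epsilon> ==> keys (f * g :: 'k::field mpoly) <= box n (\<delta> + \<epsilon>)"
proof
 fix m assume s: "keys f <= box n \<delta>" "keys g <= box n \<epsilon>" and "m : keys (f * g)"
 then obtain a b where "m = a + b" "a : keys f" "b : keys g" using keys_mult[of f g] by blast
 then show "m : box n (\<delta> + \<epsilon>)" using s by (auto simp: box_def mons_iff lookup_add add_mono subset_iff)
qed

subsection \<open>Polynomial rings\<close>

lemma poly_ring_simps [simp]:
 "f \<otimes>\<^sub>(poly_ring n) g = f * g" "f +\<^sub>(poly_ring n) g = f + g" "1\<^sub>(poly_ring n) = 1" "0\<^sub>(poly_ring n) = 0"
 by (simp_all add: poly_ring_def)

lemma poly_ring_carrier: "f : carrier (poly_ring n) \<longleftrightarrow> keys f <= mons n"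
 by (auto simp: poly_ring_def mons_def)

lemma monom_carrier: "m : mons n ==> monom m c : carrier (poly_ring n)"
 by (simp add: poly_ring_carrier)

lemma poly_ring_cring: "cring (poly_ring n :: 'k::field mpoly ring)"
proof (rule cringI[OF abelian_groupI comm_monoidI])
 let ?R = "poly_ring n :: 'k mpoly ring"
 have uminus: "- f : carrier ?R" if "f : carrier ?R" for f
  using that by (auto simp: poly_ring_carrier)
 show "f +\<^sub>?R g : carrier ?R" if "f : carrier ?R" "g : carrier ?R" for f g
  using that keys_add[of f g] by (auto simp: poly_ring_carrier)
 show "f \<otimes>\<^sub>?R g : carrier ?R" if "f : carrier ?R" "g : carrier ?R" for f g
 proof -
  have "a + b : mons n" if "a : mons n" "b : mons n" for a b using that by (simp add: mons_iff lookup_add)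
  then show ?thesis using that keys_mult[of f g] unfolding poly_ring_carrier poly_ring_simps by blast
 qed
 show "\<exists>g\<in>carrier ?R. g +\<^sub>?R f = 0\<^sub>?R" if "f : carrier ?R" for f
  using uminus[OF that] by (intro bexI[of _ "- f"]) auto
qed (auto simp: algebra_simps poly_ring_carrier mons_iff)

lemma poly_ring_pow [simp]: "f ^\<^sub>(poly_ring n) (e::nat) = f ^ e" by (induction e) (simp_all)

lemma poly_ring_finsum:
 assumes "\<And>x. x : X ==> f x : carrier (poly_ring n)"
 shows "finsum (poly_ring n) f X = (\<Sum>x\<in>X. f x :: 'k::field mpoly)"
proof -
 interpret R: cring "poly_ring n :: 'k mpoly ring" by (rule poly_ring_cring)
 show ?thesis
 proof (cases "finite X")
  case True
  then show ?thesis using assms by (induction X) (simp_all)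
 qed (simp add: R.finsum_infinite)
qed

text \<open>Linear algebra over a possibly infinite field, carried out without dimensions, by
  induction on the set of coordinates. Either some member of the chain vanishes at a, or every
  member contains an element not vanishing at a, which reduces the others to elements vanishing at
  a.\<close>

lemma descending_subspaces_stabilise:
 fixes T :: "nat => ('x => 'k::field) set"
 assumes "finite X" and "\<And>e. T (Suc e) <= T e" and "\<And>e. (\<lambda>_. 0) : T e"
  and "\<And>e f x. f : T e ==> x \<notin> X ==> f x = 0"
  and "\<And>e f g c. f : T e ==> g : T e ==> (\<lambda>x. f x + c * g x) : T e"
 shows "\<exists>e0. \<forall>e\<ge>e0. T e = T e0" using assms
proof (induction X arbitrary: T)
 case empty
 have "T e = {\<lambda>_. 0}" for e using empty.prems(2,3) by blast
 then show ?case by simp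
next
 case (insert a X)
 note dec = insert.prems(1) and zero = insert.prems(2) and outside = insert.prems(3) and comb = insert.prems(4)
 define T0 where "T0 e = {f : T e. f a = 0}" for e
 have "\<exists>e0. \<forall>e\<ge>e0. T0 e = T0 e0"
 proof (rule insert.IH)
  show "f x = 0" if "f : T0 e" "x \<notin> X" for e f x
   using that outside by (cases "x = a") (auto simp: T0_def)
 qed (use dec zero comb in \<open>auto simp: T0_def\<close>)
 then obtain e0 where e0: "\<And>e. e0 \<le> e ==> T0 e = T0 e0" by blast
 have decr: "T e' <= T e" if "e \<le> e'" for e e' using lift_Suc_antimono_le[of T] dec that by blast
 show ?case
 proof (cases "\<exists>e. T e = T0 e")
  case True
  then obtain e1 where e1: "T e1 = T0 e1" by blast
  have "T e = T0 e" if "e1 \<le> e" for e using e1 decr[OF that] by (auto simp: T0_def)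
  then have "T e = T0 e0" if "max e0 e1 \<le> e" for e using e0[of e] that by simp
  then show ?thesis by (metis order_refl)
 next
  case False
  have "w : T e" if w: "w : T e0" and e: "e0 \<le> e" for w e
  proof -
   obtain u where u: "u : T e" "u a \<noteq> 0" using False by (auto simp: T0_def)
   have "(\<lambda>x. w x + (- (w a / u a)) * u x) : T0 e0"
    using comb[OF w subsetD[OF decr[OF e] u(1)], of "- (w a / u a)"] u(2) by (simp add: T0_def)
   then have "(\<lambda>x. w x + (- (w a / u a)) * u x) : T e" using e0[OF e] by (auto simp: T0_def)
   from comb[OF this u(1), of "w a / u a"] show ?thesis by simp
  qed
  then show ?thesis using decr by blast
 qed
qed

section \<open>The polynomial ring over its p-th powers, and degree bounds\<close>

locale poly_frobenius =
 fixes p n :: nat and B :: "'k::field set"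
 assumes p: "prime p" and char: "CHAR('k) = p"
  and B_gen: "\<And>a. \<exists>F c. finite F \<and> F <= B \<and> a = (\<Sum>\<beta>\<in>F. c \<beta> ^ p * \<beta>)"
  and B_indep: "\<And>F c \<beta>. finite F ==> F <= B ==> (\<Sum>\<beta>\<in>F. c \<beta> ^ p * \<beta>) = 0 ==> \<beta> : F ==> c \<beta> = 0"
begin

abbreviation R :: "'k mpoly ring" where "R \<equiv> poly_ring n"
text \<open>Products of a basis of the field over its p-th powers with the monomials all of whose
  exponents are below p form a basis of the polynomial ring over its p-th powers.\<close>

definition J where "J = B \<times> {\<mu> : mons n. \<forall>i. lookup \<mu> i < p}"
definition b :: "'k \<times> (nat \<Rightarrow>\<^sub>0 nat) => 'k mpoly" where "b j = monom (snd j) (fst j)"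

sublocale cring R by (rule poly_ring_cring)

text \<open>By division with remainder, an exponent vector is \<nu> + p m for exactly one \<nu> with
  entries below p, so at most one term of y^p contributes.\<close>

lemma lookup_b_pow:
 assumes "j : J" and \<nu>: "\<forall>i. lookup \<nu> i < p"
 shows "lookup (b j * y ^ p) (\<nu> + pmap ((*) p) m) = (if snd j = \<nu> then lookup y m ^ p * fst j else 0)"
proof -
 obtain \<beta> \<mu> where j: "j = (\<beta>, \<mu>)" "\<forall>i. lookup \<mu> i < p" using assms(1) by (auto simp: J_def)
 have eq: "\<mu> + pmap ((*) p) m' = \<nu> + pmap ((*) p) m \<longleftrightarrow> \<mu> = \<nu> \<and> m' = m" for m'
 proof
  assume e: "\<mu> + pmap ((*) p) m' = \<nu> + pmap ((*) p) m"
  have "lookup \<mu> i = lookup \<nu> i \<and> lookup m' i = lookup m i" for i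
  proof -
   have "lookup \<mu> i + p * lookup m' i = lookup \<nu> i + p * lookup m i"
    using arg_cong[OF e, of "\<lambda>f. lookup f i"] by (simp add: lookup_add lookup_pmap)
   then have "(lookup \<mu> i + p * lookup m' i) mod p = (lookup \<nu> i + p * lookup m i) mod p"
    "(lookup \<mu> i + p * lookup m' i) div p = (lookup \<nu> i + p * lookup m i) div p" by simp_all
   then show ?thesis using j(2) \<nu> prime_gt_0_nat[OF p] by simp
  qed
  then show "\<mu> = \<nu> \<and> m' = m" by (auto intro: poly_mapping_eqI)
 qed simp
 have "b j * y ^ p = (\<Sum>m'\<in>keys y. monom (\<mu> + pmap ((*) p) m') (\<beta> * lookup y m' ^ p))"
  unfolding mpoly_power_p[OF p char] by (simp add: b_def j(1) sum_distrib_left mult_single)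
 then have "lookup (b j * y ^ p) (\<nu> + pmap ((*) p) m) = (\<Sum>m'\<in>keys y. \<beta> * lookup y m' ^ p when \<mu> = \<nu> \<and> m' = m)"
  by (simp add: lookup_sum lookup_single eq)
 also have "\<dots> = (\<Sum>m'\<in>keys y. if m' = m then (if \<mu> = \<nu> then \<beta> * lookup y m' ^ p else 0) else 0)"
  by (intro sum.cong) auto
 also have "\<dots> = (if snd j = \<nu> then lookup y m ^ p * fst j else 0)"
  using prime_gt_0_nat[OF p] by (simp add: in_keys_iff j(1))
 finally show ?thesis .
qed

lemma lookup_b_sum:
 assumes F: "finite F" "F <= J" and \<nu>: "\<forall>i. lookup \<nu> i < p"
 shows "lookup (\<Sum>j\<in>F. b j * y j ^ p) (\<nu> + pmap ((*) p) m) = (\<Sum>\<beta> | (\<beta>, \<nu>) : F. lookup (y (\<beta>, \<nu>)) m ^ p * \<beta>)"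
proof -
 have "lookup (\<Sum>j\<in>F. b j * y j ^ p) (\<nu> + pmap ((*) p) m) = (\<Sum>j\<in>F. if snd j = \<nu> then lookup (y j) m ^ p * fst j else 0)"
  unfolding lookup_sum using F by (intro sum.cong lookup_b_pow \<nu>) auto
 also have "\<dots> = (\<Sum>j\<in>{j : F. snd j = \<nu>}. lookup (y j) m ^ p * fst j)"
  using F(1) by (simp add: sum.inter_filter)
 also have "\<dots> = (\<Sum>\<beta> | (\<beta>, \<nu>) : F. lookup (y (\<beta>, \<nu>)) m ^ p * \<beta>)"
  by (rule sum.reindex_bij_witness[of _ "\<lambda>\<beta>. (\<beta>, \<nu>)" fst]) auto
 finally show ?thesis .
qed

text \<open>A single vanishing coefficient of the sum makes a single coefficient of y j vanish. In
  this form the lemma gives independence and also, in \<open>keys_DR\<close>, the bound on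
  exponents.\<close>

lemma b_indep:
 assumes F: "finite F" "F <= J" and z: "lookup (\<Sum>j\<in>F. b j * y j ^ p) (snd j + pmap ((*) p) m) = 0"
  and j: "j : F"
 shows "lookup (y j) m = 0"
proof -
 obtain \<beta> \<nu> where bn: "j = (\<beta>, \<nu>)" "\<forall>i. lookup \<nu> i < p" using j F by (auto simp: J_def)
 have fin: "finite {\<beta>. (\<beta>, \<nu>) : F}" using finite_vimageI[OF F(1), of "\<lambda>\<beta>. (\<beta>, \<nu>)"] by (simp add: inj_on_def vimage_def)
 have "lookup (y (\<beta>, \<nu>)) m = 0" if "(\<Sum>\<beta> | (\<beta>, \<nu>) : F. lookup (y (\<beta>, \<nu>)) m ^ p * \<beta>) = 0"
  by (rule B_indep[OF fin _ that]) (use F j in \<open>auto simp: J_def bn(1)\<close>)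
 then show ?thesis using z lookup_b_sum[OF F bn(2), of y m] by (simp add: bn(1))
qed

lemma b_gen:
 assumes f: "f : carrier R"
 shows "\<exists>F y. finite F \<and> F <= J \<and> (\<forall>j. y j : carrier R) \<and> f = (\<Sum>j\<in>F. b j * y j ^ p)"
proof -
 let ?Q = "\<lambda>f. \<exists>F y. finite F \<and> F <= J \<and> (\<forall>j. y j : carrier R) \<and> f = (\<Sum>j\<in>F. b j * y j ^ p)"
 have p0: "0 < p" using prime_gt_0_nat[OF p] .
 have mono: "?Q (monom m a)" if m: "m : mons n" for m a
 proof -
  define \<mu> m' where "\<mu> = pmap (\<lambda>x. x mod p) m" and "m' = pmap (\<lambda>x. x div p) m"
  have mm: "m = \<mu> + pmap ((*) p) m'" by (rule poly_mapping_eqI) (simp add: \<mu>_def m'_def lookup_pmap lookup_add)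
  have \<mu>: "\<mu> : mons n" "\<forall>i. lookup \<mu> i < p" "m' : mons n" using m p0 by (auto simp: \<mu>_def m'_def mons_iff lookup_pmap)
  obtain F c where F: "finite F" "F <= B" "a = (\<Sum>\<beta>\<in>F. c \<beta> ^ p * \<beta>)" using B_gen by blast
  have "monom m a = (\<Sum>\<beta>\<in>F. monom m (c \<beta> ^ p * \<beta>))" unfolding F(3)
   by (rule poly_mapping_eqI) (simp add: lookup_sum lookup_single when_def)
  also have "\<dots> = (\<Sum>\<beta>\<in>F. b (\<beta>, \<mu>) * monom m' (c \<beta>) ^ p)"
   by (intro sum.cong refl) (simp add: b_def power_monom mult_single mm mult.commute)
  also have "\<dots> = (\<Sum>j\<in>F \<times> {\<mu>}. b j * monom m' (c (fst j)) ^ p)"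
   by (rule sum.reindex_bij_witness[of _ fst "\<lambda>\<beta>. (\<beta>, \<mu>)"]) auto
  finally show ?thesis using F \<mu> monom_carrier[OF \<mu>(3)]
   by (intro exI[of _ "F \<times> {\<mu>}"] exI[of _ "\<lambda>j. monom m' (c (fst j))"]) (auto simp: J_def)
 qed
 have add: "?Q (f + g)" if f: "?Q f" and g: "?Q g" for f g
 proof -
  obtain F y where F: "finite F" "F <= J" "\<forall>j. y j : carrier R" "f = (\<Sum>j\<in>F. b j * y j ^ p)" using f by blast
  obtain G z where G: "finite G" "G <= J" "\<forall>j. z j : carrier R" "g = (\<Sum>j\<in>G. b j * z j ^ p)" using g by blast
  let ?y = "\<lambda>j. if j : F then y j else 0" and ?z = "\<lambda>j. if j : G then z j else 0"
  have "f = (\<Sum>j\<in>F \<union> G. b j * ?y j ^ p)" unfolding F(4) using F(1) G(1) p0 by (intro sum.mono_neutral_cong_left) auto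
  moreover have "g = (\<Sum>j\<in>F \<union> G. b j * ?z j ^ p)" unfolding G(4) using F(1) G(1) p0 by (intro sum.mono_neutral_cong_left) auto
  moreover have "(u + v :: 'k mpoly) ^ p = u ^ p + v ^ p" for u v
  proof -
   have "CHAR('k mpoly) = p" by (rule CHAR_mpoly[OF char])
   then show ?thesis using p by (intro freshmans_dream) auto
  qed
  ultimately have "f + g = (\<Sum>j\<in>F \<union> G. b j * (?y j + ?z j) ^ p)" by (simp add: sum.distrib distrib_left)
  moreover have "?y j + ?z j : carrier R" for j using F(3)[rule_format, of j] G(3)[rule_format, of j] a_closed[of "y j" "z j"] zero_closed
   by (auto simp del: split_paired_All)
  ultimately show ?thesis using F(1,2) G(1,2) by (intro exI[of _ "F \<union> G"] exI[of _ "\<lambda>j. ?y j + ?z j"]) auto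
 qed
 have "?Q (\<Sum>m\<in>K. monom m (lookup f m))" if "finite K" "K <= mons n" for K using that
 proof (induction K)
  case empty
  then show ?case using zero_closed by (intro exI[of _ "{}"] exI[of _ "\<lambda>_. 0"]) auto
 next
  case (insert m K)
  then show ?case using add[OF mono] by simp
 qed
 from this[of "keys f"] show ?thesis using f sum_monoms[of f] by (simp add: poly_ring_carrier)
qed

lemma b_closed': "j : J ==> b j : carrier R" using monom_carrier by (auto simp: J_def b_def)

lemma bsum_R:
 assumes "F <= J" "\<And>j. y j : carrier R"
 shows "bsum b (\<lambda>x. x ^\<^sub>R p) (reg R) F y = (\<Sum>j\<in>F. b j * y j ^ p)"
proof -
 have "b j \<otimes>\<^sub>R y j ^\<^sub>R p : carrier R" if "j : F" for j
  by (intro m_closed nat_pow_closed b_closed') (use assms that in auto)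
 then have "finsum R (\<lambda>j. b j * y j ^ p) F = (\<Sum>j\<in>F. b j * y j ^ p)" by (intro poly_ring_finsum) simp
 then show ?thesis by (simp add: bsum_def)
qed

sublocale frob_ring R p J b
proof unfold_locales
 have p0: "0 < p" using prime_gt_0_nat[OF p] .
 then show "0 < p" .
 show "b j : carrier R" if "j : J" for j by (rule b_closed'[OF that])
 show "unit_mod R p J b (reg R) (\<lambda>x. x ^\<^sub>R p)" unfolding unit_mod_def
 proof (intro conjI ballI allI impI reg_is_module is_cring)
  have "(u + v :: 'k mpoly) ^ p = u ^ p + v ^ p" for u v
   using p CHAR_mpoly[OF char] by (intro freshmans_dream) auto
  then show "(\<lambda>x. x ^\<^sub>R p) : semilin R p (reg R) (reg R)"
   using nat_pow_closed by (intro semilinI) (auto simp: power_mult_distrib)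
  show "\<exists>F y. finite F \<and> F <= J \<and> (\<forall>j. y j : carrier (reg R)) \<and> x = bsum b (\<lambda>x. x ^\<^sub>R p) (reg R) F y"
   if x: "x : carrier (reg R)" for x
  proof -
   obtain F y where F: "finite F" "F <= J" "\<forall>j. y j : carrier R" "x = (\<Sum>j\<in>F. b j * y j ^ p)"
    using b_gen[of x] x by auto
   then show ?thesis using bsum_R[OF F(2) spec[OF F(3)]] by (intro exI[of _ F] exI[of _ y]) simp
  qed
  fix F y j assume F: "finite F" "F <= J" "\<forall>j. y j : carrier (reg R)"
   "bsum b (\<lambda>x. x ^\<^sub>R p) (reg R) F y = 0\<^sub>(reg R)" and j: "j : F"
  have yR: "\<And>j. y j : carrier R" using F(3) by (simp del: split_paired_All)
  have "lookup (y j) m = 0" for m using b_indep[OF F(1,2) _ j, of y] bsum_R[OF F(2) yR] F(4) by simp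
  then show "y j = 0\<^sub>(reg R)" using poly_mapping_eqI[of "y j" 0] by simp
 qed
qed

lemma keys_DR:
 assumes f: "f : carrier R" "keys f <= box n (p * \<delta>)" and j: "j : J"
 shows "keys (DR j f) <= box n \<delta>"
proof -
 interpret u: unit_module R p J b "reg R" "\<lambda>x. x ^\<^sub>R p" by (rule unit_module_reg)
 have fr: "f : carrier (reg R)" using f(1) by simp
 have jJ: "{j} <= J" using j by simp
 obtain F where F: "finite F" "{j} <= F" "F <= J" "f = bsum b (\<lambda>x. x ^\<^sub>R p) (reg R) F (\<lambda>j. DR j f)"
  by (rule u.D_expand[OF fr, of "{j}"]) (use jJ in simp_all)
 have fs: "f = (\<Sum>j\<in>F. b j * DR j f ^ p)" using F(4) bsum_R[OF F(3), of "\<lambda>j. DR j f"] DR_closed[OF f(1)] by simp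
 show ?thesis
 proof
  fix m assume "m : keys (DR j f)"
  then have "lookup f (snd j + pmap ((*) p) m) \<noteq> 0"
   using b_indep[OF F(1,3), of "\<lambda>j. DR j f" j m] F(2) unfolding fs[symmetric] by auto
  then have k: "snd j + pmap ((*) p) m : box n (p * \<delta>)" using f(2) by (auto simp: in_keys_iff)
  have p0: "0 < p" using prime_gt_0_nat[OF p] .
  have e: "lookup (snd j + pmap ((*) p) m) i = lookup (snd j) i + p * lookup m i" for i by (simp add: lookup_add lookup_pmap)
  have "lookup (snd j) i + p * lookup m i \<le> p * \<delta>" for i unfolding e[symmetric] using k by (simp add: box_def)
  then have "p * lookup m i \<le> p * \<delta>" for i using add_leD2 by blast
  moreover have "lookup m i = 0" if "n \<le> i" for i using k e[of i] that p0 by (simp add: box_def mons_iff)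
  ultimately show "m : box n \<delta>" using p0 by (simp add: box_def mons_iff)
 qed
qed

lemma lookup_const_mult: "lookup (monom 0 c * f) m = c * lookup f m"
 by (simp add: mult_map_scale_conv_mult[symmetric] Poly_Mapping.map.rep_eq when_def)

text \<open>Let delta bound the exponents in the entries of U. Every member of the chain is
  generated by its vectors with exponents at most delta; these form subspaces of a
  finite-dimensional space over the field, and a decreasing sequence of such subspaces is
  stationary.\<close>

lemma stab_seq_stabilises:
 assumes U: "is_matrix R \<alpha> \<alpha> U"
 shows "\<exists>e0. \<forall>e\<ge>e0. stab_seq R p J b \<alpha> U e = stab_seq R p J b \<alpha> U e0"
proof -
 interpret V: unit_module R p J b "vecs R \<alpha>" "vec_pow R \<alpha> p" by (rule unit_vecs)
 let ?S = "stab_seq R p J b \<alpha> U" and ?u = "mat_vec R \<alpha> \<alpha> U"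
 note h = U_hom[OF U]
 have "\<exists>\<delta>. \<forall>i<\<alpha>. \<forall>j<\<alpha>. keys (U i j) <= box n \<delta>"
 proof -
  have mono: "box n \<delta> <= box n \<epsilon>" if "\<delta> \<le> \<epsilon>" for \<delta> \<epsilon> using that by (auto simp: box_def intro: order_trans)
  have "\<forall>x\<in>{..<\<alpha>} \<times> {..<\<alpha>}. \<exists>\<delta>. keys (U (fst x) (snd x)) <= box n \<delta>"
   using U by (auto simp: is_matrix_def intro!: keys_box)
  from bchoice[OF this] obtain \<delta> where d: "\<forall>x\<in>{..<\<alpha>} \<times> {..<\<alpha>}. keys (U (fst x) (snd x)) <= box n (\<delta> x)" by blast
  have "keys (U i j) <= box n (Max (\<delta> ` ({..<\<alpha>} \<times> {..<\<alpha>})))" if "i < \<alpha>" "j < \<alpha>" for i j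
   using that d mono[OF Max_ge[of "\<delta> ` ({..<\<alpha>} \<times> {..<\<alpha>})" "\<delta> (i, j)"]] by force
  then show ?thesis by blast
 qed
 then obtain \<delta> where \<delta>: "\<And>i j. i < \<alpha> ==> j < \<alpha> ==> keys (U i j) <= box n \<delta>" by blast
 define W where "W = {v : carrier (vecs R \<alpha>). \<forall>i<\<alpha>. keys (v i) <= box n \<delta>}"
 have Wc: "W <= carrier (vecs R \<alpha>)" by (auto simp: W_def)
 have step: "DV \<alpha> j (?u v) : W" if j: "j : J" and v: "v : W" for j v
 proof -
  have vc: "v : carrier (vecs R \<alpha>)" using v Wc by blast
  have uv: "?u v : carrier (vecs R \<alpha>)" by (rule mod_homD(1)[OF h vc])
  have "keys (DV \<alpha> j (?u v) i) <= box n \<delta>" if i: "i < \<alpha>" for i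
  proof -
   have vk: "v k : carrier R" "U i k : carrier R" if "k < \<alpha>" for k using that i vc U by (auto simp: vecs_carrier is_matrix_def)
   have "?u v i = (\<Sum>k<\<alpha>. U i k * v k)"
    using i vk poly_ring_finsum[of "{..<\<alpha>}" "\<lambda>k. U i k * v k" n] m_closed by (simp add: mat_vec_def)
   moreover have "keys (U i k * v k) <= box n (p * \<delta>)" if k: "k < \<alpha>" for k
   proof -
    have "keys (U i k * v k) <= box n (\<delta> + \<delta>)" using \<delta>[OF i k] v k by (intro keys_box_mult) (auto simp: W_def)
    \<comment> \<open>Here p >= 2 absorbs the doubling of exponents caused by U, so that components
      of U v are again bounded by \<delta>.\<close>
    moreover have "\<delta> + \<delta> \<le> p * \<delta>" unfolding mult_2[symmetric] by (rule mult_le_mono1[OF prime_ge_2_nat[OF p]])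
    ultimately show ?thesis unfolding box_def by (blast intro: le_trans)
   qed
   ultimately have "keys (?u v i) <= box n (p * \<delta>)"
    using keys_sum[of "\<lambda>k. U i k * v k" "{..<\<alpha>}"] by fastforce
   then show ?thesis using keys_DR[OF _ _ j] uv i by (simp add: DV_apply[OF uv i j] vecs_carrier)
  qed
  then show ?thesis using DV_closed[OF uv] by (simp add: W_def)
 qed
 have Sc: "?S e <= carrier (vecs R \<alpha>)" and Ssub: "submodule (?S e) R (vecs R \<alpha>)" for e
  using V.M.submoduleE(1)[OF Lseq_submodule[OF U]] Lseq_submodule[OF U] by auto
 have gen: "\<exists>T\<subseteq>W. ?S e = gen_submodule R (vecs R \<alpha>) T" for e
 proof (induction e)
  case 0
  have "unitv \<alpha> ` {..<\<alpha>} <= W"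
   using unitv_closed by (auto simp: W_def unitv_apply box_def mons_iff split: if_splits)
  then show ?case using vecs_gen by auto
 next
  case (Suc e)
  then obtain T where T: "T <= W" "?S e = gen_submodule R (vecs R \<alpha>) T" by blast
  have Tc: "T <= carrier (vecs R \<alpha>)" using T(1) Wc by blast
  have "?u ` ?S e = gen_submodule R (vecs R \<alpha>) (?u ` T)"
   unfolding T(2) by (rule mod_hom_image_gen[OF V.is_mod V.is_mod h Tc])
  moreover have "?u ` T <= carrier (vecs R \<alpha>)" using Tc mod_homD(1)[OF h] by blast
  ultimately have "?S (Suc e) = V.Dgen (?u ` T)" using V.Dgen_gen[of "?u ` T"] by simp
  moreover have "{DV \<alpha> j x |j x. j : J \<and> x : ?u ` T} <= W" using step T(1) by blast
  ultimately show ?case unfolding dgen_def by blast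
 qed
 have Sgen: "?S e = gen_submodule R (vecs R \<alpha>) (W \<inter> ?S e)" for e
 proof -
  obtain T where T: "T <= W" "?S e = gen_submodule R (vecs R \<alpha>) T" using gen by blast
  have "T <= W \<inter> ?S e" using T gen_submodule_subset[OF V.is_mod, of T] Wc by auto
  then have "gen_submodule R (vecs R \<alpha>) T <= gen_submodule R (vecs R \<alpha>) (W \<inter> ?S e)" by (rule gen_submodule_mono)
  moreover have "gen_submodule R (vecs R \<alpha>) (W \<inter> ?S e) <= ?S e" by (rule gen_submodule_minimal[OF V.is_mod Ssub]) simp
  ultimately show ?thesis using T(2) by simp
 qed
 \<comment> \<open>Coefficients turn the bounded vectors into functions supported on a finite set,
   as \<open>descending_subspaces_stabilise\<close> expects.\<close>
 define co where "co v = (\<lambda>(i, m). if i < \<alpha> then lookup (v i) m else 0 :: 'k)" for v :: "nat => 'k mpoly"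
 have inj: "v = w" if vw: "co v = co w" "v : W" "w : W" for v w
 proof (rule vecs_eqI)
  show "v i = w i" if i: "i < \<alpha>" for i
   using fun_cong[OF vw(1), of "(i, _)"] i by (intro poly_mapping_eqI) (simp add: co_def)
 qed (use vw Wc in auto)
 have "\<exists>e0. \<forall>e\<ge>e0. co ` (W \<inter> ?S e) = co ` (W \<inter> ?S e0)"
 proof (rule descending_subspaces_stabilise[of "{..<\<alpha>} \<times> box n \<delta>"])
  show "co ` (W \<inter> ?S (Suc e)) <= co ` (W \<inter> ?S e)" for e using Lseq_decreasing[OF U, of e] by blast
  show "(\<lambda>_. 0) : co ` (W \<inter> ?S e)" for e
  proof (rule image_eqI)
   show "0\<^sub>(vecs R \<alpha>) : W \<inter> ?S e" using submodule_zero[OF Ssub] Sc unfolding W_def by auto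
  qed (auto simp: co_def)
  show "f x = 0" if "f : co ` (W \<inter> ?S e)" "x \<notin> {..<\<alpha>} \<times> box n \<delta>" for e f x
   using that by (auto simp: co_def W_def in_keys_iff subset_iff split: prod.splits)
  show "(\<lambda>x. f x + c * g x) : co ` (W \<inter> ?S e)" if fg: "f : co ` (W \<inter> ?S e)" "g : co ` (W \<inter> ?S e)" for e f g c
  proof -
   obtain v w where v: "v : W" "v : ?S e" "f = co v" and w: "w : W" "w : ?S e" "g = co w" using fg by blast
   let ?c = "monom 0 c :: 'k mpoly"
   let ?x = "v +\<^sub>(vecs R \<alpha>) ?c *\<^sub>(vecs R \<alpha>) w"
   have cc: "?c : carrier R" by (rule monom_carrier) (simp add: mons_iff)
   have x: "?x i = v i + ?c * w i" if "i < \<alpha>" for i using that by simp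
   have xS: "?x : ?S e" by (intro V.M.submoduleE(5)[OF Ssub] V.M.submoduleE(4)[OF Ssub] v w cc)
   have "keys (?x i) <= box n \<delta>" if i: "i < \<alpha>" for i
   proof -
    have "keys (?x i) <= keys (v i) \<union> keys (w i)"
     unfolding x[OF i] by (auto simp: in_keys_iff lookup_add lookup_const_mult)
    then show ?thesis using v(1) w(1) i unfolding W_def by blast
   qed
   then have "?x : W" using xS Sc by (auto simp: W_def)
   moreover have "(\<lambda>x. f x + c * g x) = co ?x" using x by (auto simp: v(3) w(3) co_def lookup_add lookup_const_mult)
   ultimately show ?thesis using xS by blast
  qed
 qed (simp add: finite_box)
 then obtain e0 where e0: "\<And>e. e0 \<le> e ==> co ` (W \<inter> ?S e) = co ` (W \<inter> ?S e0)" by blast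
 have "W \<inter> ?S e = W \<inter> ?S e0" if e: "e0 \<le> e" for e
 proof -
  have "v : ?S e'" if v: "v : W" "v : ?S e''" "co ` (W \<inter> ?S e'') = co ` (W \<inter> ?S e')" for v e' e''
  proof -
   have "co v : co ` (W \<inter> ?S e')" using v by blast
   then show ?thesis using inj v(1) by blast
  qed
  then show ?thesis using e0[OF e] by blast
 qed
 then show ?thesis using Sgen by metis
qed

end

subsection \<open>Noetherianness of polynomial rings\<close>

text \<open>A monotone subsequence that decreases is constant from the place where it attains its
  minimum.\<close>

lemma nat_incseq_subseq: "\<exists>r::nat => nat. strict_mono r \<and> incseq (\<lambda>i. f (r i) :: nat)"
proof -
 obtain r where r: "strict_mono r" "monoseq (\<lambda>i. f (r i))" using seq_monosub by blast
 show ?thesis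
 proof (cases "incseq (\<lambda>i. f (r i))")
  case False
  then have dec: "decseq (\<lambda>i. f (r i))" using r(2) by (simp add: monoseq_iff)
  obtain N where N: "f (r N) \<le> f (r i)" for i using ex_has_least_nat[of "\<lambda>_. True" 0 "\<lambda>i. f (r i)"] by auto
  have "f (r (N + i)) = f (r N)" for i using N[of "N + i"] decseqD[OF dec, of N "N + i"] by simp
  then show ?thesis using r(1) by (intro exI[of _ "\<lambda>i. r (N + i)"]) (auto simp: strict_mono_def)
 qed (use r(1) in blast)
qed

text \<open>One variable after the other, pass to a subsequence along which its exponent does not
  decrease.\<close>

lemma dickson:
 fixes m :: "nat => (nat \<Rightarrow>\<^sub>0 nat)"
 assumes m: "\<And>i. m i : mons n"
 shows "\<exists>i j. i < j \<and> (\<forall>l. lookup (m i) l \<le> lookup (m j) l)"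
proof -
 have "\<exists>r. strict_mono r \<and> (\<forall>l<k. incseq (\<lambda>i. lookup (m (r i)) l))" for k
 proof (induction k)
  case 0
  show ?case using strict_mono_id by auto
 next
  case (Suc k)
  then obtain r where r: "strict_mono r" "\<And>l. l < k ==> incseq (\<lambda>i. lookup (m (r i)) l)" by blast
  obtain s where s: "strict_mono s" "incseq (\<lambda>i. lookup (m (r (s i))) k)"
   using nat_incseq_subseq[of "\<lambda>i. lookup (m (r i)) k"] by blast
  have "incseq (\<lambda>i. lookup (m (r (s i))) l)" if "l < k" for l
   using r(2)[OF that] s(1) by (auto simp: incseq_def dest: strict_mono_mono)
  then show ?case using s r(1) by (intro exI[of _ "\<lambda>i. r (s i)"]) (auto simp: less_Suc_eq strict_mono_def)
 qed
 then obtain r where r: "strict_mono r" "\<And>l. l < n ==> incseq (\<lambda>i. lookup (m (r i)) l)" by blast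
 have "lookup (m (r 0)) l \<le> lookup (m (r 1)) l" for l
  using incseqD[OF r(2), of l 0 1] m[of "r 0"] by (cases "l < n") (auto simp: mons_iff)
 then show ?thesis using strict_monoD[OF r(1), of 0 1] by blast
qed

definition mdvd :: "(nat \<Rightarrow>\<^sub>0 nat) => (nat \<Rightarrow>\<^sub>0 nat) => bool" where
 "mdvd a m \<longleftrightarrow> (\<forall>l. lookup a l \<le> lookup m l)"

lemma mdvd_diff: "mdvd a m ==> (m - a) + a = m"
 by (rule poly_mapping_eqI) (simp add: mdvd_def lookup_add lookup_minus)

text \<open>The order on exponent vectors is the lexicographic one of the library; it is total,
  compatible with addition, and extends divisibility.\<close>

lemma mdvd_le: "mdvd a m ==> a \<le> m"
proof (rule ccontr)
 assume d: "mdvd a m" and "\<not> a \<le> m"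
 then have "m < a" by simp
 then obtain k where "lookup m k < lookup a k" by (auto simp: less_poly_mapping.rep_eq less_fun_def)
 then show False using d by (simp add: mdvd_def not_le[symmetric])
qed

text \<open>By \<open>dickson\<close>, an infinite descent would contain an earlier term that
  divides a later one, hence is at most that later term.\<close>

lemma mons_wf: "wf {(a, m). a : mons n \<and> m : mons n \<and> a < m}"
 unfolding wf_iff_no_infinite_down_chain
proof
 assume "\<exists>f. \<forall>i. (f (Suc i), f i) : {(a, m). a : mons n \<and> m : mons n \<and> a < m}"
 then obtain f where f: "\<And>i. f i : mons n" "\<And>i. f (Suc i) < f i" by auto
 obtain i j where "i < j" "mdvd (f i) (f j)" using dickson[of f n] f(1) unfolding mdvd_def by blast
 moreover have "f j < f i" if "i < j" for i j using that
  by (induction rule: less_Suc_induct) (use f(2) in auto)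
 ultimately show False using mdvd_le by fastforce
qed

lemma dickson_basis:
 assumes M: "M <= mons n"
 shows "\<exists>K\<subseteq>M. finite K \<and> (\<forall>m\<in>M. \<exists>a\<in>K. mdvd a m)"
proof (intro exI conjI ballI)
 let ?K = "{a : M. \<forall>a'\<in>M. mdvd a' a \<longrightarrow> a' = a}"
 show "?K <= M" by blast
 show "finite ?K"
 proof (rule ccontr)
  assume "infinite ?K"
  then obtain f :: "nat => _" where f: "inj_on f UNIV" "range f <= ?K" using infinite_countable_subset by blast
  then obtain i j where "i < j" "mdvd (f i) (f j)" using dickson[of f n] M unfolding mdvd_def by blast
  moreover have "f i : ?K" "f j : ?K" using f(2) by auto
  ultimately have "f i = f j" by blast
  then show False using f(1) \<open>i < j\<close> by (auto simp: inj_on_def)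
 qed
 fix m assume m: "m : M"
 then have mm: "m : {a : M. mdvd a m}" by (simp add: mdvd_def)
 obtain a where a: "a : {a : M. mdvd a m}" "\<And>y. (y, a) : {(a, m). a : mons n \<and> m : mons n \<and> a < m} ==> y \<notin> {a : M. mdvd a m}"
  by (rule wfE_min[OF mons_wf[of n] mm]) blast
 have "a' = a" if "a' : M" "mdvd a' a" for a'
 proof -
  have "mdvd a' m" using that a(1) unfolding mdvd_def by (blast intro: le_trans)
  then show ?thesis using a that M mdvd_le[OF that(2)] by (auto simp: order_le_less)
 qed
 then show "\<exists>a\<in>?K. mdvd a m" using a(1) by blast
qed

definition LM :: "'k::field mpoly => (nat \<Rightarrow>\<^sub>0 nat)" where "LM f = Max (keys f)"

lemma LM_keys: "f \<noteq> 0 ==> LM f : keys f" unfolding LM_def by (rule Max_in) auto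

lemma LM_le: "m : keys f ==> m \<le> LM f" unfolding LM_def by (rule Max_ge) auto

text \<open>The multiple of g is chosen to cancel the leading term of f; its other monomials are
  smaller because the order is compatible with addition.\<close>

lemma LM_reduce:
 assumes f: "f \<noteq> 0" and g: "g \<noteq> 0" and d: "mdvd (LM g) (LM f)"
 defines "f' \<equiv> f + monom (LM f - LM g) (- (lookup f (LM f) / lookup g (LM g))) * g"
 shows "f' = 0 \<or> LM f' < LM f"
proof -
 let ?a = "LM f - LM g" and ?c = "- (lookup f (LM f) / lookup g (LM g))"
 have a: "?a + LM g = LM f" by (rule mdvd_diff[OF d])
 have "m \<le> LM f" if m: "m : keys f'" for m
 proof -
  have "m : keys f \<or> m : keys (monom ?a ?c * g)" using m by (auto simp: f'_def in_keys_iff lookup_add)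
  then show ?thesis
  proof
   assume "m : keys (monom ?a ?c * g)"
   then obtain m' where m': "m = ?a + m'" "m' : keys g"
    using keys_mult[of "monom ?a ?c" g] by (auto split: if_splits)
   then show ?thesis using add_left_mono[OF LM_le[OF m'(2)], of ?a] a by simp
  qed (rule LM_le)
 qed
 moreover have "LM f \<notin> keys f'"
 proof -
  have "monom ?a ?c * g = (\<Sum>m\<in>keys g. monom (?a + m) (?c * lookup g m))"
   by (subst sum_monoms[of g]) (simp add: sum_distrib_left mult_single)
  then have "lookup (monom ?a ?c * g) (?a + LM g) = (\<Sum>m\<in>keys g. if m = LM g then ?c * lookup g m else 0)"
   by (simp add: lookup_sum lookup_single when_def)
  also have "\<dots> = - lookup f (LM f)" using LM_keys[OF g] by (simp add: sum.delta in_keys_iff)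
  finally show ?thesis by (simp add: f'_def a in_keys_iff lookup_add)
 qed
 ultimately show ?thesis using LM_keys[of f'] by (metis order_le_less)
qed

text \<open>A Groebner basis argument: every leading monomial of the ideal is divisible by one of
  finitely many (\<open>dickson_basis\<close>), and elements with these leading monomials generate,
  by reduction and well-founded induction on the leading monomial.\<close>

lemma poly_ring_noeth: "noeth_ring (poly_ring n :: 'k::field mpoly ring)" unfolding noeth_ring_def
proof (intro conjI allI impI poly_ring_cring)
 let ?R = "poly_ring n :: 'k mpoly ring"
 interpret R: cring ?R by (rule poly_ring_cring)
 note rm = reg_is_module[OF R.is_cring]
 interpret M: Module.module ?R "reg ?R" by (rule rm)
 fix I assume I: "submodule I ?R (reg ?R)"
 have Ic: "I <= carrier ?R" using M.submoduleE(1)[OF I] by simp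
 have LMm: "LM f : mons n" if "f : I" "f \<noteq> 0" for f
  using LM_keys[OF that(2)] subsetD[OF Ic that(1)] unfolding poly_ring_carrier by blast
 have LMI: "LM ` (I - {0}) <= mons n" using LMm by blast
 obtain K where K: "K <= LM ` (I - {0})" "finite K" "\<And>m. m : LM ` (I - {0}) ==> \<exists>a\<in>K. mdvd a m"
  using dickson_basis[OF LMI] by blast
 obtain S where S: "S <= I - {0}" "finite S" "K = LM ` S" using finite_subset_image[OF K(2,1)] by blast
 have Sc: "S <= carrier (reg ?R)" using S(1) Ic by auto
 let ?G = "gen_submodule ?R (reg ?R) S"
 have G: "submodule ?G ?R (reg ?R)" "S <= ?G"
  using gen_submodule_is_submodule[OF rm Sc] gen_submodule_subset[OF rm] by auto
 have "f \<noteq> 0 \<longrightarrow> f : I \<longrightarrow> LM f = m \<longrightarrow> f : ?G" for f m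
 proof (induction m arbitrary: f rule: wf_induct[OF mons_wf[of n]])
  case (1 m)
  show ?case
  proof (intro impI)
   assume f: "f \<noteq> 0" "f : I" "LM f = m"
   then obtain g where g: "g : S" "mdvd (LM g) (LM f)" using K(3)[of "LM f"] S(3) by blast
   have gI: "g : I" "g \<noteq> 0" using g(1) S(1) by auto
   let ?t = "monom (LM f - LM g) (- (lookup f (LM f) / lookup g (LM g))) :: 'k mpoly"
   have t: "?t : carrier ?R" using LMm[OF f(2,1)] by (intro monom_carrier) (simp add: mons_iff lookup_minus)
   have tg: "?t * g : ?G" "?t * g : I"
    using M.submoduleE(4)[OF G(1) t, of g] M.submoduleE(4)[OF I t gI(1)] g(1) G(2) by auto
   define f' where "f' = f + ?t * g"
   have f'I: "f' : I" using M.submoduleE(5)[OF I f(2) tg(2)] by (simp add: f'_def)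
   have "f' : ?G"
   proof (cases "f' = 0")
    case True
    then show ?thesis using submodule_zero[OF G(1)] by simp
   next
    case False
    then have "LM f' < LM f" using LM_reduce[OF f(1) gI(2) g(2)] by (simp add: f'_def)
    then show ?thesis using 1 False f'I LMm[OF f(2,1)] LMm[OF f'I False] f(3) by blast
   qed
   then have "f' +\<^sub>(reg ?R) -\<^sub>(reg ?R) (?t * g) : ?G"
    using M.submoduleE(3,5)[OF G(1)] tg(1) by blast
   moreover have "f = f' +\<^sub>(reg ?R) -\<^sub>(reg ?R) (?t * g)"
    using M.M.r_neg[of "?t * g"] subsetD[OF Ic tg(2)] by (simp add: f'_def add.assoc)
   ultimately show "f : ?G" by simp
  qed
 qed
 then have "f : ?G" if "f : I" for f using submodule_zero[OF G(1)] that by (cases "f = 0") auto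
 then have "I <= ?G" by blast
 moreover have "?G <= I" by (rule gen_submodule_minimal[OF rm I]) (use S(1) in blast)
 ultimately show "\<exists>S. finite S \<and> S <= I \<and> I = gen_submodule ?R (reg ?R) S" using S by blast
qed

section \<open>F-submodules and the special prime obtained from one\<close>

context unit_module
begin

text \<open>The linearization of phi on the pullback of N is inverse to \<theta>', so its image is
  N, which gives stability under phi. Also x is its value at \<theta>' x, an expansion with
  coefficients in N, which gives stability under components.\<close>

lemma F_submodule_stable:
 assumes F: "F_submodule A p M Frob_inv N"
 shows "submodule N A M" "x : N ==> \<phi> x : N" "x : N ==> j : J ==> D j x : N"
proof -
 show N: "submodule N A M" using F unfolding F_submodule_def by blast
 obtain \<theta>' where \<theta>': "\<theta>' : mod_iso A (submod M N) (Frob A p (submod M N))"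
  and eq: "\<And>x. x : N ==> Frob_map A p (submod M N) M (\<lambda>y. y) (\<theta>' x) = Frob_inv x"
  using F unfolding F_submodule_def by blast
 let ?Q = "submod M N"
 have Q: "Module.module A ?Q" unfolding submod_def by (rule submodule.submodule_is_module[OF N is_mod])
 have Qc: "carrier ?Q = N" by (simp add: submod_def)
 have NM: "N <= carrier M" by (rule M.submoduleE(1)[OF N])
 have i: "(\<lambda>y. y) : mod_hom A ?Q M" using NM by (intro mod_homI) (auto simp: submod_def)
 define \<Lambda> where "\<Lambda> = Frob_lift A ?Q M 1 (\<lambda>x. \<phi> x)"
 note L = Frob_lift_phi[OF Q i, folded \<Lambda>_def]
 note P = Frob_lift_phi[OF is_mod semilin_id[OF is_cring]]
 have LP: "\<Lambda> X = Frob_lift A M M 1 \<phi> (Frob_map A p ?Q M (\<lambda>y. y) X)" if X: "X : carrier (Frob A p ?Q)" for X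
  by (rule Frob_hom_ext[OF Q is_mod L(1) mod_hom_comp[OF Frob_map_hom(1)[OF Q is_mod i] P(1)] _ X])
   (use Frob_map_hom(2)[OF Q is_mod i] L(2) P(2) NM Qc in auto)
 have \<theta>h: "\<theta>' : mod_hom A ?Q (Frob A p ?Q)" using \<theta>' by (simp add: mod_iso_def)
 have \<theta>c: "\<theta>' x : carrier (Frob A p ?Q)" if "x : N" for x
  using mod_homD(1)[OF \<theta>h, of x] that Qc by simp
 have L\<theta>: "\<Lambda> (\<theta>' x) = x" if x: "x : N" for x
  unfolding LP[OF \<theta>c[OF x]] eq[OF x] using P(4) x NM by (intro f_inv_into_f) auto
 have LN: "\<Lambda> X : N" if X: "X : carrier (Frob A p ?Q)" for X
 proof -
  have "X : \<theta>' ` N" using X \<theta>' by (auto simp: mod_iso_def bij_betw_def Qc)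
  then show ?thesis using L\<theta> by auto
 qed
 note ot = one_tensor_semilin[OF Q, of p]
 show "\<phi> x : N" if "x : N" using LN[OF semilin_closed[OF ot]] L(2) that by (simp add: Qc)
 show "D j x : N" if x: "x : N" and j: "j : J"
 proof -
  obtain F y where F: "finite F" "F <= J" "\<And>j. y j : carrier ?Q"
   "\<theta>' x = (\<Oplus>\<^bsub>Frob A p ?Q\<^esub>j\<in>F. b j *\<^sub>(Frob A p ?Q) one_tensor A p ?Q (y j))"
   by (rule Frob_basis_form[OF Q \<theta>c[OF x]]) blast
  have T: "Module.module A (Frob A p ?Q)" by (rule Frob_is_module[OF Q])
  have L': "\<Lambda> : semilin A 1 (Frob A p ?Q) M" using L(1) mod_hom_eq_semilin[OF is_cring] by blast
  have tc: "one_tensor A p ?Q (y j) : carrier (Frob A p ?Q)" for j by (rule semilin_closed[OF ot F(3)])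
  have bj: "b j : carrier A" if "j : F" for j using that F(2) b_closed by blast
  have *: "(\<lambda>j. b j *\<^sub>(Frob A p ?Q) one_tensor A p ?Q (y j)) : F \<rightarrow> carrier (Frob A p ?Q)"
   using Module.module.smult_closed[OF T bj tc] by blast
  have "x = (\<Oplus>\<^bsub>M\<^esub>j\<in>F. \<Lambda> (b j *\<^sub>(Frob A p ?Q) one_tensor A p ?Q (y j)))"
   using L\<theta>[OF x] semilin_finsum[OF T is_mod L' F(1) *] F(4) by simp
  also have "\<dots> = bs F y" unfolding bsum_def
   using mod_homD(3)[OF L(1) bj tc] L(2)[OF F(3)] bj subsetD[OF NM F(3)[unfolded Qc]] by (intro M.M.finsum_cong') auto
  finally have "x = bs F y" .
  then show ?thesis using D_unique[OF F(1,2) _ j, of y] F(3) NM submodule_zero[OF N] by (auto simp: Qc subset_iff)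
 qed
qed

text \<open>N is to be thought of as an F-submodule pulled back from the local ring. With I = (N :
  M1), torsion and the finite generation of P give an a outside I with P a in I, and saturation
  gives that r a in I only for r in P.\<close>

lemma special_prime:
 assumes noeth: "noeth_ring A" and P: "primeideal P A"
  and U: "is_matrix A d d U" and x: "\<And>i. i < d ==> x i : carrier M"
  and g: "g : mod_hom A (vecs A d) M" and gI: "g ` carrier (vecs A d) = gen_submodule A M (x ` {..<d})"
  and DU: "\<And>v j. v : carrier (vecs A d) ==> j : J ==> D j (g v) = g (DV d j (mat_vec A d d U v))"
  and gen: "\<And>y. y : carrier M ==> \<exists>e. y : (Dinv ^^ e) (gen_submodule A M (x ` {..<d}))"
  and K: "g ` stable_K A p d U = gen_submodule A M (x ` {..<d})"
  and N: "submodule N A M" "N \<noteq> carrier M" and N_phi: "\<And>y. y : N ==> \<phi> y : N"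
  and N_D: "\<And>y j. y : N ==> j : J ==> D j y : N"
  and tor: "\<And>y a. y : carrier M ==> a : P ==> \<exists>t::nat. (a [^] t) *\<^sub>M y : N"
  and sat: "\<And>y s. y : carrier M ==> s : carrier A - P ==> s *\<^sub>M y : N ==> y : N"
 shows "P : special_primes A p d U"
proof -
 interpret P: primeideal P A by fact
 let ?M1 = "gen_submodule A M (x ` {..<d})"
 note N' = M.submoduleE[OF N(1)] submodule_zero[OF N(1)]
 have V: "Module.module A (vecs A d)" by (rule vecs_is_module)
 interpret V: Module.module A "vecs A d" by (rule V)
 have xs: "x ` {..<d} <= carrier M" using x by auto
 have M1: "?M1 <= carrier M" by (rule gen_submodule_closed[OF is_mod xs])
 define T where "T a = {y : carrier M. a *\<^sub>M y : N}" for a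
 have T: "submodule (T a) A M" if "a : carrier A" for a
 proof -
  have "(\<lambda>y. a *\<^sub>M y) : mod_hom A M M"
   using that by (intro mod_homI) (auto simp: M.smult_r_distr M.smult_assoc1[symmetric] m_comm)
  then have "(\<lambda>y. a *\<^sub>M y) : semilin A 1 M M" using mod_hom_eq_semilin[OF is_cring] by blast
  then show ?thesis unfolding T_def by (rule semilin_preimage[OF is_mod is_mod _ N(1)])
 qed
 define I where "I = {a : carrier A. ?M1 <= T a}"
 have I_iff: "a : I \<longleftrightarrow> a : carrier A \<and> (\<forall>i<d. a *\<^sub>M x i : N)" for a
 proof -
  have "?M1 <= T a \<longleftrightarrow> x ` {..<d} <= T a" if "a : carrier A" by (rule gen_submodule_le_iff[OF is_mod T[OF that]])
  then show ?thesis using x by (auto simp: I_def T_def)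
 qed
 have Dinv_N: "Dinv N <= N"
 proof
  fix y assume y: "y : Dinv N"
  then have yc: "y : carrier M" by (simp add: dinv_def)
  obtain F where F: "finite F" "F <= J" "y = bs F (\<lambda>j. D j y)" by (rule D_expand[OF yc, of "{}"]) auto
  have "b j *\<^sub>M \<phi> (D j y) : N" if "j : F" for j
   using N'(4)[OF b_closed N_phi] DinvD[OF y] that F(2) by blast
  then have "bs F (\<lambda>j. D j y) : N" unfolding bsum_def by (intro submodule_finsum[OF is_mod N(1) F(1)]) auto
  then show "y : N" using F(3) by simp
 qed
 \<comment> \<open>If M1 were contained in N, then so would be all \<open>(Dinv ^^ e)\<close> of M1,
   because stability under phi gives \<open>Dinv N <= N\<close>; but these exhaust M.\<close>
 have one: "\<one> \<notin> I"
 proof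
  assume "\<one> : I"
  then have le: "?M1 <= N" using M1 by (auto simp: I_def T_def)
  have "(Dinv ^^ e) ?M1 <= N" for e
  proof (induction e)
   case (Suc e)
   then show ?case using Dinv_mono[OF Suc] Dinv_N by auto
  qed (use le in simp)
  then show False using gen N(2) N'(1) by blast
 qed
 have I_mult: "r \<otimes> a : I" if "a : I" "r : carrier A" for a r
  using that N'(4) x by (auto simp: I_iff M.smult_assoc1)
 \<comment> \<open>Torsion is known element by element; the largest exponent for the finitely many
   generators x i serves them all.\<close>
 have nil: "\<exists>t::nat. c [^] t \<otimes> a : I" if a: "a : carrier A" and c: "c : P" for a c
 proof -
  have gc: "c : carrier A" by (rule P.Icarr[OF c])
  have "\<forall>i\<in>{..<d}. \<exists>t::nat. (c [^] t) *\<^sub>M x i : N" using tor[OF x c] by simp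
  from bchoice[OF this] obtain t :: "nat => nat" where t: "\<forall>i\<in>{..<d}. (c [^] t i) *\<^sub>M x i : N" by blast
  define m where "m = Max (t ` {..<d})"
  have "(c [^] m \<otimes> a) *\<^sub>M x i : N" if i: "i < d" for i
  proof -
   have "t i \<le> m" unfolding m_def using i by (intro Max_ge) auto
   then have "c [^] m = c [^] (m - t i) \<otimes> c [^] t i" using gc by (simp add: nat_pow_mult)
   then have "c [^] m \<otimes> a = (a \<otimes> c [^] (m - t i)) \<otimes> c [^] t i"
    using gc a m_comm[of "c [^] (m - t i) \<otimes> c [^] t i" a] by (simp add: m_assoc)
   then show ?thesis using N'(4)[of "a \<otimes> c [^] (m - t i)" "(c [^] t i) *\<^sub>M x i"] t i a gc x by (simp add: M.smult_assoc1)
  qed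
  then show ?thesis using a gc by (auto simp: I_iff)
 qed
 \<comment> \<open>The generators of P are treated one at a time: a is replaced by c^s a with s the
   largest exponent for which this is still outside I. Conditions already obtained persist because I
   is closed under multiples.\<close>
 have fin: "\<exists>a\<in>carrier A - I. \<forall>c\<in>G. c \<otimes> a : I" if "finite G" "G <= P" for G using that
 proof (induction G)
  case empty
  then show ?case using one by auto
 next
  case (insert c G)
  then obtain a where a: "a : carrier A" "a \<notin> I" "\<And>c. c : G ==> c \<otimes> a : I" by auto
  have c: "c : P" "c : carrier A" using insert.prems by auto
  define t where "t = (LEAST t::nat. c [^] t \<otimes> a : I)"
  have t: "c [^] t \<otimes> a : I" unfolding t_def by (rule LeastI_ex[OF nil[OF a(1) c(1)]])
  then have "t \<noteq> 0" using a by (intro notI) simp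
  then obtain s where s: "t = Suc s" using not0_implies_Suc by blast
  have "c [^] s \<otimes> a \<notin> I" using not_less_Least[of s "\<lambda>t::nat. c [^] t \<otimes> a : I"] unfolding t_def[symmetric] s by simp
  moreover have "c \<otimes> (c [^] s \<otimes> a) : I" using t c(2) a(1) by (simp add: s m_assoc[symmetric] m_comm)
  moreover have "c' \<otimes> (c [^] s \<otimes> a) : I" if c': "c' : G" for c'
  proof -
   have "c' : carrier A" using insert.prems c' by auto
   then show ?thesis using I_mult[OF a(3)[OF c'], of "c [^] s"] c(2) a(1) by (simp add: m_lcomm)
  qed
  ultimately show ?case using c(2) a(1) by (intro bexI[of _ "c [^] s \<otimes> a"]) auto
 qed
 have "submodule P A (reg A)" using submodule_reg_iff_ideal[OF is_cring] P.ideal_axioms by blast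
 then obtain G where G: "finite G" "G <= P" "P = gen_submodule A (reg A) G" using noeth unfolding noeth_ring_def by blast
 obtain a where a: "a : carrier A" "a \<notin> I" "\<And>c. c : G ==> c \<otimes> a : I" using fin[OF G(1,2)] by auto
 have Pa: "r \<otimes> a : I" if r: "r : P" for r
 proof -
  have rm: "Module.module A (reg A)" by (rule reg_is_module[OF is_cring])
  have "(r \<otimes> a) *\<^sub>M x i : N" if i: "i < d" for i
  proof -
   have s: "(\<lambda>r. (r \<otimes> a) *\<^sub>M x i) : semilin A 1 (reg A) M"
    using a(1) x[OF i] by (intro semilinI) (auto simp: M.smult_l_distr M.smult_assoc1)
   have "P <= {r : carrier (reg A). (r \<otimes> a) *\<^sub>M x i : N}"
    unfolding G(3) by (rule gen_submodule_minimal[OF rm semilin_preimage[OF rm is_mod s N(1)]])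
     (use a(3) G(2) i in \<open>auto simp: I_iff\<close>)
   then show ?thesis using r by blast
  qed
  then show ?thesis using a(1) P.Icarr[OF r] by (simp add: I_iff)
 qed
 have aP: "r : P" if r: "r : carrier A" "r \<otimes> a : I" for r
 proof (rule ccontr)
  assume "r \<notin> P"
  then have "a *\<^sub>M x i : N" if "i < d" for i
   using sat[of "a *\<^sub>M x i" r] r that x a(1) by (auto simp: I_iff M.smult_assoc1)
  then show False using a by (simp add: I_iff)
 qed
 define W where "W = {v : carrier (vecs A d). g v : T a}"
 have g': "g : semilin A 1 (vecs A d) M" using g mod_hom_eq_semilin[OF is_cring] by blast
 have W: "submodule W A (vecs A d)" unfolding W_def by (rule semilin_preimage[OF V is_mod g' T[OF a(1)]])
 have Wc: "W <= carrier (vecs A d)" by (auto simp: W_def)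
 have W_iff: "r *\<^sub>(vecs A d) v : W \<longleftrightarrow> (r \<otimes> a) *\<^sub>M g v : N" if "r : carrier A" "v : carrier (vecs A d)" for r v
  using that a(1) mod_homD(1,3)[OF g]
  by (simp add: W_def T_def M.smult_assoc1[symmetric] m_comm del: direct_sum_simps)
 have I_g: "r : I \<longleftrightarrow> r : carrier A \<and> (\<forall>v\<in>carrier (vecs A d). r *\<^sub>M g v : N)" for r
  using mod_homD(1)[OF g] unfolding I_def gI[symmetric] T_def by auto
 interpret v: unit_module A p J b "vecs A d" "vec_pow A d p" by (rule unit_vecs)
 note h = mod_homD(1)[OF mat_vec_hom[OF U]]
 have "mat_vec A d d U ` W <= submod_pow A d p W"
 proof
  fix w assume "w : mat_vec A d d U ` W"
  then obtain v where v: "v : W" "w = mat_vec A d d U v" by blast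
  have vc: "v : carrier (vecs A d)" using v(1) Wc by blast
  have gv: "g v : carrier M" "a *\<^sub>M g v : N" using v(1) by (auto simp: W_def T_def)
  have "DV d j w : W" if j: "j : J" for j
  proof -
   have c: "DV d j w : carrier (vecs A d)" using h[OF vc] v(2) by simp
   \<comment> \<open>With a g(v) also a^p g(v) lies in N; D j takes a^p out as a, which is the
     factor in the definition of W.\<close>
   have "a [^] p *\<^sub>M g v = a [^] (p - 1) *\<^sub>M (a *\<^sub>M g v)"
    using a(1) gv(1) p_pos by (simp add: M.smult_assoc1[symmetric] nat_pow_Suc[symmetric])
   then have "a [^] p *\<^sub>M g v : N" using N'(4)[OF _ gv(2), of "a [^] (p - 1)"] a(1) by simp
   from N_D[OF this j] have "a *\<^sub>M g (DV d j w) : N"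
    unfolding D_pow_smult[OF a(1) gv(1) j] DU[OF vc j] v(2) .
   then show ?thesis using c mod_homD(1)[OF g c] by (simp add: W_def T_def)
  qed
  then have "w : v.Dinv W" using h[OF vc] v(2) by (simp add: dinv_def)
  then show "w : submod_pow A d p W" using submod_pow_eq[OF W, of 1] by simp
 qed
 moreover have "P = ann A (quot_module (vecs A d) W)"
 proof -
  have "r : ann A (quot_module (vecs A d) W) \<longleftrightarrow> r : carrier A \<and> (\<forall>v\<in>carrier (vecs A d). r *\<^sub>(vecs A d) v : W)" for r
  proof -
   have "r *\<^sub>(quot_module (vecs A d) W) (W +>\<^sub>(vecs A d) v) = 0\<^sub>(quot_module (vecs A d) W) \<longleftrightarrow> r *\<^sub>(vecs A d) v : W"
    if "r : carrier A" "v : carrier (vecs A d)" for v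
    unfolding quot_smult[OF V W that] quot_zero[OF V W] by (rule coset_eq_N_iff[OF V W V.smult_closed[OF that]])
   then show ?thesis unfolding ann_def quot_carrier[OF V W] by blast
  qed
  then have "r : ann A (quot_module (vecs A d) W) \<longleftrightarrow> r : carrier A \<and> r \<otimes> a : I" for r
   using W_iff I_g[of "r \<otimes> a"] a(1) by auto
  then show ?thesis using Pa aP P.Icarr by blast
 qed
 ultimately have "special_ideal A p d U P" using W unfolding special_ideal_def by blast
 moreover have "\<not> stable_K A p d U <= ideal_vecs A d P"
 proof
  assume le: "stable_K A p d U <= ideal_vecs A d P"
  \<comment> \<open>As P a lies in I, the submodule P A^d lies in W. If it contained the stable
    submodule, the image M1 of the latter would be carried into N by a, and a would be in I.\<close>
  have "ideal_vecs A d P <= W" unfolding ideal_vecs_def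
   by (rule gen_submodule_minimal[OF V W]) (use W_iff I_g Pa P.Icarr in \<open>auto simp del: direct_sum_simps\<close>)
  then have "?M1 <= T a" unfolding K[symmetric] using le by (auto simp: W_def)
  then show False using a by (simp add: I_def)
 qed
 ultimately show ?thesis using P unfolding special_primes_def by blast
qed

end

section \<open>Cohomology and localization\<close>

locale cech_localization = cech_complex A p J b fs + L: localization A S
 for A :: "('a, 'x) ring_scheme" (structure) and p and J :: "'j set" and b fs S
begin

abbreviation lm where "lm \<equiv> loc_map A S"
abbreviation A' where "A' \<equiv> loc_ring A S"
abbreviation gs where "gs \<equiv> map lm fs"

sublocale FL: frob_localization A S p J b ..
sublocale G: cech_complex A' p J "\<lambda>j. lm (b j)" gs
proof -
 interpret F': frob_ring A' p J "\<lambda>j. lm (b j)" by (rule FL.frob_ring_loc)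
 show "cech_complex A' p J (\<lambda>j. lm (b j)) gs" by unfold_locales (use fs L.loc_map_closed in auto)
qed

lemma G_Ix: "G.Ix i = Ix i" by (simp add: cech_index_def)

lemma Den_image:
 assumes T: "T <= {..<length fs}" shows "G.Den T = lm ` Den T"
proof -
 interpret h: ring_hom_cring A A' lm by unfold_locales (rule L.loc_map_hom)
 have hom_pow: "lm (a [^] e) = lm a ^\<^sub>A' e" if "a : carrier A" for a and e :: nat
  using that by (induction e) (simp_all)
 have f: "fs ! j : carrier A" if "j : T" for j using fs_closed that T by auto
 have "lm (finprod A (\<lambda>j. fs ! j [^] (e j)) T) = finprod A' (\<lambda>j. gs ! j ^\<^sub>A' e j) T" for e :: "nat => nat"
 proof -
  have "lm (finprod A (\<lambda>j. fs ! j [^] (e j)) T) = finprod A' (lm \<circ> (\<lambda>j. fs ! j [^] (e j))) T"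
   using f by (intro h.hom_finprod) auto
  also have "\<dots> = finprod A' (\<lambda>j. gs ! j ^\<^sub>A' e j) T"
   using f T by (intro G.finprod_cong') (auto simp: hom_pow)
  finally show ?thesis .
 qed
 then show ?thesis unfolding cech_denoms_def by force
qed

abbreviation ll where "ll T \<equiv> loc_lift lm A' (G.Den T)"

context
 fixes T assumes T: "T <= {..<length fs}"
begin

lemma Gl: "localization A' (G.Den T)" by (rule G.loc) (use T in simp)

lemma ell_Den: "s : Den T ==> lm s : G.Den T" using Den_image[OF T] by blast

lemma ll_fr: "a : carrier A ==> s : Den T ==> ll T (frL T a s) = G.frL T (lm a) (lm s)"
 by (rule loc_lift_fr[OF loc[OF T] Gl L.loc_map_hom ell_Den])

lemma ll_props:
 assumes X: "X : carrier (LS T)"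
 shows ll_closed: "ll T X : carrier (G.LS T)"
  and ll_add: "Y : carrier (LS T) ==> ll T (X +\<^sub>(LS T) Y) = ll T X +\<^sub>(G.LS T) ll T Y"
  and ll_smult: "a : carrier A ==> ll T (a *\<^sub>(LS T) X) = lm a *\<^sub>(G.LS T) ll T X"
  and ll_pow: "ll T (X ^\<^sub>(LS T) (n::nat)) = ll T X ^\<^sub>(G.LS T) n"
 using loc_lift_closed[OF loc[OF T] Gl L.loc_map_hom ell_Den X] loc_lift_add[OF loc[OF T] Gl L.loc_map_hom ell_Den X]
  loc_lift_smult[OF loc[OF T] Gl L.loc_map_hom ell_Den _ X] loc_lift_pow[OF loc[OF T] Gl L.loc_map_hom ell_Den X] by blast+

text \<open>A denominator annihilating the numerator after localization comes from a denominator t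
  over T, which is invertible there; what remains is an element of S.\<close>

lemma ll_zero_imp:
 assumes X: "X : carrier (LS T)" and z: "ll T X = 0\<^sub>(G.LS T)"
 shows "\<exists>u\<in>S. u *\<^sub>(LS T) X = 0\<^sub>(LS T)"
proof -
 interpret l: localization A "Den T" by (rule loc[OF T])
 interpret l': localization A' "G.Den T" by (rule Gl)
 obtain a s where a: "a : carrier A" "s : Den T" "X = frL T a s" using X by (auto simp: l.L_carrier)
 have "\<exists>u\<in>G.Den T. u \<otimes>\<^sub>A' lm a = 0\<^sub>A'"
  using z l'.fr_eq_zero_iff[OF L.loc_map_closed[OF a(1)] ell_Den[OF a(2)]] by (simp add: a(3) ll_fr[OF a(1,2)])
 then obtain t where t: "t : Den T" "lm t \<otimes>\<^sub>A' lm a = 0\<^sub>A'" using Den_image[OF T] by auto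
 have "lm (t \<otimes> a) = 0\<^sub>A'" using t a ring_hom_mult[OF L.loc_map_hom] by simp
 then obtain u where u: "u : S" "u \<otimes> (t \<otimes> a) = \<zero>"
  using L.fr_eq_zero_iff[of "t \<otimes> a" \<one>] t(1) a(1) by (auto simp: loc_map_def)
 have "t \<otimes> (u \<otimes> a) = \<zero>" using u t(1) a(1) by (simp add: m_lcomm)
 then have "u *\<^sub>(LS T) X = 0\<^sub>(LS T)"
  using l.fr_eq_zero_iff[of "u \<otimes> a" s] t(1) u(1) a by (auto simp: l.fr_smult)
 then show ?thesis using u(1) by blast
qed

lemma ll_surj:
 assumes Y: "Y : carrier (G.LS T)"
 shows "\<exists>s\<in>S. \<exists>X\<in>carrier (LS T). lm s *\<^sub>(G.LS T) Y = ll T X"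
proof -
 interpret l: localization A "Den T" by (rule loc[OF T])
 interpret l': localization A' "G.Den T" by (rule Gl)
 obtain y t' where y': "y : carrier A'" "t' : G.Den T" "Y = G.frL T y t'" using Y by (auto simp: l'.L_carrier)
 then obtain t where "t' = lm t" "t : Den T" using Den_image[OF T] by auto
 then have y: "y : carrier A'" "t : Den T" "Y = G.frL T y (lm t)" using y' by auto
 obtain a s where a: "a : carrier A" "s : S" "y = L.fr a s" using y(1) by (auto simp: L.L_carrier)
 have "lm s \<otimes>\<^sub>A' y = lm a"
  using a L.fr_cancel[of a \<one> s] L.loc_map_mult[of s y] by (simp add: L.fr_smult loc_map_def)
 then have "lm s *\<^sub>(G.LS T) Y = ll T (frL T a t)"
  using y(1,2) a(1,2) L.loc_map_closed ell_Den by (simp add: y(3) l'.fr_smult ll_fr)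
 then show ?thesis using a(1,2) y(2) by (intro bexI[of _ s] bexI[of _ "frL T a t"]) auto
qed

end

text \<open>Localization of cochains, coordinate by coordinate. It is linear along
  \<open>lm\<close>, between modules over different rings, so the lemmas on additive maps are used
  for it.\<close>

definition kap where "kap i x = (\<lambda>T\<in>Ix i. ll T (x T))"

lemma kap_apply: "T : Ix i ==> kap i x T = ll T (x T)" by (simp add: kap_def)

lemma kap_closed: "x : carrier (C i) ==> kap i x : carrier (G.C i)"
 using ll_closed[OF Ix_D(1)] by (auto simp: C_carrier G.C_carrier G_Ix kap_def)

lemma kap_eqI: "y : carrier (G.C i) ==> x : carrier (C i) ==> (\<And>T. T : Ix i ==> y T = ll T (x T)) ==> y = kap i x"
 using G.C_eqI[of y i "kap i x"] kap_closed[of x i] kap_apply[of _ i x] by (simp add: G_Ix)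

lemma kap_add:
 assumes "x : carrier (C i)" "y : carrier (C i)"
 shows "kap i (x +\<^sub>(C i) y) = kap i x +\<^sub>(G.C i) kap i y"
 unfolding kap_def cech_def using assms ll_add[OF Ix_D(1)] unfolding C_carrier by (simp add: G_Ix cong: restrict_cong)

lemma kap_smult:
 assumes "a : carrier A" "x : carrier (C i)"
 shows "kap i (a *\<^sub>(C i) x) = lm a *\<^sub>(G.C i) kap i x"
 unfolding kap_def cech_def using assms ll_smult[OF Ix_D(1)] unfolding C_carrier by (simp add: G_Ix cong: restrict_cong)

lemma kap_phC: "x : carrier (C i) ==> kap i (phC i x) = G.phC i (kap i x)"
 using ll_pow[OF Ix_D(1)] by (auto simp: C_carrier kap_def G_Ix phC_def G.phC_def intro!: restrict_ext)

lemma ll_dterm: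
 assumes T: "T : Ix (Suc i)" and j: "j : T" and x: "x : carrier (C i)"
 shows "ll T (dterm T j x) = G.dterm T j (kap i x)"
proof -
 note T' = Ix_D(1)[OF T] and R = Ix_remove[OF T j]
 let ?R = "T - {j}"
 have sub: "?R <= T" by blast
 interpret l: localization A "Den ?R" by (rule loc[OF Ix_D(1)[OF R]])
 have X: "x ?R : carrier (LS ?R)" using x R by (simp add: C_carrier)
 then obtain a s where a: "a : carrier A" "s : Den ?R" "x ?R = frL ?R a s" by (auto simp: l.L_carrier)
 have sT: "s : Den T" using Den_mono[OF sub T'] a(2) by blast
 have c: "frL T a s : carrier (LS T)" by (rule localization.fr_closed[OF loc[OF T'] a(1) sT])
 have r: "ll T (res T (x ?R)) = G.res T (ll ?R (x ?R))"
  unfolding a(3) res_fr[OF sub T' a(1,2)] ll_fr[OF Ix_D(1)[OF R] a(1,2)] ll_fr[OF T' a(1) sT]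
  using G.res_fr[OF sub _ L.loc_map_closed[OF a(1)] ell_Den[OF Ix_D(1)[OF R] a(2)]] T' by simp
 have ab: "abelian_group (LS T)" "abelian_group (G.LS T)"
  using module_ab[OF LS_module[OF T']] module_ab[OF G.LS_module[of T]] T' by auto
 have sg: "ll T (sg n (LS T) X) = sg n (G.LS T) (ll T X)" if "X : carrier (LS T)" for n X
  using additive_neg[OF ab ll_closed[OF T'] ll_add[OF T'] that] by (simp add: sg_def)
 show ?thesis unfolding dterm_def G.dterm_def kap_apply[OF R] r[symmetric]
  by (rule sg) (use c res_fr[OF sub T' a(1,2)] a(3) in simp)
qed

lemma kap_d:
 assumes x: "x : carrier (C i)"
 shows "kap (Suc i) (d i x) = G.d i (kap i x)"
proof (rule kap_eqI[OF G.d_closed[OF kap_closed[OF x]] d_closed[OF x], symmetric])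
 fix T assume T: "T : Ix (Suc i)"
 note T' = Ix_D(1)[OF T]
 have ab: "abelian_group (LS T)" "abelian_group (G.LS T)"
  using module_ab[OF LS_module[OF T']] module_ab[OF G.LS_module[of T]] T' by auto
 interpret g: abelian_group "G.LS T" by (rule ab(2))
 have c: "dterm T j x : carrier (LS T)" if "j : T" for j by (rule mod_homD(1)[OF dterm_hom[OF T that] x])
 have "G.d i (kap i x) T = (\<Oplus>\<^bsub>G.LS T\<^esub>j\<in>T. G.dterm T j (kap i x))" by (rule G.d_apply) (simp add: G_Ix T)
 also have "\<dots> = (\<Oplus>\<^bsub>G.LS T\<^esub>j\<in>T. ll T (dterm T j x))"
  using ll_dterm[OF T _ x] ll_closed[OF T'] c by (intro g.finsum_cong') auto
 also have "\<dots> = ll T (d i x T)" unfolding d_apply[OF T] using Ix_D(2)[OF T] c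
  by (intro additive_finsum[OF ab ll_closed[OF T'] ll_add[OF T'], symmetric]) auto
 finally show "G.d i (kap i x) T = ll T (d i x T)" .
qed

lemma kap_zero: "kap i 0\<^sub>(C i) = 0\<^sub>(G.C i)"
 by (rule additive_zero[where f = "kap i", OF module_ab[OF C_module] module_ab[OF G.C_module] kap_closed kap_add])

lemma kap_Z: "z : Z i ==> kap i z : G.Z i"
 using kap_d[of z i] kap_closed[of z i] kap_zero[of "Suc i"] by (auto simp: cech_cycles_def)

lemma kap_Bd: "z : Bd i ==> kap i z : G.Bd i"
 using kap_d kap_closed kap_zero[of 0] by (cases i) (auto simp: cech_boundaries_def)

definition hmap where "hmap i X = the_elem ((\<lambda>z. G.cl i (kap i z)) ` X)"

lemma hmap_cl:
 assumes z: "z : Z i" shows "hmap i (cl i z) = G.cl i (kap i z)" unfolding hmap_def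
proof (rule quot_lift_additive[OF Zmod Bd_submodule_Z module_ab[OF G.H_module]])
 show "G.cl i (kap i x) : carrier (G.H i)" if "x : carrier (submod (C i) (Z i))" for x
  using that Zc G.cl_closed[OF kap_Z] by simp
 show "G.cl i (kap i (x +\<^sub>(submod (C i) (Z i)) y)) = G.cl i (kap i x) +\<^sub>(G.H i) G.cl i (kap i y)"
  if "x : carrier (submod (C i) (Z i))" "y : carrier (submod (C i) (Z i))" for x y
  using that Zc kap_add[OF Z_closed Z_closed, of x i y] G.cl_add[OF kap_Z kap_Z] by (simp add: submod_def)
 show "G.cl i (kap i x) = 0\<^sub>(G.H i)" if "x : Bd i" for x
  using G.cl_zero_iff[OF kap_Z] kap_Bd[OF that] Bd_Z that by blast
qed (use z Zc in simp)

lemma hmap_props: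
 assumes X: "X : carrier (H i)"
 shows "hmap i X : carrier (G.H i)"
  "Y : carrier (H i) ==> hmap i (X +\<^sub>(H i) Y) = hmap i X +\<^sub>(G.H i) hmap i Y"
  "a : carrier A ==> hmap i (a *\<^sub>(H i) X) = lm a *\<^sub>(G.H i) hmap i X"
  "hmap i (cech_frob A p fs i X) = cech_frob A' p gs i (hmap i X)"
proof -
 obtain z where z: "z : Z i" "X = cl i z" using X by (auto simp: H_carrier)
 note zc = Z_closed[OF z(1)]
 note Z' = Module.module.submoduleE[OF C_module Z_submodule]
 show "hmap i X : carrier (G.H i)" using z hmap_cl G.cl_closed[OF kap_Z] by simp
 show "hmap i (a *\<^sub>(H i) X) = lm a *\<^sub>(G.H i) hmap i X" if a: "a : carrier A"
  unfolding z(2) cl_smult[OF a z(1), symmetric] hmap_cl[OF z(1)] hmap_cl[OF Z'(4)[OF a z(1)]] kap_smult[OF a zc]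
  by (rule G.cl_smult[OF L.loc_map_closed[OF a] kap_Z[OF z(1)]])
 show "hmap i (cech_frob A p fs i X) = cech_frob A' p gs i (hmap i X)"
  unfolding z(2) cech_frob_cl[OF z(1)] hmap_cl[OF z(1)] hmap_cl[OF Z_phC[OF z(1)]] kap_phC[OF zc]
  using G.cech_frob_cl[OF kap_Z[OF z(1)]] by simp
 assume "Y : carrier (H i)"
 then obtain w where w: "w : Z i" "Y = cl i w" by (auto simp: H_carrier)
 show "hmap i (X +\<^sub>(H i) Y) = hmap i X +\<^sub>(G.H i) hmap i Y"
  unfolding z(2) w(2) cl_add[OF z(1) w(1), symmetric] hmap_cl[OF z(1)] hmap_cl[OF w(1)] hmap_cl[OF Z'(5)[OF z(1) w(1)]]
   kap_add[OF zc Z_closed[OF w(1)]] by (rule G.cl_add[OF kap_Z[OF z(1)] kap_Z[OF w(1)]])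
qed

text \<open>Two denominators occur: s makes the coordinates of a cocycle come from the complex over
  A, and u kills the differential of the lift, which vanishes only after localization. There are
  finitely many indices, so common choices exist.\<close>

lemma hmap_surj:
 assumes Y: "Y : carrier (G.H i)"
 shows "\<exists>s\<in>S. \<exists>X\<in>carrier (H i). lm s *\<^sub>(G.H i) Y = hmap i X"
proof -
 obtain y where y: "y : G.Z i" "Y = G.cl i y" using Y by (auto simp: G.H_carrier)
 have yc: "y : carrier (G.C i)" by (rule G.Z_closed[OF y(1)])
 have "\<exists>s\<in>S. \<forall>T\<in>Ix i. \<exists>X. X : carrier (LS T) \<and> lm s *\<^sub>(G.LS T) y T = ll T X"
 proof (rule L.common_multiple[OF Ix_finite])
  fix T assume T: "T : Ix i"
  note T' = Ix_D(1)[OF T]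
  interpret m: Module.module A "LS T" by (rule LS_module[OF T'])
  interpret m': Module.module A' "G.LS T" by (rule G.LS_module) (use T' in simp)
  have yT: "y T : carrier (G.LS T)" using yc T by (simp add: G.C_carrier G_Ix)
  then show "\<exists>s\<in>S. \<exists>X. X : carrier (LS T) \<and> lm s *\<^sub>(G.LS T) y T = ll T X" using ll_surj[OF T'] by blast
  fix s r assume s: "s : S" "r : S" "\<exists>X. X : carrier (LS T) \<and> lm s *\<^sub>(G.LS T) y T = ll T X"
  then obtain X where X: "X : carrier (LS T)" "lm s *\<^sub>(G.LS T) y T = ll T X" by blast
  have "lm (r \<otimes> s) *\<^sub>(G.LS T) y T = ll T (r *\<^sub>(LS T) X)"
   using s(1,2) X yT L.loc_map_closed ll_smult[OF T' X(1), of r] by (simp add: ring_hom_mult[OF L.loc_map_hom] m'.smult_assoc1)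
  then show "\<exists>X. X : carrier (LS T) \<and> lm (r \<otimes> s) *\<^sub>(G.LS T) y T = ll T X" using s(2) X(1) by (intro exI conjI) auto
 qed
 then obtain s where s: "s : S" "\<forall>T\<in>Ix i. \<exists>X. X : carrier (LS T) \<and> lm s *\<^sub>(G.LS T) y T = ll T X" by blast
 from bchoice[OF s(2)] obtain X where X: "\<forall>T\<in>Ix i. X T : carrier (LS T) \<and> lm s *\<^sub>(G.LS T) y T = ll T (X T)" by blast
 have sc: "lm s : carrier A'" using s(1) L.loc_map_closed by simp
 define x where "x = restrict X (Ix i)"
 have x: "x : carrier (C i)" using X by (auto simp: C_carrier x_def)
 note G_Z = Module.module.submoduleE[OF G.C_module G.Z_submodule]
 have sy: "lm s *\<^sub>(G.C i) y = kap i x"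
 proof (rule kap_eqI[OF Module.module.smult_closed[OF G.C_module sc yc] x])
  show "(lm s *\<^sub>(G.C i) y) T = ll T (x T)" if "T : Ix i" for T
   using X that by (simp add: x_def cech_def G_Ix)
 qed
 have dx: "kap (Suc i) (d i x) = 0\<^sub>(G.C (Suc i))"
  using kap_d[OF x] G_Z(4)[OF sc y(1)] sy by (simp add: cech_cycles_def)
 have "\<exists>u\<in>S. \<forall>T\<in>Ix (Suc i). u *\<^sub>(LS T) d i x T = 0\<^sub>(LS T)"
 proof (rule L.common_multiple[OF Ix_finite])
  fix T assume T: "T : Ix (Suc i)"
  interpret m: Module.module A "LS T" by (rule LS_module[OF Ix_D(1)[OF T]])
  have dc: "d i x T : carrier (LS T)" using d_closed[OF x] T by (simp add: C_carrier)
  have "ll T (d i x T) = 0\<^sub>(G.LS T)" using fun_cong[OF dx, of T] T G.C_zero_apply[of T "Suc i"] by (simp add: kap_apply G_Ix)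
  then show "\<exists>u\<in>S. u *\<^sub>(LS T) d i x T = 0\<^sub>(LS T)" using ll_zero_imp[OF Ix_D(1)[OF T] dc] by blast
  show "(r \<otimes> u) *\<^sub>(LS T) d i x T = 0\<^sub>(LS T)" if "u : S" "r : S" "u *\<^sub>(LS T) d i x T = 0\<^sub>(LS T)" for u r
   using that dc by (simp add: m.smult_assoc1)
 qed
 then obtain u where u: "u : S" "\<forall>T\<in>Ix (Suc i). u *\<^sub>(LS T) d i x T = 0\<^sub>(LS T)" by blast
 have uc: "u : carrier A" using u(1) by simp
 interpret Ci: Module.module A "C i" by (rule C_module)
 have "d i (u *\<^sub>(C i) x) = 0\<^sub>(C (Suc i))"
 proof (rule C_eqI[OF d_closed[OF Ci.smult_closed[OF uc x]] abelian_groupE(2)[OF module_ab[OF C_module]]])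
  show "d i (u *\<^sub>(C i) x) T = 0\<^sub>(C (Suc i)) T" if T: "T : Ix (Suc i)" for T
   using mod_homD(3)[OF d_hom uc x] T u(2) by (simp add: cech_def)
 qed
 then have ux: "u *\<^sub>(C i) x : Z i" using x uc by (simp add: cech_cycles_def)
 have us: "lm (u \<otimes> s) = lm u \<otimes>\<^sub>A' lm s" using ring_hom_mult[OF L.loc_map_hom uc] s(1) by simp
 have usc: "lm (u \<otimes> s) : carrier A'" using L.loc_map_closed uc s(1) by simp
 have "hmap i (cl i (u *\<^sub>(C i) x)) = G.cl i (lm u *\<^sub>(G.C i) (lm s *\<^sub>(G.C i) y))"
  unfolding hmap_cl[OF ux] kap_smult[OF uc x] sy ..
 also have "lm u *\<^sub>(G.C i) (lm s *\<^sub>(G.C i) y) = lm (u \<otimes> s) *\<^sub>(G.C i) y"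
  unfolding us using Module.module.smult_assoc1[OF G.C_module L.loc_map_closed[OF uc] sc yc] by simp
 also have "G.cl i \<dots> = lm (u \<otimes> s) *\<^sub>(G.H i) Y" unfolding y(2) by (rule G.cl_smult[OF usc y(1)])
 finally show ?thesis using u(1) s(1) cl_closed[OF ux] by (intro bexI[of _ "u \<otimes> s"] bexI[of _ "cl i (u *\<^sub>(C i) x)"]) auto
qed

end

section \<open>The injective hull of the residue field\<close>

lemma noeth_ascending:
 assumes A: "noeth_ring A" and sub: "\<And>t. submodule (I t) A (reg A)" and inc: "\<And>t::nat. I t <= I (Suc t)"
 shows "\<exists>T. \<forall>t. I t <= I T"
proof -
 have rm: "Module.module A (reg A)" using A reg_is_module unfolding noeth_ring_def by blast
 have mono: "I t <= I t'" if "t \<le> t'" for t t' using lift_Suc_mono_le[of I, OF inc that] .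
 note E = Module.module.submoduleE[OF rm sub]
 have "submodule (\<Union>t. I t) A (reg A)"
 proof (rule Module.module.submoduleI[OF rm])
  fix r r' assume "r : (\<Union>t. I t)" "r' : (\<Union>t. I t)"
  then obtain t t' where "r : I t" "r' : I t'" by blast
  then have "r : I (max t t')" "r' : I (max t t')" using mono[of t "max t t'"] mono[of t' "max t t'"] by auto
  then show "r +\<^sub>(reg A) r' : (\<Union>t. I t)" using E(5) by blast
 next
  show "0\<^sub>(reg A) : (\<Union>t. I t)" using submodule_zero[OF sub] by blast
  show "(\<Union>t. I t) <= carrier (reg A)" using E(1) by blast
  show "-\<^sub>(reg A) r : (\<Union>t. I t)" if "r : (\<Union>t. I t)" for r using E(3) that by blast
  show "a *\<^sub>(reg A) r : (\<Union>t. I t)" if "a : carrier A" "r : (\<Union>t. I t)" for a r using E(4) that by blast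
 qed
 then obtain G where G: "finite G" "G <= (\<Union>t. I t)" "(\<Union>t. I t) = gen_submodule A (reg A) G"
  using A unfolding noeth_ring_def by blast
 have "\<forall>g\<in>G. \<exists>t. g : I t" using G(2) by blast
 from bchoice[OF this] obtain f where f: "\<forall>g\<in>G. g : I (f g)" by blast
 have "G <= I (Max (f ` G))" using f mono[OF Max_ge[of "f ` G"]] G(1) by blast
 then have "gen_submodule A (reg A) G <= I (Max (f ` G))" by (rule gen_submodule_minimal[OF rm sub])
 then show ?thesis using G(3) by blast
qed

locale prime_localization = primeideal P A for P and A :: "('a, 'x) ring_scheme" (structure)
begin

abbreviation S where "S \<equiv> carrier A - P"

lemma one_notin: "\<one> \<notin> P" using one_imp_carrier I_notcarr by blast

sublocale L: localization A S by unfold_locales (use one_notin I_prime in auto)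

abbreviation A' where "A' \<equiv> loc_ring A S"
definition mm where "mm = {L.fr a s | a s. a : P \<and> s : S}"

sublocale A': cring A' by (rule L.L_cring)

lemma fr_in_mm:
 assumes "a : carrier A" "s : S" shows "L.fr a s : mm \<longleftrightarrow> a : P"
proof
 assume "L.fr a s : mm"
 then obtain b t where b: "b : P" "t : S" "L.fr a s = L.fr b t" by (auto simp: mm_def)
 have bc: "b : carrier A" using b(1) by (rule Icarr)
 obtain u where u: "u : S" "u \<otimes> (t \<otimes> a) = u \<otimes> (s \<otimes> b)" using b L.fr_eq_iff[OF assms(1) bc assms(2) b(2)] by auto
 then have "u \<otimes> (t \<otimes> a) : P" using b(1) assms bc by (simp add: I_l_closed)
 then show "a : P" using I_prime[of u "t \<otimes> a"] I_prime[of t a] u(1) b(2) assms by auto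
qed (use assms in \<open>auto simp: mm_def\<close>)

lemma mm_ideal: "ideal mm A'"
proof (rule idealI[OF A'.ring_axioms])
 have sub: "mm <= carrier A'" by (auto simp: mm_def)
 have mult: "X \<otimes>\<^sub>A' Y : mm" if Y: "Y : mm" and X: "X : carrier A'" for X Y
 proof -
  obtain a s where a: "a : P" "s : S" "Y = L.fr a s" using Y by (auto simp: mm_def)
  obtain b t where b: "b : carrier A" "t : S" "X = L.fr b t" using X by (auto simp: L.L_carrier)
  show ?thesis unfolding a(3) b(3) L.fr_mult[OF b(1) Icarr[OF a(1)] b(2) a(2)]
   using fr_in_mm[of "b \<otimes> a" "t \<otimes> s"] a b Icarr[OF a(1)] I_l_closed L.mult_S[OF b(2) a(2)] by simp
 qed
 show "X \<otimes>\<^sub>A' Y : mm" if "Y : mm" "X : carrier A'" for X Y by (rule mult[OF that])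
 show "Y \<otimes>\<^sub>A' X : mm" if "Y : mm" "X : carrier A'" for X Y
  using mult[OF that] that sub A'.m_comm by auto
 show "subgroup mm (add_monoid A')"
 proof (rule A'.add.subgroupI)
  show "mm \<noteq> {}" using fr_in_mm[of \<zero> \<one>] one_notin by auto
  show "-\<^sub>A' Y : mm" if "Y : mm" for Y
   using mult[OF that, of "-\<^sub>A' 1\<^sub>A'"] that sub A'.l_minus[of "1\<^sub>A'" Y] by auto
  fix X Y assume "X : mm" "Y : mm"
  then have XY: "X : carrier A'" "Y : carrier A'" "X : mm" "Y : mm" using sub by auto
  obtain a b s where ab: "a : carrier A" "b : carrier A" "s : S" "X = L.fr a s" "Y = L.fr b s"
   by (rule L.common_denom2[OF XY(1,2)])
  then have "a \<oplus> b : P" using XY(3,4) fr_in_mm[of a s] fr_in_mm[of b s] by (intro additive_subgroup.a_closed[OF is_additive_subgroup]) auto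
  then show "X +\<^sub>A' Y : mm" unfolding ab(4,5) L.fr_add_same[OF ab(1-3)] using fr_in_mm[of "a \<oplus> b" s] ab(1-3) by simp
 qed (use sub in auto)
qed

lemma unit_inverse:
 assumes "s : S" shows "L.fr \<one> s \<otimes>\<^sub>A' loc_map A S s = 1\<^sub>A'"
 unfolding loc_map_def using assms L.fr_mult[of \<one> s s \<one>] L.fr_cancel[of \<one> \<one> s] L.one_S by (simp add: L.L_one)

text \<open>\<open>residue_module\<close> refers to the maximal ideal by a description; it is
  evaluated by showing that every proper ideal lies in \<open>mm\<close>.\<close>

lemma mm_maximal: "(THE \<mm>. maximalideal \<mm> A') = mm"
proof (rule the_equality)
 have one: "1\<^sub>A' \<notin> mm" unfolding L.L_one using fr_in_mm[of \<one> \<one>] one_notin by simp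
 have sub: "I <= mm" if I: "ideal I A'" "I \<noteq> carrier A'" for I
 proof
  interpret I: ideal I A' by fact
  fix X assume X: "X : I"
  then have "X : carrier A'" by (rule I.Icarr)
  then obtain a s where a: "a : carrier A" "s : S" "X = L.fr a s" by (auto simp: L.L_carrier)
  have "a : P"
  proof (rule ccontr)
   assume "a \<notin> P"
   then have "L.fr s a \<otimes>\<^sub>A' X = 1\<^sub>A'"
    unfolding a(3) L.L_one using a \<open>a \<notin> P\<close> L.fr_mult[of s a a s] L.fr_cancel[of \<one> \<one> "a \<otimes> s"] L.one_S L.mult_S[of a s] by (simp add: m_comm)
   then have "1\<^sub>A' : I" using I.I_l_closed[OF X, of "L.fr s a"] a \<open>a \<notin> P\<close> by simp
   then show False using I.one_imp_carrier I(2) by blast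
  qed
  then show "X : mm" using fr_in_mm[OF a(1,2)] a(3) by simp
 qed
 have ne: "mm \<noteq> carrier A'" using one by auto
 show m: "maximalideal mm A'"
 proof (rule maximalidealI[OF mm_ideal ne[symmetric]])
  show "I = mm \<or> I = carrier A'" if "ideal I A'" "mm <= I" for I using sub that by blast
 qed
 fix I assume I: "maximalideal I A'"
 have "I <= mm" using sub[of I] maximalideal.axioms(1)[OF I] maximalideal.I_notcarr[OF I] by auto
 then show "I = mm" using maximalideal.I_maximal[OF I mm_ideal] ne ideal.Icarr[OF mm_ideal] by blast
qed

context
 fixes EE :: "(('a \<times> 'a) set, 'e) module"
 assumes noeth: "noeth_ring A" and hull: "injective_hull A' (residue_module A') EE"
begin

lemma E_module: "Module.module A' EE" using hull by (simp add: injective_hull_def injective_module_def)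

interpretation E: Module.module A' EE by (rule E_module)

lemma residue_props:
 shows "Module.module A' (residue_module A')" "carrier (residue_module A') \<noteq> {0\<^sub>(residue_module A')}"
  "X : mm ==> K : carrier (residue_module A') ==> X *\<^sub>(residue_module A') K = 0\<^sub>(residue_module A')"
proof -
 note rm = reg_is_module[OF A'.is_cring]
 have sm: "submodule mm A' (reg A')" using submodule_reg_iff_ideal[OF A'.is_cring] mm_ideal by blast
 have K: "residue_module A' = quot_module (reg A') mm" by (simp add: residue_module_def mm_maximal)
 interpret m: ideal mm A' by (rule mm_ideal)
 show "Module.module A' (residue_module A')" unfolding K by (rule quot_is_module[OF rm sm])
 have "1\<^sub>A' \<notin> mm" unfolding L.L_one using fr_in_mm[of \<one> \<one>] one_notin by simp
 then have "mm +>\<^sub>(reg A') 1\<^sub>A' \<noteq> mm" using coset_eq_N_iff[OF rm sm, of "1\<^sub>A'"] by simp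
 then show "carrier (residue_module A') \<noteq> {0\<^sub>(residue_module A')}"
  unfolding K quot_carrier[OF rm sm] quot_zero[OF rm sm] by auto
 assume X: "X : mm" and "K : carrier (residue_module A')"
 then obtain Y where Y: "Y : carrier A'" "K = mm +>\<^sub>(reg A') Y" unfolding K quot_carrier[OF rm sm] by auto
 show "X *\<^sub>(residue_module A') K = 0\<^sub>(residue_module A')"
  using quot_smult[OF rm sm, of X Y] coset_eq_N_iff[OF rm sm, of "X \<otimes>\<^sub>A' Y"] m.I_r_closed[OF X Y(1)] m.Icarr[OF X] Y(1)
  unfolding Y(2) unfolding K quot_zero[OF rm sm] by simp
qed

lemma hull_nonzero: "carrier EE \<noteq> {0\<^sub>EE}"
proof
 assume z: "carrier EE = {0\<^sub>EE}"
 obtain \<iota> where i: "\<iota> : mod_hom A' (residue_module A') EE" "inj_on \<iota> (carrier (residue_module A'))"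
  using hull unfolding injective_hull_def by blast
 interpret K: Module.module A' "residue_module A'" by (rule residue_props)
 have "K = 0\<^sub>(residue_module A')" if K: "K : carrier (residue_module A')" for K
  using inj_onD[OF i(2) _ K K.M.zero_closed] mod_homD(1)[OF i(1) K] mod_homD(1)[OF i(1) K.M.zero_closed] z by simp
 then show False using residue_props(2) by blast
qed

text \<open>Let c be the image of a. The ideals of those r in A that kill c^t y increase with t and
  become stationary at some T. If c^T y were not 0, essentiality would give a nonzero multiple of it
  in the image of the residue field, where c acts as 0; the numerator of the factor then kills
  c^(T+1) y, hence c^T y, a contradiction. Working with ideals of A makes noetherianness of A
  directly applicable.\<close>

lemma hull_torsion:
 assumes y: "y : carrier EE" and a: "a : P"
 shows "\<exists>t::nat. (loc_map A S a ^\<^sub>A' t) *\<^sub>EE y = 0\<^sub>EE"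
proof -
 let ?c = "loc_map A S a" and ?l = "loc_map A S"
 have ac: "a : carrier A" using a by (rule Icarr)
 have cc: "?c : carrier A'" by (rule L.loc_map_closed[OF ac])
 have rm: "Module.module A (reg A)" by (rule reg_is_module[OF is_cring])
 define z where "z t = (?c ^\<^sub>A' t) *\<^sub>EE y" for t :: nat
 have zc: "z t : carrier EE" for t using y cc by (simp add: z_def)
 have zS: "z (Suc t) = ?c *\<^sub>EE z t" for t
  using y cc A'.m_comm[of "?c ^\<^sub>A' t" ?c] by (simp add: z_def E.smult_assoc1[symmetric])
 define I where "I t = {r : carrier A. ?l r *\<^sub>EE z t = 0\<^sub>EE}" for t
 have inc: "I t <= I (Suc t)" for t
 proof
  fix r assume r: "r : I t"
  then have rc: "?l r : carrier A'" using L.loc_map_closed by (simp add: I_def)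
  have "?l r *\<^sub>EE z (Suc t) = ?c *\<^sub>EE (?l r *\<^sub>EE z t)"
   unfolding zS using rc cc zc[of t] by (simp add: E.smult_assoc1[symmetric] A'.m_comm)
  then show "r : I (Suc t)" using r cc by (simp add: I_def)
 qed
 have sub: "submodule (I t) A (reg A)" for t
 proof -
  have sm: "x \<otimes> r : I t" if "x : carrier A" "r : I t" for x r
   using that L.loc_map_closed zc[of t] by (simp add: I_def ring_hom_mult[OF L.loc_map_hom] E.smult_assoc1)
  show ?thesis
  proof (rule Module.module.submoduleI[OF rm])
   show "-\<^sub>(reg A) r : I t" if r: "r : I t" for r
   proof -
    have "-\<^sub>(reg A) r = \<ominus> r" by simp
    moreover have "\<ominus> r = \<ominus> \<one> \<otimes> r" using r by (simp add: I_def l_minus)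
    ultimately show ?thesis using sm[OF _ r] by simp
   qed
   show "r +\<^sub>(reg A) r' : I t" if "r : I t" "r' : I t" for r r'
    using that L.loc_map_closed zc[of t] by (simp add: I_def ring_hom_add[OF L.loc_map_hom] E.smult_l_distr)
   show "0\<^sub>(reg A) : I t" using E.smult_l_null[OF zc] L.L_zero by (simp add: I_def loc_map_def)
  qed (use sm in \<open>auto simp: I_def\<close>)
 qed
 obtain T where T: "\<And>t. I t <= I T" using noeth_ascending[where I = I, OF noeth sub inc] by blast
 have "z T = 0\<^sub>EE"
 proof (rule ccontr)
  assume nz: "z T \<noteq> 0\<^sub>EE"
  obtain \<iota> where i: "\<iota> : mod_hom A' (residue_module A') EE"
   "\<And>N. submodule N A' EE ==> N \<noteq> {0\<^sub>EE} ==> N \<inter> \<iota> ` carrier (residue_module A') \<noteq> {0\<^sub>EE}"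
   using hull unfolding injective_hull_def by blast
  define N where "N = (\<lambda>X. X *\<^sub>EE z T) ` carrier A'"
  have "(\<lambda>X. X *\<^sub>EE z T) : mod_hom A' (reg A') EE"
   using zc by (intro mod_homI) (auto simp: E.smult_l_distr E.smult_assoc1)
  from mod_hom_image_submodule[OF reg_is_module[OF A'.is_cring] E_module this Module.module.carrier_is_submodule[OF reg_is_module[OF A'.is_cring]]]
  have N: "submodule N A' EE" by (simp add: N_def)
  have "z T : N" using zc by (auto simp: N_def intro!: image_eqI[of _ _ "1\<^sub>A'"])
  then have "N \<inter> \<iota> ` carrier (residue_module A') \<noteq> {0\<^sub>EE}" using i(2)[OF N] nz by blast
  moreover have "0\<^sub>EE : N \<inter> \<iota> ` carrier (residue_module A')"
   using submodule_zero[OF N] submodule_zero[OF mod_hom_image_submodule[OF residue_props(1) E_module i(1)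
    Module.module.carrier_is_submodule[OF residue_props(1)]]] by blast
  ultimately obtain w where "w : N" "w : \<iota> ` carrier (residue_module A')" "w \<noteq> 0\<^sub>EE" by blast
  then obtain X K where X: "X : carrier A'" "K : carrier (residue_module A')" "X *\<^sub>EE z T = \<iota> K" "\<iota> K \<noteq> 0\<^sub>EE"
   by (auto simp: N_def)
  obtain r s where r: "r : carrier A" "s : S" "X = L.fr r s" using X(1) by (auto simp: L.L_carrier)
  have rX: "?l r = ?l s \<otimes>\<^sub>A' X"
   using r L.fr_cancel[of r \<one> s] L.loc_map_mult[of s X] one_notin by (simp add: L.fr_smult loc_map_def)
  have sc: "?l s : carrier A'" "s : carrier A" using r(2) L.loc_map_closed by auto
  have "?l r *\<^sub>EE z (Suc T) = ?l s *\<^sub>EE (?c *\<^sub>EE \<iota> K)"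
   unfolding zS rX X(3)[symmetric] using sc X(1) cc zc[of T]
   by (simp add: E.smult_assoc1[symmetric] A'.m_assoc A'.m_comm[of X])
  also have "?c *\<^sub>EE \<iota> K = \<iota> (?c *\<^sub>(residue_module A') K)" by (rule mod_homD(3)[OF i(1) cc X(2), symmetric])
  also have "?c *\<^sub>(residue_module A') K = 0\<^sub>(residue_module A')"
   by (rule residue_props(3)[OF _ X(2)]) (use fr_in_mm[OF ac L.one_S] a in \<open>simp add: loc_map_def\<close>)
  also have "\<iota> 0\<^sub>(residue_module A') = 0\<^sub>EE"
   by (rule additive_zero[OF module_ab[OF residue_props(1)] module_ab[OF E_module] mod_homD(1)[OF i(1)] mod_homD(2)[OF i(1)]])
  finally have "r : I T" using T r(1) sc by (auto simp: I_def)
  then have "?l r *\<^sub>EE z T = 0\<^sub>EE" by (simp add: I_def)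
  then have "?l s *\<^sub>EE \<iota> K = 0\<^sub>EE" unfolding rX X(3)[symmetric] using sc X(1) zc[of T] by (simp add: E.smult_assoc1)
  then have "L.fr \<one> s *\<^sub>EE (?l s *\<^sub>EE \<iota> K) = 0\<^sub>EE" using r(2) by simp
  then show False using X(4) mod_homD(1)[OF i(1) X(2)] r(2) sc(1) unit_inverse[OF r(2)] by (simp add: E.smult_assoc1[symmetric])
 qed
 then show ?thesis unfolding z_def by blast
qed

text \<open>The quotient is a k-fold sum of E, and E is neither zero nor free of P-torsion: each
  coordinate is killed by a power, and the largest of the finitely many exponents serves for
  all.\<close>

lemma corank_quotient:
 assumes M: "Module.module A' M" and N: "submodule N A' M"
  and f: "f : mod_iso A' (quot_module M N) (direct_sum {..<k::nat} (\<lambda>_. EE))"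
 shows "k \<noteq> 0 ==> N \<noteq> carrier M"
  and "y : carrier M ==> a : P ==> \<exists>t::nat. (loc_map A S a ^\<^sub>A' t) *\<^sub>M y : N"
proof -
 let ?Q = "quot_module M N" and ?E = "direct_sum {..<k} (\<lambda>_. EE)"
 interpret M: Module.module A' M by fact
 have Q: "Module.module A' ?Q" by (rule quot_is_module[OF M N])
 have EM: "Module.module A' ?E" by (rule direct_sum_is_module[OF A'.is_cring E_module])
 interpret Em: Module.module A' ?E by (rule EM)
 have fh: "f : mod_hom A' ?Q ?E" and inj: "inj_on f (carrier ?Q)" and im: "f ` carrier ?Q = carrier ?E"
  using f by (auto simp: mod_iso_def bij_betw_def)
 have Qz: "N : carrier ?Q" using abelian_groupE(2)[OF module_ab[OF Q]] by (simp add: quot_zero[OF M N])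
 have f0: "f N = 0\<^sub>?E"
  using additive_zero[OF module_ab[OF Q] module_ab[OF EM] mod_homD(1)[OF fh] mod_homD(2)[OF fh]] by (simp add: quot_zero[OF M N])
 show "N \<noteq> carrier M" if k: "k \<noteq> 0"
 proof
  assume NM: "N = carrier M"
  have "carrier ?Q = {N}" unfolding quot_carrier[OF M N] using coset_eq_N_iff[OF M N] NM by auto
  then have all: "carrier ?E = {0\<^sub>?E}" using im f0 by auto
  obtain e where e: "e : carrier EE" "e \<noteq> 0\<^sub>EE" using hull_nonzero by blast
  have "(\<lambda>j\<in>{..<k}. e) : carrier ?E" using e(1) by (auto simp: direct_sum_carrier)
  then have "(\<lambda>j\<in>{..<k}. e) = (\<lambda>j\<in>{..<k}. 0\<^sub>EE)" using all by auto
  from fun_cong[OF this, of 0] show False using k e(2) by simp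
 qed
 assume y: "y : carrier M" and a: "a : P"
 let ?c = "loc_map A S a"
 have cc: "?c : carrier A'" by (rule L.loc_map_closed[OF Icarr[OF a]])
 define v where "v = f (N +>\<^sub>M y)"
 have Qy: "N +>\<^sub>M y : carrier ?Q" using y by (simp add: quot_carrier[OF M N])
 have v: "v : carrier ?E" unfolding v_def by (rule mod_homD(1)[OF fh Qy])
 have vj: "v j : carrier EE" if "j < k" for j using v that by (auto simp: direct_sum_carrier)
 have "\<forall>j\<in>{..<k}. \<exists>t::nat. (?c ^\<^sub>A' t) *\<^sub>EE v j = 0\<^sub>EE" using hull_torsion[OF vj a] by simp
 from bchoice[OF this] obtain t :: "nat => nat" where t: "\<forall>j\<in>{..<k}. (?c ^\<^sub>A' t j) *\<^sub>EE v j = 0\<^sub>EE" by blast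
 define m where "m = Max (t ` {..<k})"
 have ct: "?c ^\<^sub>A' m : carrier A'" using cc by simp
 have "(?c ^\<^sub>A' m) *\<^sub>EE v j = 0\<^sub>EE" if j: "j < k" for j
 proof -
  have "t j \<le> m" unfolding m_def using j by (intro Max_ge) auto
  then have "?c ^\<^sub>A' m = ?c ^\<^sub>A' (m - t j) \<otimes>\<^sub>A' ?c ^\<^sub>A' t j" using cc by (simp add: A'.nat_pow_mult)
  then show ?thesis using t j cc vj[OF j] by (simp add: E.smult_assoc1)
 qed
 then have "(?c ^\<^sub>A' m) *\<^sub>?E v = 0\<^sub>?E" by auto
 then have "f (N +>\<^sub>M ((?c ^\<^sub>A' m) *\<^sub>M y)) = f N"
  using mod_homD(3)[OF fh ct Qy] quot_smult[OF M N ct y] f0 by (simp add: v_def)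
 then have "N +>\<^sub>M ((?c ^\<^sub>A' m) *\<^sub>M y) = N"
  using M.smult_closed[OF ct y] Qz by (intro inj_onD[OF inj]) (auto simp: quot_carrier[OF M N])
 then have "(?c ^\<^sub>A' m) *\<^sub>M y : N" using coset_eq_N_iff[OF M N M.smult_closed[OF ct y]] by blast
 then show "\<exists>t::nat. (?c ^\<^sub>A' t) *\<^sub>M y : N" by blast
qed

end

section \<open>From nonzero corank to a special prime\<close>

text \<open>The map h stands for localization on cohomology: linear along the map to the local ring,
  and onto up to denominators. The F-submodule is pulled back along h; elements outside P act
  invertibly on M', which gives saturation, and torsion comes from the injective hull.\<close>

lemma corank_special_prime:
 fixes M :: "('a, 'm) module" and M' :: "(('a \<times> 'a) set, 'n) module"
 assumes M: "unit_module A p J b M \<phi>" and M': "unit_module A' p J (\<lambda>j. loc_map A S (b j)) M' \<phi>'"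
  and h: "\<And>x. x : carrier M ==> h x : carrier M'"
   "\<And>x y. x : carrier M ==> y : carrier M ==> h (x +\<^sub>M y) = h x +\<^sub>M' h y"
   "\<And>a x. a : carrier A ==> x : carrier M ==> h (a *\<^sub>M x) = loc_map A S a *\<^sub>M' h x"
   "\<And>x. x : carrier M ==> h (\<phi> x) = \<phi>' (h x)"
   "\<And>y. y : carrier M' ==> \<exists>s\<in>S. \<exists>x\<in>carrier M. loc_map A S s *\<^sub>M' y = h x"
  and noeth: "noeth_ring A"
  and crk: "corank_is A' p M' (inv_into (carrier (Frob A' p M')) (Frob_lift A' M' M' 1 \<phi>')) k" "k \<noteq> 0"
  and U: "is_matrix A d d U" and x: "\<And>i. i < d ==> x i : carrier M"
  and g: "g : mod_hom A (vecs A d) M" and gI: "g ` carrier (vecs A d) = gen_submodule A M (x ` {..<d})"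
  and DU: "\<And>v j. v : carrier (vecs A d) ==> j : J ==>
   dcomp J b M \<phi> j (g v) = g (dcomp J b (vecs A d) (vec_pow A d p) j (mat_vec A d d U v))"
  and gen: "\<And>y. y : carrier M ==> \<exists>e. y : (dinv J b M \<phi> ^^ e) (gen_submodule A M (x ` {..<d}))"
  and K: "g ` stable_K A p d U = gen_submodule A M (x ` {..<d})"
 shows "P : special_primes A p d U"
proof -
 interpret M: unit_module A p J b M \<phi> by fact
 interpret M': unit_module A' p J "\<lambda>j. loc_map A S (b j)" M' \<phi>' by fact
 let ?l = "loc_map A S"
 obtain N' and EE :: "(('a \<times> 'a) set, nat => ('a \<times> 'a) set) module"
  where F: "F_submodule A' p M' M'.Frob_inv N'" and hull: "injective_hull A' (residue_module A') EE"
   and "mod_iso A' (quot_module M' N') (direct_sum {..<k} (\<lambda>_. EE)) \<noteq> {}"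
  using crk(1) unfolding corank_is_def is_smallest_def by blast
 then obtain f where f: "f : mod_iso A' (quot_module M' N') (direct_sum {..<k} (\<lambda>_. EE))" by blast
 note st = M'.F_submodule_stable[OF F]
 note cq = corank_quotient[OF noeth hull M'.is_mod st(1) f]
 note N'E = M'.M.submoduleE[OF st(1)] submodule_zero[OF st(1)]
 have ab: "abelian_group M" "abelian_group M'" using module_ab M.is_mod M'.is_mod by auto
 have h0: "h 0\<^sub>M = 0\<^sub>M'" by (rule additive_zero[OF ab h(1,2)])
 have hn: "h (-\<^sub>M y) = -\<^sub>M' h y" if "y : carrier M" for y by (rule additive_neg[OF ab h(1,2) that])
 have sat': "y : N'" if y: "y : carrier M'" and s: "s : S" and sy: "?l s *\<^sub>M' y : N'" for y s
 proof -
  have "L.fr \<one> s *\<^sub>M' (?l s *\<^sub>M' y) = y"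
   using unit_inverse[OF s] y s L.loc_map_closed[of s] by (simp add: M'.M.smult_assoc1[symmetric])
  then show ?thesis using N'E(4)[OF _ sy, of "L.fr \<one> s"] s by simp
 qed
 define N where "N = {y : carrier M. h y : N'}"
 show ?thesis
 proof (rule M.special_prime[OF noeth primeideal U x g gI DU gen K])
  show "submodule N A M"
   by (rule M.M.submoduleI) (use N'E h L.loc_map_closed h0 hn in \<open>auto simp: N_def\<close>)
  show "N \<noteq> carrier M"
  proof
   assume NM: "N = carrier M"
   have "y : N'" if y: "y : carrier M'" for y
   proof -
    obtain s z where s: "s : S" "z : carrier M" "?l s *\<^sub>M' y = h z" using h(5)[OF y] by blast
    have "z : N" using s(2) NM by simp
    then show ?thesis using sat'[OF y s(1)] s(3) by (simp add: N_def)
   qed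
   then show False using cq(1)[OF crk(2)] N'E(1) by blast
  qed
  show "\<phi> y : N" if "y : N" for y using that st(2) h(4) by (simp add: N_def)
  show "M.D j y : N" if "y : N" "j : J" for y j
  proof -
   have y: "y : carrier M" "h y : N'" using that(1) by (auto simp: N_def)
   have "M'.D j (h y) = h (M.D j y)"
    by (rule D_commute[where h = h, OF M M' h(1,2) _ h(4) y(1) that(2)]) (use h(3) M.b_closed in auto)
   then show ?thesis using st(3)[OF y(2) that(2)] y(1) by (simp add: N_def)
  qed
  show "\<exists>t::nat. (a [^] t) *\<^sub>M y : N" if y: "y : carrier M" and a: "a : P" for y a
  proof -
   obtain t :: nat where t: "(?l a ^\<^sub>A' t) *\<^sub>M' h y : N'" using cq(2)[OF h(1)[OF y] a] by blast
   have ac: "a : carrier A" by (rule Icarr[OF a])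
   have "?l (a [^] t) = ?l a ^\<^sub>A' t"
    using ac by (induction t) (simp_all add: ring_hom_one[OF L.loc_map_hom] ring_hom_mult[OF L.loc_map_hom])
   then show ?thesis using t ac y h(3)[of "a [^] t" y] by (intro exI[of _ t]) (simp add: N_def)
  qed
  show "y : N" if "y : carrier M" "s : S" "s *\<^sub>M y : N" for y s
   using that h(1)[of y] h(3)[of s y] sat'[of "h y" s] by (auto simp: N_def)
 qed
qed

end

section \<open>The main theorem\<close>

lemma extended_ideal_generators:
 assumes P: "primeideal P A" and fs: "set fs <= carrier A"
 shows "extended_ideal A P (genideal A (set fs)) =
  genideal (loc_at_prime A P) (set (map (loc_map A (carrier A - P)) fs))"
proof -
 interpret prime_localization P A by (rule prime_localization.intro[OF P])
 let ?l = "loc_map A S"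
 interpret h: ring_hom_ring A A' ?l
  by (rule ring_hom_ringI2[OF ring_axioms A'.ring_axioms L.loc_map_hom])
 have ls: "?l ` set fs <= carrier A'" using fs by auto
 have gI: "genideal A (set fs) <= carrier A" using ideal.Icarr[OF genideal_ideal[OF fs]] by blast
 have lI: "?l ` genideal A (set fs) <= carrier A'" using gI by auto
 note J = A'.genideal_ideal[OF ls]
 have "genideal A (set fs) <= {r : carrier A. ?l r : genideal A' (?l ` set fs)}"
  by (rule genideal_minimal[OF h.ideal_vimage[OF J]]) (use fs A'.genideal_self[OF ls] in auto)
 then have "genideal A' (?l ` genideal A (set fs)) <= genideal A' (?l ` set fs)"
  by (intro A'.genideal_minimal[OF J]) auto
 moreover have "genideal A' (?l ` set fs) <= genideal A' (?l ` genideal A (set fs))"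
  using genideal_self[OF fs] A'.genideal_self[OF lI] by (intro A'.genideal_minimal[OF A'.genideal_ideal[OF lI]]) blast
 ultimately show ?thesis by (simp add: extended_ideal_def)
qed
theorem theorem5p3:
  fixes p n i :: nat and I :: "('k::field) mpoly set"
    and H :: "('k mpoly, (nat set \<Rightarrow> ('k mpoly \<times> 'k mpoly) set) set) module"
    and \<theta> :: "(nat set \<Rightarrow> ('k mpoly \<times> 'k mpoly) set) set
               \<Rightarrow> ((nat set \<Rightarrow> ('k mpoly \<times> 'k mpoly) set) set \<Rightarrow> 'k mpoly) set"
  defines "R \<equiv> poly_ring n :: 'k mpoly ring"
  assumes "prime p" and "CHAR('k) = p"
    and "ideal I R"
    and "local_cohomology R p I i H \<theta>"
  shows "\<exists>\<alpha> U. 1 \<le> \<alpha> \<and> is_matrix R \<alpha> \<alpha> U \<and> represents_root R p \<alpha> U H \<theta> \<and>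
    (\<forall>P H' \<theta>' k. primeideal P R \<and>
       local_cohomology (loc_at_prime R P) p (extended_ideal R P I) i H' \<theta>' \<and>
       corank_is (loc_at_prime R P) p H' \<theta>' k \<and> k \<noteq> 0
       \<longrightarrow> P \<in> special_primes R p \<alpha> U)"
proof -
 obtain B :: "'k set" where B: "\<forall>a. \<exists>F c. finite F \<and> F <= B \<and> a = (\<Sum>\<beta>\<in>F. c \<beta> ^ p * \<beta>)"
  "\<forall>F c. finite F \<longrightarrow> F <= B \<longrightarrow> (\<Sum>\<beta>\<in>F. c \<beta> ^ p * \<beta>) = 0 \<longrightarrow> (\<forall>\<beta>\<in>F. c \<beta> = 0)"
  using frobenius_basis[OF assms(2,3)] by blast
 interpret pf: poly_frobenius p n B
 proof (rule poly_frobenius.intro[OF assms(2,3) B(1)[rule_format]])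
  show "c \<beta> = 0" if "finite F" "F <= B" "(\<Sum>\<beta>\<in>F. c \<beta> ^ p * \<beta>) = 0" "\<beta> : F" for F c \<beta>
   using B(2) that by blast
 qed
 note frob = pf.frob_ring_axioms[folded R_def]
 note stab = pf.stab_seq_stabilises[folded R_def]
 have noeth: "noeth_ring R" unfolding R_def by (rule poly_ring_noeth)
 have p1: "1 < p" using assms(2) by (rule prime_gt_1_nat)
 obtain fs where fs: "set fs <= carrier R" and I: "I = genideal R (set fs)"
  and H: "H = cech_cohomology R fs i" and \<theta>: "\<theta> = cech_structure R p fs i"
  using assms(5) unfolding local_cohomology_def by blast
 interpret F: cech_complex R p pf.J pf.b fs by (rule frob_ring.cech[OF frob fs])
 interpret H: unit_module R p pf.J pf.b "F.H i" "cech_frob R p fs i" by (rule F.H_unit)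
 obtain X where X: "finite X" "X <= carrier (F.H i)" "X <= H.Dinv (gen_submodule R (F.H i) X)"
  "\<And>y. y : carrier (F.H i) ==> \<exists>e. y : (H.Dinv ^^ e) (gen_submodule R (F.H i) X)"
  by (rule F.H_root_generators[OF noeth p1, of i]) blast
 \<comment> \<open>The root is fixed here, before any prime P is considered, as the order of the
   quantifiers demands.\<close>
 obtain d U x g where U: "1 \<le> d" "is_matrix R d d U" and rep: "represents_root R p d U (F.H i) H.Frob_inv"
  and x: "\<And>i'. i' < d ==> x i' : carrier (F.H i)"
  and g: "g : mod_hom R (vecs R d) (F.H i)" "g ` carrier (vecs R d) = gen_submodule R (F.H i) (x ` {..<d})"
  and DU: "\<And>v j. v : carrier (vecs R d) ==> j : pf.J ==> H.D j (g v) =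
    g (dcomp pf.J pf.b (vecs R d) (vec_pow R d p) j (mat_vec R d d U v))"
  and gen: "\<And>y. y : carrier (F.H i) ==> \<exists>e. y : (H.Dinv ^^ e) (gen_submodule R (F.H i) (x ` {..<d}))"
  and K: "g ` stable_K R p d U = gen_submodule R (F.H i) (x ` {..<d})"
  by (rule H.minimal_root_exists[OF noeth stab X]) blast+
 have "P : special_primes R p d U"
  if P: "primeideal P R" and lc: "local_cohomology (loc_at_prime R P) p (extended_ideal R P I) i H' \<theta>'"
   and crk: "corank_is (loc_at_prime R P) p H' \<theta>' k" "k \<noteq> 0" for P H' \<theta>' k
 proof -
  interpret pl: prime_localization P R by (rule prime_localization.intro[OF P])
  interpret cl: cech_localization R p pf.J pf.b fs "carrier R - P" by unfold_locales
  obtain gs where gs: "set gs <= carrier cl.A'" "extended_ideal R P I = genideal cl.A' (set gs)"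
   and H': "H' = cech_cohomology cl.A' gs i" and \<theta>': "\<theta>' = cech_structure cl.A' p gs i"
   using lc unfolding local_cohomology_def by blast
  have "genideal cl.A' (set cl.gs) = genideal cl.A' (set gs)"
   using gs(2) extended_ideal_generators[OF P fs] unfolding I by simp
  \<comment> \<open>The local cohomology at P may be given by any generators of the extended ideal,
    whereas localizing the chosen complex yields the images of fs; here the two are
    compared.\<close>
  then have "coh_iso cl.A' p i cl.gs gs" by (rule cl.G.cech_generators_iso[OF p1 cl.G.fs gs(1)])
  then obtain \<psi> where \<psi>: "\<psi> : mod_iso cl.A' (cl.G.H i) H'"
   and \<psi>_frob: "\<And>X. X : carrier (cl.G.H i) ==> \<psi> (cech_frob cl.A' p cl.gs i X) = cech_frob cl.A' p gs i (\<psi> X)"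
   unfolding coh_iso_def H' by blast
  have \<psi>h: "\<psi> : mod_hom cl.A' (cl.G.H i) H'" and \<psi>im: "\<psi> ` carrier (cl.G.H i) = carrier H'"
   using \<psi> by (auto simp: mod_iso_def bij_betw_def)
  note ph = mod_homD[OF \<psi>h] and hp = cl.hmap_props[of _ i]
  interpret G': cech_complex cl.A' p pf.J "\<lambda>j. loc_map R (carrier R - P) (pf.b j)" gs by (rule cl.G.cech[OF gs(1)])
  show ?thesis
  proof (rule pl.corank_special_prime[where h = "\<lambda>X. \<psi> (cl.hmap i X)", OF F.H_unit G'.H_unit[of i, folded H'] _ _ _ _ _ noeth _ crk(2) U(2) x g DU gen K])
   show "corank_is cl.A' p H' (inv_into (carrier (Frob cl.A' p H')) (Frob_lift cl.A' H' H' 1 (cech_frob cl.A' p gs i))) k"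
    using crk(1) unfolding \<theta>' G'.cech_structure_eq H' .
   show "\<exists>s\<in>carrier R - P. \<exists>x\<in>carrier (F.H i). cl.lm s *\<^sub>H' y = \<psi> (cl.hmap i x)" if y: "y : carrier H'" for y
   proof -
    have "y : \<psi> ` carrier (cl.G.H i)" using y \<psi>im by simp
    then obtain Y where Y: "Y : carrier (cl.G.H i)" "y = \<psi> Y" by blast
    obtain s X where s: "s : carrier R - P" "X : carrier (F.H i)" "cl.lm s *\<^sub>(cl.G.H i) Y = cl.hmap i X"
     using cl.hmap_surj[OF Y(1)] by blast
    have "cl.lm s : carrier cl.A'" using s(1) pl.L.loc_map_closed by simp
    from ph(3)[OF this Y(1)] have "cl.lm s *\<^sub>H' y = \<psi> (cl.hmap i X)" unfolding Y(2) s(3) by simp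
    then show ?thesis using s(1,2) by blast
   qed
  qed (use ph hp pl.L.loc_map_closed \<psi>_frob in auto)
 qed
 then show ?thesis using U rep unfolding H \<theta> F.cech_structure_eq by blast
qed

end
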